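(* Let $n,g\in\mathbb{N}$ and let $\mathbf{f}=(f_1,\dots,f_g)\in\mathbb{N}^g$ with $\sum_{i=1}^g f_i=n$. Let $\mathbf{1}=(1,\dots,1)\in\mathbb{N}^g$ and let $W^{\vartriangleleft}_{\mathbf{1},\mathbf{f}}(X,Y)\in\mathbb{Q}(X,Y)$ be the rational function describing the Euler factors $\zeta^{\vartriangleleft}_{H(\mathcal{O}_K),p}(s)$ of the normal zeta functions of the Heisenberg groups $H(\mathcal{O}_K)$ at primes $p$ of decomposition type $(\mathbf{1},\mathbf{f})$ in number fields $K$ of degree $n$. Then $$W^{\vartriangleleft}_{\mathbf{1},\mathbf{f}}(X^{-1},Y^{-1})=(-1)^{3n}X^{\binom{3n}{2}}Y^{5n}\,W^{\vartriangleleft}_{\mathbf{1},\mathbf{f}}(X,Y).$$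
   Context: $\mathbb{N}=\{1,2,\dots\}$. For a finitely generated group $G$, let $a_m^{\vartriangleleft}(G)$ be the number of normal subgroups of $G$ of index $m$. For a prime $p$ put $\zeta^{\vartriangleleft}_{G,p}(s)=\sum_{k\ge 0}a^{\vartriangleleft}_{p^k}(G)p^{-ks}$. For a ring $R$, the Heisenberg group $H(R)$ is the group of upper unitriangular $3\times 3$ matrices over $R$. For a number field $K$, $\mathcal{O}_K$ denotes its ring of integers. Let $n=[K:\mathbb{Q}]$ and let $\mathbf{e},\mathbf{f}\in\mathbb{N}^g$ with $\sum_{i=1}^g e_if_i=n$. A rational prime $p$ has decomposition type $(\mathbf{e},\mathbf{f})$ in $K$ if $p\mathcal{O}_K=\mathfrak{p}_1^{e_1}\cdots\mathfrak{p}_g^{e_g}$ with distinct prime ideals $\mathfrak{p}_i$ and $[\mathcal{O}_K/\mathfrak{p}_i:\mathbb{F}_p]=f_i$ for all $i$. It is a known theorem of Grunewald, Segal and Smith that for each such $(\mathbf{e},\mathbf{f})$ there is a rational function $W^{\vartriangleleft}_{\mathbf{e},\mathbf{f}}(X,Y)\in\mathbb{Q}(X,Y)$ such that for all number fields $K$ of degree $n$ and all primes $p$ of decomposition type $(\mathbf{e},\mathbf{f})$ in $K$ one has $\zeta^{\vartriangleleft}_{H(\mathcal{O}_K),p}(s)=W^{\vartriangleleft}_{\mathbf{e},\mathbf{f}}(p,p^{-s})$. This is the function referred to in the claim (with $\mathbf{e}=\mathbf{1}$). *)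

theory Defs
  imports
    "HOL-Analysis.Analysis"
    "HOL-Computational_Algebra.Computational_Algebra"
    "HOL-Algebra.Embedded_Algebras"
    "HOL-Algebra.Ideal_Product"
    "HOL-Algebra.QuotRing"
    "HOL-Algebra.Algebraic_Closure_Type"
begin

section \<open>The field of rational functions in two variables\<close>

text \<open>
  The field \<open>\<rat>(X,Y)\<close> is the fraction field of \<open>\<rat>[X][Y]\<close>: the inner polynomial variable
  is \<open>X\<close>, the outer one is \<open>Y\<close>.
\<close>

type_synonym ratfun2 = "rat poly poly fract"

instance fract :: ("{idom, ring_char_0}") field_char_0
proof
  have "of_nat n = Fract (of_nat n :: 'a) 1" for n
    by (induction n) (simp_all add: Zero_fract_def One_fract_def add.commute)
  then show "inj (of_nat :: nat \<Rightarrow> 'a fract)"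
    by (auto simp: inj_def eq_fract)
qed

definition rfX :: ratfun2 where
  "rfX = Fract [:[:0, 1:]:] 1"

definition rfY :: ratfun2 where
  "rfY = Fract [:0, 1:] 1"

definition bipoly_eval :: "rat poly poly \<Rightarrow> 'a::field_char_0 \<Rightarrow> 'a \<Rightarrow> 'a" where
  "bipoly_eval P x y = poly (map_poly (\<lambda>c. poly (map_poly of_rat c) x) P) y"

text \<open>
  A rational function is regular at a point if some representation of it as a fraction has a
  denominator that does not vanish there; its value is then the quotient of the values, which does
  not depend on the representation (lemma \<open>rf_eval_Fract\<close>). Points may have coordinates in
  any field of characteristic \<open>0\<close>, in particular in \<open>\<rat>(X,Y)\<close> itself, where evaluation is
  substitution.
\<close>

definition rf_regular :: "ratfun2 \<Rightarrow> 'a::field_char_0 \<Rightarrow> 'a \<Rightarrow> bool" where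
  "rf_regular W x y \<longleftrightarrow> (\<exists>P Q. W = Fract P Q \<and> bipoly_eval Q x y \<noteq> 0)"

definition rf_eval :: "ratfun2 \<Rightarrow> 'a::field_char_0 \<Rightarrow> 'a \<Rightarrow> 'a" where
  "rf_eval W x y =
     (THE v. \<exists>P Q. W = Fract P Q \<and> bipoly_eval Q x y \<noteq> 0 \<and>
                   v = bipoly_eval P x y / bipoly_eval Q x y)"

lemma bipoly_eval_0 [simp]: "bipoly_eval 0 x y = 0"
  by (simp add: bipoly_eval_def)

lemma map_of_rat_add:
  "map_poly (of_rat :: rat \<Rightarrow> 'a::field_char_0) (p + q) = map_poly of_rat p + map_poly of_rat q"
  by (intro poly_eqI) (simp add: coeff_map_poly of_rat_add)

lemma map_of_rat_mult:
  "map_poly (of_rat :: rat \<Rightarrow> 'a::field_char_0) (p * q) = map_poly of_rat p * map_poly of_rat q"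
  by (intro poly_eqI) (simp add: coeff_map_poly coeff_mult of_rat_sum of_rat_mult)

lemma bipoly_eval_pCons [simp]:
  "bipoly_eval (pCons c P) x y = poly (map_poly of_rat c) x + y * bipoly_eval P x y"
  by (cases "c = 0 \<and> P = 0") (auto simp: bipoly_eval_def map_poly_pCons)

lemma bipoly_eval_add: "bipoly_eval (P + Q) x y = bipoly_eval P x y + bipoly_eval Q x y"
proof -
  have "map_poly (\<lambda>c. poly (map_poly of_rat c) x) (P + Q) =
        map_poly (\<lambda>c. poly (map_poly of_rat c) x) P + map_poly (\<lambda>c. poly (map_poly of_rat c) x) Q"
    by (intro poly_eqI) (simp add: coeff_map_poly map_of_rat_add)
  then show ?thesis by (simp add: bipoly_eval_def)
qed

lemma bipoly_eval_mult: "bipoly_eval (P * Q) x y = bipoly_eval P x y * bipoly_eval Q x y"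
proof (induction P)
  case (pCons c P)
  have "bipoly_eval (Polynomial.smult c Q) x y = poly (map_poly of_rat c) x * bipoly_eval Q x y"
    by (induction Q) (simp_all add: map_of_rat_mult algebra_simps)
  with pCons show ?case
    by (simp add: bipoly_eval_add algebra_simps)
qed simp

lemma rf_eval_Fract:
  assumes "bipoly_eval Q x y \<noteq> 0"
  shows "rf_eval (Fract P Q) x y = bipoly_eval P x y / bipoly_eval Q x y"
  unfolding rf_eval_def
proof (rule the_equality)
  fix v assume "\<exists>P' Q'. Fract P Q = Fract P' Q' \<and> bipoly_eval Q' x y \<noteq> 0 \<and>
                  v = bipoly_eval P' x y / bipoly_eval Q' x y"
  then obtain P' Q' where *: "Fract P Q = Fract P' Q'" "bipoly_eval Q' x y \<noteq> 0"
    "v = bipoly_eval P' x y / bipoly_eval Q' x y" by blast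
  have "Q \<noteq> 0" using assms by auto
  moreover have "Q' \<noteq> 0" using *(2) by auto
  ultimately have "P * Q' = P' * Q" using *(1) by (simp add: eq_fract(1))
  then have "bipoly_eval P x y * bipoly_eval Q' x y = bipoly_eval P' x y * bipoly_eval Q x y"
    by (simp only: bipoly_eval_mult [symmetric])
  then show "v = bipoly_eval P x y / bipoly_eval Q x y"
    unfolding *(3) using assms *(2) by (subst frac_eq_eq) simp_all
qed (use assms in blast)


section \<open>Normal zeta functions\<close>

text \<open>
  An infinite set of cosets has \<open>card\<close> equal to \<open>0\<close>, so for \<open>m > 0\<close> exactly the
  subgroups of finite index \<open>m\<close> are counted.
\<close>

definition normal_subgroup_count :: "('a, 'b) monoid_scheme \<Rightarrow> nat \<Rightarrow> nat" where
  "normal_subgroup_count G m = card {N. N \<lhd> G \<and> card (rcosets\<^bsub>G\<^esub> N) = m}"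

definition local_normal_zeta_term ::
    "('a, 'b) monoid_scheme \<Rightarrow> nat \<Rightarrow> complex \<Rightarrow> nat \<Rightarrow> complex" where
  "local_normal_zeta_term G p s k =
     of_nat (normal_subgroup_count G (p ^ k)) * of_nat p powr (- of_nat k * s)"

definition local_normal_zeta :: "('a, 'b) monoid_scheme \<Rightarrow> nat \<Rightarrow> complex \<Rightarrow> complex" where
  "local_normal_zeta G p s = (\<Sum>k. local_normal_zeta_term G p s k)"


section \<open>Heisenberg groups over rings of integers\<close>

text \<open>
  The ring \<open>R\<close> is given as a subring of a type. The conditions are written out entrywise
  because \<open>3 = 0\<close> in the index type, so its order relation is not the order of the rows.
\<close>

unbundle no Formal_Power_Series.fps_syntax  (* otherwise $ is ambiguous *)

definition heisenberg_group :: "'a::ring_1 set \<Rightarrow> ('a^3^3) monoid" where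
  "heisenberg_group R =
     \<lparr> carrier = {A. A$1$1 = 1 \<and> A$2$2 = 1 \<and> A$3$3 = 1 \<and>
                     A$2$1 = 0 \<and> A$3$1 = 0 \<and> A$3$2 = 0 \<and>
                     A$1$2 \<in> R \<and> A$1$3 \<in> R \<and> A$2$3 \<in> R},
       monoid.mult = (**),
       one = mat 1 \<rparr>"

text \<open>
  Number fields are taken inside \<open>\<complex>\<close>, which represents all of them up to isomorphism.
\<close>

abbreviation complex_ring :: "complex ring" where
  "complex_ring \<equiv> ring_of_type_algebra"

definition number_field :: "complex set \<Rightarrow> nat \<Rightarrow> bool" where
  "number_field K n \<longleftrightarrow> subfield K complex_ring \<and> ring.dimension complex_ring n \<rat> K"

definition integers_of :: "complex set \<Rightarrow> complex set" where
  "integers_of K = {x \<in> K. algebraic_int x}"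

definition ring_of_integers :: "complex set \<Rightarrow> complex ring" where
  "ring_of_integers K = complex_ring \<lparr> carrier := integers_of K \<rparr>"

text \<open>
  For an ideal \<open>P\<close> containing the prime \<open>p\<close>, the image of \<open>\<int>\<close> in the quotient by
  \<open>P\<close> is the prime field with \<open>p\<close> elements.
\<close>

definition residue_prime_field :: "complex set \<Rightarrow> complex set \<Rightarrow> complex set set" where
  "residue_prime_field K P = range (\<lambda>m::int. P +>\<^bsub>ring_of_integers K\<^esub> of_int m)"

definition decomposition_type :: "complex set \<Rightarrow> nat \<Rightarrow> nat list \<Rightarrow> nat list \<Rightarrow> bool" where
  "decomposition_type K p e f \<longleftrightarrow>
     length e = length f \<and>
     (\<exists>P :: nat \<Rightarrow> complex set.
        inj_on P {..<length f} \<and>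
        (\<forall>i<length f. primeideal (P i) (ring_of_integers K) \<and>
           ring.dimension (ring_of_integers K Quot P i) (f ! i)
             (residue_prime_field K (P i)) (carrier (ring_of_integers K Quot P i))) \<and>
        Idl\<^bsub>ring_of_integers K\<^esub> {of_nat p} =
          (\<Otimes>\<^bsub>ideals_set (ring_of_integers K)\<^esub> i\<in>{..<length f}.
             P i [^]\<^bsub>ideals_set (ring_of_integers K)\<^esub> (e ! i)))"

text \<open>
  The rational function \<open>W\<close> describes the Euler factors at primes of decomposition type
  \<open>(e, f)\<close> in number fields of degree \<open>n\<close>. The identity of the Euler factor with
  \<open>W(p, p\<^sup>-\<^sup>s)\<close> is required on some right half-plane, which may depend on \<open>K\<close> and \<open>p\<close>.
\<close>

definition describes_euler_factors :: "nat \<Rightarrow> nat list \<Rightarrow> nat list \<Rightarrow> ratfun2 \<Rightarrow> bool" where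
  "describes_euler_factors n e f W \<longleftrightarrow>
     (\<forall>K p. number_field K n \<and> Factorial_Ring.prime p \<and> decomposition_type K p e f \<longrightarrow>
        (\<exists>\<sigma>::real. \<forall>s::complex. Re s > \<sigma> \<longrightarrow>
           summable (local_normal_zeta_term (heisenberg_group (integers_of K)) p s) \<and>
           rf_regular W (of_nat p) (of_nat p powr (- s)) \<and>
           local_normal_zeta (heisenberg_group (integers_of K)) p s =
             rf_eval W (of_nat p) (of_nat p powr (- s))))"

end

theory Submission
  imports Defs "HOL-Number_Theory.Number_Theory"
begin

text \<open>
  It suffices to compute \<open>W\<close> at points \<open>(p, p\<^sup>-\<^sup>s)\<close> for infinitely many primes \<open>p\<close>, each in one
  number field. For \<open>p\<close> congruent to \<open>1\<close> modulo \<open>4 f\<^sub>1 \<dots> f\<^sub>g\<close> the field is generated by a root \<open>\<alpha>\<close> of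
  \<open>\<Prod>\<^sub>i (x\<^bsup>f\<^sub>i\<^esup> - a\<^sub>i) - p(p + 1)\<close>: the \<open>a\<^sub>i\<close> are powers of a primitive root, divisible by \<open>4\<close>, so that an
  Eisenstein argument at \<open>2\<close> gives irreducibility, and Kummer theory modulo \<open>p\<close> shows that the elements
  \<open>\<pi>\<^sub>i = \<alpha>\<^bsup>f\<^sub>i\<^esup> - a\<^sub>i\<close> generate the primes above \<open>p\<close> locally at \<open>p\<close>.

  Let \<open>R\<close> be the ring of integers localised at \<open>p\<close>. Normal subgroups of \<open>p\<close>-power index correspond
  to additive subgroups \<open>N\<close> of \<open>R\<^sup>2 \<times> R\<close> whose image \<open>L\<close> in \<open>R\<^sup>2\<close> is contained in \<open>J \<times> J\<close>, where \<open>J\<close>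
  is the largest ideal inside \<open>M = N \<inter> R\<close>. Multiplying \<open>L\<close> by a generator of \<open>J\<close> separates the sum
  into the zeta function of the lattice \<open>R\<^sup>2\<close> and a sum over pairs of an ideal \<open>\<Prod>\<pi>\<^sub>i\<^bsup>l\<^sub>i\<^esup>\<close> and a lattice
  \<open>M\<close> containing it. Removing one factor \<open>\<pi>\<^sub>i\<close> for each \<open>i\<close> with \<open>l\<^sub>i > 0\<close> gives a recursion for the latter
  sum, restricted to a given set of indices \<open>i\<close> and a given corank of \<open>M\<close>. Its transfer matrix is a
  product of an incidence matrix of subsets and a matrix of Gaussian binomial coefficients, each conjugate
  to its inverse under inversion of \<open>X\<close> and \<open>Y\<close>; this yields the functional equation.
\<close>

section \<open>Gaussian binomial coefficients\<close>

text \<open>The hypothesis constrains \<open>W\<close> only through Euler factors that occur, so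
  fields with the prescribed splitting have to be constructed. The constant p(p + 1) in their
  equation serves two purposes: as p is 1 modulo 4, it is 2 modulo 4, which the argument at 2 needs;
  and p + 1 is a unit at p, so the product of the \<pi>_i generates the ideal (p). The zeta function
  is compared with the recursion only at real irrational s. There all terms are nonnegative, so sums
  may be regrouped freely as extended reals, and p^(-s i) p^j = 1 forces i = 0, so no denominator of
  the recursion vanishes. Infinitely many such s for infinitely many p determine \<open>W\<close>.
  The reciprocity of the recursion rests on identities M(1/q) D M(q) = D with a diagonal sign matrix
  D, valid both for inclusion of subsets and for the Gaussian matrix. They transform single entries
  of the solution; the passage to the total works because the entry with all indices and maximal
  corank is the total times a monomial.\<close>

fun qbin :: "'a::comm_semiring_1 \<Rightarrow> nat \<Rightarrow> nat \<Rightarrow> 'a" where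
  "qbin q n 0 = 1"
| "qbin q 0 (Suc k) = 0"
| "qbin q (Suc n) (Suc k) = qbin q n (Suc k) + q ^ (n - k) * qbin q n k"

text \<open>This makes the truncated exponent \<open>n - k\<close> in the Pascal rule harmless. The
  rule involves no division, so the same definition serves for counts in \<open>nat\<close> and for
  rational functions.\<close>

lemma qbin_eq_0: "n < k \<Longrightarrow> qbin q n k = 0"
  by (induction q n k rule: qbin.induct) auto

lemma qbin_same [simp]: "qbin q n n = 1"
  by (induction n) (auto simp: qbin_eq_0)

definition qpoch :: "'a::comm_ring_1 \<Rightarrow> nat \<Rightarrow> 'a" where
  "qpoch q n = (\<Prod>i=1..n. 1 - q ^ i)"

lemma qpoch_0 [simp]: "qpoch q 0 = 1"
  by (simp add: qpoch_def)

lemma qpoch_Suc [simp]: "qpoch q (Suc n) = qpoch q n * (1 - q ^ Suc n)"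
  by (simp add: qpoch_def)

text \<open>The quotient formula (q)_n / ((q)_k (q)_(n-k)) with denominators cleared, hence valid
  for every q. The induction splits 1 - q^(n+1) as (1 - q^j) + q^j (1 - q^(k+1)) with j = n -
  k.\<close>

lemma qbin_qpoch: "k \<le> n \<Longrightarrow> qbin q n k * (qpoch q k * qpoch q (n - k)) = qpoch q n"
proof (induction q n k rule: qbin.induct)
  case (3 q n k)
  show ?case
  proof (cases "k = n")
    case False
    with 3 have k: "k < n" by simp
    then obtain j where j: "n - k = Suc j" "n - Suc k = j"
      by (metis Suc_diff_Suc)
    have e: "n = Suc j + k" using j k by simp
    have "qbin q (Suc n) (Suc k) * (qpoch q (Suc k) * qpoch q (Suc n - Suc k)) =
        qbin q n (Suc k) * (qpoch q (Suc k) * qpoch q (n - Suc k)) * (1 - q ^ Suc j) +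
        q ^ Suc j * (1 - q ^ Suc k) * (qbin q n k * (qpoch q k * qpoch q (n - k)))"
      by (simp add: j algebra_simps)
    also have "\<dots> = qpoch q n * (1 - q ^ Suc j) + q ^ Suc j * (1 - q ^ Suc k) * qpoch q n"
      using 3 k by simp
    also have "\<dots> = qpoch q (Suc n)"
      unfolding e by (simp add: algebra_simps power_add)
    finally show ?thesis .
  qed (simp add: qbin_eq_0)
qed auto

lemma qpoch_nonzero:
  fixes q :: "'a::field"
  assumes "\<And>i. i > 0 \<Longrightarrow> q ^ i \<noteq> 1"
  shows "qpoch q n \<noteq> 0"
  using assms by (induction n) (auto simp del: power_Suc)

text \<open>Each factor satisfies (1 - q^(-i)) q^i = -(1 - q^i), and the exponents 1, ..., n add up
  to n + 1 choose 2.\<close>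

lemma qpoch_inverse:
  fixes q :: "'a::field"
  assumes "q \<noteq> 0"
  shows "qpoch (inverse q) n * q ^ (Suc n choose 2) = (- 1) ^ n * qpoch q n"
proof (induction n)
  case (Suc n)
  have c: "Suc (Suc n) choose 2 = (Suc n choose 2) + Suc n"
    by (simp add: numeral_2_eq_2)
  have "qpoch (inverse q) (Suc n) * q ^ (Suc (Suc n) choose 2) =
    (qpoch (inverse q) n * q ^ (Suc n choose 2)) * ((1 - inverse q ^ Suc n) * q ^ Suc n)"
    unfolding c power_add by (simp del: power_Suc add: mult_ac)
  also have "(1 - inverse q ^ Suc n) * q ^ Suc n = - (1 - q ^ Suc n)"
    using assms by (simp add: left_diff_distrib power_inverse del: power_Suc)
  finally show ?case unfolding Suc.IH by (simp add: algebra_simps)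
qed (simp add: numeral_2_eq_2)

lemma choose_2_add: "(a + b) choose 2 = (a choose 2) + (b choose 2) + a * (b::nat)"
  by (induction b) (auto simp: numeral_2_eq_2)

text \<open>In the closed form the signs cancel, and the power of q left over has the exponent (n+1
  choose 2) - (k+1 choose 2) - (n-k+1 choose 2) = k (n - k).\<close>

lemma qbin_inverse:
  fixes q :: "'a::field"
  assumes "q \<noteq> 0" and q: "\<And>i. i > 0 \<Longrightarrow> q ^ i \<noteq> 1" and "k \<le> n"
  shows "qbin (inverse q) n k * q ^ (k * (n - k)) = qbin q n k"
proof -
  obtain j where n: "n = k + j" using assms(3) le_Suc_ex by blast
  have e: "Suc n choose 2 = (Suc k choose 2) + (Suc j choose 2) + k * j"
    using choose_2_add[of k "Suc j"] by (simp add: n numeral_2_eq_2)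
  let ?Q = "inverse q"
  have "qbin ?Q n k * q ^ (k * j) * ((qpoch q k) * (qpoch q j)) * (- 1) ^ n =
     qbin ?Q n k * q ^ (k * j) * (((-1) ^ k * qpoch q k) * ((-1) ^ j * qpoch q j))"
    by (simp add: n power_add mult_ac)
  also have "\<dots> = (qbin ?Q n k * (qpoch ?Q k * qpoch ?Q j)) * q ^ (Suc n choose 2)"
    unfolding qpoch_inverse[OF assms(1), symmetric] e power_add by (simp add: mult_ac)
  also have "\<dots> = qpoch q n * (-1) ^ n"
    using qbin_qpoch[OF assms(3), of ?Q] qpoch_inverse[OF assms(1), of n] by (simp add: n mult_ac)
  also have "\<dots> = qbin q n k * (qpoch q k * qpoch q j) * (-1) ^ n"
    using qbin_qpoch[OF assms(3), of q] by (simp add: n)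
  finally show ?thesis using qpoch_nonzero[OF q] by (simp add: n)
qed

text \<open>The q-binomial theorem at the root 1: by the Pascal rule the sum for N + 1 is 1 - q^N
  times the sum for N, and this factor is already 0 at N = 0.\<close>

lemma qbin_alternating_sum:
  "N > 0 \<Longrightarrow> (\<Sum>k\<le>N. (- 1) ^ k * q ^ (k choose 2) * qbin q N k) = (0 :: 'a::comm_ring_1)"
proof (induction N)
  case (Suc N)
  let ?S = "\<lambda>N. \<Sum>k\<le>N. (- 1) ^ k * q ^ (k choose 2) * qbin q N k"
  have c: "Suc k choose 2 = (k choose 2) + k" for k
    by (simp add: numeral_2_eq_2)
  have "?S (Suc N) = 1 + (\<Sum>k\<le>N. (- 1) ^ Suc k * q ^ (Suc k choose 2) *
                                 (qbin q N (Suc k) + q ^ (N - k) * qbin q N k))"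
    by (subst sum.atMost_Suc_shift) (simp add: numeral_2_eq_2)
  also have "\<dots> = (1 + (\<Sum>k\<le>N. (- 1) ^ Suc k * q ^ (Suc k choose 2) * qbin q N (Suc k))) -
       (\<Sum>k\<le>N. (- 1) ^ k * q ^ (Suc k choose 2) * (q ^ (N - k) * qbin q N k))"
    by (simp add: ring_distribs sum.distrib sum_negf sum_subtractf)
  also have "(1 + (\<Sum>k\<le>N. (- 1) ^ Suc k * q ^ (Suc k choose 2) * qbin q N (Suc k))) =
      (\<Sum>k\<le>Suc N. (- 1) ^ k * q ^ (k choose 2) * qbin q N k)"
    by (simp only: sum.atMost_Suc_shift) (simp add: numeral_2_eq_2)
  also have "\<dots> = ?S N"
    by (simp add: qbin_eq_0)
  also have "(\<Sum>k\<le>N. (- 1) ^ k * q ^ (Suc k choose 2) * (q ^ (N - k) * qbin q N k)) =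
      (\<Sum>k\<le>N. q ^ N * ((- 1) ^ k * q ^ (k choose 2) * qbin q N k))"
  proof (rule sum.cong)
    fix k assume "k \<in> {..N}"
    then have "q ^ N = q ^ k * q ^ (N - k)" by (simp flip: power_add)
    then show "(- 1) ^ k * q ^ (Suc k choose 2) * (q ^ (N - k) * qbin q N k) =
        q ^ N * ((- 1) ^ k * q ^ (k choose 2) * qbin q N k)"
      by (simp add: c power_add mult_ac)
  qed simp
  also have "\<dots> = q ^ N * ?S N" by (simp add: sum_distrib_left)
  finally have "?S (Suc N) = (1 - q ^ N) * ?S N" by (simp add: algebra_simps)
  then show ?case using Suc.IH by (cases "N = 0") auto
qed simp

section \<open>The functional equation of the recursively defined rational functions\<close>

text \<open>
  \<open>step_count p r m m'\<close> is the number of subgroups \<open>H\<close> of corank \<open>m\<close> in an abelian \<open>p\<close>-group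
  \<open>A\<close> of rank \<open>r\<close> with prescribed intersection \<open>H \<inter> pA\<close> of corank \<open>m'\<close> in \<open>pA\<close>.
\<close>

definition step_count :: "'a::comm_semiring_1 \<Rightarrow> nat \<Rightarrow> nat \<Rightarrow> nat \<Rightarrow> 'a" where
  "step_count q r m m' =
     (if m' \<le> m \<and> m \<le> r then q ^ (m' * (r - m)) * qbin q (r - m') (m - m') else 0)"

lemma step_count_top: "m' \<le> r \<Longrightarrow> step_count q r r m' = 1"
  by (simp add: step_count_def)

lemma step_count_diag: "m \<le> r \<Longrightarrow> step_count q r m m = q ^ (m * (r - m))"
  by (simp add: step_count_def)

text \<open>With m = m' + a and r = m + b, the exponent m' b from \<open>step_count\<close> and the
  exponent a b from \<open>qbin_inverse\<close> add up to m b.\<close>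

lemma step_count_inverse:
  fixes q :: "'a::field"
  assumes "q \<noteq> 0" and q: "\<And>i. i > 0 \<Longrightarrow> q ^ i \<noteq> 1" and "m' \<le> m" "m \<le> r"
  shows "step_count (inverse q) r m m' = inverse q ^ (m * (r - m)) * qbin q (r - m') (m - m')"
proof -
  obtain a where a: "m = m' + a" using assms(3) le_Suc_ex by blast
  obtain b where b: "r = m + b" using assms(4) le_Suc_ex by blast
  have "qbin (inverse q) (r - m') (m - m') * q ^ (a * b) = qbin q (r - m') (m - m')"
    using qbin_inverse[OF assms(1) q, of "m - m'" "r - m'"] assms(3,4) by (simp add: a b)
  then have "qbin (inverse q) (r - m') (m - m') = inverse q ^ (a * b) * qbin q (r - m') (m - m')"
    using assms(1) by (auto simp: field_simps power_inverse)
  then show ?thesis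
    using assms(3,4) by (simp add: step_count_def a b power_add ring_distribs)
qed

text \<open>In matrix form M(1/q) D M(q) = D, where M is \<open>step_count\<close> and D is diagonal
  with entries (-1)^j q^(j choose 2). An entry off the diagonal is a constant times the vanishing
  alternating sum of length m - k.\<close>

lemma step_count_inversion:
  fixes q :: "'a::field"
  assumes "q \<noteq> 0" and q: "\<And>i. i > 0 \<Longrightarrow> q ^ i \<noteq> 1" and "k \<le> m" "m \<le> r"
  shows "(\<Sum>j\<le>m. step_count (inverse q) r m j * ((- 1) ^ j * q ^ (j choose 2) * step_count q r j k)) =
         (if k = m then (- 1) ^ m * q ^ (m choose 2) else 0)"
proof -
  obtain N where N: "m = k + N" using assms(3) le_Suc_ex by blast
  obtain b where b: "r = m + b" using assms(4) le_Suc_ex by blast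
  let ?P = "qpoch q"
  have nz: "?P i \<noteq> 0" for i using qpoch_nonzero[OF q] by blast
  define c where "c = inverse q ^ (m * b) * (-1) ^ k * q ^ (k choose 2) * q ^ (k * b + k * N)
                        * qbin q (N + b) N"
  \<comment> \<open>Both sides are the q-multinomial coefficient with parts i, N - i and b.\<close>
  have rev: "qbin q (N + b) i * qbin q (N - i + b) (N - i) = qbin q (N + b) N * qbin q N i"
    if i: "i \<le> N" for i
  proof -
    have "qbin q (N + b) i * qbin q (N - i + b) (N - i) * (?P i * ?P (N - i) * ?P b) =
       qbin q (N + b) i * (?P i * (qbin q (N - i + b) (N - i) * (?P (N - i) * ?P b)))"
      by (simp add: mult_ac)
    also have "\<dots> = ?P (N + b)"
      using qbin_qpoch[of i "N + b" q] qbin_qpoch[of "N - i" "N - i + b" q] i by simp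
    also have "\<dots> = qbin q (N + b) N * (qbin q N i * (?P i * ?P (N - i)) * ?P b)"
      using qbin_qpoch[of N "N + b" q] qbin_qpoch[of i N q] i by simp
    also have "\<dots> = qbin q (N + b) N * qbin q N i * (?P i * ?P (N - i) * ?P b)"
      by (simp add: mult_ac)
    finally have "qbin q (N + b) i * qbin q (N - i + b) (N - i) * (?P i * ?P (N - i) * ?P b) =
       qbin q (N + b) N * qbin q N i * (?P i * ?P (N - i) * ?P b)" .
    then show ?thesis using nz by simp
  qed
  have "(\<Sum>j\<le>m. step_count (inverse q) r m j * ((- 1) ^ j * q ^ (j choose 2) * step_count q r j k)) =
        (\<Sum>j\<in>{k..m}. step_count (inverse q) r m j * ((- 1) ^ j * q ^ (j choose 2) * step_count q r j k))"
    by (rule sum.mono_neutral_right) (auto simp: step_count_def)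
  also have "\<dots> = (\<Sum>i\<le>N. step_count (inverse q) r m (k + i) *
                     ((- 1) ^ (k + i) * q ^ ((k + i) choose 2) * step_count q r (k + i) k))"
    by (rule sum.reindex_bij_witness[of _ "\<lambda>i. k + i" "\<lambda>j. j - k"]) (auto simp: N)
  also have "\<dots> = (\<Sum>i\<le>N. c * ((- 1) ^ i * q ^ (i choose 2) * qbin q N i))"
  proof (rule sum.cong)
    fix i assume "i \<in> {..N}"
    then have i: "i \<le> N" by simp
    have "step_count (inverse q) r m (k + i) =
        inverse q ^ (m * b) * qbin q (N - i + b) (N - i)"
      using step_count_inverse[OF assms(1) q, of "k + i" m r] i by (simp add: N b)
    moreover have "step_count q r (k + i) k = q ^ (k * (N - i + b)) * qbin q (N + b) i"
      using i by (simp add: step_count_def N b)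
    moreover have "q ^ ((k + i) choose 2) = q ^ (k choose 2) * q ^ (i choose 2) * q ^ (k * i)"
      by (simp add: choose_2_add power_add)
    moreover have "q ^ (k * i) * q ^ (k * (N - i + b)) = q ^ (k * b + k * N)"
    proof -
      have "k * i + k * (N - i + b) = k * b + k * N"
        using i by (metis add.assoc add.commute distrib_left le_add_diff_inverse)
      then show ?thesis by (simp flip: power_add)
    qed
    ultimately have 1: "step_count (inverse q) r m (k + i) *
          ((- 1) ^ (k + i) * q ^ ((k + i) choose 2) * step_count q r (k + i) k) =
        inverse q ^ (m * b) * (-1) ^ k * q ^ (k choose 2) * q ^ (k * b + k * N) *
         (qbin q (N + b) i * qbin q (N - i + b) (N - i)) * ((- 1) ^ i * q ^ (i choose 2))"
      by (simp add: power_add mult_ac)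
    show "step_count (inverse q) r m (k + i) *
          ((- 1) ^ (k + i) * q ^ ((k + i) choose 2) * step_count q r (k + i) k) =
          c * ((- 1) ^ i * q ^ (i choose 2) * qbin q N i)"
      unfolding 1 rev[OF i] c_def using assms(1) by (simp add: mult_ac)
  qed simp
  also have "\<dots> = c * (\<Sum>i\<le>N. (- 1) ^ i * q ^ (i choose 2) * qbin q N i)"
    by (simp add: sum_distrib_left)
  also have "\<dots> = (if k = m then (- 1) ^ m * q ^ (m choose 2) else 0)"
  proof (cases "N = 0")
    case True
    then show ?thesis using assms(1) by (simp add: c_def N numeral_2_eq_2 power_add mult_ac power_inverse)
  next
    case False
    then show ?thesis using qbin_alternating_sum[of N q] by (simp add: N)
  qed
  finally show ?thesis .
qed


text \<open>The analogue Z D Z = D for the incidence matrix Z of inclusion, with D the diagonal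
  matrix of signs; this is Moebius inversion on the lattice of subsets.\<close>

lemma sum_Pow_alternating:
  fixes h :: "'b set \<Rightarrow> 'a::comm_ring_1"
  assumes "finite S"
  shows "(\<Sum>A\<in>Pow S. (- 1) ^ card A * (\<Sum>B\<in>Pow A. h B)) = (- 1) ^ card S * h S"
  using assms
proof (induction S arbitrary: h)
  case (insert a S)
  have inj: "inj_on (insert a) (Pow S)" and disj: "Pow S \<inter> insert a ` Pow S = {}"
    using insert.hyps by (auto simp: inj_on_def)
  have split: "(\<Sum>A\<in>Pow (insert a A0). k A) = (\<Sum>A\<in>Pow A0. k A) + (\<Sum>A\<in>Pow A0. k (insert a A))"
    if "A0 \<subseteq> S" for k :: "'b set \<Rightarrow> 'a" and A0
  proof -
    have "inj_on (insert a) (Pow A0)" using inj that by (auto simp: inj_on_def)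
    moreover have "Pow A0 \<inter> insert a ` Pow A0 = {}" using insert.hyps that by auto
    moreover have "finite A0" using that insert.hyps finite_subset by blast
    ultimately show ?thesis
      by (simp add: Pow_insert sum.union_disjoint sum.reindex)
  qed
  have "(\<Sum>A\<in>Pow (insert a S). (- 1) ^ card A * (\<Sum>B\<in>Pow A. h B)) =
      (\<Sum>A\<in>Pow S. (- 1) ^ card A * (\<Sum>B\<in>Pow A. h B)) +
      (\<Sum>A\<in>Pow S. (- 1) ^ card (insert a A) * (\<Sum>B\<in>Pow (insert a A). h B))"
    by (rule split) simp
  also have "(\<Sum>A\<in>Pow S. (- 1) ^ card (insert a A) * (\<Sum>B\<in>Pow (insert a A). h B)) =
      (\<Sum>A\<in>Pow S. - ((- 1) ^ card A * (\<Sum>B\<in>Pow A. h B)) - (- 1) ^ card A * (\<Sum>B\<in>Pow A. h (insert a B)))"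
  proof (rule sum.cong)
    fix A assume "A \<in> Pow S"
    then have A: "A \<subseteq> S" by simp
    then have "card (insert a A) = Suc (card A)"
      using insert.hyps by (metis card_insert_disjoint in_mono rev_finite_subset)
    then show "(- 1) ^ card (insert a A) * (\<Sum>B\<in>Pow (insert a A). h B) =
        - ((- 1) ^ card A * (\<Sum>B\<in>Pow A. h B)) - (- 1) ^ card A * (\<Sum>B\<in>Pow A. h (insert a B))"
      by (simp add: split[OF A] algebra_simps)
  qed simp
  also have "\<dots> = - (\<Sum>A\<in>Pow S. (- 1) ^ card A * (\<Sum>B\<in>Pow A. h B)) -
      (\<Sum>A\<in>Pow S. (- 1) ^ card A * (\<Sum>B\<in>Pow A. h (insert a B)))"
    by (simp add: sum_subtractf sum_negf)
  also have "(\<Sum>A\<in>Pow S. (- 1) ^ card A * (\<Sum>B\<in>Pow A. h (insert a B))) = (- 1) ^ card S * h (insert a S)"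
    by (rule insert.IH)
  finally show ?case using insert.hyps by simp
qed simp

text \<open>The partial generating functions of pairs (l, M) with l supported exactly on S and M of
  corank m; compare \<open>wsum_pairs_rec\<close>. The recursion for the entry (S, m) contains that
  entry itself: this term is moved to the left, where it becomes the denominator, and its exclusion
  from the sum makes the definition terminate.\<close>

function flag_gf :: "'a::field \<Rightarrow> 'a \<Rightarrow> 'a \<Rightarrow> ('b \<Rightarrow> nat) \<Rightarrow> 'b set \<Rightarrow> nat \<Rightarrow> 'a" where
  "flag_gf q T u f S m =
     (if finite S \<and> S \<noteq> {} then
        u ^ sum f S * T ^ m / (1 - u ^ sum f S * T ^ m * step_count q (sum f S) m m) *
          (\<Sum>S'\<in>Pow S. \<Sum>m'\<le>m. if S' = S \<and> m' = m then 0
             else step_count q (sum f S) m m' * flag_gf q T u f S' m')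
      else if S = {} \<and> m = 0 then 1 else 0)"
  by auto
termination
proof (relation "inv_image (less_than <*lex*> less_than) (\<lambda>(q, T, u, f, S, m). (card S, m))", goal_cases)
  case (2 q T u f S m S' m')
  then show ?case by (cases "S' = S") (auto intro: psubset_card_mono)
qed auto

declare flag_gf.simps [simp del]

lemma flag_gf_empty: "flag_gf q T u f {} m = (if m = 0 then 1 else 0)"
  by (simp add: flag_gf.simps)

lemma flag_gf_eq_0: "finite S \<Longrightarrow> sum f S < m \<Longrightarrow> flag_gf q T u f S m = 0"
proof -
  assume "sum f S < m"
  then have "step_count q (sum f S) m m' = 0" for m' by (simp add: step_count_def)
  with \<open>sum f S < m\<close> show ?thesis by (subst flag_gf.simps) (simp cong: if_cong)
qed

lemma sum_Pow_atMost_remove: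
  fixes c :: "'b set \<Rightarrow> nat \<Rightarrow> 'a::comm_ring_1"
  assumes "finite S"
  shows "(\<Sum>S'\<in>Pow S. \<Sum>m'\<le>m. c S' m') =
         (\<Sum>S'\<in>Pow S. \<Sum>m'\<le>m. if S' = S \<and> m' = m then 0 else c S' m') + c S m"
proof -
  have "(\<Sum>S'\<in>Pow S. \<Sum>m'\<le>m. c S' m') =
      (\<Sum>S'\<in>Pow S. \<Sum>m'\<le>m. (if S' = S \<and> m' = m then 0 else c S' m') +
          (if S' = S then if m' = m then c S m else 0 else 0))"
    by (intro sum.cong refl) auto
  also have "\<dots> = (\<Sum>S'\<in>Pow S. \<Sum>m'\<le>m. if S' = S \<and> m' = m then 0 else c S' m') +
      (\<Sum>S'\<in>Pow S. if S' = S then (\<Sum>m'\<le>m. if m' = m then c S m else 0) else 0)"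
    by (simp add: sum.distrib) (intro sum.cong refl, auto)
  also have "(\<Sum>S'\<in>Pow S. if S' = S then (\<Sum>m'\<le>m. if m' = m then c S m else 0) else 0) = c S m"
    using assms by (simp add: sum.delta)
  finally show ?thesis .
qed

lemma flag_gf_rec:
  assumes "finite S" "S \<noteq> {}" "u ^ sum f S * T ^ m * step_count q (sum f S) m m \<noteq> 1"
  shows "flag_gf q T u f S m = u ^ sum f S * T ^ m *
    (\<Sum>S'\<in>Pow S. \<Sum>m'\<le>m. step_count q (sum f S) m m' * flag_gf q T u f S' m')"
proof -
  let ?a = "u ^ sum f S * T ^ m" and ?c = "step_count q (sum f S) m m"
  let ?R = "\<Sum>S'\<in>Pow S. \<Sum>m'\<le>m. if S' = S \<and> m' = m then 0
             else step_count q (sum f S) m m' * flag_gf q T u f S' m'"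
  have "flag_gf q T u f S m = ?a / (1 - ?a * ?c) * ?R"
    using assms by (subst flag_gf.simps) simp
  then have "(1 - ?a * ?c) * flag_gf q T u f S m = ?a * ?R"
    using assms(3) by simp
  then show ?thesis
    by (subst sum_Pow_atMost_remove[OF assms(1)]) (simp add: algebra_simps)
qed

text \<open>
  A vector satisfying the recursion of \<^const>\<open>flag_gf\<close> with inverted parameters is obtained from
  \<^const>\<open>flag_gf\<close> itself by summation over subsets, because both factors of the transfer matrix, the
  incidence matrix of the subset lattice and \<^const>\<open>step_count\<close>, become conjugate to their inverses.
\<close>

theorem flag_gf_reciprocity:
  fixes q T u :: "'a::field" and f :: "'b \<Rightarrow> nat"
  assumes nz: "q \<noteq> 0" "T \<noteq> 0" "u \<noteq> 0" and q: "\<And>i. i > 0 \<Longrightarrow> q ^ i \<noteq> 1"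
    and "finite S"
    and gen: "\<And>A m. A \<subseteq> S \<Longrightarrow> A \<noteq> {} \<Longrightarrow> m \<le> sum f A \<Longrightarrow>
               u ^ sum f A * T ^ m * q ^ (m * (sum f A - m)) \<noteq> 1"
  shows "flag_gf (inverse q) (inverse T) (inverse u) f S m =
    (- 1) ^ (card S + m) * q ^ (m choose 2) * inverse T ^ m * (\<Sum>A\<in>Pow S. flag_gf q T u f A m)"
  using assms(5) gen
proof (induction "(card S, m)" arbitrary: S m rule: wf_induct_rule[OF wf_lex_prod[OF wf_less_than wf_less_than]])
  case (1 S m)
  let ?V = "flag_gf q T u f" and ?W = "flag_gf (inverse q) (inverse T) (inverse u) f"
  \<comment> \<open>The right-hand side of the claim; it will be shown to satisfy the recursion of
    \<open>?W\<close>.\<close>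
  define G where "G = (\<lambda>S m. (- 1) ^ (card S + m) * q ^ (m choose 2) * inverse T ^ m * (\<Sum>A\<in>Pow S. ?V A m))"
  let ?r = "sum f S"
  have fin: "finite S" by fact
  have subfin: "finite A" if "A \<subseteq> S" for A using fin that finite_subset by blast
  show ?case
  proof (cases "S = {} \<or> m > ?r")
    case True
    have "?V A m = 0" if "m > ?r" "A \<subseteq> S" for A
    proof (rule flag_gf_eq_0)
      have "sum f A \<le> ?r" using that fin by (intro sum_mono2) auto
      then show "sum f A < m" using that by simp
    qed (use subfin that in auto)
    then show ?thesis using True fin
      by (auto simp: flag_gf_empty flag_gf_eq_0 numeral_2_eq_2 gr0_conv_Suc)
  next
    case False
    then have S: "S \<noteq> {}" and m: "m \<le> ?r" by auto
    let ?a = "u ^ ?r * T ^ m" and ?b = "inverse u ^ ?r * inverse T ^ m"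
    let ?C = "\<lambda>j. step_count (inverse q) ?r m j"
    \<comment> \<open>The coefficient \<open>step_count q ?r j k\<close> does not depend on the
      subset A, so the transfer matrix is a product and the sum over A can be taken first.\<close>
    have Vrec: "inverse T ^ j * ?V S j = u ^ ?r * (\<Sum>k\<le>j. step_count q ?r j k * (\<Sum>A\<in>Pow S. ?V A k))"
      if "j \<le> m" for j
    proof -
      have "?V S j = u ^ ?r * T ^ j * (\<Sum>A\<in>Pow S. \<Sum>k\<le>j. step_count q ?r j k * ?V A k)"
        using \<open>S \<noteq> {}\<close> fin "1.prems"(2)[of S j] m that
        by (intro flag_gf_rec) (auto simp: step_count_diag)
      also have "(\<Sum>A\<in>Pow S. \<Sum>k\<le>j. step_count q ?r j k * ?V A k) =
          (\<Sum>k\<le>j. step_count q ?r j k * (\<Sum>A\<in>Pow S. ?V A k))"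
        by (subst sum.swap) (simp add: sum_distrib_left)
      finally show ?thesis using nz by (simp add: field_simps power_inverse)
    qed
    \<comment> \<open>Three moves: Moebius inversion collapses the sum over A to A = S, the
      recursion expands \<open>?V S j\<close> again, and \<open>step_count_inversion\<close>
      collapses the sum over j.\<close>
    have "(\<Sum>A\<in>Pow S. \<Sum>j\<le>m. ?C j * G A j) =
        (\<Sum>j\<le>m. ?C j * ((- 1) ^ j * q ^ (j choose 2) * inverse T ^ j *
            (\<Sum>A\<in>Pow S. (- 1) ^ card A * (\<Sum>B\<in>Pow A. ?V B j))))"
      unfolding G_def by (subst sum.swap) (simp add: sum_distrib_left power_add mult_ac)
    also have "\<dots> = (\<Sum>j\<le>m. (- 1) ^ card S * (?C j * ((- 1) ^ j * q ^ (j choose 2) * (inverse T ^ j * ?V S j))))"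
      unfolding sum_Pow_alternating[OF fin] by (simp add: mult_ac)
    also have "\<dots> = (\<Sum>j\<le>m. (- 1) ^ card S * (?C j * ((- 1) ^ j * q ^ (j choose 2) *
        (u ^ ?r * (\<Sum>k\<le>m. step_count q ?r j k * (\<Sum>A\<in>Pow S. ?V A k))))))"
    proof (rule sum.cong)
      fix j assume "j \<in> {..m}"
      then have "(\<Sum>k\<le>j. step_count q ?r j k * (\<Sum>A\<in>Pow S. ?V A k)) =
        (\<Sum>k\<le>m. step_count q ?r j k * (\<Sum>A\<in>Pow S. ?V A k))"
        by (intro sum.mono_neutral_left) (auto simp: step_count_def)
      then show "(- 1) ^ card S * (?C j * ((- 1) ^ j * q ^ (j choose 2) * (inverse T ^ j * ?V S j))) =
         (- 1) ^ card S * (?C j * ((- 1) ^ j * q ^ (j choose 2) *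
        (u ^ ?r * (\<Sum>k\<le>m. step_count q ?r j k * (\<Sum>A\<in>Pow S. ?V A k)))))"
        using Vrec \<open>j \<in> {..m}\<close> by simp
    qed simp
    also have "\<dots> = (- 1) ^ card S * u ^ ?r * (\<Sum>k\<le>m. (\<Sum>j\<le>m. ?C j * ((- 1) ^ j * q ^ (j choose 2) *
        step_count q ?r j k)) * (\<Sum>A\<in>Pow S. ?V A k))"
    proof -
      have "(\<Sum>j\<le>m. c * (?C j * (e j * (d * (\<Sum>k\<le>m. h j k * U k))))) =
          c * d * (\<Sum>k\<le>m. (\<Sum>j\<le>m. ?C j * (e j * h j k)) * U k)"
        for c d :: 'a and e U and h :: "nat \<Rightarrow> nat \<Rightarrow> 'a"
        by (simp only: sum_distrib_left sum_distrib_right, subst sum.swap) (simp add: mult_ac)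
      then show ?thesis .
    qed
    also have "(\<Sum>k\<le>m. (\<Sum>j\<le>m. ?C j * ((- 1) ^ j * q ^ (j choose 2) *
        step_count q ?r j k)) * (\<Sum>A\<in>Pow S. ?V A k)) =
        (\<Sum>k\<le>m. if k = m then (- 1) ^ m * q ^ (m choose 2) * (\<Sum>A\<in>Pow S. ?V A m) else 0)"
      using step_count_inversion[OF nz(1) q _ m] by (intro sum.cong) auto
    also have "\<dots> = (- 1) ^ m * q ^ (m choose 2) * (\<Sum>A\<in>Pow S. ?V A m)"
      by simp
    finally have 3: "(\<Sum>A\<in>Pow S. \<Sum>j\<le>m. ?C j * G A j) =
      (- 1) ^ card S * u ^ ?r * ((- 1) ^ m * q ^ (m choose 2) * (\<Sum>A\<in>Pow S. ?V A m))" .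
    have "u ^ ?r * inverse u ^ ?r = 1"
      using nz by (simp flip: power_mult_distrib)
    moreover have "?b * (c * u ^ ?r * (d * e * U)) = c * d * e * inverse T ^ m * U * (u ^ ?r * inverse u ^ ?r)"
      for c d e U :: 'a by (simp only: mult_ac)
    ultimately have "?b * (\<Sum>A\<in>Pow S. \<Sum>j\<le>m. ?C j * G A j) =
       (- 1) ^ card S * (- 1) ^ m * q ^ (m choose 2) * inverse T ^ m * (\<Sum>A\<in>Pow S. ?V A m)"
      unfolding 3 by (simp only: mult_1_right)
    also have "\<dots> = G S m"
      by (simp only: G_def power_add)
    finally have 2: "G S m = ?b * (\<Sum>A\<in>Pow S. \<Sum>j\<le>m. ?C j * G A j)" ..
    have C: "?b * ?C m \<noteq> 1"
    proof
      assume "?b * ?C m = 1"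
      moreover have "?b * ?C m = inverse (u ^ ?r * T ^ m * q ^ (m * (?r - m)))"
        unfolding step_count_diag[OF m] power_inverse inverse_mult_distrib ..
      ultimately have "u ^ ?r * T ^ m * q ^ (m * (?r - m)) = 1"
        by (simp only: inverse_eq_1_iff)
      then show False using "1.prems"(2)[of S m] m S by blast
    qed
    have IH: "?W A j = G A j" if "A \<subseteq> S" "j \<le> m" "\<not> (A = S \<and> j = m)" for A j
      unfolding G_def
    proof (rule "1.hyps")
      show "((card A, j), (card S, m)) \<in> less_than <*lex*> less_than"
        using that fin by (cases "A = S") (auto intro: psubset_card_mono)
    qed (use that subfin "1.prems"(2) in auto)
    have W: "?W S m = ?b * (\<Sum>A\<in>Pow S. \<Sum>j\<le>m. ?C j * ?W A j)"
      using C fin S by (intro flag_gf_rec) assumption+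
    define R where "R = (\<Sum>A\<in>Pow S. \<Sum>j\<le>m. if A = S \<and> j = m then 0 else ?C j * G A j)"
    have "(\<Sum>A\<in>Pow S. \<Sum>j\<le>m. if A = S \<and> j = m then 0 else ?C j * ?W A j) = R"
      unfolding R_def by (intro sum.cong refl) (auto simp: IH)
    then have "?W S m = ?b * (R + ?C m * ?W S m)"
      using W by (subst (asm) (2) sum_Pow_atMost_remove[OF fin]) simp
    moreover have "G S m = ?b * (R + ?C m * G S m)"
      using 2 by (subst (asm) sum_Pow_atMost_remove[OF fin]) (simp add: R_def)
    \<comment> \<open>Both entries solve the same equation w = b (R + c w), and b c differs from
      1.\<close>
    moreover have "w - x = b * c * (w - x)" if "w = b * (R + c * w)" "x = b * (R + c * x)" for w x b c :: 'a
    proof -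
      have "w - x = b * (R + c * w) - b * (R + c * x)" using that by simp
      then show ?thesis by (simp add: algebra_simps)
    qed
    ultimately have "?W S m - G S m = ?b * ?C m * (?W S m - G S m)"
      by blast
    then have "(1 - ?b * ?C m) * (?W S m - G S m) = 0"
      by (simp add: left_diff_distrib)
    then show ?thesis using C unfolding G_def by simp
  qed
qed

lemma of_nat_qbin: "of_nat (qbin p n k) = qbin (of_nat p) n k"
  by (induction p n k rule: qbin.induct) auto

lemma of_nat_step_count: "of_nat (step_count p r m m') = step_count (of_nat p) r m m'"
  by (simp add: step_count_def of_nat_qbin)

text \<open>In the maximal corank every \<open>step_count\<close> is 1, so this single entry carries
  the total over all subsets and coranks.\<close>

lemma flag_gf_sum_top:
  fixes q T u :: "'a::field"
  assumes "finite S" "S \<noteq> {}" "u ^ sum f S * T ^ sum f S \<noteq> 1"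
  shows "flag_gf q T u f S (sum f S) =
    u ^ sum f S * T ^ sum f S * (\<Sum>A\<in>Pow S. \<Sum>m\<le>sum f S. flag_gf q T u f A m)"
proof -
  have "step_count q (sum f S) (sum f S) m = 1" if "m \<le> sum f S" for m
    using that by (rule step_count_top)
  then show ?thesis
    using flag_gf_rec[of S u f T "sum f S" q] assms by simp
qed

text \<open>Reciprocity is applied to the top entry. In its sum over A only A = S survives, because
  a proper subset has too small a rank. Expressing both top entries by their totals contributes
  u^(2n) T^(2n), which turns T^(-n) into T^n.\<close>

corollary flag_gf_total_reciprocity:
  fixes q T u :: "'a::field" and f :: "'b \<Rightarrow> nat"
  assumes nz: "q \<noteq> 0" "T \<noteq> 0" "u \<noteq> 0" and q: "\<And>i. i > 0 \<Longrightarrow> q ^ i \<noteq> 1"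
    and S: "finite S" "S \<noteq> {}" and f: "\<And>i. i \<in> S \<Longrightarrow> f i > 0"
    and gen: "\<And>A m. A \<subseteq> S \<Longrightarrow> A \<noteq> {} \<Longrightarrow> m \<le> sum f A \<Longrightarrow>
               u ^ sum f A * T ^ m * q ^ (m * (sum f A - m)) \<noteq> 1"
  shows "(\<Sum>A\<in>Pow S. \<Sum>m\<le>sum f S. flag_gf (inverse q) (inverse T) (inverse u) f A m) =
    (- 1) ^ (card S + sum f S) * q ^ (sum f S choose 2) * u ^ (2 * sum f S) * T ^ sum f S *
    (\<Sum>A\<in>Pow S. \<Sum>m\<le>sum f S. flag_gf q T u f A m)"
proof -
  let ?n = "sum f S"
  let ?a = "u ^ ?n * T ^ ?n" and ?b = "inverse u ^ ?n * inverse T ^ ?n"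
  have a: "?a \<noteq> 1" using gen[of S ?n] S by simp
  moreover have ab: "?b = inverse ?a" by (simp add: power_inverse)
  ultimately have b: "?b \<noteq> 1" by (metis inverse_eq_1_iff)
  have "(\<Sum>A\<in>Pow S. flag_gf q T u f A ?n) = flag_gf q T u f S ?n"
  proof (subst sum.remove[of _ S])
    have "flag_gf q T u f A ?n = 0" if "A \<subset> S" for A
    proof (rule flag_gf_eq_0)
      obtain x where "x \<in> S" "x \<notin> A" using \<open>A \<subset> S\<close> by blast
      then show "sum f A < sum f S"
        using that S(1) f by (intro sum_strict_mono2[of S A x]) auto
    qed (use that S finite_subset in auto)
    then show "flag_gf q T u f S ?n + (\<Sum>A\<in>Pow S - {S}. flag_gf q T u f A ?n) = flag_gf q T u f S ?n"
      by (auto intro!: sum.neutral)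
  qed (use S in auto)
  then have 1: "flag_gf (inverse q) (inverse T) (inverse u) f S ?n =
     (- 1) ^ (card S + ?n) * q ^ (?n choose 2) * inverse T ^ ?n *
     (?a * (\<Sum>A\<in>Pow S. \<Sum>m\<le>sum f S. flag_gf q T u f A m))"
    using flag_gf_reciprocity[OF nz q S(1) gen, of ?n] flag_gf_sum_top[OF S a, of q] by simp
  have "?a \<noteq> 0" using nz by simp
  then have "?a * ?b = 1" unfolding ab by (rule right_inverse)
  then have "(\<Sum>A\<in>Pow S. \<Sum>m\<le>?n. flag_gf (inverse q) (inverse T) (inverse u) f A m) =
     ?a * flag_gf (inverse q) (inverse T) (inverse u) f S ?n"
    unfolding flag_gf_sum_top[OF S b] by (simp only: mult.assoc[symmetric] mult_1_left)
  also have "\<dots> = (- 1) ^ (card S + ?n) * q ^ (?n choose 2) *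
      (T ^ ?n * inverse T ^ ?n) * (u ^ ?n * u ^ ?n) * T ^ ?n *
     (\<Sum>A\<in>Pow S. \<Sum>m\<le>sum f S. flag_gf q T u f A m)"
    unfolding 1 by (simp only: mult_ac)
  also have "T ^ ?n * inverse T ^ ?n = 1"
    using nz by (simp flip: power_mult_distrib)
  finally show ?thesis by (simp add: mult_2 power_add)
qed

text \<open>The analogue without subsets: sublattices of p-power index in a lattice of rank d,
  sorted by corank m. The sum over m is the local zeta function of a lattice of rank d.\<close>

function lattice_gf :: "'a::field \<Rightarrow> 'a \<Rightarrow> nat \<Rightarrow> nat \<Rightarrow> 'a" where
  "lattice_gf q T d m =
     (if m = 0 then 1
      else T ^ m / (1 - T ^ m * step_count q d m m) * (\<Sum>k<m. step_count q d m k * lattice_gf q T d k))"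
  by auto
termination by (relation "inv_image less_than (\<lambda>(q, T, d, m). m)") auto

declare lattice_gf.simps [simp del]

lemma lattice_gf_0 [simp]: "lattice_gf q T d 0 = 1"
  by (simp add: lattice_gf.simps)

lemma lattice_gf_rec:
  assumes "m > 0 \<Longrightarrow> T ^ m * step_count q d m m \<noteq> 1"
  shows "lattice_gf q T d m = T ^ m * (\<Sum>k\<le>m. step_count q d m k * lattice_gf q T d k)"
proof (cases "m = 0")
  case False
  let ?c = "step_count q d m m" and ?R = "\<Sum>k<m. step_count q d m k * lattice_gf q T d k"
  have "lattice_gf q T d m = T ^ m / (1 - T ^ m * ?c) * ?R"
    using False by (subst lattice_gf.simps) simp
  then have "(1 - T ^ m * ?c) * lattice_gf q T d m = T ^ m * ?R"
    using assms False by simp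
  moreover have "{..m} = insert m {..<m}" by auto
  ultimately show ?thesis by (simp add: algebra_simps)
qed (simp add: step_count_def)

text \<open>Here \<open>step_count\<close> is the whole transfer matrix, and the right-hand side
  satisfies the inverted recursion by \<open>step_count_inversion\<close>.\<close>

lemma lattice_gf_reciprocity:
  fixes q T :: "'a::field"
  assumes nz: "q \<noteq> 0" "T \<noteq> 0" and q: "\<And>i. i > 0 \<Longrightarrow> q ^ i \<noteq> 1"
    and gen: "\<And>m. 0 < m \<Longrightarrow> m \<le> d \<Longrightarrow> T ^ m * q ^ (m * (d - m)) \<noteq> 1"
    and "m \<le> d"
  shows "lattice_gf (inverse q) (inverse T) d m =
    (- 1) ^ m * q ^ (m choose 2) * inverse T ^ m * lattice_gf q T d m"
  using \<open>m \<le> d\<close>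
proof (induction m rule: less_induct)
  case (less m)
  show ?case
  proof (cases "m = 0")
    case False
    let ?V = "lattice_gf q T d" and ?W = "lattice_gf (inverse q) (inverse T) d"
    define G where "G = (\<lambda>m. (- 1) ^ m * q ^ (m choose 2) * inverse T ^ m * ?V m)"
    let ?C = "step_count (inverse q) d m"
    have Vrec: "inverse T ^ j * ?V j = (\<Sum>k\<le>m. step_count q d j k * ?V k)" if "j \<le> m" for j
    proof -
      have "?V j = T ^ j * (\<Sum>k\<le>j. step_count q d j k * ?V k)"
        using gen[of j] that less.prems by (intro lattice_gf_rec) (auto simp: step_count_diag)
      also have "(\<Sum>k\<le>j. step_count q d j k * ?V k) = (\<Sum>k\<le>m. step_count q d j k * ?V k)"
        using that by (intro sum.mono_neutral_left) (auto simp: step_count_def)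
      finally show ?thesis using nz by (simp add: field_simps power_inverse)
    qed
    have "(\<Sum>j\<le>m. ?C j * G j) =
       (\<Sum>j\<le>m. ?C j * ((- 1) ^ j * q ^ (j choose 2) * (\<Sum>k\<le>m. step_count q d j k * ?V k)))"
      unfolding G_def using Vrec by (intro sum.cong) (auto simp: mult.assoc)
    also have "\<dots> = (\<Sum>k\<le>m. (\<Sum>j\<le>m. ?C j * ((- 1) ^ j * q ^ (j choose 2) * step_count q d j k)) * ?V k)"
      by (simp only: sum_distrib_left sum_distrib_right, subst sum.swap) (simp add: mult_ac)
    also have "\<dots> = (\<Sum>k\<le>m. if k = m then (- 1) ^ m * q ^ (m choose 2) * ?V m else 0)"
      using step_count_inversion[OF nz(1) q _ less.prems] by (intro sum.cong) auto
    also have "\<dots> = (- 1) ^ m * q ^ (m choose 2) * ?V m"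
      by simp
    finally have G: "G m = inverse T ^ m * (\<Sum>j\<le>m. ?C j * G j)"
      by (simp add: G_def)
    have C: "inverse T ^ m * ?C m \<noteq> 1"
    proof
      assume "inverse T ^ m * ?C m = 1"
      moreover have "inverse T ^ m * ?C m = inverse (T ^ m * q ^ (m * (d - m)))"
        unfolding step_count_diag[OF less.prems] power_inverse inverse_mult_distrib ..
      ultimately have "T ^ m * q ^ (m * (d - m)) = 1"
        by (simp only: inverse_eq_1_iff)
      then show False using gen[of m] less.prems False by blast
    qed
    have W: "?W m = inverse T ^ m * (\<Sum>j\<le>m. ?C j * ?W j)"
      by (rule lattice_gf_rec) (rule C)
    have "(\<Sum>j<m. ?C j * ?W j) = (\<Sum>j<m. ?C j * G j)"
      using less unfolding G_def by (intro sum.cong) auto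
    moreover have "{..m} = insert m {..<m}" by auto
    ultimately have "?W m - G m = inverse T ^ m * ?C m * (?W m - G m)"
      by (subst W, subst G) (simp add: algebra_simps)
    then have "(1 - inverse T ^ m * ?C m) * (?W m - G m) = 0"
      by (simp add: left_diff_distrib)
    then show ?thesis using C unfolding G_def by simp
  qed (simp add: numeral_2_eq_2)
qed

corollary lattice_gf_total_reciprocity:
  fixes q T :: "'a::field"
  assumes nz: "q \<noteq> 0" "T \<noteq> 0" and q: "\<And>i. i > 0 \<Longrightarrow> q ^ i \<noteq> 1"
    and gen: "\<And>m. 0 < m \<Longrightarrow> m \<le> d \<Longrightarrow> T ^ m * q ^ (m * (d - m)) \<noteq> 1"
  shows "(\<Sum>m\<le>d. lattice_gf (inverse q) (inverse T) d m) =
    (- 1) ^ d * q ^ (d choose 2) * T ^ d * (\<Sum>m\<le>d. lattice_gf q T d m)"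
proof -
  have top: "lattice_gf q T d d = T ^ d * (\<Sum>m\<le>d. lattice_gf q T d m)"
    if "d > 0 \<Longrightarrow> T ^ d \<noteq> 1" for q T :: 'a
    using lattice_gf_rec[of d T q d] that by (simp add: step_count_top)
  have 1: "d > 0 \<Longrightarrow> T ^ d \<noteq> 1" using gen[of d] by simp
  then have 2: "d > 0 \<Longrightarrow> inverse T ^ d \<noteq> 1" by (simp add: power_inverse)
  have TT: "T ^ d * inverse T ^ d = 1"
    using nz by (simp flip: power_mult_distrib)
  have "lattice_gf (inverse q) (inverse T) d d = inverse T ^ d * (\<Sum>m\<le>d. lattice_gf (inverse q) (inverse T) d m)"
    by (rule top) (rule 2)
  with TT have "(\<Sum>m\<le>d. lattice_gf (inverse q) (inverse T) d m) =
      T ^ d * lattice_gf (inverse q) (inverse T) d d"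
    by (simp only: mult.assoc[symmetric] mult_1_left)
  also have "\<dots> = (- 1) ^ d * q ^ (d choose 2) * (T ^ d * inverse T ^ d) * lattice_gf q T d d"
    by (subst lattice_gf_reciprocity[OF nz q gen order.refl]) (auto simp: mult_ac)
  also have "lattice_gf q T d d = T ^ d * (\<Sum>m\<le>d. lattice_gf q T d m)"
    by (rule top) (rule 1)
  finally show ?thesis unfolding TT by (simp add: mult_ac)
qed

text \<open>The factors are the zeta function of the lattice R^2 of rank 2n, the inverse of the sum
  of u^deg over all ideals, and the sum over pairs. The argument u = y^2 comes from the index of J x
  J in R^2, and T = q^(2n) y from the |R/M|^(2n) homomorphisms from a sublattice L of R^2 to
  R/M.\<close>

definition euler_gf :: "'a::field \<Rightarrow> 'a \<Rightarrow> ('b \<Rightarrow> nat) \<Rightarrow> 'b set \<Rightarrow> 'a" where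
  "euler_gf q y f I =
     (\<Sum>m\<le>2 * sum f I. lattice_gf q y (2 * sum f I) m) * (\<Prod>i\<in>I. 1 - (y\<^sup>2) ^ f i) *
     (\<Sum>S\<in>Pow I. \<Sum>m\<le>sum f I. flag_gf q (q ^ (2 * sum f I) * y) (y\<^sup>2) f S m)"

text \<open>Exponents of q: (3n choose 2) = (2n choose 2) + (n choose 2) + 2n n, the last term from
  q^(2n) inside T. Exponents of y: 2n from the lattice, 4n - 2n from u, and n from T. The sign
  (-1)^(card I) of the sum over pairs is cancelled by the product over I.\<close>

theorem euler_gf_functional_equation:
  fixes q y :: "'a::field" and f :: "'b \<Rightarrow> nat"
  assumes nz: "q \<noteq> 0" "y \<noteq> 0" and q: "\<And>i. i > 0 \<Longrightarrow> q ^ i \<noteq> 1"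
    and gen: "\<And>i j. i > 0 \<Longrightarrow> y ^ i * q ^ j \<noteq> 1"
    and I: "finite I" "I \<noteq> {}" and f: "\<And>i. i \<in> I \<Longrightarrow> f i > 0"
  defines "n \<equiv> sum f I"
  shows "euler_gf (inverse q) (inverse y) f I =
    (- 1) ^ (3 * n) * q ^ ((3 * n) choose 2) * y ^ (5 * n) * euler_gf q y f I"
proof -
  let ?T = "q ^ (2 * n) * y" and ?u = "y\<^sup>2"
  let ?L = "\<lambda>q y. \<Sum>m\<le>2 * n. lattice_gf q y (2 * n) m"
  let ?F = "\<lambda>q T u. \<Sum>S\<in>Pow I. \<Sum>m\<le>n. flag_gf q T u f S m"
  have 1: "?L (inverse q) (inverse y) = (- 1) ^ (2 * n) * q ^ ((2 * n) choose 2) * y ^ (2 * n) * ?L q y"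
    using gen by (intro lattice_gf_total_reciprocity nz q) auto
  have iT: "inverse q ^ (2 * n) * inverse y = inverse ?T" and iu: "(inverse y)\<^sup>2 = inverse ?u"
    by (simp_all add: power_inverse)
  have 2: "?F (inverse q) (inverse ?T) (inverse ?u) =
      (- 1) ^ (card I + n) * q ^ (n choose 2) * ?u ^ (2 * n) * ?T ^ n * ?F q ?T ?u"
    unfolding n_def
  proof (intro flag_gf_total_reciprocity q I f)
    fix A :: "'b set" and m assume A: "A \<subseteq> I" "A \<noteq> {}"
    let ?t = "q ^ (2 * sum f I) * y"
    have "finite A" using A I finite_subset by blast
    then have "sum f A > 0" using A f by (intro sum_pos) blast+
    moreover have "?u ^ sum f A * ?t ^ m * q ^ (m * (sum f A - m)) =
       y ^ (2 * sum f A + m) * q ^ (2 * sum f I * m + m * (sum f A - m))"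
      by (simp only: power_mult_distrib power_add power_mult[symmetric] mult_ac)
    ultimately show "?u ^ sum f A * ?t ^ m * q ^ (m * (sum f A - m)) \<noteq> 1"
      using gen[of "2 * sum f A + m" "2 * sum f I * m + m * (sum f A - m)"] by simp
  qed (use nz in auto)
  have "(\<Prod>i\<in>I. 1 - inverse ?u ^ f i) * ?u ^ n = (\<Prod>i\<in>I. (1 - inverse ?u ^ f i) * ?u ^ f i)"
    by (simp add: prod.distrib n_def power_sum)
  also have "\<dots> = (\<Prod>i\<in>I. (-1) * (1 - ?u ^ f i))"
    using nz by (intro prod.cong) (auto simp: left_diff_distrib power_inverse)
  also have "\<dots> = (- 1) ^ card I * (\<Prod>i\<in>I. 1 - ?u ^ f i)"
    by (simp only: prod.distrib prod_constant)
  finally have 3: "(\<Prod>i\<in>I. 1 - inverse ?u ^ f i) * ?u ^ n = (- 1) ^ card I * (\<Prod>i\<in>I. 1 - ?u ^ f i)" .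
  have "((2 * n) choose 2) + (n choose 2) + 2 * n * n = (3 * n) choose 2"
    using choose_2_add[of "2 * n" n] by simp
  then have e: "q ^ ((2 * n) choose 2) * q ^ (n choose 2) * q ^ (2 * n * n) = q ^ ((3 * n) choose 2)"
    by (simp only: power_add[symmetric])
  have "euler_gf (inverse q) (inverse y) f I =
      ?L (inverse q) (inverse y) * (\<Prod>i\<in>I. 1 - inverse ?u ^ f i) * ?F (inverse q) (inverse ?T) (inverse ?u)"
    by (simp only: euler_gf_def iT iu n_def[symmetric])
  also have "\<dots> = (- 1) ^ (2 * n) * (- 1) ^ (card I + n) * (q ^ ((2 * n) choose 2) * q ^ (n choose 2) * q ^ (2 * n * n)) *
      (y ^ (2 * n) * ?u ^ n * y ^ n) *
      ?L q y * ((\<Prod>i\<in>I. 1 - inverse ?u ^ f i) * ?u ^ n) * ?F q ?T ?u"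
  proof -
    have "?u ^ (2 * n) = ?u ^ n * ?u ^ n" by (simp only: mult_2 power_add)
    moreover have "?T ^ n = q ^ (2 * n * n) * y ^ n" by (simp only: power_mult_distrib power_mult)
    ultimately show ?thesis unfolding 1 2 by (simp only: mult_ac)
  qed
  also have "\<dots> = ((- 1) ^ (2 * n) * (- 1) ^ (card I + n) * (-1) ^ card I) * q ^ ((3 * n) choose 2) *
      (y ^ (2 * n) * ?u ^ n * y ^ n) *
      (?L q y * (\<Prod>i\<in>I. 1 - ?u ^ f i) * ?F q ?T ?u)"
    unfolding 3 e by (simp only: mult_ac)
  also have "y ^ (2 * n) * ?u ^ n * y ^ n = y ^ (5 * n)"
    by (simp only: power_mult[symmetric] power_add[symmetric]) simp
  also have "(- 1) ^ (2 * n) * (- 1) ^ (card I + n) * (-1) ^ card I = ((- 1) ^ (3 * n) :: 'a)"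
    by (simp add: power_add power_mult power_mult_distrib[symmetric])
  finally show ?thesis
    by (simp only: euler_gf_def n_def[symmetric])
qed

section \<open>Subgroups of finite index\<close>

text \<open>Additive groups are taken inside real vector spaces: they are then torsion-free, and
  integer multiples are scalings.\<close>

definition subgrp :: "'a::real_vector set \<Rightarrow> bool" where
  "subgrp H \<longleftrightarrow> 0 \<in> H \<and> (\<forall>x\<in>H. \<forall>y\<in>H. x - y \<in> H)"

definition cosets :: "'a::real_vector set \<Rightarrow> 'a set \<Rightarrow> 'a set set" where
  "cosets E H = (\<lambda>x. (+) x ` H) ` E"

text \<open>Since \<open>card\<close> is 0 on infinite sets, \<open>idx E H > 0\<close> expresses
  that the index is finite and E is not empty.\<close>

definition idx :: "'a::real_vector set \<Rightarrow> 'a set \<Rightarrow> nat" where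
  "idx E H = card (cosets E H)"

lemma subgrpI: "0 \<in> H \<Longrightarrow> (\<And>x y. x \<in> H \<Longrightarrow> y \<in> H \<Longrightarrow> x - y \<in> H) \<Longrightarrow> subgrp H"
  by (simp add: subgrp_def)

lemma subgrp_0: "subgrp H \<Longrightarrow> 0 \<in> H"
  by (simp add: subgrp_def)

lemma subgrp_diff: "subgrp H \<Longrightarrow> x \<in> H \<Longrightarrow> y \<in> H \<Longrightarrow> x - y \<in> H"
  by (simp add: subgrp_def)

lemma subgrp_uminus: "subgrp H \<Longrightarrow> x \<in> H \<Longrightarrow> - x \<in> H"
  using subgrp_diff[of H 0 x] subgrp_0 by auto

lemma subgrp_add: "subgrp H \<Longrightarrow> x \<in> H \<Longrightarrow> y \<in> H \<Longrightarrow> x + y \<in> H"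
  using subgrp_diff[of H x "- y"] subgrp_uminus by auto

lemma subgrp_sum: "subgrp H \<Longrightarrow> (\<And>i. i \<in> A \<Longrightarrow> f i \<in> H) \<Longrightarrow> sum f A \<in> H"
  by (induction A rule: infinite_finite_induct) (auto intro: subgrp_0 subgrp_add)

lemma subgrp_of_nat: "subgrp H \<Longrightarrow> x \<in> H \<Longrightarrow> real n *\<^sub>R x \<in> H"
  by (induction n) (auto intro: subgrp_0 subgrp_add simp: scaleR_add_left)

lemma subgrp_of_int: "subgrp H \<Longrightarrow> x \<in> H \<Longrightarrow> real_of_int k *\<^sub>R x \<in> H"
proof (cases "k \<ge> 0")
  case False
  assume H: "subgrp H" "x \<in> H"
  have "real_of_int k *\<^sub>R x = - (real (nat (- k)) *\<^sub>R x)"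
    using False by (simp add: scaleR_minus_left[symmetric] del: scaleR_minus_left)
  then show ?thesis using H by (metis subgrp_of_nat subgrp_uminus)
qed (metis subgrp_of_nat of_nat_nat of_int_of_nat_eq)

lemma subgrp_Int: "subgrp H \<Longrightarrow> subgrp K \<Longrightarrow> subgrp (H \<inter> K)"
  by (simp add: subgrp_def)

lemma subgrp_plus: 
  assumes "subgrp H" "subgrp K" shows "subgrp (H + K)"
proof (rule subgrpI)
  show "0 \<in> H + K" using assms subgrp_0 by (metis add.right_neutral set_plus_intro)
  fix x y assume "x \<in> H + K" "y \<in> H + K"
  then obtain a b c d where "x = a + b" "y = c + d" "a \<in> H" "b \<in> K" "c \<in> H" "d \<in> K"
    by (elim set_plus_elim)
  then have "x - y = (a - c) + (b - d)" "a - c \<in> H" "b - d \<in> K"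
    using assms subgrp_diff by auto
  then show "x - y \<in> H + K" by (metis set_plus_intro)
qed

lemma plus_upper1: "subgrp K \<Longrightarrow> H \<subseteq> H + K"
  by (metis add.right_neutral set_plus_intro subgrp_0 subsetI)

lemma plus_upper2: "subgrp H \<Longrightarrow> K \<subseteq> H + K"
  by (metis add.left_neutral set_plus_intro subgrp_0 subsetI)

lemma plus_least: "subgrp E \<Longrightarrow> H \<subseteq> E \<Longrightarrow> K \<subseteq> E \<Longrightarrow> H + K \<subseteq> E"
  by (auto elim!: set_plus_elim intro: subgrp_add)

lemma plus_absorb: "subgrp H \<Longrightarrow> subgrp K \<Longrightarrow> K \<subseteq> H \<Longrightarrow> H + K = H"
  using plus_least[of H H K] plus_upper1[of K H] by auto

lemma subgrp_image:
  assumes "linear \<phi>" "subgrp H"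
  shows "subgrp (\<phi> ` H)"
proof (rule subgrpI)
  show "0 \<in> \<phi> ` H" using assms by (metis image_eqI linear_0 subgrp_0)
  fix x y assume "x \<in> \<phi> ` H" "y \<in> \<phi> ` H"
  then obtain a b where "a \<in> H" "b \<in> H" "x = \<phi> a" "y = \<phi> b" by blast
  then have "x - y = \<phi> (a - b)" "a - b \<in> H"
    using linear_diff[OF assms(1)] subgrp_diff[OF assms(2)] by auto
  then show "x - y \<in> \<phi> ` H" by blast
qed

lemma subgrp_vimage: "linear \<phi> \<Longrightarrow> subgrp B \<Longrightarrow> subgrp C \<Longrightarrow> subgrp {x \<in> B. \<phi> x \<in> C}"
  by (auto simp: subgrp_def linear_0 linear_diff)

lemma coset_eq_iff: "subgrp H \<Longrightarrow> (+) x ` H = (+) y ` H \<longleftrightarrow> x - y \<in> H"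
proof
  assume H: "subgrp H" and "(+) x ` H = (+) y ` H"
  then have "x + 0 \<in> (+) y ` H" using subgrp_0 by blast
  then show "x - y \<in> H" by auto
next
  assume H: "subgrp H" and d: "x - y \<in> H"
  have "(+) x ` H \<subseteq> (+) y ` H" if "x - y \<in> H" for x y
  proof
    fix z assume "z \<in> (+) x ` H"
    then obtain h where "h \<in> H" "z = y + ((x - y) + h)" by auto
    then show "z \<in> (+) y ` H" using subgrp_add[OF H that] by blast
  qed
  from this[OF d] this[of y x] show "(+) x ` H = (+) y ` H"
    using subgrp_uminus[OF H d] by auto
qed

lemma card_image_eq:
  assumes "\<And>x y. x \<in> A \<Longrightarrow> y \<in> A \<Longrightarrow> f x = f y \<longleftrightarrow> g x = g y"
  shows "card (f ` A) = card (g ` A)"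
proof (rule bij_betw_same_card)
  let ?h = "\<lambda>z. g (inv_into A f z)"
  have *: "?h (f x) = g x" if "x \<in> A" for x
    using assms[of "inv_into A f (f x)" x] that by (simp add: f_inv_into_f inv_into_into)
  then show "bij_betw ?h (f ` A) (g ` A)"
    using assms by (auto simp: bij_betw_def inj_on_def image_iff)
qed

lemma idx_self: "subgrp H \<Longrightarrow> idx H H = 1"
proof -
  assume H: "subgrp H"
  have "(+) x ` H = H" if "x \<in> H" for x
    using coset_eq_iff[OF H, of x 0] that by simp
  then have "cosets H H = (\<lambda>x. H) ` H"
    unfolding cosets_def by (intro image_cong) auto
  also have "\<dots> = {H}" using subgrp_0[OF H] by auto
  finally have "cosets H H = {H}" .
  then show ?thesis by (simp add: idx_def)
qed

text \<open>A choice r of representatives turns a J-coset in E into an H-coset in E together with a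
  J-coset in H. The value 0 of \<open>card\<close> on infinite sets respects products, so infinite
  indices are covered.\<close>

lemma idx_mult:
  assumes "subgrp J" "subgrp H" "subgrp E" "J \<subseteq> H" "H \<subseteq> E"
  shows "idx E J = idx E H * idx H J"
proof -
  define r where "r = (\<lambda>Z. SOME x. x \<in> E \<and> (+) x ` H = Z)"
  have r: "r ((+) x ` H) \<in> E" "(+) (r ((+) x ` H)) ` H = (+) x ` H" if "x \<in> E" for x
    using someI[of "\<lambda>y. y \<in> E \<and> (+) y ` H = (+) x ` H" x] that unfolding r_def by auto
  define g where "g = (\<lambda>x. ((+) x ` H, (+) (x - r ((+) x ` H)) ` J))"
  have "idx E J = card (g ` E)"
    unfolding idx_def cosets_def
  proof (rule card_image_eq)
    fix x y assume "x \<in> E" "y \<in> E"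
    have "x - y \<in> H" if "x - y \<in> J" using that assms by blast
    then show "(+) x ` J = (+) y ` J \<longleftrightarrow> g x = g y"
      unfolding g_def by (auto simp: coset_eq_iff assms)
        (metis coset_eq_iff[OF assms(2)] diff_diff_eq2 diff_add_cancel add_diff_eq)+
  qed
  also have "g ` E = cosets E H \<times> cosets H J"
  proof (intro equalityI subsetI)
    fix z assume "z \<in> g ` E"
    then obtain x where x: "x \<in> E" "z = g x" by blast
    then have "x - r ((+) x ` H) \<in> H" using r[OF x(1)] coset_eq_iff[OF assms(2)] by metis
    then show "z \<in> cosets E H \<times> cosets H J" using x by (auto simp: g_def cosets_def)
  next
    fix z assume "z \<in> cosets E H \<times> cosets H J"
    then obtain x h where x: "x \<in> E" "h \<in> H" "z = ((+) x ` H, (+) h ` J)"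
      by (auto simp: cosets_def)
    let ?y = "r ((+) x ` H) + h"
    have "?y \<in> E" using x r assms subgrp_add by blast
    moreover have "(+) ?y ` H = (+) x ` H"
      using x r(2)[OF x(1)] coset_eq_iff[OF assms(2), of ?y "r ((+) x ` H)"] by simp
    ultimately show "z \<in> g ` E"
      using x by (intro image_eqI[of _ _ ?y]) (auto simp: g_def)
  qed
  finally show ?thesis by (simp add: idx_def card_cartesian_product)
qed

lemma idx_vimage:
  assumes "linear \<phi>" "subgrp B" "subgrp C"
  shows "idx B {x \<in> B. \<phi> x \<in> C} = idx (\<phi> ` B + C) C"
proof -
  let ?K = "{x \<in> B. \<phi> x \<in> C}"
  have K: "subgrp ?K" using assms by (rule subgrp_vimage)
  have "idx B ?K = card ((\<lambda>x. (+) (\<phi> x) ` C) ` B)"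
    unfolding idx_def cosets_def
  proof (rule card_image_eq)
    fix x y assume "x \<in> B" "y \<in> B"
    then show "(+) x ` ?K = (+) y ` ?K \<longleftrightarrow> (+) (\<phi> x) ` C = (+) (\<phi> y) ` C"
      using assms by (auto simp: coset_eq_iff[OF K] coset_eq_iff[OF assms(3)] linear_diff subgrp_diff)
  qed
  also have "(\<lambda>x. (+) (\<phi> x) ` C) ` B = cosets (\<phi> ` B + C) C"
  proof (intro equalityI subsetI)
    fix z assume "z \<in> (\<lambda>x. (+) (\<phi> x) ` C) ` B"
    then show "z \<in> cosets (\<phi> ` B + C) C"
      using plus_upper1[OF assms(3), of "\<phi> ` B"] unfolding cosets_def by blast
  next
    fix z assume "z \<in> cosets (\<phi> ` B + C) C"
    then obtain b c where "b \<in> B" "c \<in> C" "z = (+) (\<phi> b + c) ` C"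
      unfolding cosets_def by (auto elim!: set_plus_elim)
    then have "z = (+) (\<phi> b) ` C" using coset_eq_iff[OF assms(3), of "\<phi> b + c" "\<phi> b"] by simp
    then show "z \<in> (\<lambda>x. (+) (\<phi> x) ` C) ` B" using \<open>b \<in> B\<close> by blast
  qed
  finally show ?thesis by (simp add: idx_def)
qed

lemma idx_Int: "subgrp H \<Longrightarrow> subgrp K \<Longrightarrow> idx H (H \<inter> K) = idx (H + K) K"
  using idx_vimage[of "\<lambda>x. x" H K] by (simp add: linear_ident Int_def)

lemma idx_image:
  assumes "linear \<phi>" "inj \<phi>" "subgrp E" "subgrp H"
  shows "idx (\<phi> ` E) (\<phi> ` H) = idx E H"
proof -
  have "cosets (\<phi> ` E) (\<phi> ` H) = (\<lambda>Z. \<phi> ` Z) ` cosets E H"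
    unfolding cosets_def image_image using assms by (simp add: linear_add)
  moreover have "inj (image \<phi>)" using assms(2) by (simp add: inj_image_eq_iff inj_def)
  ultimately show ?thesis unfolding idx_def by (simp add: card_image inj_on_subset)
qed

lemma finite_cosets: "idx E H > 0 \<Longrightarrow> finite (cosets E H)"
  unfolding idx_def by (rule card_ge_0_finite)

text \<open>Translation by x permutes the cosets. Summing the elements x + r Z - r (x + Z) of H over
  all cosets Z cancels the representatives and leaves the index times x.\<close>

lemma lagrange:
  assumes "subgrp H" "subgrp E" "H \<subseteq> E" "idx E H > 0" "x \<in> E"
  shows "real (idx E H) *\<^sub>R x \<in> H"
proof -
  let ?C = "cosets E H"
  have fin: "finite ?C" using assms(4) by (rule finite_cosets)
  define r where "r = (\<lambda>Z. SOME y. y \<in> E \<and> (+) y ` H = Z)"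
  have r: "r Z \<in> E \<and> (+) (r Z) ` H = Z" if Z: "Z \<in> ?C" for Z
  proof -
    obtain y where "y \<in> E \<and> (+) y ` H = Z" using Z by (auto simp: cosets_def)
    then show ?thesis unfolding r_def by (rule someI)
  qed
  define s where "s = (\<lambda>Z. (+) x ` Z)"
  have s_in: "s Z \<in> ?C" if "Z \<in> ?C" for Z
  proof -
    from that obtain y where "y \<in> E" "Z = (+) y ` H" by (auto simp: cosets_def)
    then have "s Z = (+) (x + y) ` H" "x + y \<in> E"
      using assms subgrp_add by (auto simp: s_def image_image add.assoc)
    then show ?thesis by (auto simp: cosets_def)
  qed
  have "inj_on s ?C" unfolding s_def by (auto intro!: inj_onI simp: inj_image_eq_iff)
  then have bij: "bij_betw s ?C ?C"
    using endo_inj_surj[OF fin, of s] s_in by (auto simp: bij_betw_def)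
  have "x + r Z - r (s Z) \<in> H" if Z: "Z \<in> ?C" for Z
  proof -
    have "s Z = s ((+) (r Z) ` H)" using r[OF Z] by simp
    also have "\<dots> = (+) (x + r Z) ` H" by (simp add: s_def image_image add.assoc)
    finally have "(+) (x + r Z) ` H = s Z" ..
    then show ?thesis using r[OF s_in[OF Z]] coset_eq_iff[OF assms(1)] by metis
  qed
  then have "(\<Sum>Z\<in>?C. x + r Z - r (s Z)) \<in> H" by (intro subgrp_sum assms)
  also have "(\<Sum>Z\<in>?C. x + r Z - r (s Z)) = real (card ?C) *\<^sub>R x + sum r ?C - (\<Sum>Z\<in>?C. r (s Z))"
    by (simp add: sum.distrib sum_subtractf sum_constant_scaleR)
  also have "(\<Sum>Z\<in>?C. r (s Z)) = sum r ?C"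
    by (rule sum.reindex_bij_betw[OF bij])
  finally show ?thesis by (simp add: idx_def)
qed

lemma finite_between:
  assumes "subgrp J" "idx E J > 0"
  shows "finite {H. subgrp H \<and> J \<subseteq> H \<and> H \<subseteq> E}"
proof (rule inj_on_finite)
  show "(\<lambda>H. cosets H J) ` {H. subgrp H \<and> J \<subseteq> H \<and> H \<subseteq> E} \<subseteq> Pow (cosets E J)"
    by (auto simp: cosets_def)
  show "finite (Pow (cosets E J))" using finite_cosets[OF assms(2)] by simp
  show "inj_on (\<lambda>H. cosets H J) {H. subgrp H \<and> J \<subseteq> H \<and> H \<subseteq> E}"
  proof -
    obtain j where j: "j \<in> J" using assms(1) subgrp_0 by blast
    have "H = \<Union> (cosets H J)" if "subgrp H" "J \<subseteq> H" for H
    proof (intro equalityI subsetI)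
      fix x assume "x \<in> H"
      then have "x - j \<in> H" "x = (x - j) + j" using that j subgrp_diff by auto
      then show "x \<in> \<Union> (cosets H J)" using j unfolding cosets_def by blast
    qed (use that in \<open>auto simp: cosets_def intro: subgrp_add\<close>)
    then show ?thesis by (intro inj_onI) (metis (mono_tags, lifting) mem_Collect_eq)
  qed
qed


lemma idx_pow_between:
  assumes "Factorial_Ring.prime p" "subgrp J" "subgrp H" "subgrp E" "J \<subseteq> H" "H \<subseteq> E" "idx E J = p ^ k"
  obtains a b where "idx E H = p ^ a" "idx H J = p ^ b" "a + b = k"
proof -
  have eq: "idx E H * idx H J = p ^ k" using idx_mult[OF assms(2-6)] assms(7) by simp
  then obtain a b where ab: "idx E H = p ^ a" "idx H J = p ^ b"
    using divides_primepow_nat[OF assms(1)] by (metis dvd_triv_left dvd_triv_right)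
  then have "p ^ (a + b) = p ^ k" using eq by (simp add: power_add)
  then have "a + b = k" using prime_gt_1_nat[OF assms(1)] by simp
  with ab show ?thesis using that by blast
qed

lemma idx_eq_1:
  assumes "subgrp H" "H \<subseteq> E" "idx E H = 1" "subgrp E"
  shows "E = H"
proof -
  have "x \<in> H" if "x \<in> E" for x using lagrange[of H E x] assms that by simp
  then show ?thesis using assms by blast
qed

section \<open>Adjoining one element, and subgroups of index p\<close>

definition line :: "'a::real_vector set \<Rightarrow> 'a \<Rightarrow> 'a set" where
  "line J z = J + range (\<lambda>k. real_of_int k *\<^sub>R z)"

lemma mem_line: "x \<in> line J z \<longleftrightarrow> (\<exists>j\<in>J. \<exists>k. x = j + real_of_int k *\<^sub>R z)"
  by (auto simp: line_def elim!: set_plus_elim)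

lemma subgrp_multiples: "subgrp (range (\<lambda>k. real_of_int k *\<^sub>R z))"
proof (rule subgrpI)
  show "0 \<in> range (\<lambda>k. real_of_int k *\<^sub>R z)" by (auto intro: image_eqI[of _ _ 0])
  fix x y assume "x \<in> range (\<lambda>k. real_of_int k *\<^sub>R z)" "y \<in> range (\<lambda>k. real_of_int k *\<^sub>R z)"
  then obtain a b where "x = real_of_int a *\<^sub>R z" "y = real_of_int b *\<^sub>R z" by auto
  then have "x - y = real_of_int (a - b) *\<^sub>R z" by (simp add: scaleR_diff_left)
  then show "x - y \<in> range (\<lambda>k. real_of_int k *\<^sub>R z)" by blast
qed

lemma subgrp_line: "subgrp J \<Longrightarrow> subgrp (line J z)"
  unfolding line_def by (intro subgrp_plus subgrp_multiples)

lemma line_base: "subgrp J \<Longrightarrow> J \<subseteq> line J z"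
  unfolding line_def by (intro plus_upper1 subgrp_multiples)

lemma line_point: "subgrp J \<Longrightarrow> z \<in> line J z"
  unfolding mem_line using subgrp_0[of J] by (intro bexI[of _ 0] exI[of _ 1]) auto

lemma line_subset: "subgrp E \<Longrightarrow> J \<subseteq> E \<Longrightarrow> z \<in> E \<Longrightarrow> line J z \<subseteq> E"
  by (auto simp: mem_line intro!: subgrp_add subgrp_of_int)

lemma multiple_mem_imp_dvd:
  assumes "Factorial_Ring.prime p" "subgrp J" "z \<notin> J" "real p *\<^sub>R z \<in> J" "real_of_int k *\<^sub>R z \<in> J"
  shows "int p dvd k"
proof (rule ccontr)
  assume "\<not> int p dvd k"
  then have "coprime (int p) k"
    using assms(1) by (simp add: prime_imp_coprime)
  then obtain u v where uv: "u * int p + v * k = 1"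
    using bezout_int[of "int p" k] by (auto simp: coprime_iff_gcd_eq_1)
  have "real_of_int u *\<^sub>R (real p *\<^sub>R z) + real_of_int v *\<^sub>R (real_of_int k *\<^sub>R z) \<in> J"
    by (intro subgrp_add subgrp_of_int assms)
  also have "real_of_int u *\<^sub>R (real p *\<^sub>R z) + real_of_int v *\<^sub>R (real_of_int k *\<^sub>R z) =
     real_of_int (u * int p + v * k) *\<^sub>R z"
    by (simp add: scaleR_add_left)
  finally show False unfolding uv using assms(3) by simp
qed

lemma idx_line:
  assumes "Factorial_Ring.prime p" "subgrp J" "z \<notin> J" "real p *\<^sub>R z \<in> J"
  shows "idx (line J z) J = p"
proof -
  let ?f = "\<lambda>i. (+) (real i *\<^sub>R z) ` J"
  have "cosets (line J z) J = ?f ` {..<p}"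
  proof (intro equalityI subsetI)
    fix Z assume "Z \<in> cosets (line J z) J"
    then obtain j k where jk: "j \<in> J" "Z = (+) (j + real_of_int k *\<^sub>R z) ` J"
      by (auto simp: cosets_def mem_line)
    define i where "i = nat (k mod int p)"
    have p: "int p > 0" using assms(1) prime_gt_0_nat by simp
    have "k = int i + (k div int p) * int p" using p by (simp add: i_def)
    then have k: "real_of_int k = real i + real_of_int (k div int p) * real p"
      by (metis of_int_add of_int_mult of_int_of_nat_eq)
    have "j + real_of_int k *\<^sub>R z - real i *\<^sub>R z = j + real_of_int (k div int p) *\<^sub>R (real p *\<^sub>R z)"
      by (simp add: k scaleR_add_left)
    also have "\<dots> \<in> J" using assms jk by (intro subgrp_add subgrp_of_int)
    finally have "Z = ?f i" unfolding jk(2) using coset_eq_iff[OF assms(2)] by blast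
    moreover have "i < p" using p by (simp add: i_def nat_less_iff)
    ultimately show "Z \<in> ?f ` {..<p}" by blast
  next
    fix Z assume "Z \<in> ?f ` {..<p}"
    then show "Z \<in> cosets (line J z) J"
      unfolding cosets_def using line_point[OF assms(2)] subgrp_line[OF assms(2)]
      by (auto intro!: imageI subgrp_of_nat)
  qed
  moreover have "inj_on ?f {..<p}"
  proof (rule inj_onI)
    fix i j assume ij: "i \<in> {..<p}" "j \<in> {..<p}" "?f i = ?f j"
    then have "real i *\<^sub>R z - real j *\<^sub>R z \<in> J" using coset_eq_iff[OF assms(2)] by blast
    then have "real_of_int (int i - int j) *\<^sub>R z \<in> J" by (simp add: scaleR_diff_left)
    then have "int p dvd int i - int j" by (rule multiple_mem_imp_dvd[OF assms])
    moreover have "\<bar>int i - int j\<bar> < int p" using ij by auto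
    ultimately show "i = j" by (metis abs_of_nat dvd_imp_le_int eq_iff_diff_eq_0 linorder_not_less of_nat_eq_iff)
  qed
  ultimately show ?thesis by (simp add: idx_def card_image)
qed

text \<open>Cauchy's theorem for the p-group E/J: take the last multiple p^j x of some x that is
  still outside J.\<close>

lemma ex_order_p_element:
  assumes "Factorial_Ring.prime p" "subgrp J" "subgrp E" "J \<subseteq> E" "E \<noteq> J" "idx E J = p ^ k"
  obtains z where "z \<in> E" "z \<notin> J" "real p *\<^sub>R z \<in> J"
proof -
  obtain x where x: "x \<in> E" "x \<notin> J" using assms by blast
  define P where "P = (\<lambda>i. real (p ^ i) *\<^sub>R x \<in> J)"
  have "P k" using lagrange[OF assms(2-4) _ x(1)] assms(6) prime_gt_0_nat[OF assms(1)]
    by (simp add: P_def)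
  define i where "i = (LEAST i. P i)"
  have i: "P i" "\<And>j. j < i \<Longrightarrow> \<not> P j"
    unfolding i_def using \<open>P k\<close> LeastI not_less_Least by blast+
  have "i \<noteq> 0" using i(1) x by (auto simp: P_def intro!: gr0I)
  then obtain j where j: "i = Suc j" using not0_implies_Suc by blast
  show ?thesis
  proof
    show "real (p ^ j) *\<^sub>R x \<in> E" using x assms by (intro subgrp_of_nat)
    show "real (p ^ j) *\<^sub>R x \<notin> J" using i(2)[of j] j by (simp add: P_def)
    show "real p *\<^sub>R real (p ^ j) *\<^sub>R x \<in> J" using i(1) j by (simp add: P_def)
  qed
qed

text \<open>A maximal proper subgroup has index p, because together with an element of order p
  modulo it, it generates E.\<close>

lemma ex_maximal_subgrp:
  assumes "Factorial_Ring.prime p" "subgrp J" "subgrp E" "J \<subseteq> E" "E \<noteq> J" "idx E J = p ^ k"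
  obtains E1 where "subgrp E1" "J \<subseteq> E1" "E1 \<subseteq> E" "idx E E1 = p"
proof -
  define A where "A = {H. subgrp H \<and> J \<subseteq> H \<and> H \<subseteq> E \<and> H \<noteq> E}"
  have "finite A"
    by (rule finite_subset[OF _ finite_between[of J E]])
      (use assms prime_gt_0_nat[OF assms(1)] in \<open>auto simp: A_def\<close>)
  moreover have "J \<in> A" using assms by (simp add: A_def)
  ultimately have "\<exists>m\<in>A. \<forall>b\<in>A. m \<subseteq> b \<longrightarrow> m = b"
    by (intro finite_has_maximal) auto
  then obtain E1 where "E1 \<in> A" and max: "\<And>H. H \<in> A \<Longrightarrow> E1 \<subseteq> H \<Longrightarrow> E1 = H"
    by blast
  then have E1: "subgrp E1" "J \<subseteq> E1" "E1 \<subseteq> E" "E1 \<noteq> E" by (auto simp: A_def)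
  obtain a b where a: "idx E E1 = p ^ a"
    by (rule idx_pow_between[OF assms(1,2) E1(1) assms(3) E1(2,3) assms(6)])
  obtain z where z: "z \<in> E" "z \<notin> E1" "real p *\<^sub>R z \<in> E1"
    by (rule ex_order_p_element[OF assms(1) E1(1) assms(3) E1(3) E1(4)[symmetric] a])
  have "line E1 z = E"
  proof (rule ccontr)
    assume "line E1 z \<noteq> E"
    moreover have base: "E1 \<subseteq> line E1 z" using line_base E1 by blast
    ultimately have "line E1 z \<in> A"
      unfolding A_def using line_subset[OF assms(3) E1(3) z(1)] subgrp_line[OF E1(1)] E1 by blast
    then have "E1 = line E1 z" using max base by blast
    then show False using line_point[of E1 z] z E1 by blast
  qed
  then have "idx E E1 = p" using idx_line[OF assms(1) E1(1) z(2,3)] by simp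
  then show ?thesis using that E1 by blast
qed

section \<open>Counting complements and subgroups in quotients\<close>

lemma card_fibers:
  assumes "finite A" "finite B" "f ` A \<subseteq> B" "\<And>b. b \<in> B \<Longrightarrow> card {a \<in> A. f a = b} = c"
  shows "card A = c * card B"
proof -
  have "card A = (\<Sum>b\<in>B. \<Sum>a\<in>{a \<in> A. f a = b}. 1)"
    using sum.group[OF assms(1-3), of "\<lambda>_. 1::nat"] by simp
  then show ?thesis using assms(4) by simp
qed

text \<open>Modulo J these are the complements of D/J in E/J. If there is one, they form a torsor
  under Hom(E/D, D/J), and the counts below are orders of this group.\<close>

definition complements :: "'a::real_vector set \<Rightarrow> 'a set \<Rightarrow> 'a set \<Rightarrow> 'a set set" where
  "complements E D J = {H. subgrp H \<and> H \<subseteq> E \<and> H \<inter> D = J \<and> H + D = E}"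

lemma finite_complements: "subgrp J \<Longrightarrow> idx E J > 0 \<Longrightarrow> finite (complements E D J)"
  by (rule finite_subset[OF _ finite_between[of J E]]) (auto simp: complements_def)

lemma idx_complement:
  assumes "subgrp D" "subgrp E" "H \<in> complements E D J"
  shows "idx E H = idx D J" "idx H J = idx E D"
proof -
  have H: "subgrp H" "H \<inter> D = J" "H + D = E" using assms(3) by (auto simp: complements_def)
  show "idx E H = idx D J" using idx_Int[OF assms(1) H(1)] H by (simp add: add.commute Int_commute)
  show "idx H J = idx E D" using idx_Int[OF H(1) assms(1)] H by simp
qed

text \<open>
  A subgroup \<open>H\<close> meeting \<open>E\<^sub>1\<close> in \<open>H\<^sub>1\<close> is determined by the coset of \<open>H\<^sub>1\<close> in which
  it meets the translate \<open>v + E\<^sub>1\<close>.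
\<close>

lemma card_complements_extending:
  assumes p: "Factorial_Ring.prime p" and sg: "subgrp J" "subgrp D" "subgrp E1" "subgrp E"
    and sub: "J \<subseteq> D" "D \<subseteq> E1" "E1 \<subseteq> E" and el: "\<And>x. x \<in> E \<Longrightarrow> real p *\<^sub>R x \<in> J"
    and i: "idx E E1 = p" and H1: "H1 \<in> complements E1 D J"
  shows "card {H \<in> complements E D J. H \<inter> E1 = H1} = idx D J"
proof -
  have H1': "subgrp H1" "H1 \<subseteq> E1" "H1 \<inter> D = J" "H1 + D = E1" "J \<subseteq> H1"
    using H1 by (auto simp: complements_def)
  have "E \<noteq> E1" using i idx_self[OF sg(3)] prime_gt_1_nat[OF p] by auto
  then obtain v where v: "v \<in> E" "v \<notin> E1" using sub by blast
  have pv: "real p *\<^sub>R v \<in> E1" using el[OF v(1)] sub by blast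
  have "idx E (line E1 v) * idx (line E1 v) E1 = idx E E1"
    using idx_mult[of E1 "line E1 v" E] sg subgrp_line[OF sg(3)] line_base[of E1 v] line_subset[of E E1 v] sub v by simp
  then have "idx E (line E1 v) = 1"
    using idx_line[OF p sg(3) v(2) pv] i prime_gt_0_nat[OF p] by simp
  then have E: "E = line E1 v"
    using idx_eq_1[of "line E1 v" E] sg subgrp_line[OF sg(3)] line_subset[of E E1 v] sub v by simp
  let ?F = "{H \<in> complements E D J. H \<inter> E1 = H1}"
  let ?\<psi> = "\<lambda>H. {w \<in> E1. v + w \<in> H}"
  have 1: "\<exists>w0\<in>E1. ?\<psi> H = (+) w0 ` H1 \<and> H = line H1 (v + w0)" if H: "H \<in> ?F" for H
  proof -
    have H': "subgrp H" "H \<subseteq> E" "H \<inter> D = J" "H + D = E" "H \<inter> E1 = H1"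
      using H by (auto simp: complements_def)
    \<comment> \<open>The element h = v - d shows that H meets the translate v + E1.\<close>
    obtain h d where hd: "h \<in> H" "d \<in> D" "v = h + d" using v(1) H'(4) by (auto elim!: set_plus_elim)
    have w0: "- d \<in> E1" "v + - d \<in> H" using hd sub subgrp_uminus[OF sg(3)] by auto
    have "?\<psi> H = (+) (- d) ` H1"
    proof (intro equalityI subsetI)
      fix w assume "w \<in> ?\<psi> H"
      then have "w - (- d) \<in> E1" "(v + w) - (v + - d) \<in> H"
        using subgrp_diff[OF sg(3) _ w0(1), of w] subgrp_diff[OF H'(1) _ w0(2), of "v + w"] by auto
      then have "w - (- d) \<in> H1" using H'(5) by auto
      then show "w \<in> (+) (- d) ` H1" by (intro image_eqI[of _ _ "w - (- d)"]) auto
    next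
      fix w assume "w \<in> (+) (- d) ` H1"
      then obtain h1 where h1: "h1 \<in> H1" "w = - d + h1" by auto
      then have "h1 \<in> E1" "h1 \<in> H" using H' by auto
      then have "- d + h1 \<in> E1" "(v + - d) + h1 \<in> H"
        using subgrp_add[OF sg(3) w0(1), of h1] subgrp_add[OF H'(1) w0(2), of h1] by auto
      moreover have "v + w = (v + - d) + h1" "w = - d + h1" using h1 by simp_all
      ultimately show "w \<in> ?\<psi> H" by (metis (mono_tags, lifting) mem_Collect_eq)
    qed
    moreover have "H = line H1 (v + - d)"
    proof (intro equalityI subsetI)
      fix x assume x: "x \<in> H"
      then have "x \<in> line E1 v" using H'(2) E by blast
      then obtain e k where ek: "e \<in> E1" "x = e + real_of_int k *\<^sub>R v"
        unfolding mem_line by blast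
      have "x - real_of_int k *\<^sub>R (v + - d) \<in> H" using x w0 H' by (intro subgrp_diff subgrp_of_int)
      moreover have "x - real_of_int k *\<^sub>R (v + - d) = e - real_of_int k *\<^sub>R (- d)"
        using ek by (simp add: scaleR_add_right scaleR_diff_right)
      moreover have "e - real_of_int k *\<^sub>R (- d) \<in> E1" using ek w0 sg by (intro subgrp_diff subgrp_of_int)
      ultimately have "x - real_of_int k *\<^sub>R (v + - d) \<in> H1" using H'(5) by auto
      then show "x \<in> line H1 (v + - d)" unfolding mem_line
        by (intro bexI[of _ "x - real_of_int k *\<^sub>R (v + - d)"] exI[of _ k]) auto
    next
      fix x assume "x \<in> line H1 (v + - d)"
      then show "x \<in> H" using line_subset[OF H'(1), of H1 "v + - d"] w0 H'(5) by blast
    qed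
    ultimately show ?thesis using w0(1) by blast
  qed
  have 2: "line H1 (v + w) \<in> ?F" if w: "w \<in> E1" for w
  proof -
    let ?H = "line H1 (v + w)"
    have sgH: "subgrp ?H" using H1' subgrp_line by blast
    have vw: "v + w \<in> E" using v w sub sg subgrp_add by blast
    have HE: "?H \<subseteq> E" using line_subset[OF sg(4) _ vw] H1' sub by blast
    have inter: "?H \<inter> E1 = H1"
    proof (intro equalityI subsetI)
      fix x assume x: "x \<in> ?H \<inter> E1"
      then obtain h k where hk: "h \<in> H1" "x = h + real_of_int k *\<^sub>R (v + w)" by (auto simp: mem_line)
      have "real_of_int k *\<^sub>R v = x - h - real_of_int k *\<^sub>R w" using hk by (simp add: scaleR_add_right)
      also have "\<dots> \<in> E1" using x hk H1' w sg by (intro subgrp_diff subgrp_of_int) auto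
      finally have "int p dvd k" by (rule multiple_mem_imp_dvd[OF p sg(3) v(2) pv])
      then obtain l where "k = int p * l" by blast
      then have "real_of_int k *\<^sub>R (v + w) = real_of_int l *\<^sub>R (real p *\<^sub>R (v + w))" by (simp add: mult.commute)
      also have "\<dots> \<in> H1" using el[OF vw] H1' by (intro subgrp_of_int) auto
      finally show "x \<in> H1" using hk H1' subgrp_add by blast
    qed (use H1' line_base in blast)
    moreover have "?H \<inter> D = J" using inter H1'(3) sub by blast
    moreover have "?H + D = E"
    proof (intro equalityI)
      show "?H + D \<subseteq> E" using plus_least[OF sg(4) HE] sub by blast
      show "E \<subseteq> ?H + D"
      proof
        fix x assume "x \<in> E"
        then have "x \<in> line E1 v" using E by blast
        then obtain e k where ek: "e \<in> E1" "x = e + real_of_int k *\<^sub>R v"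
          unfolding mem_line by blast
        have "e - real_of_int k *\<^sub>R w \<in> H1 + D" unfolding H1'(4) using ek w sg by (intro subgrp_diff subgrp_of_int)
        then obtain h d where "h \<in> H1" "d \<in> D" "e - real_of_int k *\<^sub>R w = h + d" by (auto elim: set_plus_elim)
        then have "x = (h + real_of_int k *\<^sub>R (v + w)) + d" "h + real_of_int k *\<^sub>R (v + w) \<in> ?H"
          using ek by (auto simp: mem_line scaleR_add_right algebra_simps)
        then show "x \<in> ?H + D" using \<open>d \<in> D\<close> by (metis set_plus_intro)
      qed
    qed
    ultimately show ?thesis using sgH HE by (simp add: complements_def)
  qed
  have "bij_betw ?\<psi> ?F (cosets E1 H1)"
  proof (rule bij_betw_imageI)
    show "inj_on ?\<psi> ?F"
    proof (rule inj_onI)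
      fix H H' assume H: "H \<in> ?F" "H' \<in> ?F" "?\<psi> H = ?\<psi> H'"
      obtain w w' where w: "w \<in> E1" "?\<psi> H = (+) w ` H1" "H = line H1 (v + w)"
          "w' \<in> E1" "?\<psi> H' = (+) w' ` H1" "H' = line H1 (v + w')"
        using 1[OF H(1)] 1[OF H(2)] by metis
      then have "w \<in> ?\<psi> H'" "w' \<in> ?\<psi> H" using H(3) subgrp_0[OF H1'(1)] by force+
      then have "v + w \<in> H'" "v + w' \<in> H" by auto
      moreover have "H1 \<subseteq> H" "H1 \<subseteq> H'" "subgrp H" "subgrp H'" using H by (auto simp: complements_def)
      ultimately show "H = H'" using w line_subset by blast
    qed
    show "?\<psi> ` ?F = cosets E1 H1"
    proof (intro equalityI subsetI)
      fix Z assume "Z \<in> ?\<psi> ` ?F"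
      then obtain H where "H \<in> ?F" "Z = ?\<psi> H" by blast
      then show "Z \<in> cosets E1 H1" using 1[of H] unfolding cosets_def by blast
    next
      fix Z assume "Z \<in> cosets E1 H1"
      then obtain w where w: "w \<in> E1" "Z = (+) w ` H1" by (auto simp: cosets_def)
      let ?H = "line H1 (v + w)"
      have F: "?H \<in> ?F" by (rule 2[OF w(1)])
      obtain w' where w': "w' \<in> E1" "?\<psi> ?H = (+) w' ` H1" using 1[OF F] by blast
      have "w \<in> ?\<psi> ?H" using w line_point[OF H1'(1)] by simp
      then have "w - w' \<in> H1" using w'(2) by auto
      then have "Z = ?\<psi> ?H" using w w' coset_eq_iff[OF H1'(1)] by metis
      then show "Z \<in> ?\<psi> ` ?F" using F by blast
    qed
  qed
  then have "card ?F = idx E1 H1" unfolding idx_def by (rule bij_betw_same_card)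
  then show ?thesis using idx_complement[OF sg(2,3) H1] by simp
qed

text \<open>The passage from D to E is made in steps of index p, and every complement has
  \<open>idx D J\<close> extensions at each step.\<close>

lemma card_complements_elementary:
  assumes p: "Factorial_Ring.prime p" and "subgrp J" "subgrp D" "subgrp E"
    and "J \<subseteq> D" "D \<subseteq> E" and el: "\<And>x. x \<in> E \<Longrightarrow> real p *\<^sub>R x \<in> J"
    and "idx E D = p ^ e" "idx D J > 0"
  shows "card (complements E D J) = idx D J ^ e"
  using assms(4,6-8)
proof (induction e arbitrary: E)
  case 0
  then have "E = D" using idx_eq_1[of D E] assms by simp
  moreover have "complements D D J = {J}"
    using assms plus_absorb[of D J] by (auto simp: complements_def add.commute)
  ultimately show ?case by simp
next
  case (Suc e)
  have "E \<noteq> D"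
  proof
    assume "E = D"
    then have "p ^ Suc e = 1" using Suc.prems(4) idx_self[OF assms(3)] by simp
    then show False using prime_gt_1_nat[OF p] by simp
  qed
  then obtain E1 where E1: "subgrp E1" "D \<subseteq> E1" "E1 \<subseteq> E" "idx E E1 = p"
    using ex_maximal_subgrp[OF p assms(3) Suc.prems(1,2) _ Suc.prems(4)] by metis
  have "idx E E1 * idx E1 D = p * p ^ e"
    using idx_mult[OF assms(3) E1(1) Suc.prems(1) E1(2,3)] Suc.prems by simp
  then have i: "idx E1 D = p ^ e" using E1 prime_gt_0_nat[OF p] by simp
  have IH: "card (complements E1 D J) = idx D J ^ e"
    using E1 i Suc.prems by (intro Suc.IH) auto
  have pos: "idx E J > 0" "idx E1 J > 0"
    using idx_mult[of J D E] idx_mult[of J D E1] assms Suc.prems E1 i prime_gt_0_nat[OF p] by auto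
  have "card (complements E D J) = idx D J * card (complements E1 D J)"
  proof (rule card_fibers[where f = "\<lambda>H. H \<inter> E1"])
    show "(\<lambda>H. H \<inter> E1) ` complements E D J \<subseteq> complements E1 D J"
    proof (intro image_subsetI)
      fix H assume "H \<in> complements E D J"
      then have H: "subgrp H" "H \<subseteq> E" "H \<inter> D = J" "H + D = E" by (auto simp: complements_def)
      have "E1 \<subseteq> H \<inter> E1 + D"
      proof
        fix x assume x: "x \<in> E1"
        then obtain h d where hd: "h \<in> H" "d \<in> D" "x = h + d" using H(4) E1 by (blast elim: set_plus_elim)
        then have "h = x - d" by simp
        then have "h \<in> E1" using x hd E1 subgrp_diff by blast
        then show "x \<in> H \<inter> E1 + D" using hd by blast
      qed
      moreover have "H \<inter> E1 + D \<subseteq> E1" using E1 by (intro plus_least) auto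
      ultimately show "H \<inter> E1 \<in> complements E1 D J"
        using H E1 assms by (auto simp: complements_def intro: subgrp_Int)
    qed
    show "card {H \<in> complements E D J. H \<inter> E1 = H1} = idx D J" if "H1 \<in> complements E1 D J" for H1
      using card_complements_extending[OF p assms(2,3) E1(1) Suc.prems(1) assms(5) E1(2,3) _ E1(4) that]
        Suc.prems by blast
  qed (use finite_complements assms pos in blast)+
  then show ?case using IH by simp
qed

text \<open>The Pascal rule, by means of a subgroup J1 of order p over J. The subgroups containing
  J1 are counted over J1; any other H of index p^j is a complement of J1 in H + J1, which has index
  p^(j-1) and admits p^(e-(j-1)) complements.\<close>

lemma card_subgroups_elementary:
  assumes p: "Factorial_Ring.prime p" and "subgrp J" "subgrp E" "J \<subseteq> E"
    and el: "\<And>x. x \<in> E \<Longrightarrow> real p *\<^sub>R x \<in> J" and "idx E J = p ^ e"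
  shows "card {H. subgrp H \<and> J \<subseteq> H \<and> H \<subseteq> E \<and> idx E H = p ^ j} = qbin p e j"
  using assms(2,4-6)
proof (induction e arbitrary: J j)
  case 0
  then have "E = J" using idx_eq_1[of J E] assms by simp
  have "j = 0" if "idx E E = p ^ j" 
    using that idx_self[OF assms(3)] prime_gt_1_nat[OF p]
    by (metis One_nat_def nat_power_eq_Suc_0_iff less_irrefl)
  then have j: "idx E E = p ^ j \<longleftrightarrow> j = 0"
    using idx_self[OF assms(3)] by auto
  have "{H. subgrp H \<and> J \<subseteq> H \<and> H \<subseteq> E \<and> idx E H = p ^ j} = {H. H = E \<and> idx E E = p ^ j}"
    using assms(3) unfolding \<open>E = J\<close> by (intro Collect_cong) (metis subset_antisym order_refl)
  also have "card \<dots> = qbin p 0 j" unfolding j by (cases j) auto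
  finally show ?case .
next
  case (Suc e)
  have p1: "p > 1" using prime_gt_1_nat[OF p] .
  show ?case
  proof (cases j)
    case 0
    have "{H. subgrp H \<and> J \<subseteq> H \<and> H \<subseteq> E \<and> idx E H = p ^ j} = {E}"
      using idx_eq_1[of _ E] assms(3) Suc.prems idx_self[OF assms(3)] by (auto simp: 0)
    then show ?thesis by (simp add: 0)
  next
    case (Suc i)
    have "E \<noteq> J"
    proof
      assume "E = J"
      then have "p ^ Suc e = 1" using Suc.prems(4) idx_self[OF assms(3)] by simp
      then show False using p1 by simp
    qed
    then obtain z where z: "z \<in> E" "z \<notin> J" "real p *\<^sub>R z \<in> J"
      using ex_order_p_element[OF p Suc.prems(1) assms(3) Suc.prems(2) _ Suc.prems(4)] by metis
    let ?J1 = "line J z"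
    have J1: "subgrp ?J1" "J \<subseteq> ?J1" "?J1 \<subseteq> E" "idx ?J1 J = p"
      using subgrp_line[OF Suc.prems(1)] line_base[OF Suc.prems(1)] line_subset[OF assms(3) Suc.prems(2) z(1)]
        idx_line[OF p Suc.prems(1) z(2,3)] by simp_all
    have "idx E ?J1 * p = p ^ e * p"
      using idx_mult[OF Suc.prems(1) J1(1) assms(3) J1(2,3)] Suc.prems(4) J1(4) by auto
    then have iJ1: "idx E ?J1 = p ^ e" using p1 by simp
    let ?S = "\<lambda>J j. {H. subgrp H \<and> J \<subseteq> H \<and> H \<subseteq> E \<and> idx E H = p ^ j}"
    have IH: "card (?S ?J1 j) = qbin p e j" for j
      using Suc.IH[OF J1(1,3) _ iJ1] Suc.prems J1 by blast
    have "idx E J > 0" "idx E ?J1 > 0" using p1 iJ1 Suc.prems(4) by simp_all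
    then have fin: "finite (?S J j)" "finite (?S ?J1 j)" for j
      by (blast intro: finite_subset[OF _ finite_between[OF Suc.prems(1), of E]],
          blast intro: finite_subset[OF _ finite_between[OF J1(1), of E]])
    let ?B = "?S J j - ?S ?J1 j"
    have "card ?B = p ^ (e - i) * card (?S ?J1 i)"
    proof (rule card_fibers[where f = "\<lambda>H. H + ?J1"])
      have H: "H \<inter> ?J1 = J \<and> idx E (H + ?J1) = p ^ i" if "H \<in> ?B" for H
      proof -
        have H: "subgrp H" "J \<subseteq> H" "H \<subseteq> E" "idx E H = p ^ Suc i" "\<not> ?J1 \<subseteq> H"
          using that \<open>j = Suc i\<close> by auto
        have sg: "subgrp (H \<inter> ?J1)" "subgrp (H + ?J1)" 
          by (rule subgrp_Int[OF H(1) J1(1)]) (rule subgrp_plus[OF H(1) J1(1)])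
        have "idx ?J1 (H \<inter> ?J1) * idx (H \<inter> ?J1) J = p"
          using idx_mult[OF Suc.prems(1) sg(1) J1(1)] H J1 by simp
        moreover have "idx ?J1 (H \<inter> ?J1) \<noteq> 1"
          using idx_eq_1[OF sg(1), of ?J1] H J1 by blast
        ultimately have q: "idx ?J1 (H \<inter> ?J1) = p \<and> idx (H \<inter> ?J1) J = 1"
          using p prime_product[of "idx ?J1 (H \<inter> ?J1)" "idx (H \<inter> ?J1) J"] by auto
        then have "H \<inter> ?J1 = J" using idx_eq_1[of J "H \<inter> ?J1"] Suc.prems J1 H sg by simp
        have "idx (H + ?J1) H = p"
          using idx_Int[OF J1(1) H(1)] q by (simp add: Int_commute add.commute)
        moreover have "idx E H = idx E (H + ?J1) * idx (H + ?J1) H"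
          using H J1 sg plus_upper1[OF J1(1)] plus_least[OF assms(3) H(3) J1(3)]
          by (intro idx_mult assms(3)) auto
        ultimately have "idx E (H + ?J1) = p ^ i" using H(4) p1 by simp
        then show ?thesis using \<open>H \<inter> ?J1 = J\<close> by simp
      qed
      show "(\<lambda>H. H + ?J1) ` ?B \<subseteq> ?S ?J1 i"
      proof (intro image_subsetI)
        fix H assume "H \<in> ?B"
        then show "H + ?J1 \<in> ?S ?J1 i" 
          using H[OF \<open>H \<in> ?B\<close>] subgrp_plus[of H ?J1, OF _ J1(1)] plus_upper2[of H ?J1]
            plus_least[OF assms(3) _ J1(3), of H] by simp
      qed
      show "card {H \<in> ?B. H + ?J1 = H1} = p ^ (e - i)" if H1: "H1 \<in> ?S ?J1 i" for H1
      proof -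
        have H1': "subgrp H1" "?J1 \<subseteq> H1" "H1 \<subseteq> E" "idx E H1 = p ^ i" using H1 by auto
        obtain a b where ab: "idx E H1 = p ^ a" "idx H1 ?J1 = p ^ b" "a + b = e"
          by (rule idx_pow_between[OF p J1(1) H1'(1) assms(3) H1'(2,3) iJ1])
        then have b: "b = e - i" using H1'(4) p1 by auto
        have "{H \<in> ?B. H + ?J1 = H1} = complements H1 ?J1 J"
        proof (intro equalityI subsetI)
          fix K assume "K \<in> {H \<in> ?B. H + ?J1 = H1}"
          then show "K \<in> complements H1 ?J1 J" using H[of K] plus_upper1[OF J1(1), of K]
            by (auto simp: complements_def)
        next
          fix K assume K: "K \<in> complements H1 ?J1 J"
          then have K': "subgrp K" "K \<subseteq> H1" "K \<inter> ?J1 = J" "K + ?J1 = H1" by (auto simp: complements_def)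
          have "idx H1 K = p" using idx_complement(1)[OF J1(1) H1'(1) K] J1 by simp
          then have "idx E K = p ^ j"
            using idx_mult[OF K'(1) H1'(1) assms(3) K'(2) H1'(3)] H1'(4) \<open>j = Suc i\<close> by simp
          moreover have "\<not> ?J1 \<subseteq> K" using K' line_point[OF Suc.prems(1), of z] z(2) by blast
          ultimately show "K \<in> {H \<in> ?B. H + ?J1 = H1}" using K' H1' by auto
        qed
        moreover have "card (complements H1 ?J1 J) = p ^ b"
          using card_complements_elementary[OF p Suc.prems(1) J1(1) H1'(1) J1(2) H1'(2) _ ab(2)]
            Suc.prems(3) H1'(3) J1(4) p1 by auto
        ultimately show ?thesis using b by simp
      qed
    qed (use fin in auto)
    moreover have sub: "?S ?J1 j \<subseteq> ?S J j" using J1(2) by blast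
    then have "card (?S J j) = card ?B + card (?S ?J1 j)"
      using card_Diff_subset[OF fin(2) sub] card_mono[OF fin(1) sub] by simp
    ultimately show ?thesis using IH[of j] IH[of i] by (simp add: \<open>j = Suc i\<close>)
  qed
qed

lemma linear_scaleR_const [simp]: "linear (\<lambda>x::'a::real_vector. c *\<^sub>R x)"
  by (intro linearI) (simp_all add: scaleR_add_right)

lemma subgrp_scale: "subgrp H \<Longrightarrow> subgrp ((*\<^sub>R) (real p) ` H)"
  by (intro subgrp_image) simp_all

text \<open>
  With \<open>A = B/D'\<close> for a subgroup \<open>D' \<subseteq> H'\<close> with \<open>D = pB + D'\<close>, this counts the subgroups of
  \<open>A\<close> of given corank having a prescribed intersection with \<open>pA\<close>. First \<open>H + D\<close> is chosen, as a
  subgroup of the elementary abelian group \<open>K/D\<close>; then \<open>H\<close> is a complement in \<open>H + D\<close>, which is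
  automatically contained in the elements \<open>x\<close> with \<open>px \<in> H'\<close>.
\<close>

lemma card_subgroups_step:
  assumes p: "Factorial_Ring.prime p" and sg: "subgrp H'" "subgrp D" "subgrp B"
    and sub: "H' \<subseteq> D" "D \<subseteq> B" and D: "D = (*\<^sub>R) (real p) ` B + H'"
    and r: "idx B D = p ^ r" and m2: "idx D ((*\<^sub>R) (real p) ` D + H') = p ^ m2" and fin: "idx D H' > 0"
  shows "card {H. subgrp H \<and> H \<subseteq> B \<and> H \<inter> D = H' \<and> idx B (H + D) = p ^ m1} = step_count p r m1 m2"
proof -
  have p1: "p > 1" using prime_gt_1_nat[OF p] .
  let ?P = "(*\<^sub>R) (real p)"
  let ?pD = "?P ` D + H'"
  have pB: "?P ` B \<subseteq> D" using plus_upper1[OF sg(1), of "?P ` B"] by (simp only: D[symmetric])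
  have pD: "subgrp ?pD" by (intro subgrp_plus subgrp_scale sg)
  have pDD: "?pD \<subseteq> D" using pB sub by (intro plus_least sg) auto
  \<comment> \<open>If H meets D in H', then pH lies in both H and D, hence in H'. So p(H + D) lies
    in pD + H', that is, H + D is contained in K.\<close>
  define K where "K = {x \<in> B. ?P x \<in> ?pD}"
  have K: "subgrp K" unfolding K_def by (intro subgrp_vimage sg pD) simp
  have KB: "K \<subseteq> B" by (auto simp: K_def)
  have DK: "D \<subseteq> K" using plus_upper1[OF sg(1), of "?P ` D"] sub by (auto simp: K_def)
  have "?P ` B + ?pD = D"
  proof (rule antisym)
    show "?P ` B + ?pD \<subseteq> D" by (rule plus_least[OF sg(2) pB pDD])
    have "H' \<subseteq> ?pD" by (intro plus_upper2 subgrp_scale sg)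
    then have "?P ` B + H' \<subseteq> ?P ` B + ?pD" by (rule set_plus_mono2[OF order_refl])
    then show "D \<subseteq> ?P ` B + ?pD" by (simp only: D[symmetric])
  qed
  then have iK: "idx B K = p ^ m2"
    using idx_vimage[of ?P B ?pD] sg pD m2 unfolding K_def by simp
  define G where "G = {x \<in> D. ?P x \<in> H'}"
  have G: "subgrp G" unfolding G_def by (intro subgrp_vimage sg) simp
  have GD: "G \<subseteq> D" and HG: "H' \<subseteq> G"
    using sub subgrp_of_nat[OF sg(1)] by (auto simp: G_def)
  \<comment> \<open>Kernel and cokernel of multiplication by p on the finite group D/H' have the
    same order.\<close>
  have iG: "idx G H' = p ^ m2"
  proof -
    have "idx D H' = idx D G * idx G H'" by (rule idx_mult[OF sg(1) G sg(2) HG GD])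
    moreover have "idx D H' = idx D ?pD * idx ?pD H'"
      by (rule idx_mult[OF sg(1) pD sg(2) _ pDD]) (intro plus_upper2 subgrp_scale sg)
    moreover have "idx D G = idx ?pD H'"
      unfolding G_def by (intro idx_vimage sg) simp
    ultimately show ?thesis using fin m2 by auto
  qed
  let ?S = "{H. subgrp H \<and> H \<subseteq> B \<and> H \<inter> D = H' \<and> idx B (H + D) = p ^ m1}"
  let ?U = "{U. subgrp U \<and> D \<subseteq> U \<and> U \<subseteq> K \<and> idx B U = p ^ m1}"
  have map: "H + D \<in> ?U" if "H \<in> ?S" for H
  proof -
    have H: "subgrp H" "H \<subseteq> B" "H \<inter> D = H'" "idx B (H + D) = p ^ m1" using that by auto
    have "H + D \<subseteq> K"
    proof
      fix x assume "x \<in> H + D"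
      then obtain h d where hd: "h \<in> H" "d \<in> D" "x = h + d" by (auto elim: set_plus_elim)
      have "?P h \<in> H'" using hd pB H subgrp_of_nat[OF H(1), of h p] by blast
      moreover have "?P x = ?P d + ?P h" using hd by (simp add: scaleR_add_right)
      ultimately have "?P x \<in> ?pD" using hd by (metis imageI set_plus_intro)
      moreover have "x \<in> B" unfolding hd(3) using hd H(2) sub(2) by (intro subgrp_add[OF sg(3)]) auto
      ultimately show "x \<in> K" by (simp add: K_def)
    qed
    then show ?thesis
      using H subgrp_plus[OF H(1) sg(2)] plus_upper2[OF H(1), of D] by simp
  qed
  have fiber: "card {H \<in> ?S. H + D = U} = p ^ (m2 * (r - m1))" if U: "U \<in> ?U" for U
  proof -
    have U': "subgrp U" "D \<subseteq> U" "U \<subseteq> K" "idx B U = p ^ m1" using U by auto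
    obtain a b where ab: "idx B U = p ^ a" "idx U D = p ^ b" "a + b = r"
      by (rule idx_pow_between[OF p sg(2) U'(1) sg(3) U'(2) _ r]) (use U' KB in blast)
    then have b: "b = r - m1" using U'(4) p1 by auto
    \<comment> \<open>Every H with H + D = U lies in E, which meets D in the kernel G. So these H
      are the complements of G in the quotient E/H', which is killed by p.\<close>
    define E where "E = {x \<in> U. ?P x \<in> H'}"
    have E: "subgrp E" unfolding E_def by (intro subgrp_vimage U' sg) simp
    have EU: "E \<subseteq> U" and GE: "G \<subseteq> E" and ED: "E \<inter> D = G"
      using U' by (auto simp: E_def G_def)
    have ED': "E + D = U"
    proof (rule antisym)
      show "E + D \<subseteq> U" using EU U' by (intro plus_least) auto
      show "U \<subseteq> E + D"
      proof
        fix u assume u: "u \<in> U"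
        then have "?P u \<in> ?pD" using U'(3) by (auto simp: K_def)
        then obtain d h where dh: "d \<in> D" "h \<in> H'" "?P u = ?P d + h" by (auto elim!: set_plus_elim)
        then have "?P (u - d) = h" by (simp add: scaleR_diff_right)
        then have "u - d \<in> E" using u dh U'(2) subgrp_diff[OF U'(1)] by (auto simp: E_def)
        then show "u \<in> E + D" using dh by (metis diff_add_cancel set_plus_intro)
      qed
    qed
    have "{H \<in> ?S. H + D = U} = complements E G H'"
    proof (intro equalityI subsetI)
      fix H assume "H \<in> {H \<in> ?S. H + D = U}"
      then have H: "subgrp H" "H \<subseteq> B" "H \<inter> D = H'" "H + D = U" by auto
      have HE: "H \<subseteq> E"
      proof
        fix h assume h: "h \<in> H"
        then have "h \<in> U" using H plus_upper1[OF sg(2), of H] by blast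
        moreover have "?P h \<in> H'" using h pB H subgrp_of_nat[OF H(1) h, of p] by blast
        ultimately show "h \<in> E" by (simp add: E_def)
      qed
      have "E \<subseteq> H + G"
      proof
        fix e assume e: "e \<in> E"
        then obtain h d where hd: "h \<in> H" "d \<in> D" "e = h + d"
          using EU H(4) by (blast elim: set_plus_elim)
        have "d = e - h" using hd by simp
        then have "d \<in> E" using subgrp_diff[OF E e, of h] hd HE by auto
        then have "d \<in> G" using hd ED by blast
        then show "e \<in> H + G" using hd by blast
      qed
      moreover have "H + G \<subseteq> E" using HE GE by (intro plus_least E)
      moreover have "H \<inter> G = H'" using H(3) HG GD by blast
      ultimately show "H \<in> complements E G H'" using H HE by (simp add: complements_def)
    next
      fix H assume "H \<in> complements E G H'"
      then have H: "subgrp H" "H \<subseteq> E" "H \<inter> G = H'" "H + G = E" by (auto simp: complements_def)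
      have "H \<inter> D = H'" using H(2,3) ED HG GD by blast
      moreover have "H + D = U"
      proof -
        have "G + D = D" using plus_absorb[OF sg(2) G GD] by (simp add: add.commute)
        then show ?thesis using ED' H(4) by (metis add.assoc)
      qed
      moreover have "H \<subseteq> B" using H(2) EU U'(3) KB by blast
      ultimately show "H \<in> {H \<in> ?S. H + D = U}" using H(1) U'(4) by simp
    qed
    moreover have "idx E G = p ^ b" using idx_Int[OF E sg(2)] ED ED' ab(2) by simp
    then have "card (complements E G H') = (p ^ m2) ^ b"
      using card_complements_elementary[OF p sg(1) G E HG GE, of b] iG p1 by (auto simp: E_def)
    ultimately show ?thesis by (simp add: b power_mult)
  qed
  show ?thesis
  proof (cases "m2 \<le> m1 \<and> m1 \<le> r")
    case False
    have "?U = {}"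
    proof (rule ccontr)
      assume "?U \<noteq> {}"
      then obtain U where U: "subgrp U" "D \<subseteq> U" "U \<subseteq> K" "idx B U = p ^ m1" by blast
      have "idx B U = idx B K * idx K U" using U KB by (intro idx_mult K sg) auto
      then have "p ^ m2 dvd p ^ m1" using U iK by simp
      then have "m2 \<le> m1" using p1 by (rule power_dvd_imp_le)
      moreover have "idx B D = idx B U * idx U D" using U KB by (intro idx_mult sg) auto
      then have "p ^ m1 dvd p ^ r" using U r by simp
      then have "m1 \<le> r" using p1 by (rule power_dvd_imp_le)
      ultimately show False using False by simp
    qed
    have "?S = {}"
    proof (rule equals0I)
      fix H assume "H \<in> ?S"
      then have "H + D \<in> ?U" by (rule map)
      then show False unfolding \<open>?U = {}\<close> by (simp only: empty_iff)
    qed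
    then have "card ?S = 0" by (simp only: card.empty)
    moreover have "step_count p r m1 m2 = 0"
      unfolding step_count_def by (rule if_not_P) (rule False)
    ultimately show ?thesis by (simp only:)
  next
    case True
    have iKD: "idx K D = p ^ (r - m2)"
    proof -
      have "p ^ r = p ^ m2 * idx K D" using idx_mult[OF sg(2) K sg(3) DK KB] r iK by simp
      moreover have "p ^ r = p ^ m2 * p ^ (r - m2)" using True by (simp flip: power_add)
      ultimately show ?thesis using p1 by simp
    qed
    have "?U = {U. subgrp U \<and> D \<subseteq> U \<and> U \<subseteq> K \<and> idx K U = p ^ (m1 - m2)}"
    proof (intro Collect_cong conj_cong refl)
      fix U assume U: "subgrp U" "U \<subseteq> K"
      have "idx B U = p ^ m2 * idx K U" using idx_mult[OF U(1) K sg(3) U(2) KB] iK by simp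
      moreover have "p ^ m1 = p ^ m2 * p ^ (m1 - m2)" using True by (simp flip: power_add)
      ultimately show "idx B U = p ^ m1 \<longleftrightarrow> idx K U = p ^ (m1 - m2)" using p1 by simp
    qed
    moreover have "real p *\<^sub>R x \<in> D" if "x \<in> K" for x using that KB pB by blast
    ultimately have cU: "card ?U = qbin p (r - m2) (m1 - m2)"
      using card_subgroups_elementary[OF p sg(2) K DK _ iKD] by simp
    have finU: "finite ?U"
      by (rule finite_subset[OF _ finite_between[OF sg(2), of K]]) (use iKD p1 in auto)
    have "idx B H' = idx B D * idx D H'" using sub by (intro idx_mult sg)
    then have finS: "finite ?S"
      by (intro finite_subset[OF _ finite_between[OF sg(1), of B]]) (use fin r p1 in auto)
    have "card ?S = p ^ (m2 * (r - m1)) * card ?U"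
      by (rule card_fibers[where f = "\<lambda>H. H + D", OF finS finU _ fiber]) (use map in blast)
    then show ?thesis using cU True by (simp add: step_count_def)
  qed
qed

text \<open>
  The number of homomorphisms from \<open>E/D\<close> to \<open>D/J\<close>, when \<open>E/D\<close> is torsion-free of rank \<open>d\<close> at \<open>p\<close>.
\<close>

lemma card_complements_torsion_free:
  assumes p: "Factorial_Ring.prime p" and sg: "subgrp J" "subgrp D" "subgrp E"
    and sub: "J \<subseteq> D" "D \<subseteq> E" and tf: "\<And>x. x \<in> E \<Longrightarrow> real p *\<^sub>R x \<in> D \<Longrightarrow> x \<in> D"
    and d: "idx E ((*\<^sub>R) (real p) ` E + D) = p ^ d" and k: "idx D J = p ^ k"
  shows "finite (complements E D J) \<and> card (complements E D J) = p ^ (k * d)"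
  using sg(1) sub(1) k
proof (induction k arbitrary: J)
  case 0
  then have "D = J" using idx_eq_1[of J D] sg by simp
  have "complements E D D = {E}"
  proof (intro equalityI subsetI)
    fix H assume "H \<in> complements E D D"
    then have H: "subgrp H" "H \<subseteq> E" "H \<inter> D = D" "H + D = E" by (auto simp: complements_def)
    then show "H \<in> {E}" using plus_absorb[OF H(1) sg(2)] by auto
  qed (use sg sub plus_absorb[OF sg(3,2)] in \<open>auto simp: complements_def\<close>)
  then show ?case using \<open>D = J\<close> by simp
next
  case (Suc k)
  let ?P = "(*\<^sub>R) (real p)"
  have p1: "p > 1" using prime_gt_1_nat[OF p] .
  have "D \<noteq> J"
  proof
    assume "D = J"
    then have "p ^ Suc k = 1" using Suc.prems(3) idx_self[OF sg(2)] by simp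
    then show False using p1 by simp
  qed
  \<comment> \<open>J is enlarged by an element of order p and the complements are fibred by H + J1;
    each of the k steps contributes a factor p^d.\<close>
  then obtain z where z: "z \<in> D" "z \<notin> J" "?P z \<in> J"
    using ex_order_p_element[OF p Suc.prems(1) sg(2) Suc.prems(2) _ Suc.prems(3)] by metis
  define J1 where "J1 = line J z"
  have J1: "subgrp J1" "J \<subseteq> J1" "J1 \<subseteq> D" "idx J1 J = p"
    unfolding J1_def using subgrp_line[OF Suc.prems(1)] line_base[OF Suc.prems(1)]
      line_subset[OF sg(2) Suc.prems(2) z(1)] idx_line[OF p Suc.prems(1) z(2,3)] by simp_all
  have pJ1: "?P x \<in> J" if "x \<in> J1" for x
    using lagrange[OF Suc.prems(1) J1(1,2) _ that] J1(4) p1 by simp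
  have "idx D J1 * p = p ^ k * p"
    using idx_mult[OF Suc.prems(1) J1(1) sg(2) J1(2,3)] Suc.prems(3) J1(4) by auto
  then have iJ1: "idx D J1 = p ^ k" using p1 by simp
  note IH = Suc.IH[OF J1(1,3) iJ1]
  have fiber: "finite {H \<in> complements E D J. H + J1 = N} \<and>
      card {H \<in> complements E D J. H + J1 = N} = p ^ d" if N: "N \<in> complements E D J1" for N
  proof -
    have N': "subgrp N" "N \<subseteq> E" "N \<inter> D = J1" "N + D = E" using N by (auto simp: complements_def)
    \<comment> \<open>If H + J1 = N, then pN lies in H, because pJ1 lies in J. So H contains pN + J,
      and the fibre is visible in N/(pN + J), which is killed by p.\<close>
    let ?Q = "?P ` N + J" and ?Q1 = "?P ` N + J1"
    have Q: "subgrp ?Q" "subgrp ?Q1" by (intro subgrp_plus subgrp_scale N' J1 Suc.prems)+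
    have JN: "J \<subseteq> N" "J1 \<subseteq> N" using N'(3) J1(2) by auto
    have PN: "?P ` N \<subseteq> N" using subgrp_of_nat[OF N'(1)] by auto
    have Q1N: "?Q1 \<subseteq> N" "?Q \<subseteq> N" by (intro plus_least N' PN JN)+
    have "?Q1 = ?Q + J1"
      using plus_absorb[OF J1(1) Suc.prems(1) J1(2)] by (metis add.assoc add.commute)
    \<comment> \<open>Absence of p-torsion in E/D enters here. It ensures that pN + J meets J1 only
      in J.\<close>
    have tor: "?P x \<in> J" if "x \<in> N" "?P x \<in> J1" for x
    proof -
      have "x \<in> D" using tf[of x] that N'(2) J1(3) by blast
      then show ?thesis using that N'(3) pJ1 by blast
    qed
    have QJ1: "?Q \<inter> J1 = J"
    proof (intro equalityI subsetI)
      fix x assume x: "x \<in> ?Q \<inter> J1"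
      then obtain y j where yj: "y \<in> N" "j \<in> J" "x = ?P y + j" by (auto elim!: set_plus_elim)
      have "?P y = x - j" using yj by simp
      also have "\<dots> \<in> J1" using x yj J1(2) by (intro subgrp_diff[OF J1(1)]) auto
      finally have "?P y \<in> J" using tor yj by blast
      then show "x \<in> J" using yj subgrp_add[OF Suc.prems(1)] by auto
    qed (use J1(2) plus_upper2[OF subgrp_scale[OF N'(1)], of J p] in auto)
    \<comment> \<open>N/(pN + J1) is E/(pE + D), since N + (pE + D) = E and N meets pE + D in pN +
      J1.\<close>
    have iQ1: "idx N ?Q1 = p ^ d"
    proof -
      let ?R = "?P ` E + D"
      have R: "subgrp ?R" by (intro subgrp_plus subgrp_scale sg)
      have "?R = ?P ` N + D"
      proof (rule antisym)
        show "?P ` N + D \<subseteq> ?R" using N'(2) by (intro set_plus_mono2) auto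
        have "?P ` E \<subseteq> ?P ` N + D"
        proof
          fix x assume "x \<in> ?P ` E"
          then obtain a b where ab: "a \<in> N" "b \<in> D" "x = ?P (a + b)" using N'(4) by (auto elim!: set_plus_elim)
          then have "x = ?P a + ?P b" "?P b \<in> D" using subgrp_of_nat[OF sg(2)] by (auto simp: scaleR_add_right)
          then show "x \<in> ?P ` N + D" using ab by blast
        qed
        then show "?R \<subseteq> ?P ` N + D"
          by (rule plus_least[OF subgrp_plus[OF subgrp_scale[OF N'(1)] sg(2)] _
                plus_upper2[OF subgrp_scale[OF N'(1)]]])
      qed
      moreover have "N \<inter> (?P ` N + D) = ?Q1"
      proof (intro equalityI subsetI)
        fix x assume x: "x \<in> N \<inter> (?P ` N + D)"
        then obtain a b where ab: "a \<in> N" "b \<in> D" "x = ?P a + b" by (auto elim!: set_plus_elim)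
        have "b = x - ?P a" using ab by simp
        also have "\<dots> \<in> N" using x ab PN by (intro subgrp_diff[OF N'(1)]) auto
        finally have "b \<in> J1" using ab N'(3) by blast
        then show "x \<in> ?Q1" using ab by blast
      next
        fix x assume "x \<in> ?Q1"
        then show "x \<in> N \<inter> (?P ` N + D)" using Q1N set_plus_mono2[OF order_refl J1(3)] by blast
      qed
      moreover have "N + ?R = E"
      proof (rule antisym)
        have "?P ` E \<subseteq> E" using subgrp_of_nat[OF sg(3)] by auto
        then show "N + ?R \<subseteq> E" using N'(2) sub(2) by (intro plus_least sg)
        have "D \<subseteq> ?R" by (intro plus_upper2 subgrp_scale sg)
        then have "N + D \<subseteq> N + ?R" by (intro set_plus_mono2) auto
        then show "E \<subseteq> N + ?R" using N'(4) by simp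
      qed
      ultimately show ?thesis using idx_Int[OF N'(1) R] d by simp
    qed
    have iQ: "idx ?Q1 ?Q = p"
      using idx_Int[OF J1(1) Q(1)] QJ1 J1(4) \<open>?Q1 = ?Q + J1\<close> by (simp add: Int_commute add.commute)
    have QQ: "?Q \<subseteq> ?Q1" using J1(2) by (intro set_plus_mono2) auto
    have "{H \<in> complements E D J. H + J1 = N} = complements N ?Q1 ?Q"
    proof (intro equalityI subsetI)
      fix H assume "H \<in> {H \<in> complements E D J. H + J1 = N}"
      then have H: "subgrp H" "H \<inter> D = J" "H + D = E" "H + J1 = N" by (auto simp: complements_def)
      have HN: "H \<subseteq> N" using plus_upper1[OF J1(1), of H] H by simp
      have JH: "J \<subseteq> H" using H by auto
      have "?P ` N \<subseteq> H"
      proof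
        fix x assume "x \<in> ?P ` N"
        then obtain a b where ab: "a \<in> H" "b \<in> J1" "x = ?P (a + b)" using H(4) by (auto elim!: set_plus_elim)
        then have "x = ?P a + ?P b" by (simp add: scaleR_add_right)
        then show "x \<in> H" using ab pJ1[of b] JH subgrp_of_nat[OF H(1)] subgrp_add[OF H(1)] by auto
      qed
      then have QH: "?Q \<subseteq> H" using JH by (intro plus_least H)
      have "H \<inter> ?Q1 = ?Q"
      proof (intro equalityI subsetI)
        fix x assume x: "x \<in> H \<inter> ?Q1"
        then obtain q j where qj: "q \<in> ?Q" "j \<in> J1" "x = q + j"
          using \<open>?Q1 = ?Q + J1\<close> by (auto elim: set_plus_elim)
        have "j = x - q" using qj by simp
        also have "\<dots> \<in> H" using x qj QH by (intro subgrp_diff[OF H(1)]) auto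
        finally have "j \<in> J" using qj H(2) J1(3) by blast
        then have "j \<in> ?Q" using plus_upper2[OF subgrp_scale[OF N'(1)], of J p] by blast
        then show "x \<in> ?Q" using qj subgrp_add[OF Q(1)] by blast
      qed (use QH QQ in auto)
      moreover have "H + ?Q1 = N"
      proof (rule antisym)
        show "H + ?Q1 \<subseteq> N" by (rule plus_least[OF N'(1) HN Q1N(1)])
        have "J1 \<subseteq> ?Q1" by (intro plus_upper2 subgrp_scale N')
        then have "H + J1 \<subseteq> H + ?Q1" by (intro set_plus_mono2) auto
        then show "N \<subseteq> H + ?Q1" using H(4) by simp
      qed
      ultimately show "H \<in> complements N ?Q1 ?Q" using H HN by (simp add: complements_def)
    next
      fix H assume "H \<in> complements N ?Q1 ?Q"
      then have H: "subgrp H" "H \<subseteq> N" "H \<inter> ?Q1 = ?Q" "H + ?Q1 = N" by (auto simp: complements_def)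
      have QH: "?Q \<subseteq> H" using H(3) by blast
      have J1Q1: "J1 \<subseteq> ?Q1" by (intro plus_upper2 subgrp_scale N')
      have JQ: "J \<subseteq> ?Q" by (intro plus_upper2 subgrp_scale N')
      have HJ1: "H \<inter> J1 = J"
        using H(3) QJ1 J1Q1 JQ J1(2) QH by blast
      then have HD: "H \<inter> D = J" using H(2) N'(3) J1(3) by blast
      have HJN: "H + J1 = N"
      proof -
        have "H + ?Q1 = (H + ?Q) + J1" unfolding \<open>?Q1 = ?Q + J1\<close> by (simp add: add.assoc)
        also have "H + ?Q = H" using QH by (intro plus_absorb H Q)
        finally show ?thesis using H(4) by simp
      qed
      moreover have "H + D = E"
      proof -
        have "J1 + D = D" using plus_absorb[OF sg(2) J1(1,3)] by (simp add: add.commute)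
        then show ?thesis using N'(4) HJN by (metis add.assoc)
      qed
      ultimately show "H \<in> {H \<in> complements E D J. H + J1 = N}"
        using H HD N'(2) by (auto simp: complements_def)
    qed
    moreover have "finite (complements N ?Q1 ?Q)"
    proof (rule finite_complements[OF Q(1)])
      show "idx N ?Q > 0" using idx_mult[OF Q(1,2) N'(1) QQ Q1N(1)] iQ iQ1 p1 by simp
    qed
    moreover have "card (complements N ?Q1 ?Q) = p ^ d"
    proof -
      have "real p *\<^sub>R x \<in> ?Q" if "x \<in> N" for x
        using that plus_upper1[OF Suc.prems(1), of "?P ` N"] by blast
      then show ?thesis
        using card_complements_elementary[OF p Q N'(1) QQ Q1N(1) _ iQ1] iQ p1 by simp
    qed
    ultimately show ?thesis by simp
  qed
  have map: "H + J1 \<in> complements E D J1" if "H \<in> complements E D J" for H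
  proof -
    have H: "subgrp H" "H \<subseteq> E" "H \<inter> D = J" "H + D = E" using that by (auto simp: complements_def)
    have "(H + J1) \<inter> D = J1"
    proof (intro equalityI subsetI)
      fix x assume x: "x \<in> (H + J1) \<inter> D"
      then obtain h j where hj: "h \<in> H" "j \<in> J1" "x = h + j" by (auto elim: set_plus_elim)
      have "h = x - j" using hj by simp
      also have "\<dots> \<in> D" using x hj J1(3) by (intro subgrp_diff[OF sg(2)]) auto
      finally have "h \<in> J" using hj H(3) by blast
      then show "x \<in> J1" using hj J1(2) subgrp_add[OF J1(1)] by blast
    qed (use J1(3) plus_upper2[OF H(1), of J1] in auto)
    moreover have "H + J1 + D = E"
    proof -
      have "J1 + D = D" using plus_absorb[OF sg(2) J1(1,3)] by (simp add: add.commute)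
      then show ?thesis using H(4) by (simp add: add.assoc)
    qed
    moreover have "H + J1 \<subseteq> E" using H(2) J1(3) sub(2) by (intro plus_least sg) auto
    ultimately show ?thesis using subgrp_plus[OF H(1) J1(1)] by (simp add: complements_def)
  qed
  have "complements E D J = (\<Union>N\<in>complements E D J1. {H \<in> complements E D J. H + J1 = N})"
    using map by blast
  then have fin: "finite (complements E D J)" using IH fiber by (metis (no_types, lifting) finite_UN)
  have "card (complements E D J) = p ^ d * card (complements E D J1)"
  proof (rule card_fibers[where f = "\<lambda>H. H + J1", OF fin])
    show "finite (complements E D J1)" using IH by blast
    show "(\<lambda>H. H + J1) ` complements E D J \<subseteq> complements E D J1" using map by blast
  qed (use fiber in blast)
  then show ?case using IH fin by (simp add: power_add)
qed

section \<open>Values of rational functions in two variables\<close>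

text \<open>Regularity and value in one relation. It is closed under the field operations, with a
  non-zero value of the denominator as the only side condition, so it can be traced backwards
  through a recursive formula.\<close>

definition rf_has_value :: "ratfun2 \<Rightarrow> 'a::field_char_0 \<Rightarrow> 'a \<Rightarrow> 'a \<Rightarrow> bool" where
  "rf_has_value W x y v \<longleftrightarrow>
     (\<exists>P Q. W = Fract P Q \<and> bipoly_eval Q x y \<noteq> 0 \<and> v = bipoly_eval P x y / bipoly_eval Q x y)"

lemma rf_has_valueI:
  "W = Fract P Q \<Longrightarrow> bipoly_eval Q x y \<noteq> 0 \<Longrightarrow> v = bipoly_eval P x y / bipoly_eval Q x y \<Longrightarrow>
    rf_has_value W x y v"
  unfolding rf_has_value_def by blast

lemma rf_has_valueE:
  assumes "rf_has_value W x y v"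
  obtains P Q where "W = Fract P Q" "Q \<noteq> 0" "bipoly_eval Q x y \<noteq> 0"
    "v = bipoly_eval P x y / bipoly_eval Q x y"
  using assms unfolding rf_has_value_def by fastforce

lemma rf_has_value_eval: "rf_has_value W x y v \<Longrightarrow> rf_eval W x y = v"
  unfolding rf_has_value_def using rf_eval_Fract by blast

lemma rf_regular_has_value: "rf_regular W x y \<Longrightarrow> rf_has_value W x y (rf_eval W x y)"
  unfolding rf_regular_def by (elim exE conjE) (auto simp: rf_eval_Fract intro: rf_has_valueI)

lemma bipoly_eval_1 [simp]: "bipoly_eval 1 x y = 1"
  by (simp add: one_pCons map_poly_pCons)

lemma bipoly_eval_minus [simp]: "bipoly_eval (- P) x y = - bipoly_eval P x y"
proof -
  have "bipoly_eval (P + - P) x y = 0" by simp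
  then show ?thesis unfolding bipoly_eval_add by (simp add: eq_neg_iff_add_eq_0 add.commute)
qed

lemma rf_has_value_0 [simp]: "rf_has_value 0 x y 0"
  by (rule rf_has_valueI[of _ 0 1]) (simp_all add: Zero_fract_def)

lemma rf_has_value_1 [simp]: "rf_has_value 1 x y 1"
  by (rule rf_has_valueI[of _ 1 1]) (simp_all add: One_fract_def)

lemma rf_has_value_rfX [simp]: "rf_has_value rfX x y x"
  by (rule rf_has_valueI[of _ "[:[:0, 1:]:]" 1]) (simp_all add: rfX_def map_poly_pCons)

lemma rf_has_value_rfY [simp]: "rf_has_value rfY x y y"
  by (rule rf_has_valueI[of _ "[:0, 1:]" 1]) (simp_all add: rfY_def map_poly_pCons)

lemma rf_has_value_add:
  assumes "rf_has_value V x y v" "rf_has_value W x y w"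
  shows "rf_has_value (V + W) x y (v + w)"
  using assms(1)
proof (rule rf_has_valueE)
  fix P Q assume PQ: "V = Fract P Q" "Q \<noteq> 0" "bipoly_eval Q x y \<noteq> 0"
    "v = bipoly_eval P x y / bipoly_eval Q x y"
  from assms(2) show ?thesis
  proof (rule rf_has_valueE)
    fix P' Q' assume "W = Fract P' Q'" "Q' \<noteq> 0" "bipoly_eval Q' x y \<noteq> 0"
      "w = bipoly_eval P' x y / bipoly_eval Q' x y"
    with PQ show ?thesis
      by (intro rf_has_valueI[of _ "P * Q' + P' * Q" "Q * Q'"])
        (simp_all add: bipoly_eval_mult bipoly_eval_add add_frac_eq)
  qed
qed

lemma rf_has_value_mult:
  assumes "rf_has_value V x y v" "rf_has_value W x y w"
  shows "rf_has_value (V * W) x y (v * w)"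
  using assms(1)
proof (rule rf_has_valueE)
  fix P Q assume PQ: "V = Fract P Q" "Q \<noteq> 0" "bipoly_eval Q x y \<noteq> 0"
    "v = bipoly_eval P x y / bipoly_eval Q x y"
  from assms(2) show ?thesis
  proof (rule rf_has_valueE)
    fix P' Q' assume "W = Fract P' Q'" "Q' \<noteq> 0" "bipoly_eval Q' x y \<noteq> 0"
      "w = bipoly_eval P' x y / bipoly_eval Q' x y"
    with PQ show ?thesis
      by (intro rf_has_valueI[of _ "P * P'" "Q * Q'"]) (simp_all add: bipoly_eval_mult)
  qed
qed

lemma rf_has_value_uminus:
  assumes "rf_has_value V x y v"
  shows "rf_has_value (- V) x y (- v)"
  using assms
proof (rule rf_has_valueE)
  fix P Q assume "V = Fract P Q" "Q \<noteq> 0" "bipoly_eval Q x y \<noteq> 0"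
    "v = bipoly_eval P x y / bipoly_eval Q x y"
  then show ?thesis by (intro rf_has_valueI[of _ "- P" Q]) simp_all
qed

lemma rf_has_value_inverse:
  assumes "rf_has_value V x y v" "v \<noteq> 0"
  shows "rf_has_value (inverse V) x y (inverse v)"
  using assms(1)
proof (rule rf_has_valueE)
  fix P Q assume "V = Fract P Q" "Q \<noteq> 0" "bipoly_eval Q x y \<noteq> 0"
    "v = bipoly_eval P x y / bipoly_eval Q x y"
  with assms(2) show ?thesis by (intro rf_has_valueI[of _ Q P]) simp_all
qed

lemma rf_has_value_diff:
  "rf_has_value V x y v \<Longrightarrow> rf_has_value W x y w \<Longrightarrow> rf_has_value (V - W) x y (v - w)"
  using rf_has_value_add[of V x y v "- W" "- w"] rf_has_value_uminus[of W x y w] by simp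

lemma rf_has_value_divide:
  "rf_has_value V x y v \<Longrightarrow> rf_has_value W x y w \<Longrightarrow> w \<noteq> 0 \<Longrightarrow> rf_has_value (V / W) x y (v / w)"
  unfolding divide_inverse by (intro rf_has_value_mult rf_has_value_inverse)

lemma rf_has_value_power: "rf_has_value V x y v \<Longrightarrow> rf_has_value (V ^ n) x y (v ^ n)"
  by (induction n) (auto intro: rf_has_value_mult)

lemma rf_has_value_sum:
  "(\<And>i. i \<in> A \<Longrightarrow> rf_has_value (V i) x y (v i)) \<Longrightarrow> rf_has_value (sum V A) x y (sum v A)"
  by (induction A rule: infinite_finite_induct) (auto intro: rf_has_value_add)

lemma rf_has_value_prod:
  "(\<And>i. i \<in> A \<Longrightarrow> rf_has_value (V i) x y (v i)) \<Longrightarrow> rf_has_value (prod V A) x y (prod v A)"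
  by (induction A rule: infinite_finite_induct) (auto intro: rf_has_value_mult)

lemma rf_has_value_if:
  "(b \<Longrightarrow> rf_has_value V x y v) \<Longrightarrow> (\<not> b \<Longrightarrow> rf_has_value W x y w) \<Longrightarrow>
    rf_has_value (if b then V else W) x y (if b then v else w)"
  by simp

lemma rf_has_value_unique: "rf_has_value W x y v \<Longrightarrow> rf_has_value W x y w \<Longrightarrow> v = w"
  using rf_has_value_eval by blast

lemma rf_has_value_qbin: "rf_has_value Q x y q \<Longrightarrow> rf_has_value (qbin Q n k) x y (qbin q n k)"
  by (induction Q n k rule: qbin.induct)
    (auto intro!: rf_has_value_add rf_has_value_mult rf_has_value_power)

lemma rf_has_value_step_count:
  "rf_has_value Q x y q \<Longrightarrow> rf_has_value (step_count Q r m m') x y (step_count q r m m')"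
  unfolding step_count_def by (auto intro!: rf_has_value_mult rf_has_value_power rf_has_value_qbin)

lemma rf_has_value_flag_gf:
  assumes "rf_has_value Q x y q" "rf_has_value T x y t" "rf_has_value U x y u"
    and "\<And>A m. A \<subseteq> S \<Longrightarrow> A \<noteq> {} \<Longrightarrow> u ^ sum f A * t ^ m * step_count q (sum f A) m m \<noteq> 1"
  shows "rf_has_value (flag_gf Q T U f S m) x y (flag_gf q t u f S m)"
  using assms
proof (induction Q T U f S m rule: flag_gf.induct)
  case (1 Q T U f S m)
  have rec: "rf_has_value (flag_gf Q T U f S' m') x y (flag_gf q t u f S' m')"
    if "finite S" "S \<noteq> {}" "S' \<in> Pow S" "m' \<in> {..m}" "\<not> (S' = S \<and> m' = m)" for S' m'
  proof (rule "1.IH"[OF _ that(3,4,5)])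
    fix A and m :: nat assume "A \<subseteq> S'" "A \<noteq> {}"
    then show "u ^ sum f A * t ^ m * step_count q (sum f A) m m \<noteq> 1"
      using that(3) "1.prems"(4)[of A m] by blast
  qed (use that "1.prems" in auto)
  have "u ^ sum f S * t ^ m * step_count q (sum f S) m m \<noteq> 1" if "S \<noteq> {}"
    using "1.prems"(4)[of S m] that by blast
  then show ?case
    unfolding flag_gf.simps[of Q T U f S m] flag_gf.simps[of q t u f S m]
    by (intro rf_has_value_if rf_has_value_mult rf_has_value_divide rf_has_value_diff rf_has_value_power
          rf_has_value_step_count rf_has_value_sum rf_has_value_0 rf_has_value_1 "1.prems"(1-3) rec) simp_all
qed

lemma rf_has_value_lattice_gf:
  assumes "rf_has_value Q x y q" "rf_has_value T x y t"
    and "\<And>m. m > 0 \<Longrightarrow> t ^ m * step_count q d m m \<noteq> 1"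
  shows "rf_has_value (lattice_gf Q T d m) x y (lattice_gf q t d m)"
proof (induction m rule: less_induct)
  case (less m)
  show ?case
    unfolding lattice_gf.simps[of Q T d m] lattice_gf.simps[of q t d m]
    using assms less
    by (auto intro!: rf_has_value_mult rf_has_value_divide rf_has_value_diff rf_has_value_power
          rf_has_value_step_count rf_has_value_sum)
qed

text \<open>Every denominator that occurs is 1 or of the form 1 - y^i x^j with i > 0, so the single
  condition \<open>gen\<close> excludes all poles.\<close>

lemma rf_has_value_euler_gf:
  fixes x y :: "'a::field_char_0" and f :: "'b \<Rightarrow> nat"
  assumes "finite I" and f: "\<And>i. i \<in> I \<Longrightarrow> f i > 0"
    and gen: "\<And>i j. i > 0 \<Longrightarrow> y ^ i * x ^ j \<noteq> 1"
  shows "rf_has_value (euler_gf rfX rfY f I) x y (euler_gf x y f I)"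
proof -
  have step: "t * step_count x r m m \<noteq> 1" if "\<And>j. t * x ^ j \<noteq> 1" for t :: 'a and r m
    using that[of 0] that by (auto simp: step_count_def)
  have 1: "rf_has_value (lattice_gf rfX rfY d m) x y (lattice_gf x y d m)" for d m
    using gen by (intro rf_has_value_lattice_gf step) auto
  have 2: "rf_has_value (flag_gf rfX (rfX ^ k * rfY) (rfY\<^sup>2) f S m) x y
         (flag_gf x (x ^ k * y) (y\<^sup>2) f S m)" if "S \<subseteq> I" for k S m
  proof (intro rf_has_value_flag_gf step)
    fix A m j assume A: "A \<subseteq> S" "A \<noteq> {}"
    then have "sum f A > 0" using f that finite_subset[OF _ assms(1)] by (intro sum_pos) blast+
    moreover have "(y\<^sup>2) ^ sum f A * (x ^ k * y) ^ m * x ^ j = y ^ (2 * sum f A + m) * x ^ (k * m + j)"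
      by (simp only: power_mult_distrib power_add power_mult[symmetric] mult_ac)
    ultimately show "(y\<^sup>2) ^ sum f A * (x ^ k * y) ^ m * x ^ j \<noteq> 1"
      using gen[of "2 * sum f A + m" "k * m + j"] by simp
  qed (auto intro!: rf_has_value_mult rf_has_value_power)
  show ?thesis
    unfolding euler_gf_def
    by (intro rf_has_value_mult rf_has_value_sum rf_has_value_prod rf_has_value_diff
        rf_has_value_power 1 2) auto
qed

lemma rfY_rfX_generic:
  assumes "i > 0 \<or> j > 0"
  shows "rfY ^ i * rfX ^ j \<noteq> 1"
proof
  assume "rfY ^ i * rfX ^ j = 1"
  \<comment> \<open>At X = Y = 2 the monomial takes the value 2^(i + j), which exceeds 1.\<close>
  moreover have "rf_has_value (rfY ^ i * rfX ^ j) 2 2 (2 ^ i * 2 ^ j :: rat)"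
    by (intro rf_has_value_mult rf_has_value_power) simp_all
  ultimately have "2 ^ (i + j) = (1 :: rat)"
    using rf_has_value_unique[OF _ rf_has_value_1] by (simp add: power_add)
  then show False using one_less_power[of "2::rat" "i + j"] assms by simp
qed

lemma rfX_rfY_nonzero: "rfX \<noteq> 0" "rfY \<noteq> 0"
  using rf_has_value_unique[OF rf_has_value_rfX[of "1::rat" "1"]] 
    rf_has_value_unique[OF rf_has_value_rfY[of "1::rat" "1"]] by (metis rf_has_value_0 zero_neq_one)+

text \<open>\<open>euler_gf\<close> is one formula for all fields. Its value at (1/X, 1/Y), a point
  over the field of rational functions, is therefore the same formula with inverted
  parameters.\<close>

lemma euler_gf_ratfun_functional_equation:
  assumes "finite I" "I \<noteq> {}" and f: "\<And>i. i \<in> I \<Longrightarrow> f i > 0"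
  defines "n \<equiv> sum f I"
  shows "rf_eval (euler_gf rfX rfY f I) (inverse rfX) (inverse rfY) =
    (- 1) ^ (3 * n) * rfX ^ ((3 * n) choose 2) * rfY ^ (5 * n) * euler_gf rfX rfY f I"
proof -
  have "rf_eval (euler_gf rfX rfY f I) (inverse rfX) (inverse rfY) = euler_gf (inverse rfX) (inverse rfY) f I"
  proof (intro rf_has_value_eval rf_has_value_euler_gf assms)
    fix i j :: nat assume "i > 0"
    then have "rfY ^ i * rfX ^ j \<noteq> 1" using rfY_rfX_generic by blast
    moreover have "inverse rfY ^ i * inverse rfX ^ j = inverse (rfY ^ i * rfX ^ j)"
      by (simp add: power_inverse)
    ultimately show "inverse rfY ^ i * inverse rfX ^ j \<noteq> 1" by (metis inverse_eq_1_iff)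
  qed
  also have "\<dots> = (- 1) ^ (3 * n) * rfX ^ ((3 * n) choose 2) * rfY ^ (5 * n) * euler_gf rfX rfY f I"
    unfolding n_def
  proof (intro euler_gf_functional_equation assms rfX_rfY_nonzero)
    show "rfX ^ i \<noteq> 1" if "i > 0" for i using rfY_rfX_generic[of 0 i] that by simp
  qed (use rfY_rfX_generic in blast)
  finally show ?thesis .
qed

text \<open>The numerator vanishes at all these points. For fixed p it is a polynomial in Y with
  infinitely many roots, so its coefficients vanish at X = p; having infinitely many roots p, they
  are zero.\<close>

lemma ratfun2_eq_0I:
  fixes A :: "nat set" and B :: "nat \<Rightarrow> complex set"
  assumes "infinite A" "\<And>p. p \<in> A \<Longrightarrow> infinite (B p)"
    and "\<And>p y. p \<in> A \<Longrightarrow> y \<in> B p \<Longrightarrow> rf_has_value W (of_nat p) y 0"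
  shows "W = 0"
proof -
  obtain P Q where W: "W = Fract P Q" "Q \<noteq> 0" by (cases W) auto
  have P: "bipoly_eval P (of_nat p) y = 0" if "p \<in> A" "y \<in> B p" for p y
    using assms(3)[OF that]
  proof (rule rf_has_valueE)
    fix P' Q' assume *: "W = Fract P' Q'" "Q' \<noteq> 0" "bipoly_eval Q' (of_nat p) y \<noteq> 0"
      "0 = bipoly_eval P' (of_nat p) y / bipoly_eval Q' (of_nat p) y"
    then have "P * Q' = P' * Q" using W by (simp add: eq_fract)
    then have "bipoly_eval P (of_nat p) y * bipoly_eval Q' (of_nat p) y =
        bipoly_eval P' (of_nat p) y * bipoly_eval Q (of_nat p) y"
      by (simp only: bipoly_eval_mult [symmetric])
    then show ?thesis using * by auto
  qed
  have "Polynomial.coeff P i = 0" for i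
  proof -
    have "poly (map_poly of_rat (Polynomial.coeff P i)) (of_nat p :: complex) = 0" if "p \<in> A" for p
    proof -
      let ?R = "map_poly (\<lambda>c. poly (map_poly of_rat c) (of_nat p :: complex)) P"
      have "B p \<subseteq> {y. poly ?R y = 0}" using P[OF that] by (auto simp: bipoly_eval_def)
      then have "?R = 0" using assms(2)[OF that] poly_roots_finite finite_subset by blast
      then have "Polynomial.coeff ?R i = 0" by simp
      then show ?thesis by (simp add: coeff_map_poly)
    qed
    then have "of_nat ` A \<subseteq> {x::complex. poly (map_poly of_rat (Polynomial.coeff P i)) x = 0}" by auto
    moreover have "infinite (of_nat ` A :: complex set)"
      using assms(1) by (simp add: finite_image_iff inj_on_def)
    ultimately have "map_poly (of_rat :: rat \<Rightarrow> complex) (Polynomial.coeff P i) = 0"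
      using poly_roots_finite finite_subset by blast
    then have "Polynomial.coeff (map_poly (of_rat :: rat \<Rightarrow> complex) (Polynomial.coeff P i)) j = 0" for j by simp
    then show ?thesis by (intro poly_eqI) (simp add: coeff_map_poly)
  qed
  then have "P = 0" by (intro poly_eqI) simp
  then show ?thesis using W by (simp add: Zero_fract_def eq_fract)
qed

section \<open>Primes congruent to one\<close>

text \<open>Toggling one fixed element is an involution that changes the parity.\<close>

lemma card_even_odd_subsets:
  assumes "finite A" "A \<noteq> {}"
  shows "card {T \<in> Pow A. even (card T)} = card {T \<in> Pow A. odd (card T)}"
proof -
  obtain q where q: "q \<in> A" using assms(2) by blast
  define \<tau> where "\<tau> = (\<lambda>T. if q \<in> T then T - {q} else insert q T)"
  have tt: "\<tau> (\<tau> T) = T" for T by (auto simp: \<tau>_def)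
  have sub: "\<tau> T \<subseteq> A" if "T \<subseteq> A" for T using that q by (auto simp: \<tau>_def)
  have par: "even (card (\<tau> T)) \<longleftrightarrow> odd (card T)" if "T \<subseteq> A" for T
  proof -
    have fin: "finite T" using that assms(1) finite_subset by blast
    show ?thesis
    proof (cases "q \<in> T")
      case True
      then have "card T = Suc (card (T - {q}))" using fin by (metis card_Suc_Diff1)
      then show ?thesis using True by (simp add: \<tau>_def)
    qed (simp add: \<tau>_def fin)
  qed
  show ?thesis
    by (rule bij_betw_same_card[of \<tau>], rule bij_betw_byWitness[of _ \<tau>]) (use tt sub par in auto)
qed

lemma cong_1_iff_dvd: "x \<ge> 1 \<Longrightarrow> [x = 1] (mod p) \<longleftrightarrow> p dvd x - 1" for x p :: nat
  using cong_diff_iff_cong_0_nat[of 1 x p] by (simp add: cong_0_iff)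

text \<open>In x^k - 1 = (x - 1)(1 + x + ... + x^(k-1)) the second factor is congruent to k modulo
  p.\<close>

lemma multiplicity_power_minus_1:
  fixes x :: nat
  assumes p: "Factorial_Ring.prime p" and "p dvd x - 1" and "\<not> p dvd k" and "x > 1"
  shows "multiplicity p (x ^ k - 1) = multiplicity p (x - 1)"
proof -
  have eq: "x ^ k - 1 = (x - 1) * (\<Sum>i<k. x ^ i)"
  proof -
    have "int (x ^ k - 1) = int ((x - 1) * (\<Sum>i<k. x ^ i))"
      using power_diff_1_eq[of "int x" k] assms(4) by (simp add: of_nat_diff)
    then show ?thesis by (simp only: of_nat_eq_iff)
  qed
  have "[x = 1] (mod p)" using assms(2,4) cong_1_iff_dvd[of x p] by simp
  then have "[(\<Sum>i<k. x ^ i) = (\<Sum>i<k. 1 ^ i)] (mod p)" by (intro cong_sum cong_pow)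
  then have nd: "\<not> p dvd (\<Sum>i<k. x ^ i)" using assms(3) by (simp add: cong_dvd_iff)
  have "(\<Sum>i<k. x ^ i) \<noteq> 0" using nd by (metis dvd_0_right)
  then have "multiplicity p (x ^ k - 1) = multiplicity p (x - 1) + multiplicity p (\<Sum>i<k. x ^ i)"
    unfolding eq using p assms(4) by (intro prime_elem_multiplicity_mult_distrib) auto
  then show ?thesis using nd by (simp add: not_dvd_imp_multiplicity_0)
qed

text \<open>
  If no prime divisor of \<open>a\<^sup>N - 1\<close> had \<open>a\<close> of order exactly \<open>N\<close>, the value
  \<open>\<Phi>\<^sub>N(a) = \<Prod>\<^sub>T (a\<^bsup>N/\<Prod>T\<^esup> - 1)\<^bsup>(-1)\<^bsup>|T|\<^esup>\<^esup>\<close> of the cyclotomic polynomial, with \<open>T\<close> ranging over the sets of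
  prime divisors of \<open>N\<close>, would be \<open>1\<close>; comparing the lowest powers of \<open>a\<close> refutes this.
\<close>

lemma exists_prime_with_order:
  fixes N a :: nat
  assumes N: "N > 1" and a: "a > 1" "N dvd a"
  shows "\<exists>p. Factorial_Ring.prime p \<and> p dvd a ^ N - 1 \<and> ord p a = N"
proof (rule ccontr)
  assume no: "\<not> ?thesis"
  define S where "S = prime_factors N"
  have S: "finite S" "\<And>q. q \<in> S \<Longrightarrow> Factorial_Ring.prime q" "\<And>q. q \<in> S \<Longrightarrow> q dvd N"
    by (auto simp: S_def)
  have "S \<noteq> {}" using N prime_factor_nat[of N] by (auto simp: S_def prime_factors_dvd)
  have prod_dvd: "\<Prod>T dvd m" if "T \<subseteq> S" "\<And>q. q \<in> T \<Longrightarrow> q dvd m" for T m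
  proof -
    have "finite T" using that S finite_subset by blast
    then show ?thesis using that
    proof (induction T)
      case (insert q T)
      have "coprime q (\<Prod>T)" using insert S by (intro prod_coprime_right primes_coprime) auto
      then show ?case using insert by (simp add: divides_mult)
    qed simp
  qed
  have pos: "\<Prod>T > 0" if "T \<subseteq> S" for T
    using that S prime_gt_0_nat by (intro prod_pos) auto
  \<comment> \<open>The factors of the cyclotomic value: sets of even size belong to the numerator,
    sets of odd size to the denominator.\<close>
  define b where "b = (\<lambda>T. a ^ (N div \<Prod>T) - 1)"
  have divN: "\<Prod>T dvd N" if "T \<subseteq> S" for T using prod_dvd[OF that] S that by blast
  have expo: "N div \<Prod>T > 0" if "T \<subseteq> S" for T
    using divN[OF that] N pos[OF that] by (simp add: dvd_imp_le div_greater_zero_iff)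
  have b_pos: "b T > 0" if "T \<subseteq> S" for T
    using one_less_power[OF a(1) expo[OF that]] by (simp add: b_def)
  have mult_eq: "multiplicity p (\<Prod>T\<in>{T \<in> Pow S. even (card T)}. b T) =
      multiplicity p (\<Prod>T\<in>{T \<in> Pow S. odd (card T)}. b T)" if p: "Factorial_Ring.prime p" for p
  proof -
    have dist: "multiplicity p (\<Prod>T\<in>{T \<in> Pow S. Q T}. b T) = (\<Sum>T\<in>{T \<in> Pow S. Q T}. multiplicity p (b T))"
      for Q
    proof (rule prime_elem_multiplicity_prod_distrib)
      show "0 \<notin> b ` {T \<in> Pow S. Q T}"
      proof
        assume "0 \<in> b ` {T \<in> Pow S. Q T}"
        then obtain T where "T \<subseteq> S" "b T = 0" by auto
        then show False using b_pos[of T] by simp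
      qed
    qed (use p S(1) in auto)
    show ?thesis
    proof (cases "p dvd a ^ N - 1")
      case False
      have "\<not> p dvd b T" if T: "T \<subseteq> S" for T
      proof
        assume "p dvd b T"
        then have "[a ^ (N div \<Prod>T) = 1] (mod p)"
          using a cong_1_iff_dvd[of "a ^ (N div \<Prod>T)" p] by (simp add: b_def)
        then have "ord p a dvd N div \<Prod>T" by (simp only: ord_divides)
        then have "ord p a dvd N" using divN[OF T] by (metis dvd_div_mult_self dvd_mult2)
        then have "[a ^ N = 1] (mod p)" by (simp only: ord_divides)
        then show False using False a cong_1_iff_dvd[of "a ^ N" p] by simp
      qed
      then have "multiplicity p (b T) = 0" if "T \<subseteq> S" for T
        using that by (intro not_dvd_imp_multiplicity_0) auto
      then show ?thesis unfolding dist by simp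
    next
      case True
      let ?o = "ord p a"
      have cong_dvd: "[a ^ k = 1] (mod p) \<longleftrightarrow> p dvd a ^ k - 1" for k
        using a by (intro cong_1_iff_dvd) simp
      have oN: "?o dvd N" using True cong_dvd ord_divides by blast
      have "?o \<noteq> N" using no True p by blast
      have "coprime p a"
      proof (rule ccontr)
        assume "\<not> coprime p a"
        then have "p dvd a ^ N" using p N by (metis dvd_power_le dvd_trans dvd_power prime_imp_coprime zero_less_one less_trans)
        then have "p dvd a ^ N - (a ^ N - 1)" using True by (rule dvd_diff_nat)
        then show False using p a by simp
      qed
      then have o: "?o > 0" by (simp add: coprime_commute)
      \<comment> \<open>A prime divisor of a^N - 1 does not divide a, and N divides a.\<close>
      have pN: "\<not> p dvd N" using \<open>coprime p a\<close> a(2) p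
        by (metis coprime_common_divisor dvd_refl dvd_trans not_prime_unit)
      \<comment> \<open>p divides \<open>b T\<close> exactly when T is a subset of S', and then
        always to the same power, by \<open>multiplicity_power_minus_1\<close>. The order of a is a
        proper divisor of N, so S' is not empty and has as many even as odd subsets.\<close>
      define S' where "S' = {q \<in> S. ?o dvd N div q}"
      have "N div ?o > 1" using \<open>?o \<noteq> N\<close> oN N o by (metis One_nat_def Suc_lessI div_greater_zero_iff dvd_imp_le dvd_mult_div_cancel less_trans mult.right_neutral zero_less_one)
      then obtain q where q: "Factorial_Ring.prime q" "q dvd N div ?o"
        using prime_factor_nat[of "N div ?o"] by auto
      have "q * ?o dvd N" using q oN by (metis dvd_div_iff_mult gr_implies_not0 o)
      then obtain k where k: "N = q * ?o * k" by blast
      have "q > 0" using q(1) prime_gt_0_nat by blast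
      then have "N div q = ?o * k" using k by (metis mult.assoc nonzero_mult_div_cancel_left less_not_refl)
      then have "?o dvd N div q" by (metis dvd_triv_left)
      have "q dvd N" using k by (metis dvd_triv_left mult.assoc)
      then have "q \<in> S" using q(1) N by (simp add: S_def prime_factors_dvd)
      then have "S' \<noteq> {}" using \<open>?o dvd N div q\<close> by (auto simp: S'_def)
      have iff: "?o dvd N div \<Prod>T \<longleftrightarrow> T \<subseteq> S'" if T: "T \<subseteq> S" for T
      proof
        assume o1: "?o dvd N div \<Prod>T"
        have "?o dvd N div q" if "q \<in> T" for q
        proof -
          have "finite T" using T S finite_subset by blast
          then have "\<Prod>T = q * \<Prod>(T - {q})" using that by (rule prod.remove)
          moreover obtain m where m: "N = \<Prod>T * m" using divN[OF T] by blast
          moreover have "q > 0" using that T S prime_gt_0_nat by blast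
          ultimately have "N div q = \<Prod>(T - {q}) * m" by simp
          moreover have "N div \<Prod>T = m" using m pos[OF T] by simp
          ultimately show ?thesis using o1 by simp
        qed
        then show "T \<subseteq> S'" using T by (auto simp: S'_def)
      next
        assume T': "T \<subseteq> S'"
        have "q dvd N div ?o" if "q \<in> T" for q
        proof -
          have "?o dvd N div q" "q dvd N" "q > 0" using that T T' S prime_gt_0_nat by (auto simp: S'_def)
          then have "?o * q dvd N" by (simp add: dvd_div_iff_mult)
          then show ?thesis using o oN by (simp add: dvd_div_iff_mult mult.commute)
        qed
        then have "\<Prod>T dvd N div ?o" by (rule prod_dvd[OF T])
        then have "?o * \<Prod>T dvd N" using o oN by (simp add: dvd_div_iff_mult mult.commute)
        then show "?o dvd N div \<Prod>T" using divN[OF T] pos[OF T] by (simp add: dvd_div_iff_mult)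
      qed
      have v: "multiplicity p (b T) = (if T \<subseteq> S' then multiplicity p (a ^ ?o - 1) else 0)" if T: "T \<subseteq> S" for T
      proof (cases "T \<subseteq> S'")
        case True
        then obtain k where k: "N div \<Prod>T = ?o * k" using iff[OF T] by blast
        have "k dvd N" using k divN[OF T] by (metis dvd_div_mult_self dvd_mult2 dvd_triv_right)
        then have "\<not> p dvd k" using pN dvd_trans by blast
        moreover have "[a ^ ?o = 1] (mod p)" by (simp only: ord_divides dvd_refl)
        then have "p dvd a ^ ?o - 1" by (simp only: cong_dvd)
        moreover have "a ^ ?o > 1" using one_less_power[OF a(1) o] .
        ultimately have "multiplicity p ((a ^ ?o) ^ k - 1) = multiplicity p (a ^ ?o - 1)"
          by (intro multiplicity_power_minus_1 p)
        then show ?thesis using True by (simp add: b_def k power_mult)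
      next
        case False
        moreover have "p dvd b T \<longleftrightarrow> ?o dvd N div \<Prod>T"
          unfolding b_def using cong_dvd[of "N div \<Prod>T"] by (simp only: ord_divides)
        ultimately have "\<not> p dvd b T" using iff[OF T] by blast
        then show ?thesis using False by (simp add: not_dvd_imp_multiplicity_0)
      qed
      have cnt: "(\<Sum>T\<in>{T \<in> Pow S. Q T}. multiplicity p (b T)) =
          card {T \<in> Pow S'. Q T} * multiplicity p (a ^ ?o - 1)" for Q
      proof -
        have "(\<Sum>T\<in>{T \<in> Pow S. Q T}. multiplicity p (b T)) =
           (\<Sum>T\<in>{T \<in> Pow S. Q T}. if T \<subseteq> S' then multiplicity p (a ^ ?o - 1) else 0)"
          by (intro sum.cong refl) (simp add: v)
        also have "\<dots> = (\<Sum>T\<in>{T \<in> Pow S'. Q T}. multiplicity p (a ^ ?o - 1))"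
          using S(1) by (intro sum.mono_neutral_cong_right) (auto simp: S'_def)
        finally show ?thesis by simp
      qed
      have "finite S'" using S by (simp add: S'_def)
      then show ?thesis unfolding dist cnt using card_even_odd_subsets[OF _ \<open>S' \<noteq> {}\<close>] by simp
    qed
  qed
  \<comment> \<open>The smallest of the exponents \<open>N div \<Prod>T\<close>, attained only for T
    = S. Modulo a^(e+1) all other factors become -1, and equality of the two products leaves the
    contradiction that a^(e+1) divides a^e.\<close>
  define e where "e = N div \<Prod>S"
  have e: "e > 0" using expo[of S] by (simp add: e_def)
  define m where "m = int a ^ Suc e"
  have b_cong: "[int (b T) = - (if T = S then 1 - int a ^ e else 1)] (mod m)" if T: "T \<subseteq> S" for T
  proof -
    have ib: "int (b T) = int a ^ (N div \<Prod>T) - 1" using a by (simp add: b_def of_nat_diff)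
    show ?thesis
    proof (cases "T = S")
      case False
      then obtain q where q: "q \<in> S" "q \<notin> T" using T by blast
      have fT: "finite T" using T S finite_subset by blast
      have "N div \<Prod>T > e"
      proof -
        obtain k where k: "N = \<Prod>S * k" using divN[of S] by blast
        have "\<Prod>S = \<Prod>T * \<Prod>(S - T)" using T S(1) by (metis prod.subset_diff mult.commute)
        moreover have "\<Prod>(S - T) > 1"
        proof -
          have "\<Prod>(S - T) = q * \<Prod>(S - T - {q})" using q S by (intro prod.remove) auto
          moreover have "\<Prod>(S - T - {q}) \<ge> 1" using pos[of "S - T - {q}"] by fastforce
          moreover have "q > 1" using q S prime_gt_1_nat by blast
          ultimately show ?thesis by (metis less_le_trans mult.right_neutral mult_le_mono2)
        qed
        moreover have "k > 0" using k N by (cases k) auto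
        moreover have "e = k" using k pos[of S] by (simp add: e_def)
        moreover have "N div \<Prod>T = \<Prod>(S - T) * k"
          using k pos[OF T] calculation(1) by (simp add: mult.assoc)
        ultimately show ?thesis by simp
      qed
      then have "m dvd int a ^ (N div \<Prod>T)" unfolding m_def by (intro le_imp_power_dvd) simp
      then show ?thesis using False by (simp add: ib cong_iff_dvd_diff)
    next
      case True
      with ib show ?thesis by (simp add: e_def)
    qed
  qed
  have prod_cong: "[int (\<Prod>T\<in>{T \<in> Pow S. Q T}. b T) =
     (- 1) ^ card {T \<in> Pow S. Q T} * (if Q S then 1 - int a ^ e else 1)] (mod m)" for Q
  proof -
    let ?A = "{T \<in> Pow S. Q T}"
    have fin: "finite ?A" using S by simp
    have "[(\<Prod>T\<in>?A. int (b T)) = (\<Prod>T\<in>?A. (- 1) * (if T = S then 1 - int a ^ e else 1))] (mod m)"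
      using b_cong by (intro cong_prod) auto
    also have "(\<Prod>T\<in>?A. (- 1) * (if T = S then 1 - int a ^ e else 1)) =
        (- 1) ^ card ?A * (\<Prod>T\<in>?A. if T = S then 1 - int a ^ e else 1)"
      by (simp only: prod.distrib prod_constant)
    also have "(\<Prod>T\<in>?A. if T = S then 1 - int a ^ e else 1) = (if Q S then 1 - int a ^ e else 1)"
      using fin by (simp add: prod.delta)
    finally show ?thesis by simp
  qed
  have EO: "(\<Prod>T\<in>{T \<in> Pow S. even (card T)}. b T) = (\<Prod>T\<in>{T \<in> Pow S. odd (card T)}. b T)"
  proof (rule multiplicity_eq_nat)
    have pp: "(\<Prod>T\<in>{T \<in> Pow S. Q T}. b T) > 0" for Q
      by (rule prod_pos, rule b_pos) blast
    show "(\<Prod>T\<in>{T \<in> Pow S. even (card T)}. b T) > 0" by (rule pp)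
    show "(\<Prod>T\<in>{T \<in> Pow S. odd (card T)}. b T) > 0" by (rule pp)
  qed (rule mult_eq)
  define c where "c = card {T \<in> Pow S. odd (card T)}"
  have c: "card {T \<in> Pow S. even (card T)} = c"
    using card_even_odd_subsets[OF S(1) \<open>S \<noteq> {}\<close>] by (simp add: c_def)
  have "[(- 1) ^ c * (if even (card S) then 1 - int a ^ e else 1) =
       (- 1) ^ c * (if odd (card S) then 1 - int a ^ e else 1)] (mod m)"
    by (rule cong_trans[OF cong_sym[OF prod_cong[of "\<lambda>T. even (card T)", unfolded c]]
          prod_cong[of "\<lambda>T. odd (card T)", folded c_def EO]])
  then have "m dvd int a ^ e"
    by (cases "even c"; cases "even (card S)") (auto simp: cong_iff_dvd_diff dvd_diff_commute)
  moreover have "int a ^ e > 0" using a by simp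
  ultimately have "m \<le> int a ^ e" by (rule zdvd_imp_le)
  then show False using a \<open>int a ^ e > 0\<close> by (simp add: m_def)
qed

lemma exists_prime_cong_1:
  fixes N B :: nat
  assumes "N > 0"
  shows "\<exists>p. Factorial_Ring.prime p \<and> p > B \<and> N dvd p - 1"
proof -
  \<comment> \<open>The factor B! of the base keeps p away from the primes up to B; the factor 2N
    makes the base divisible by the order 2N, which exceeds 1.\<close>
  let ?N = "2 * N" and ?a = "2 * N * fact B"
  have "2 * 1 * 1 \<le> ?a" using assms by (intro mult_le_mono) auto
  then have "?a > 1" by linarith
  then obtain p where p: "Factorial_Ring.prime p" "p dvd ?a ^ ?N - 1" "ord p ?a = ?N"
    using exists_prime_with_order[of ?N ?a] assms by (auto simp: mult.assoc)
  have "p > B"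
  proof (rule ccontr)
    assume "\<not> p > B"
    then have "p dvd fact B" using p(1) by (simp add: prime_dvd_fact_iff)
    then have "p dvd ?a" by (intro dvd_mult)
    moreover have "?a dvd ?a ^ ?N" using assms by (intro dvd_power) auto
    ultimately have "p dvd ?a ^ ?N" by (rule dvd_trans)
    then have "p dvd ?a ^ ?N - (?a ^ ?N - 1)" using p(2) by (rule dvd_diff_nat)
    moreover have "1 \<le> ?a ^ ?N" using \<open>?a > 1\<close> by (intro one_le_power less_imp_le)
    then have "?a ^ ?N - (?a ^ ?N - 1) = 1" by (rule diff_diff_cancel)
    ultimately show False using p(1) by simp
  qed
  moreover have "?N dvd p - 1"
  proof -
    have "ord p ?a > 0" using p(3) assms by simp
    then have "coprime p ?a" by (simp only: ord_gt_0_iff)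
    then show ?thesis using order_divides_totient[of p ?a] p by (simp add: totient_prime)
  qed
  then have "N dvd p - 1" using dvd_mult_right by blast
  ultimately show ?thesis using p(1) by blast
qed

section \<open>Semilocal principal ideal domains inside the complex numbers\<close>

lemma linear_times_complex [simp]: "linear (\<lambda>x::complex. c * x)"
  by (intro linearI) (simp_all add: algebra_simps)

lemma inj_times_complex: "c \<noteq> 0 \<Longrightarrow> inj (\<lambda>x::complex. c * x)"
  by (simp add: inj_def)

lemma scale_real_of_nat: "real n *\<^sub>R (x::complex) = of_nat n * x"
  by (simp add: scaleR_conv_of_real)

locale subring_complex =
  fixes R :: "complex set"
  assumes one_mem: "1 \<in> R" and diff_mem: "x \<in> R \<Longrightarrow> y \<in> R \<Longrightarrow> x - y \<in> R"
    and mult_mem: "x \<in> R \<Longrightarrow> y \<in> R \<Longrightarrow> x * y \<in> R"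
begin

lemma subgrp_R: "subgrp R"
  using diff_mem[OF one_mem one_mem] diff_mem by (intro subgrpI) auto

lemma zero_mem: "0 \<in> R"
  using subgrp_R by (rule subgrp_0)

lemma add_mem: "x \<in> R \<Longrightarrow> y \<in> R \<Longrightarrow> x + y \<in> R"
  using subgrp_R by (rule subgrp_add)

lemma uminus_mem: "x \<in> R \<Longrightarrow> - x \<in> R"
  using subgrp_R by (rule subgrp_uminus)

lemma of_nat_mem: "of_nat k \<in> R"
  using subgrp_of_nat[OF subgrp_R one_mem, of k] by (simp add: scale_real_of_nat)

lemma of_int_mem: "of_int k \<in> R"
  using subgrp_of_int[OF subgrp_R one_mem, of k] by (simp add: scaleR_conv_of_real)

lemma power_mem: "x \<in> R \<Longrightarrow> x ^ k \<in> R"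
  by (induction k) (auto intro: one_mem mult_mem)

lemma prod_mem: "(\<And>i. i \<in> A \<Longrightarrow> h i \<in> R) \<Longrightarrow> prod h A \<in> R"
  by (induction A rule: infinite_finite_induct) (auto intro: one_mem mult_mem)

lemma sum_mem: "(\<And>i. i \<in> A \<Longrightarrow> h i \<in> R) \<Longrightarrow> sum h A \<in> R"
  using subgrp_R by (rule subgrp_sum)

definition princ :: "complex \<Rightarrow> complex set" where
  "princ a = (\<lambda>x. a * x) ` R"

lemma mem_princ: "x \<in> princ a \<longleftrightarrow> (\<exists>r\<in>R. x = a * r)"
  by (auto simp: princ_def)

lemma subgrp_princ: "subgrp (princ a)"
  unfolding princ_def by (intro subgrp_image subgrp_R) simp

lemma princ_subset: "a \<in> R \<Longrightarrow> princ a \<subseteq> R"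
  by (auto simp: princ_def intro: mult_mem)

lemma princ_self: "a \<in> princ a"
  unfolding mem_princ using one_mem by force

lemma princ_1: "princ 1 = R"
  by (simp add: princ_def)

lemma princ_mult: "princ (a * b) = (\<lambda>x. a * x) ` princ b"
  by (auto simp: princ_def image_image mult.assoc)

lemma princ_mult_subset: "b \<in> R \<Longrightarrow> princ (a * b) \<subseteq> princ a"
  by (auto simp: princ_def mult.assoc intro!: imageI mult_mem)

lemma princ_ideal: "x \<in> princ a \<Longrightarrow> r \<in> R \<Longrightarrow> x * r \<in> princ a"
  by (auto simp: mem_princ mult.assoc intro: mult_mem)

lemma idx_princ_mult:
  assumes "a \<in> R" "b \<in> R" "a \<noteq> 0"
  shows "idx R (princ (a * b)) = idx R (princ a) * idx R (princ b)"
proof -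
  have "idx R (princ (a * b)) = idx R (princ a) * idx (princ a) (princ (a * b))"
    by (intro idx_mult subgrp_princ subgrp_R princ_mult_subset princ_subset assms)
  also have "idx (princ a) (princ (a * b)) = idx R (princ b)"
    unfolding princ_mult using idx_image[OF linear_times_complex inj_times_complex[OF assms(3)] subgrp_R subgrp_princ[of b]]
    by (simp add: princ_def)
  finally show ?thesis .
qed

section \<open>Comaximal elements\<close>

definition comax :: "complex \<Rightarrow> complex \<Rightarrow> bool" where
  "comax a b \<longleftrightarrow> (\<exists>y\<in>R. \<exists>z\<in>R. a * y + b * z = 1)"

lemma comax_sym: "comax a b \<Longrightarrow> comax b a"
  unfolding comax_def by (metis add.commute)

lemma comax_1: "comax 1 b"
  unfolding comax_def using one_mem zero_mem by force

lemma comax_mult: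
  assumes "a \<in> R" "b \<in> R" "c \<in> R" "comax a c" "comax b c"
  shows "comax (a * b) c"
proof -
  obtain y z y' z' where *: "y \<in> R" "z \<in> R" "y' \<in> R" "z' \<in> R" "a * y + c * z = 1" "b * y' + c * z' = 1"
    using assms(4,5) by (auto simp: comax_def)
  have "(a * y + c * z) * (b * y' + c * z') =
      a * b * (y * y') + c * (a * y * z' + z * b * y' + c * z * z')"
    by (simp add: algebra_simps)
  then have "a * b * (y * y') + c * (a * y * z' + z * b * y' + c * z * z') = 1"
    using * by simp
  moreover have "y * y' \<in> R" "a * y * z' + z * b * y' + c * z * z' \<in> R"
    using * assms by (auto intro!: add_mem mult_mem)
  ultimately show ?thesis unfolding comax_def by blast
qed

lemma comax_power: "a \<in> R \<Longrightarrow> c \<in> R \<Longrightarrow> comax a c \<Longrightarrow> comax (a ^ k) c"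
  by (induction k) (auto intro: comax_1 comax_mult power_mem)

lemma comax_prod:
  "c \<in> R \<Longrightarrow> (\<And>i. i \<in> A \<Longrightarrow> h i \<in> R \<and> comax (h i) c) \<Longrightarrow> comax (prod h A) c"
  by (induction A rule: infinite_finite_induct) (auto intro: comax_1 comax_mult prod_mem)

lemma comax_plus:
  assumes "a \<in> R" "b \<in> R" "comax a b"
  shows "princ (c * a) + princ (c * b) = princ c"
proof (rule antisym)
  show "princ (c * a) + princ (c * b) \<subseteq> princ c"
    by (intro plus_least subgrp_princ princ_mult_subset assms)
  obtain y z where yz: "y \<in> R" "z \<in> R" "a * y + b * z = 1" using assms(3) by (auto simp: comax_def)
  show "princ c \<subseteq> princ (c * a) + princ (c * b)"
  proof
    fix x assume "x \<in> princ c"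
    then obtain r where r: "r \<in> R" "x = c * r" by (auto simp: mem_princ)
    then have "x = c * r * (a * y + b * z)" using yz by simp
    then have "x = c * a * (r * y) + c * b * (r * z)" by (simp add: algebra_simps)
    moreover have "c * a * (r * y) \<in> princ (c * a)" "c * b * (r * z) \<in> princ (c * b)"
      using r yz by (auto simp: mem_princ intro: mult_mem)
    ultimately show "x \<in> princ (c * a) + princ (c * b)" by blast
  qed
qed

end

text \<open>The situation at an unramified prime: the primes above p are principal, generated by the
  \<pi>_i, with residue fields of p^(f_i) elements. Maximality of an ideal is stated as comaximality
  with all elements outside it, and the unit \<epsilon> accounts for the difference between p and
  the product of the \<pi>_i.\<close>

locale split_prime = subring_complex +
  fixes p g :: nat and \<pi> :: "nat \<Rightarrow> complex" and f :: "nat \<Rightarrow> nat" and \<epsilon> :: complex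
  assumes p: "Factorial_Ring.prime p"
    and pi_mem: "i < g \<Longrightarrow> \<pi> i \<in> R" and pi_nz: "i < g \<Longrightarrow> \<pi> i \<noteq> 0"
    and eps: "\<epsilon> \<in> R" "inverse \<epsilon> \<in> R" "\<epsilon> \<noteq> 0" "(\<Prod>i<g. \<pi> i) = of_nat p * \<epsilon>"
    and f_pos: "i < g \<Longrightarrow> f i > 0"
    and idx_pi: "i < g \<Longrightarrow> idx R (princ (\<pi> i)) = p ^ f i"
    and maximal: "i < g \<Longrightarrow> x \<in> R \<Longrightarrow> x \<notin> princ (\<pi> i) \<Longrightarrow> comax x (\<pi> i)"
    and comax_pi: "i < g \<Longrightarrow> j < g \<Longrightarrow> i \<noteq> j \<Longrightarrow> comax (\<pi> i) (\<pi> j)"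
begin

definition varpi :: "(nat \<Rightarrow> nat) \<Rightarrow> complex" where
  "varpi l = (\<Prod>i<g. \<pi> i ^ l i)"

definition J :: "(nat \<Rightarrow> nat) \<Rightarrow> complex set" where
  "J l = princ (varpi l)"

lemma p1: "p > 1"
  using p by (rule prime_gt_1_nat)

lemma varpi_mem: "varpi l \<in> R"
  unfolding varpi_def by (intro prod_mem power_mem pi_mem) auto

lemma varpi_nz: "varpi l \<noteq> 0"
  using pi_nz by (simp add: varpi_def)

lemma varpi_add: "varpi (\<lambda>i. l i + m i) = varpi l * varpi m"
  by (simp add: varpi_def power_add prod.distrib)

lemma varpi_cong: "(\<And>i. i < g \<Longrightarrow> l i = m i) \<Longrightarrow> varpi l = varpi m"
  by (auto simp: varpi_def intro!: prod.cong)

lemma subgrp_J: "subgrp (J l)"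
  unfolding J_def by (rule subgrp_princ)

lemma J_subset: "J l \<subseteq> R"
  unfolding J_def by (intro princ_subset varpi_mem)

lemma J_zero: "(\<And>i. i < g \<Longrightarrow> l i = 0) \<Longrightarrow> J l = R"
  by (simp add: J_def varpi_def princ_1)

lemma J_mono: "(\<And>i. i < g \<Longrightarrow> m i \<le> l i) \<Longrightarrow> J l \<subseteq> J m"
proof -
  assume le: "\<And>i. i < g \<Longrightarrow> m i \<le> l i"
  have "varpi l = varpi (\<lambda>i. m i + (l i - m i))" using le by (intro varpi_cong) simp
  then show ?thesis unfolding J_def varpi_add using princ_mult_subset varpi_mem by simp
qed

lemma idx_J: "idx R (J l) = p ^ (\<Sum>i<g. f i * l i)"
proof -
  have pw: "idx R (princ (\<pi> i ^ k)) = p ^ (f i * k)" if "i < g" for i k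
  proof (induction k)
    case (Suc k)
    then show ?case using idx_princ_mult[of "\<pi> i" "\<pi> i ^ k"] that
      by (simp add: pi_mem pi_nz power_mem idx_pi power_add)
  qed (simp add: princ_1 idx_self subgrp_R)
  have "idx R (princ (\<Prod>i\<in>A. \<pi> i ^ l i)) = p ^ (\<Sum>i\<in>A. f i * l i)" if "finite A" "A \<subseteq> {..<g}" for A
    using that
  proof (induction A rule: finite_induct)
    case (insert i A)
    then have "idx R (princ (\<pi> i ^ l i * (\<Prod>i\<in>A. \<pi> i ^ l i))) =
       idx R (princ (\<pi> i ^ l i)) * idx R (princ (\<Prod>i\<in>A. \<pi> i ^ l i))"
      by (intro idx_princ_mult power_mem pi_mem prod_mem) (auto simp: pi_nz)
    then show ?case using insert by (simp add: pw power_add)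
  qed (simp add: princ_1 idx_self subgrp_R)
  then show ?thesis unfolding J_def varpi_def by blast
qed

lemma not_comax_self: "i < g \<Longrightarrow> \<not> comax (\<pi> i * x) (\<pi> i)" if "x \<in> R"
proof
  assume i: "i < g" and "comax (\<pi> i * x) (\<pi> i)"
  then obtain y z where yz: "y \<in> R" "z \<in> R" "\<pi> i * x * y + \<pi> i * z = 1" by (auto simp: comax_def)
  have "R \<subseteq> princ (\<pi> i)"
  proof
    fix r assume "r \<in> R"
    moreover have "r = (\<pi> i * x * y + \<pi> i * z) * r" using yz(3) by simp
    then have "r = \<pi> i * ((x * y + z) * r)" by (simp add: algebra_simps)
    moreover have "(x * y + z) * r \<in> R" using yz that \<open>r \<in> R\<close> by (intro mult_mem add_mem)
    ultimately show "r \<in> princ (\<pi> i)" unfolding mem_princ by blast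
  qed
  then have "princ (\<pi> i) = R" using princ_subset[OF pi_mem[OF i]] by blast
  then have "p ^ f i = 1" using idx_pi[OF i] idx_self[OF subgrp_R] by simp
  then show False using p1 f_pos[OF i] by simp
qed

lemma varpi_split:
  assumes "i < g" 
  shows "varpi l = \<pi> i ^ l i * (\<Prod>j\<in>{..<g} - {i}. \<pi> j ^ l j)"
  unfolding varpi_def using assms by (intro prod.remove) auto

lemma comax_rest:
  assumes "i < g"
  shows "comax (\<Prod>j\<in>{..<g} - {i}. \<pi> j ^ l j) (\<pi> i)"
  using assms by (intro comax_prod) (auto intro!: comax_power comax_pi pi_mem power_mem)

text \<open>If m i > l i, cancelling \<pi>_i^(l i) would exhibit the part of \<open>varpi l\<close>
  prime to \<pi>_i as a multiple of \<pi>_i.\<close>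

lemma J_subset_iff: "J l \<subseteq> J m \<longleftrightarrow> (\<forall>i<g. m i \<le> l i)"
proof
  assume sub: "J l \<subseteq> J m"
  show "\<forall>i<g. m i \<le> l i"
  proof (intro allI impI, rule ccontr)
    fix i assume i: "i < g" "\<not> m i \<le> l i"
    let ?r = "\<lambda>l. \<Prod>j\<in>{..<g} - {i}. \<pi> j ^ l j"
    have rm: "?r l \<in> R" for l using pi_mem by (intro prod_mem power_mem) auto
    have "varpi l \<in> J m" using sub princ_self by (auto simp: J_def)
    then obtain r where r: "r \<in> R" "varpi l = varpi m * r" by (auto simp: J_def mem_princ)
    obtain k where k: "m i = l i + Suc k" using i(2) by (metis add_Suc_right less_imp_Suc_add linorder_not_le)
    have "\<pi> i ^ l i * ?r l = \<pi> i ^ l i * (\<pi> i * (\<pi> i ^ k * ?r m * r))"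
      using r(2) unfolding varpi_split[OF i(1)] k by (simp add: power_add mult_ac)
    then have "?r l = \<pi> i * (\<pi> i ^ k * ?r m * r)" using pi_nz[OF i(1)] by simp
    then have "comax (\<pi> i * (\<pi> i ^ k * ?r m * r)) (\<pi> i)" using comax_rest[OF i(1), of l] by simp
    then show False using not_comax_self[of "\<pi> i ^ k * ?r m * r" i] r rm i
      by (simp add: mult_mem power_mem pi_mem)
  qed
qed (use J_mono in blast)

text \<open>Take l of least total degree with J l inside I. For x in I but not in J l, take m below
  l of greatest total degree with x in J m. Then m i < l i for some i and x =
  \<open>varpi m * z\<close> with z comaximal to \<pi>_i. Combining x with the generator of J l
  shows that this generator divided by \<pi>_i is in I, against minimality.\<close>

lemma ideal_eq_J:
  assumes I: "subgrp I" "\<And>x r. x \<in> I \<Longrightarrow> r \<in> R \<Longrightarrow> x * r \<in> I" "I \<subseteq> R" "J k \<subseteq> I"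
  shows "\<exists>l. (\<forall>i\<ge>g. l i = 0) \<and> I = J l"
proof -
  define P where "P = (\<lambda>l. (\<forall>i\<ge>g. l i = 0) \<and> J l \<subseteq> I)"
  have "P (\<lambda>i. if i < g then k i else 0)"
    using I(4) J_mono[of k "\<lambda>i. if i < g then k i else 0"] by (auto simp: P_def)
  then obtain l where l: "P l" "\<And>m. P m \<Longrightarrow> sum l {..<g} \<le> sum m {..<g}"
    using exists_least_iff[of "\<lambda>s. \<exists>l. P l \<and> sum l {..<g} = s"] by (metis linorder_not_le)
  have "I \<subseteq> J l"
  proof
    fix x assume x: "x \<in> I"
    show "x \<in> J l"
    proof (rule ccontr)
      assume nx: "x \<notin> J l"
      define Q where "Q = (\<lambda>m. (\<forall>i. m i \<le> l i) \<and> x \<in> J m)"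
      have "Q (\<lambda>_. 0)" using x I(3) J_zero[of "\<lambda>_. 0"] by (auto simp: Q_def)
      moreover have "sum m {..<g} \<le> sum l {..<g}" if "Q m" for m
        using that by (intro sum_mono) (auto simp: Q_def)
      ultimately obtain m where m: "Q m" "\<And>m'. Q m' \<Longrightarrow> sum m' {..<g} \<le> sum m {..<g}"
        using ex_has_greatest_nat[of Q "\<lambda>_. 0" "\<lambda>m. sum m {..<g}" "Suc (sum l {..<g})"]
        by (auto simp: less_Suc_eq_le)
      have "\<exists>i<g. m i < l i"
      proof (rule ccontr)
        assume "\<not> ?thesis"
        then have "J m \<subseteq> J l" by (intro J_mono) (meson linorder_not_less)
        then show False using m(1) nx by (auto simp: Q_def)
      qed
      then obtain i where i: "i < g" "m i < l i" by blast
      obtain z where z: "z \<in> R" "x = varpi m * z" using m(1) by (auto simp: Q_def J_def mem_princ)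
      define e where "e = (\<lambda>j. if j = i then 1 else 0 :: nat)"
      have ve: "varpi e = \<pi> i"
        unfolding varpi_split[OF i(1)] by (simp add: e_def)
      have "z \<notin> princ (\<pi> i)"
      proof
        assume "z \<in> princ (\<pi> i)"
        then obtain w where w: "w \<in> R" "z = \<pi> i * w" by (auto simp: mem_princ)
        have "x = varpi (\<lambda>j. m j + e j) * w" unfolding varpi_add ve using z w by simp
        then have "Q (\<lambda>j. m j + e j)" using m(1) i w by (auto simp: Q_def J_def mem_princ e_def)
        then have "sum (\<lambda>j. m j + e j) {..<g} \<le> sum m {..<g}" by (rule m(2))
        moreover have "sum e {..<g} = 1" using i by (simp add: e_def sum.delta)
        ultimately show False by (simp add: sum.distrib)
      qed
      then obtain v w where vw: "v \<in> R" "w \<in> R" "z * v + \<pi> i * w = 1"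
        using maximal[OF i(1) z(1)] by (auto simp: comax_def)
      define l' where "l' = (\<lambda>j. l j - e j)"
      have l': "l = (\<lambda>j. l' j + e j)" using i by (auto simp: l'_def e_def)
      have m': "varpi l' = varpi m * varpi (\<lambda>j. l' j - m j)"
        unfolding varpi_add[symmetric] using m(1) i by (intro varpi_cong) (auto simp: Q_def l'_def e_def)
      have vl: "varpi l = varpi l' * \<pi> i"
        using arg_cong[OF l', of varpi] by (simp only: varpi_add ve)
      have "varpi l' = varpi l' * (z * v + \<pi> i * w)" using vw by simp
      also have "\<dots> = x * (varpi (\<lambda>j. l' j - m j) * v) + varpi l * w"
        unfolding z(2) vl by (simp add: m' algebra_simps)
      also have "\<dots> \<in> I"
      proof (rule subgrp_add[OF I(1)])
        show "x * (varpi (\<lambda>j. l' j - m j) * v) \<in> I" using x vw by (intro I(2) mult_mem varpi_mem)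
        have "varpi l * w \<in> J l" using vw by (auto simp: J_def mem_princ)
        then show "varpi l * w \<in> I" using l(1) by (auto simp: P_def)
      qed
      finally have "varpi l' \<in> I" .
      then have "J l' \<subseteq> I" using I(2) by (auto simp: J_def mem_princ)
      then have "P l'" using l(1) by (auto simp: P_def l'_def)
      then have "sum l {..<g} \<le> sum l' {..<g}" by (rule l(2))
      moreover have "sum l {..<g} = sum l' {..<g} + sum e {..<g}" by (subst l') (simp add: sum.distrib)
      moreover have "sum e {..<g} = 1" using i by (simp add: e_def sum.delta)
      ultimately show False by simp
    qed
  qed
  then show ?thesis using l(1) by (auto simp: P_def)
qed

definition ones :: "nat set \<Rightarrow> nat \<Rightarrow> nat" where
  "ones S i = (if i \<in> S then 1 else 0)"

lemma scale_p_R: "(*\<^sub>R) (real p) ` R = J (ones {..<g})"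
proof -
  have v: "varpi (ones {..<g}) = of_nat p * \<epsilon>"
    unfolding eps(4)[symmetric] varpi_def by (intro prod.cong) (auto simp: ones_def)
  have pr: "(*\<^sub>R) (real p) ` R = princ (of_nat p)" by (auto simp: princ_def scale_real_of_nat)
  have "princ (of_nat p) \<subseteq> princ (of_nat p * \<epsilon>)"
  proof
    fix x assume "x \<in> princ (of_nat p)"
    then obtain r where "r \<in> R" "x = of_nat p * \<epsilon> * (inverse \<epsilon> * r)" using eps by (auto simp: mem_princ)
    then show "x \<in> princ (of_nat p * \<epsilon>)" using eps by (auto simp: mem_princ intro: mult_mem)
  qed
  moreover have "princ (of_nat p * \<epsilon>) \<subseteq> princ (of_nat p)"
    by (intro princ_mult_subset eps)
  ultimately show ?thesis unfolding pr v J_def by blast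
qed

text \<open>A greatest common divisor: p contains each \<pi>_i exactly once, so it shares with J l
  one factor \<pi>_i for every i with l i > 0.\<close>

lemma scale_p_plus_J:
  assumes S: "S = {i. i < g \<and> l i > 0}"
  shows "(*\<^sub>R) (real p) ` R + J l = J (ones S)"
proof -
  let ?c = "varpi (ones S)" and ?a = "varpi (ones ({..<g} - S))" and ?b = "varpi (\<lambda>i. l i - ones S i)"
  have 1: "varpi (ones {..<g}) = ?c * ?a"
    unfolding varpi_add[symmetric] by (intro varpi_cong) (auto simp: S ones_def)
  have 2: "varpi l = ?c * ?b"
    unfolding varpi_add[symmetric] by (intro varpi_cong) (auto simp: S ones_def)
  have pw: "comax (\<pi> i ^ a) (\<pi> j ^ b)" if "i < g" "j < g" "i \<noteq> j" for i j a b
    using that by (intro comax_power comax_sym[OF comax_power[OF _ _ comax_sym[OF comax_pi]]] pi_mem power_mem)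
  have "comax ?a ?b"
    unfolding varpi_def[of "ones ({..<g} - S)"]
  proof (intro comax_prod conjI power_mem pi_mem varpi_mem)
    fix i assume i: "i \<in> {..<g}"
    show "comax (\<pi> i ^ ones ({..<g} - S) i) ?b"
    proof (cases "i \<in> S")
      case True
      then show ?thesis by (simp add: ones_def comax_1)
    next
      case False
      show ?thesis unfolding varpi_def
      proof (rule comax_sym, intro comax_prod conjI power_mem pi_mem)
        fix j assume j: "j \<in> {..<g}"
        show "comax (\<pi> j ^ (l j - ones S j)) (\<pi> i ^ ones ({..<g} - S) i)"
        proof (cases "j = i")
          case True
          then show ?thesis using False i by (simp add: S ones_def comax_1)
        qed (use pw i j in auto)
      qed (use i in auto)
    qed
  qed auto
  then show ?thesis
    unfolding scale_p_R J_def 1 2 by (intro comax_plus varpi_mem)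
qed

end

section \<open>Sums over sets of subgroups\<close>

text \<open>With values in \<open>ennreal\<close> sums can be regrouped before anything is known
  about convergence; finiteness is derived later from the assumed summability.\<close>

definition wsum :: "'a set \<Rightarrow> ('a \<Rightarrow> ennreal) \<Rightarrow> ennreal" where
  "wsum A h = nn_integral (count_space A) h"

lemma wsum_cong: "A = B \<Longrightarrow> (\<And>x. x \<in> B \<Longrightarrow> h x = k x) \<Longrightarrow> wsum A h = wsum B k"
  unfolding wsum_def by (auto intro!: nn_integral_cong)

lemma wsum_cmult: "wsum A (\<lambda>x. c * h x) = c * wsum A h"
  unfolding wsum_def by (intro nn_integral_cmult) simp

lemma wsum_multc: "wsum A (\<lambda>x. h x * c) = wsum A h * c"
  using wsum_cmult[of A c h] by (simp add: mult.commute)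

lemma wsum_finite: "finite A \<Longrightarrow> wsum A h = sum h A"
  unfolding wsum_def by (rule nn_integral_count_space_finite)

lemma wsum_bij: "bij_betw \<phi> A B \<Longrightarrow> wsum B h = wsum A (\<lambda>x. h (\<phi> x))"
  unfolding wsum_def by (rule nn_integral_bij_count_space[symmetric])

text \<open>Tonelli's theorem for counting measures, applied to the graph of \<phi>.\<close>

lemma wsum_fiber:
  assumes "\<phi> ` A \<subseteq> B"
  shows "wsum A h = wsum B (\<lambda>b. wsum {a \<in> A. \<phi> a = b} h)"
proof -
  define F where "F = (\<lambda>(a, b). h a * indicator A a * (indicator {\<phi> a} b :: ennreal))"
  have 1: "wsum {a \<in> A. \<phi> a = b} h * indicator B b = (\<integral>\<^sup>+a. F (a, b) \<partial>count_space UNIV)" for b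
  proof (cases "b \<in> B")
    case True
    have "(\<integral>\<^sup>+a. h a * indicator {a \<in> A. \<phi> a = b} a \<partial>count_space UNIV) = (\<integral>\<^sup>+a. F (a, b) \<partial>count_space UNIV)"
      by (intro nn_integral_cong) (auto simp: F_def indicator_def)
    then show ?thesis using True by (simp add: wsum_def nn_integral_count_space_indicator)
  next
    case False
    have "F (a, b) = 0" for a using False assms by (auto simp: F_def indicator_def)
    then show ?thesis using False by simp
  qed
  have "wsum B (\<lambda>b. wsum {a \<in> A. \<phi> a = b} h) = (\<integral>\<^sup>+b. \<integral>\<^sup>+a. F (a, b) \<partial>count_space UNIV \<partial>count_space UNIV)"
    unfolding 1[symmetric] by (subst wsum_def) (rule nn_integral_count_space_indicator, simp)
  also have "\<dots> = (\<integral>\<^sup>+a. \<integral>\<^sup>+b. F (a, b) \<partial>count_space UNIV \<partial>count_space UNIV)"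
    unfolding nn_integral_fst_count_space nn_integral_snd_count_space ..
  also have "\<dots> = (\<integral>\<^sup>+a. h a * indicator A a \<partial>count_space UNIV)"
  proof (intro nn_integral_cong)
    fix a
    have "(\<integral>\<^sup>+b. F (a, b) \<partial>count_space UNIV) = (\<integral>\<^sup>+b. h a * indicator A a * indicator {\<phi> a} b \<partial>count_space UNIV)"
      by (simp add: F_def)
    also have "\<dots> = h a * indicator A a * (\<integral>\<^sup>+b. indicator {\<phi> a} b \<partial>count_space UNIV)"
      by (rule nn_integral_cmult) simp
    finally show "(\<integral>\<^sup>+b. F (a, b) \<partial>count_space UNIV) = h a * indicator A a"
      by simp
  qed
  also have "\<dots> = wsum A h"
    by (simp add: wsum_def nn_integral_count_space_indicator)
  finally show ?thesis ..
qed

lemma wsum_const_on: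
  assumes "finite A" "\<And>x. x \<in> A \<Longrightarrow> h x = c"
  shows "wsum A h = of_nat (card A) * c"
  using assms by (simp add: wsum_finite)

lemma wsum_Sigma: "wsum (Sigma A C) h = wsum A (\<lambda>a. wsum (C a) (\<lambda>c. h (a, c)))"
proof -
  have "wsum (Sigma A C) h = wsum A (\<lambda>a. wsum {x \<in> Sigma A C. fst x = a} h)"
    by (rule wsum_fiber) auto
  also have "\<dots> = wsum A (\<lambda>a. wsum (C a) (\<lambda>c. h (a, c)))"
  proof (rule wsum_cong)
    fix a assume "a \<in> A"
    then have "bij_betw (\<lambda>c. (a, c)) (C a) {x \<in> Sigma A C. fst x = a}"
      by (auto simp: bij_betw_def inj_on_def)
    then show "wsum {x \<in> Sigma A C. fst x = a} h = wsum (C a) (\<lambda>c. h (a, c))"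
      by (rule wsum_bij)
  qed simp
  finally show ?thesis .
qed

lemma preimage_eq_iff:
  assumes "inj \<phi>" "M' \<subseteq> B"
  shows "{x \<in> B. \<phi> x \<in> M} = M' \<longleftrightarrow> M \<inter> \<phi> ` B = \<phi> ` M'"
proof
  assume "M \<inter> \<phi> ` B = \<phi> ` M'"
  then have "\<phi> x \<in> M \<longleftrightarrow> \<phi> x \<in> \<phi> ` M'" if "x \<in> B" for x using that by blast
  then show "{x \<in> B. \<phi> x \<in> M} = M'" using assms(2) inj_image_mem_iff[OF assms(1)] by blast
qed auto

text \<open>\<open>card_subgroups_step\<close> for the images of B and M' under \<phi>. It is used
  with \<phi> the multiplication by p on a lattice and the multiplication by a product of distinct
  \<pi>_i on R.\<close>

lemma card_preimage_step:
  assumes p: "Factorial_Ring.prime p" and sg: "subgrp B" "subgrp M'" and M': "M' \<subseteq> B"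
    and \<phi>: "linear \<phi>" "inj \<phi>" "\<phi> ` B \<subseteq> B" and D: "(*\<^sub>R) (real p) ` B + \<phi> ` M' = \<phi> ` B"
    and r: "idx B (\<phi> ` B) = p ^ r" and m': "idx B (M' + (*\<^sub>R) (real p) ` B) = p ^ m'"
    and pos: "idx B M' > 0"
  shows "card {M. subgrp M \<and> M \<subseteq> B \<and> {x \<in> B. \<phi> x \<in> M} = M' \<and> idx B (M + \<phi> ` B) = p ^ m} =
     step_count p r m m'"
proof -
  have "(*\<^sub>R) (real p) ` \<phi> ` B + \<phi> ` M' = \<phi> ` (M' + (*\<^sub>R) (real p) ` B)"
  proof (intro equalityI subsetI)
    fix x assume "x \<in> (*\<^sub>R) (real p) ` \<phi> ` B + \<phi> ` M'"
    then obtain b c where "b \<in> B" "c \<in> M'" "x = real p *\<^sub>R \<phi> b + \<phi> c" by (auto elim!: set_plus_elim)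
    then have "x = \<phi> (c + real p *\<^sub>R b)" using \<phi>(1) by (simp add: linear_add linear_scale)
    then show "x \<in> \<phi> ` (M' + (*\<^sub>R) (real p) ` B)" using \<open>b \<in> B\<close> \<open>c \<in> M'\<close> by blast
  next
    fix x assume "x \<in> \<phi> ` (M' + (*\<^sub>R) (real p) ` B)"
    then obtain b c where "b \<in> B" "c \<in> M'" "x = \<phi> (c + real p *\<^sub>R b)" by (auto elim!: set_plus_elim)
    then have "x = real p *\<^sub>R \<phi> b + \<phi> c" using \<phi>(1) by (simp add: linear_add linear_scale)
    then show "x \<in> (*\<^sub>R) (real p) ` \<phi> ` B + \<phi> ` M'" using \<open>b \<in> B\<close> \<open>c \<in> M'\<close> by blast
  qed
  moreover have "subgrp (M' + (*\<^sub>R) (real p) ` B)" by (intro subgrp_plus subgrp_scale sg)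
  ultimately have 1: "idx (\<phi> ` B) ((*\<^sub>R) (real p) ` \<phi> ` B + \<phi> ` M') = p ^ m'"
    using idx_image[OF \<phi>(1,2) sg(1)] m' by simp
  have 2: "idx (\<phi> ` B) (\<phi> ` M') > 0" using idx_image[OF \<phi>(1,2) sg] pos by simp
  have "card {H. subgrp H \<and> H \<subseteq> B \<and> H \<inter> \<phi> ` B = \<phi> ` M' \<and> idx B (H + \<phi> ` B) = p ^ m} = step_count p r m m'"
    by (rule card_subgroups_step[OF p _ _ sg(1) image_mono[OF M'] \<phi>(3) D[symmetric] r 1 2])
      (rule subgrp_image[OF \<phi>(1) sg(2)], rule subgrp_image[OF \<phi>(1) sg(1)])
  then show ?thesis unfolding preimage_eq_iff[OF \<phi>(2) M'] .
qed

lemma idx_preimage_step: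
  assumes "subgrp B" "linear \<phi>" "inj \<phi>" "\<phi> ` B \<subseteq> B" "subgrp M" "M \<subseteq> B"
  shows "idx B M = idx B (M + \<phi> ` B) * idx B {x \<in> B. \<phi> x \<in> M}"
proof -
  have D: "subgrp (\<phi> ` B)" using assms by (intro subgrp_image)
  have M': "subgrp {x \<in> B. \<phi> x \<in> M}" using assms by (intro subgrp_vimage)
  have "idx B M = idx B (M + \<phi> ` B) * idx (M + \<phi> ` B) M"
    using assms D by (intro idx_mult subgrp_plus plus_upper1 plus_least)
  also have "idx (M + \<phi> ` B) M = idx (\<phi> ` B) (M \<inter> \<phi> ` B)"
    using idx_Int[OF D assms(5)] by (simp add: Int_commute add.commute)
  also have "M \<inter> \<phi> ` B = \<phi> ` {x \<in> B. \<phi> x \<in> M}" by auto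
  also have "idx (\<phi> ` B) \<dots> = idx B {x \<in> B. \<phi> x \<in> M}"
    using assms M' by (intro idx_image)
  finally show ?thesis .
qed

context split_prime
begin

section \<open>The recursion for pairs of an ideal and a lattice containing it\<close>

abbreviation pR :: "complex set" where
  "pR \<equiv> (*\<^sub>R) (real p) ` R"

definition lat :: "(nat \<Rightarrow> nat) \<Rightarrow> complex set set" where
  "lat l = {M. subgrp M \<and> J l \<subseteq> M \<and> M \<subseteq> R}"

definition nu :: "complex set \<Rightarrow> nat" where
  "nu M = multiplicity p (idx R M)"

text \<open>R/(M + pR) is the reduction modulo p of R/M, so this is the corank of M, the minimal
  number of generators of R/M.\<close>

definition rk :: "complex set \<Rightarrow> nat" where
  "rk M = nu (M + pR)"

text \<open>The vanishing beyond g makes each exponent vector of length g occur exactly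
  once.\<close>

definition expos :: "(nat \<Rightarrow> nat) set" where
  "expos = {l. \<forall>i\<ge>g. l i = 0}"

definition supp :: "(nat \<Rightarrow> nat) \<Rightarrow> nat set" where
  "supp l = {i. i < g \<and> l i > 0}"

abbreviation deg :: "(nat \<Rightarrow> nat) \<Rightarrow> nat" where
  "deg l \<equiv> \<Sum>i<g. f i * l i"

abbreviation n :: nat where
  "n \<equiv> \<Sum>i<g. f i"

lemma nu_power: "idx R M = p ^ k \<Longrightarrow> nu M = k"
  using p by (simp add: nu_def)

lemma idx_lat:
  assumes "M \<in> lat l"
  shows "idx R M = p ^ nu M" "idx R (M + pR) = p ^ rk M"
proof -
  have *: "idx R N = p ^ nu N" if N: "subgrp N" "J l \<subseteq> N" "N \<subseteq> R" for N
  proof -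
    obtain a b where "idx R N = p ^ a"
      by (rule idx_pow_between[OF p subgrp_J N(1) subgrp_R N(2,3) idx_J])
    then show ?thesis using nu_power by simp
  qed
  have M: "subgrp M" "J l \<subseteq> M" "M \<subseteq> R" using assms by (auto simp: lat_def)
  have pR: "subgrp pR" "pR \<subseteq> R" using subgrp_R subgrp_scale subgrp_of_nat[OF subgrp_R] by auto
  show "idx R M = p ^ nu M" using * M by blast
  show "idx R (M + pR) = p ^ rk M" unfolding rk_def
    using M pR plus_upper1[OF pR(1), of M] by (intro * subgrp_plus plus_least subgrp_R) auto
qed

lemma rk_le: "M \<in> lat l \<Longrightarrow> rk M \<le> n"
proof -
  assume M: "M \<in> lat l"
  have M': "subgrp M" "M \<subseteq> R" using M by (auto simp: lat_def)
  have pR: "subgrp pR" "pR \<subseteq> R" using subgrp_R subgrp_scale subgrp_of_nat[OF subgrp_R] by auto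
  have "idx R pR = p ^ n" unfolding scale_p_R idx_J by (simp add: ones_def)
  moreover have "idx R pR = idx R (M + pR) * idx (M + pR) pR"
    using M' pR plus_upper2[OF M'(1), of pR] by (intro idx_mult subgrp_plus plus_least subgrp_R)
  ultimately have "p ^ rk M dvd p ^ n" unfolding idx_lat(2)[OF M] by (metis dvd_triv_left)
  then show "rk M \<le> n" using p1 by (rule power_dvd_imp_le)
qed

definition wt :: "ennreal \<Rightarrow> ennreal \<Rightarrow> (nat \<Rightarrow> nat) \<times> complex set \<Rightarrow> ennreal" where
  "wt T U = (\<lambda>(l, M). U ^ deg l * T ^ nu M)"

definition pairs :: "nat set \<Rightarrow> nat \<Rightarrow> ((nat \<Rightarrow> nat) \<times> complex set) set" where
  "pairs S m = {(l, M). l \<in> expos \<and> supp l = S \<and> M \<in> lat l \<and> rk M = m}"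

definition pairs_below :: "nat set \<Rightarrow> ((nat \<Rightarrow> nat) \<times> complex set) set" where
  "pairs_below S = {(l, M). l \<in> expos \<and> supp l \<subseteq> S \<and> M \<in> lat l}"

lemma wsum_pairs_below:
  assumes "finite S"
  shows "wsum (pairs_below S) (\<lambda>(l, M). c (rk M) * wt T U (l, M)) =
    (\<Sum>S'\<in>Pow S. \<Sum>m\<le>n. c m * wsum (pairs S' m) (wt T U))"
proof -
  let ?h = "\<lambda>(l, M). c (rk M) * wt T U (l, M)"
  have "wsum (pairs_below S) ?h =
     wsum (Pow S \<times> {..n}) (\<lambda>b. wsum {a \<in> pairs_below S. (\<lambda>(l, M). (supp l, rk M)) a = b} ?h)"
    by (rule wsum_fiber) (auto simp: pairs_below_def intro: rk_le)
  also have "\<dots> = (\<Sum>b\<in>Pow S \<times> {..n}. wsum {a \<in> pairs_below S. (\<lambda>(l, M). (supp l, rk M)) a = b} ?h)"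
    using assms by (intro wsum_finite) simp
  also have "\<dots> = (\<Sum>(S', m)\<in>Pow S \<times> {..n}. c m * wsum (pairs S' m) (wt T U))"
  proof (intro sum.cong refl, clarify)
    fix S' m assume "S' \<subseteq> S"
    show "wsum {a \<in> pairs_below S. (\<lambda>(l, M). (supp l, rk M)) a = (S', m)} ?h = c m * wsum (pairs S' m) (wt T U)"
      unfolding wsum_cmult[symmetric] using \<open>S' \<subseteq> S\<close>
      by (intro wsum_cong) (auto simp: pairs_below_def pairs_def)
  qed
  finally show ?thesis by (simp add: sum.cartesian_product)
qed

definition step_fiber :: "nat set \<Rightarrow> complex set \<Rightarrow> nat \<Rightarrow> complex set set" where
  "step_fiber S M' m = {M. subgrp M \<and> M \<subseteq> R \<and> {x \<in> R. varpi (ones S) * x \<in> M} = M' \<and>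
     idx R (M + (\<lambda>x. varpi (ones S) * x) ` R) = p ^ m}"

text \<open>The step of the recursion divides the ideal by the product of the \<pi>_i with i in S
  and takes the preimage of M under multiplication by this product. The exponents before the step
  are determined by those after it, so a fibre consists of the lattices with prescribed preimage M'
  and is counted by \<open>card_preimage_step\<close>.\<close>

lemma card_lattice_fiber:
  assumes S: "S \<subseteq> {..<g}" and l: "l \<in> expos" "supp l \<subseteq> S" and M': "M' \<in> lat l"
  defines "\<phi> \<equiv> \<lambda>x. varpi (ones S) * x" and "l' \<equiv> \<lambda>i. l i + ones S i"
  shows "{(k, M). (k, M) \<in> pairs S m \<and> (\<lambda>i. k i - ones S i, {x \<in> R. \<phi> x \<in> M}) = (l, M')} =
      {l'} \<times> step_fiber S M' m"
    and "card (step_fiber S M' m) = step_count p (sum f S) m (rk M')" and "finite (step_fiber S M' m)"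
    and "\<And>M. M \<in> step_fiber S M' m \<Longrightarrow> nu M = m + nu M'"
proof -
  let ?A = "{(k, M). (k, M) \<in> pairs S m \<and> (\<lambda>i. k i - ones S i, {x \<in> R. \<phi> x \<in> M}) = (l, M')}"
  let ?B = "{M. subgrp M \<and> M \<subseteq> R \<and> {x \<in> R. \<phi> x \<in> M} = M' \<and> idx R (M + \<phi> ` R) = p ^ m}"
  have B: "step_fiber S M' m = ?B" by (simp add: step_fiber_def \<phi>_def)
  have \<phi>: "linear \<phi>" "inj \<phi>" unfolding \<phi>_def using inj_times_complex[OF varpi_nz] by simp_all
  have \<phi>R: "\<phi> ` R = J (ones S)" by (simp add: \<phi>_def J_def princ_def)
  have "\<phi> ` J l = princ (varpi (ones S) * varpi l)" unfolding J_def \<phi>_def princ_mult ..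
  then have \<phi>J: "\<phi> ` J l = J l'" unfolding J_def l'_def varpi_add by (simp only: mult.commute)
  have M'': "subgrp M'" "J l \<subseteq> M'" "M' \<subseteq> R" using M' by (auto simp: lat_def)
  have S': "S = {i. i < g \<and> l' i > 0}" and supp': "supp l' = S" and ex: "l' \<in> expos"
    using S l by (auto simp: l'_def ones_def supp_def expos_def split: if_splits)
  have D: "pR + J l' = \<phi> ` R" unfolding \<phi>R using scale_p_plus_J[OF S'] .
  have pR: "subgrp pR" by (intro subgrp_scale subgrp_R)
  have D': "pR + \<phi> ` M' = \<phi> ` R"
  proof (rule antisym)
    have "pR \<subseteq> \<phi> ` R" using D plus_upper1[OF subgrp_J, of pR l'] by simp
    then show "pR + \<phi> ` M' \<subseteq> \<phi> ` R"
      using M''(3) by (intro plus_least subgrp_image subgrp_R \<phi>) auto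
    have "J l' \<subseteq> \<phi> ` M'" unfolding \<phi>J[symmetric] using M''(2) by (rule image_mono)
    then have "pR + J l' \<subseteq> pR + \<phi> ` M'" by (intro set_plus_mono2) auto
    then show "\<phi> ` R \<subseteq> pR + \<phi> ` M'" unfolding D .
  qed
  \<comment> \<open>Since \<phi>(R) = pR + J l' and M contains J l', the corank relative to
    \<phi>(R) is the corank \<open>rk\<close> relative to pR.\<close>
  have sum_eq: "M + \<phi> ` R = M + pR" if "subgrp M" "J l' \<subseteq> M" for M
  proof -
    have "M + \<phi> ` R = (M + J l') + pR" unfolding D[symmetric] by (simp add: add_ac)
    also have "M + J l' = M" using that by (intro plus_absorb subgrp_J)
    finally show ?thesis .
  qed
  have J': "J l' \<subseteq> M" if "{x \<in> R. \<phi> x \<in> M} = M'" for M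
    using that M''(2) unfolding \<phi>J[symmetric] by blast
  have latB: "M \<in> lat l'" if "M \<in> ?B" for M
    using that J' by (auto simp: lat_def)
  have rkB: "idx R (M + \<phi> ` R) = p ^ m \<longleftrightarrow> rk M = m" if "M \<in> lat l'" for M
    using idx_lat(2)[OF that] sum_eq[of M] that p1 by (auto simp: lat_def)
  show "?A = {l'} \<times> step_fiber S M' m" unfolding B
  proof (intro equalityI subsetI)
    fix a assume "a \<in> ?A"
    then obtain k M where kM: "a = (k, M)" "(k, M) \<in> pairs S m" "l = (\<lambda>i. k i - ones S i)"
        "{x \<in> R. \<phi> x \<in> M} = M'" by blast
    have "k = l'"
    proof
      fix i
      show "k i = l' i"
      proof (cases "i \<in> S")
        case True
        then have "k i > 0" using kM(2) by (auto simp: pairs_def supp_def)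
        then show ?thesis using True kM(3) by (simp add: l'_def ones_def)
      qed (use kM(3) in \<open>simp add: l'_def ones_def\<close>)
    qed
    then have M: "M \<in> lat l'" "rk M = m" using kM(2) by (auto simp: pairs_def)
    then have "M \<in> ?B" using rkB[OF M(1)] kM(4) by (auto simp: lat_def)
    then show "a \<in> {l'} \<times> ?B" using kM(1) \<open>k = l'\<close> by blast
  next
    fix a assume "a \<in> {l'} \<times> ?B"
    then obtain M where M: "a = (l', M)" "M \<in> ?B" by blast
    have "M \<in> lat l'" by (rule latB[OF M(2)])
    then have "(l', M) \<in> pairs S m" using rkB M(2) ex supp' by (auto simp: pairs_def)
    moreover have "(\<lambda>i. l' i - ones S i) = l" by (simp add: l'_def)
    ultimately show "a \<in> ?A" using M by blast
  qed
  have sumf: "(\<Sum>i<g. f i * ones S i) = sum f S"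
  proof -
    have "(\<Sum>i<g. f i * ones S i) = (\<Sum>i\<in>{..<g} \<inter> S. f i)"
      by (simp add: ones_def sum.inter_restrict if_distrib cong: if_cong)
    also have "{..<g} \<inter> S = S" using S by blast
    finally show ?thesis .
  qed
  show "card (step_fiber S M' m) = step_count p (sum f S) m (rk M')"
    unfolding B
  proof (rule card_preimage_step[OF p subgrp_R M''(1,3) \<phi> _ D'])
    show "\<phi> ` R \<subseteq> R" unfolding \<phi>R by (rule J_subset)
    show "idx R (\<phi> ` R) = p ^ sum f S" unfolding \<phi>R idx_J sumf ..
    show "idx R (M' + pR) = p ^ rk M'" using idx_lat(2)[OF M'] .
    show "idx R M' > 0" using idx_lat(1)[OF M'] p1 by simp
  qed
  show "finite (step_fiber S M' m)" unfolding B
  proof (rule finite_subset[OF _ finite_between[OF subgrp_J[of l'], of R]])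
    show "?B \<subseteq> {H. subgrp H \<and> J l' \<subseteq> H \<and> H \<subseteq> R}" using J' by blast
    show "idx R (J l') > 0" unfolding idx_J using p1 by simp
  qed
  show "nu M = m + nu M'" if "M \<in> step_fiber S M' m" for M
  proof -
    have M: "subgrp M" "M \<subseteq> R" "{x \<in> R. \<phi> x \<in> M} = M'" "idx R (M + \<phi> ` R) = p ^ m"
      using that unfolding B by auto
    have "\<phi> ` R \<subseteq> R" unfolding \<phi>R by (rule J_subset)
    then have "idx R M = p ^ m * idx R M'"
      using idx_preimage_step[OF subgrp_R \<phi> _ M(1,2)] M(3,4) by simp
    then have "idx R M = p ^ (m + nu M')" using idx_lat(1)[OF M'] by (simp add: power_add)
    then show ?thesis by (rule nu_power)
  qed
qed

text \<open>The sum is fibred over the result of the step, which lowers the degree by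
  \<open>sum f S\<close> and the index exponent by m; these losses are the factor in front. The new
  support is an arbitrary subset of S and the new corank an arbitrary m'.\<close>

lemma wsum_pairs_rec:
  assumes S: "S \<subseteq> {..<g}"
  shows "wsum (pairs S m) (wt T U) = U ^ sum f S * T ^ m *
    (\<Sum>S'\<in>Pow S. \<Sum>m'\<le>n. of_nat (step_count p (sum f S) m m') * wsum (pairs S' m') (wt T U))"
proof -
  define \<phi> where "\<phi> = (\<lambda>x. varpi (ones S) * x)"
  define h where "h = (\<lambda>(k, M). (\<lambda>i. k i - ones S i, {x \<in> R. \<phi> x \<in> M}))"
  have \<phi>: "linear \<phi>" unfolding \<phi>_def by simp
  have h: "h ` pairs S m \<subseteq> pairs_below S"
  proof (intro image_subsetI, clarify)
    fix k M assume kM: "(k, M) \<in> pairs S m"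
    then have k: "k \<in> expos" "supp k = S" "subgrp M" "J k \<subseteq> M" by (auto simp: pairs_def lat_def)
    let ?k = "\<lambda>i. k i - ones S i"
    have "varpi k = varpi (\<lambda>i. ones S i + ?k i)" using k(2)
      by (intro varpi_cong) (auto simp: ones_def supp_def)
    then have "J k = \<phi> ` J ?k" by (simp add: J_def varpi_add princ_mult \<phi>_def)
    then have "?k \<in> expos" "supp ?k \<subseteq> S" "{x \<in> R. \<phi> x \<in> M} \<in> lat ?k"
      using k J_subset[of ?k] subgrp_vimage[OF \<phi> subgrp_R k(3)]
      by (auto simp: expos_def supp_def lat_def)
    then show "h (k, M) \<in> pairs_below S" by (simp add: h_def pairs_below_def)
  qed
  have "wsum (pairs S m) (wt T U) = wsum (pairs_below S) (\<lambda>b. wsum {a \<in> pairs S m. h a = b} (wt T U))"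
    by (rule wsum_fiber[OF h])
  also have "\<dots> = wsum (pairs_below S) (\<lambda>b. U ^ sum f S * T ^ m *
      (case b of (l, M') \<Rightarrow> of_nat (step_count p (sum f S) m (rk M')) * wt T U (l, M')))"
  proof (rule wsum_cong, simp, clarify)
    fix l M' assume lM: "(l, M') \<in> pairs_below S"
    then have l: "l \<in> expos" "supp l \<subseteq> S" "M' \<in> lat l" by (auto simp: pairs_below_def)
    let ?B = "step_fiber S M' m"
    let ?l = "\<lambda>i. l i + ones S i"
    note fib = card_lattice_fiber[OF S l, where m = m, folded \<phi>_def]
    have "{a \<in> pairs S m. h a = (l, M')} = {?l} \<times> ?B"
      unfolding fib(1)[symmetric] by (auto simp: h_def)
    then have "wsum {a \<in> pairs S m. h a = (l, M')} (wt T U) = wsum ({?l} \<times> ?B) (wt T U)" by simp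
    also have "\<dots> = of_nat (card ({?l} \<times> ?B)) * (U ^ (sum f S + deg l) * T ^ (m + nu M'))"
    proof (rule wsum_const_on)
      show "finite ({?l} \<times> ?B)" using fib(3) by simp
      fix a assume "a \<in> {?l} \<times> ?B"
      then obtain M where M: "a = (?l, M)" "M \<in> ?B" by blast
      have "deg ?l = deg l + (\<Sum>i<g. f i * ones S i)" by (simp add: algebra_simps sum.distrib)
      also have "(\<Sum>i<g. f i * ones S i) = (\<Sum>i\<in>{..<g} \<inter> S. f i)"
        by (simp add: ones_def sum.inter_restrict if_distrib cong: if_cong)
      also have "{..<g} \<inter> S = S" using S by blast
      finally show "wt T U a = U ^ (sum f S + deg l) * T ^ (m + nu M')"
        using fib(4)[OF M(2)] M(1) by (simp add: wt_def add.commute)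
    qed
    also have "card ({?l} \<times> ?B) = step_count p (sum f S) m (rk M')"
      using fib(2) by (simp add: card_cartesian_product)
    finally show "wsum {a \<in> pairs S m. h a = (l, M')} (wt T U) =
      U ^ sum f S * T ^ m * (of_nat (step_count p (sum f S) m (rk M')) * wt T U (l, M'))"
      by (simp add: wt_def power_add mult_ac)
  qed
  also have "\<dots> = U ^ sum f S * T ^ m *
      wsum (pairs_below S) (\<lambda>(l, M'). of_nat (step_count p (sum f S) m (rk M')) * wt T U (l, M'))"
    by (rule wsum_cmult)
  also have "wsum (pairs_below S) (\<lambda>(l, M'). of_nat (step_count p (sum f S) m (rk M')) * wt T U (l, M')) =
    (\<Sum>S'\<in>Pow S. \<Sum>m'\<le>n. of_nat (step_count p (sum f S) m m') * wsum (pairs S' m') (wt T U))"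
    using S finite_subset by (intro wsum_pairs_below) blast
  finally show ?thesis .
qed

lemma wsum_pairs_empty: "wsum (pairs {} m) (wt T U) = (if m = 0 then 1 else 0)"
proof -
  have l0: "l = (\<lambda>_. 0)" if "l \<in> expos" "supp l = {}" for l
    using that by (auto simp: expos_def supp_def fun_eq_iff) (metis gr0I linorder_not_less)
  have J0: "J (\<lambda>_. 0) = R" by (rule J_zero) simp
  have R: "R + pR = R" using subgrp_of_nat[OF subgrp_R] by (intro plus_absorb subgrp_R subgrp_scale) auto
  have nu: "nu R = 0" using nu_power[of R 0] idx_self[OF subgrp_R] by simp
  have "pairs {} m = (if m = 0 then {(\<lambda>_. 0, R)} else {})"
    using l0 J0 R nu subgrp_R by (auto simp: pairs_def lat_def rk_def expos_def supp_def)
  then show ?thesis using nu by (auto simp: wsum_finite wt_def)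
qed

end

text \<open>As the diagonal coefficients differ from 1, every entry is determined by smaller ones.
  This identifies the values of convergent sums with those of the rational functions.\<close>

lemma flag_gf_unique:
  fixes v :: "'b set \<Rightarrow> nat \<Rightarrow> 'a::field"
  assumes empty: "\<And>m. v {} m = (if m = 0 then 1 else 0)"
    and rec: "\<And>A m. A \<subseteq> S \<Longrightarrow> A \<noteq> {} \<Longrightarrow> m \<le> N \<Longrightarrow> v A m = u ^ sum f A * T ^ m *
      (\<Sum>S'\<in>Pow A. \<Sum>m'\<le>m. step_count q (sum f A) m m' * v S' m')"
    and gen: "\<And>A m. A \<subseteq> S \<Longrightarrow> A \<noteq> {} \<Longrightarrow> u ^ sum f A * T ^ m * step_count q (sum f A) m m \<noteq> 1"
    and S: "finite S" "A \<subseteq> S" and "m \<le> N"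
  shows "v A m = flag_gf q T u f A m"
  using S(2) \<open>m \<le> N\<close>
proof (induction "(card A, m)" arbitrary: A m rule: wf_induct_rule[OF wf_lex_prod[OF wf_less_than wf_less_than]])
  case (1 A m)
  have fin: "finite A" using 1 S finite_subset by blast
  show ?case
  proof (cases "A = {}")
    case False
    let ?b = "u ^ sum f A * T ^ m" and ?c = "step_count q (sum f A) m m"
    define Q where "Q = (\<Sum>S'\<in>Pow A. \<Sum>m'\<le>m. if S' = A \<and> m' = m then 0
       else step_count q (sum f A) m m' * flag_gf q T u f S' m')"
    have "v A m = ?b * (\<Sum>S'\<in>Pow A. \<Sum>m'\<le>m. step_count q (sum f A) m m' * v S' m')"
      using False 1 by (intro rec)
    also have "(\<Sum>S'\<in>Pow A. \<Sum>m'\<le>m. step_count q (sum f A) m m' * v S' m') =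
       (\<Sum>S'\<in>Pow A. \<Sum>m'\<le>m. if S' = A \<and> m' = m then 0 else step_count q (sum f A) m m' * v S' m') + ?c * v A m"
      by (rule sum_Pow_atMost_remove[OF fin])
    also have "(\<Sum>S'\<in>Pow A. \<Sum>m'\<le>m. if S' = A \<and> m' = m then 0 else step_count q (sum f A) m m' * v S' m') = Q"
      unfolding Q_def
    proof (intro sum.cong refl)
      fix B j assume B: "B \<in> Pow A" "j \<in> {..m}"
      have "v B j = flag_gf q T u f B j" if "\<not> (B = A \<and> j = m)"
      proof (rule "1.hyps")
        show "((card B, j), (card A, m)) \<in> less_than <*lex*> less_than"
          using B that fin by (cases "B = A") (auto intro: psubset_card_mono)
      qed (use B 1 in auto)
      then show "(if B = A \<and> j = m then 0 else step_count q (sum f A) m j * v B j) =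
        (if B = A \<and> j = m then 0 else step_count q (sum f A) m j * flag_gf q T u f B j)" by auto
    qed
    finally have v: "v A m = ?b * (Q + ?c * v A m)" .
    have "flag_gf q T u f A m = ?b * (\<Sum>S'\<in>Pow A. \<Sum>m'\<le>m. step_count q (sum f A) m m' * flag_gf q T u f S' m')"
      using False fin gen[of A m] "1.prems" by (intro flag_gf_rec)
    also have "(\<Sum>S'\<in>Pow A. \<Sum>m'\<le>m. step_count q (sum f A) m m' * flag_gf q T u f S' m') =
       Q + ?c * flag_gf q T u f A m"
      unfolding Q_def by (rule sum_Pow_atMost_remove[OF fin])
    finally have l: "flag_gf q T u f A m = ?b * (Q + ?c * flag_gf q T u f A m)" .
    have "(1 - b * c) * (x - y) = (x - b * (Q + c * x)) - (y - b * (Q + c * y))" for b c x y :: 'a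
      by (simp add: algebra_simps)
    then have "(1 - ?b * ?c) * (v A m - flag_gf q T u f A m) =
      (v A m - ?b * (Q + ?c * v A m)) - (flag_gf q T u f A m - ?b * (Q + ?c * flag_gf q T u f A m))" .
    also have "\<dots> = 0" unfolding v[symmetric] l[symmetric] by simp
    finally have "(1 - ?b * ?c) * (v A m - flag_gf q T u f A m) = 0" .
    then show ?thesis using gen[of A m] False "1.prems" by simp
  qed (simp add: empty flag_gf_empty)
qed

lemma lattice_gf_unique:
  fixes v :: "nat \<Rightarrow> 'a::field"
  assumes zero: "v 0 = 1"
    and rec: "\<And>m. m \<le> d \<Longrightarrow> v m = T ^ m * (\<Sum>k\<le>m. step_count q d m k * v k)"
    and gen: "\<And>m. m > 0 \<Longrightarrow> T ^ m * step_count q d m m \<noteq> 1"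
    and "m \<le> d"
  shows "v m = lattice_gf q T d m"
  using \<open>m \<le> d\<close>
proof (induction m rule: less_induct)
  case (less m)
  show ?case
  proof (cases "m = 0")
    case False
    let ?c = "step_count q d m m"
    have s: "{..m} = insert m {..<m}" by auto
    define Q where "Q = (\<Sum>k<m. step_count q d m k * lattice_gf q T d k)"
    have "(\<Sum>k<m. step_count q d m k * v k) = Q"
      unfolding Q_def using less by (intro sum.cong) auto
    then have v: "v m = T ^ m * (?c * v m + Q)" using rec[OF less.prems] by (simp add: s)
    let ?l = "lattice_gf q T d m"
    have l: "?l = T ^ m * (?c * ?l + Q)"
      using lattice_gf_rec[of m T q d] gen[of m] by (simp add: s Q_def)
    have "(1 - T ^ m * ?c) * (v m - ?l) = (v m - T ^ m * (?c * v m + Q)) - (?l - T ^ m * (?c * ?l + Q))"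
      by (simp add: algebra_simps)
    also have "\<dots> = 0" using v l by simp
    finally have "(1 - T ^ m * ?c) * (v m - lattice_gf q T d m) = 0" .
    then show ?thesis using gen[of m] False by simp
  qed (simp add: zero)
qed

section \<open>Sublattices of a torsion-free group\<close>

text \<open>A lattice of rank d as seen at p: B/pB has order p^d, and torsion-freeness is inherited
  from the ambient vector space.\<close>

locale p_lattice =
  fixes p :: nat and B :: "'a::real_vector set" and d :: nat
  assumes prime_p: "Factorial_Ring.prime p" and subgrp_B: "subgrp B"
    and idx_pB: "idx B ((*\<^sub>R) (real p) ` B) = p ^ d"
begin

abbreviation pB :: "'a set" where
  "pB \<equiv> (*\<^sub>R) (real p) ` B"

definition sublats :: "'a set set" where
  "sublats = {L. subgrp L \<and> L \<subseteq> B \<and> (\<exists>k. idx B L = p ^ k)}"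

definition lnu :: "'a set \<Rightarrow> nat" where
  "lnu L = multiplicity p (idx B L)"

definition lrk :: "'a set \<Rightarrow> nat" where
  "lrk L = lnu (L + pB)"

lemma p_gt_1: "p > 1"
  using prime_p by (rule prime_gt_1_nat)

lemma scale: "linear ((*\<^sub>R) (real p) :: 'a \<Rightarrow> 'a)" "inj ((*\<^sub>R) (real p) :: 'a \<Rightarrow> 'a)"
  using p_gt_1 by (auto simp: inj_def)

lemma subgrp_pB: "subgrp pB"
  by (intro subgrp_scale subgrp_B)

lemma pB_subset: "pB \<subseteq> B"
  using subgrp_of_nat[OF subgrp_B] by auto

lemma lnu_power: "idx B L = p ^ k \<Longrightarrow> lnu L = k"
  using prime_p by (simp add: lnu_def)

lemma idx_sublat: "L \<in> sublats \<Longrightarrow> idx B L = p ^ lnu L"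
  using lnu_power by (auto simp: sublats_def)

lemma B_sublat: "B \<in> sublats" "lnu B = 0"
  using lnu_power[of B 0] idx_self[OF subgrp_B] subgrp_B by (auto simp: sublats_def intro: exI[of _ 0])

lemma sublat_plus: "L \<in> sublats \<Longrightarrow> L + pB \<in> sublats"
proof -
  assume L: "L \<in> sublats"
  then have L': "subgrp L" "L \<subseteq> B" by (auto simp: sublats_def)
  have *: "subgrp (L + pB)" "L \<subseteq> L + pB" "L + pB \<subseteq> B"
    using L' subgrp_pB pB_subset by (intro subgrp_plus plus_upper1 plus_least subgrp_B; simp)+
  obtain a b where "idx B (L + pB) = p ^ a"
    by (rule idx_pow_between[OF prime_p L'(1) *(1) subgrp_B *(2,3) idx_sublat[OF L]])
  then show ?thesis using * by (auto simp: sublats_def)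
qed

lemma idx_plus: "L \<in> sublats \<Longrightarrow> idx B (L + pB) = p ^ lrk L"
  unfolding lrk_def by (intro idx_sublat sublat_plus)

lemma lrk_le: "L \<in> sublats \<Longrightarrow> lrk L \<le> d"
proof -
  assume L: "L \<in> sublats"
  then have L': "subgrp L" "L \<subseteq> B" by (auto simp: sublats_def)
  have "idx B pB = idx B (L + pB) * idx (L + pB) pB"
    using L' pB_subset plus_upper2[OF L'(1), of pB]
    by (intro idx_mult subgrp_plus plus_least subgrp_pB subgrp_B)
  then have "p ^ lrk L dvd p ^ d" unfolding idx_pB idx_plus[OF L] by (metis dvd_triv_left)
  then show "lrk L \<le> d" using p_gt_1 by (rule power_dvd_imp_le)
qed

text \<open>A form of Nakayama's lemma: a proper sublattice lies in a subgroup of index p, and such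
  a subgroup contains pB.\<close>

lemma lrk_eq_0:
  assumes "L \<in> sublats" "lrk L = 0"
  shows "L = B"
proof (rule ccontr)
  assume "L \<noteq> B"
  have L: "subgrp L" "L \<subseteq> B" using assms by (auto simp: sublats_def)
  obtain E1 where E1: "subgrp E1" "L \<subseteq> E1" "E1 \<subseteq> B" "idx B E1 = p"
    using ex_maximal_subgrp[OF prime_p L(1) subgrp_B L(2) not_sym[OF \<open>L \<noteq> B\<close>] idx_sublat[OF assms(1)]] by metis
  have "pB \<subseteq> E1" using lagrange[OF E1(1) subgrp_B E1(3)] E1(4) p_gt_1 by auto
  then have "L + pB \<subseteq> E1" using E1 by (intro plus_least)
  moreover have "L + pB = B"
    using idx_eq_1[of "L + pB" B] idx_plus[OF assms(1)] assms(2) sublat_plus[OF assms(1)] subgrp_B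
    by (simp add: sublats_def)
  ultimately have "E1 = B" using E1(3) by blast
  then show False using E1(4) idx_self[OF subgrp_B] p_gt_1 by simp
qed

definition lsum :: "ennreal \<Rightarrow> nat \<Rightarrow> ennreal" where
  "lsum Y m = wsum {L \<in> sublats. lrk L = m} (\<lambda>L. Y ^ lnu L)"

lemma lsum_0: "lsum Y 0 = 1"
proof -
  have "{L \<in> sublats. lrk L = 0} = {B}"
    using lrk_eq_0 B_sublat plus_absorb[OF subgrp_B subgrp_pB pB_subset] by (auto simp: lrk_def)
  then show ?thesis by (simp add: lsum_def wsum_finite B_sublat)
qed

lemma wsum_sublats_rk:
  "wsum sublats (\<lambda>L. c (lrk L) * Y ^ lnu L) = (\<Sum>m\<le>d. c m * lsum Y m)"
proof -
  have "wsum sublats (\<lambda>L. c (lrk L) * Y ^ lnu L) =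
     wsum {..d} (\<lambda>m. wsum {L \<in> sublats. lrk L = m} (\<lambda>L. c (lrk L) * Y ^ lnu L))"
    by (rule wsum_fiber) (auto intro: lrk_le)
  also have "\<dots> = (\<Sum>m\<le>d. wsum {L \<in> sublats. lrk L = m} (\<lambda>L. c (lrk L) * Y ^ lnu L))"
    by (intro wsum_finite) simp
  also have "\<dots> = (\<Sum>m\<le>d. c m * lsum Y m)"
  proof (intro sum.cong refl)
    fix m
    show "wsum {L \<in> sublats. lrk L = m} (\<lambda>L. c (lrk L) * Y ^ lnu L) = c m * lsum Y m"
      unfolding lsum_def wsum_cmult[symmetric] by (intro wsum_cong) auto
  qed
  finally show ?thesis .
qed

lemma lsum_total: "wsum sublats (\<lambda>L. Y ^ lnu L) = (\<Sum>m\<le>d. lsum Y m)"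
  using wsum_sublats_rk[of "\<lambda>_. 1"] by simp

text \<open>The lattices L are grouped by their preimage under multiplication by p. Its index
  exponent is smaller by the corank of L, and \<open>card_preimage_step\<close> counts the L with a
  given preimage.\<close>

lemma lsum_rec: "lsum Y m = Y ^ m * (\<Sum>k\<le>d. of_nat (step_count p d m k) * lsum Y k)"
proof -
  let ?\<phi> = "(*\<^sub>R) (real p)"
  let ?A = "{L \<in> sublats. lrk L = m}"
  define h where "h = (\<lambda>L. {x \<in> B. ?\<phi> x \<in> L})"
  define C where "C = (\<lambda>L'. {L. subgrp L \<and> L \<subseteq> B \<and> h L = L' \<and> idx B (L + pB) = p ^ m})"
  have hL: "h L \<in> sublats \<and> idx B L = p ^ lrk L * idx B (h L)" if L: "L \<in> sublats" for L
  proof -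
    have L': "subgrp L" "L \<subseteq> B" using L by (auto simp: sublats_def)
    have sg: "subgrp (h L)" "L \<subseteq> h L" "h L \<subseteq> B"
      using subgrp_vimage[OF scale(1) subgrp_B L'(1)] subgrp_of_nat[OF L'(1)] L'(2) by (auto simp: h_def)
    obtain a b where "idx B (h L) = p ^ a"
      by (rule idx_pow_between[OF prime_p L'(1) sg(1) subgrp_B sg(2,3) idx_sublat[OF L]])
    moreover have "idx B L = p ^ lrk L * idx B (h L)"
      using idx_preimage_step[OF subgrp_B scale pB_subset L'] idx_plus[OF L] by (simp add: h_def)
    ultimately show ?thesis using sg by (auto simp: sublats_def)
  qed
  have "lsum Y m = wsum sublats (\<lambda>L'. wsum {L \<in> ?A. h L = L'} (\<lambda>L. Y ^ lnu L))"
    unfolding lsum_def using hL by (intro wsum_fiber) auto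
  also have "\<dots> = wsum sublats (\<lambda>L'. Y ^ m * (of_nat (step_count p d m (lrk L')) * Y ^ lnu L'))"
  proof (rule wsum_cong, simp)
    fix L' assume L': "L' \<in> sublats"
    then have L'': "subgrp L'" "L' \<subseteq> B" by (auto simp: sublats_def)
    have A: "{L \<in> ?A. h L = L'} = C L'"
    proof (intro equalityI subsetI)
      fix L assume "L \<in> {L \<in> ?A. h L = L'}"
      then show "L \<in> C L'" using idx_plus by (auto simp: C_def sublats_def)
    next
      fix L assume L: "L \<in> C L'"
      then have L1: "subgrp L" "L \<subseteq> B" "h L = L'" "idx B (L + pB) = p ^ m" by (auto simp: C_def)
      have "idx B L = p ^ m * p ^ lnu L'"
        using idx_preimage_step[OF subgrp_B scale pB_subset L1(1,2)] L1(3,4) idx_sublat[OF L'] by (simp add: h_def)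
      then have "idx B L = p ^ (m + lnu L')" by (simp add: power_add)
      then have "L \<in> sublats" using L1 by (auto simp: sublats_def)
      moreover have "lrk L = m" using lnu_power[OF L1(4)] by (simp add: lrk_def)
      ultimately show "L \<in> {L \<in> ?A. h L = L'}" using L1 by blast
    qed
    have nuC: "lnu L = m + lnu L'" if "L \<in> C L'" for L
    proof -
      have L: "L \<in> sublats" "lrk L = m" "h L = L'" using that unfolding A[symmetric] by auto
      have "idx B L = p ^ (m + lnu L')" using hL[OF L(1)] L idx_sublat[OF L'] by (simp add: power_add)
      then show ?thesis by (rule lnu_power)
    qed
    have "card (C L') = step_count p d m (lrk L')"
      unfolding C_def h_def
    proof (rule card_preimage_step[OF prime_p subgrp_B L'' scale pB_subset _ idx_pB])
      show "pB + ?\<phi> ` L' = pB" using L'' by (intro plus_absorb subgrp_scale subgrp_B) auto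
      show "idx B (L' + pB) = p ^ lrk L'" by (rule idx_plus[OF L'])
      show "idx B L' > 0" using idx_sublat[OF L'] p_gt_1 by simp
    qed
    moreover have "finite (C L')"
    proof (rule finite_subset[OF _ finite_between])
      show "C L' \<subseteq> {H. subgrp H \<and> ?\<phi> ` L' \<subseteq> H \<and> H \<subseteq> B}" by (auto simp: C_def h_def)
      show "subgrp (?\<phi> ` L')" by (intro subgrp_scale L'')
      have "idx B (?\<phi> ` L') = idx B pB * idx pB (?\<phi> ` L')"
        using L''(2) by (intro idx_mult subgrp_scale L'' subgrp_B pB_subset image_mono)
      also have "idx pB (?\<phi> ` L') = idx B L'" using scale subgrp_B L'' by (intro idx_image)
      finally show "idx B (?\<phi> ` L') > 0" using idx_pB idx_sublat[OF L'] p_gt_1 by simp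
    qed
    ultimately show "wsum {L \<in> ?A. h L = L'} (\<lambda>L. Y ^ lnu L) =
        Y ^ m * (of_nat (step_count p d m (lrk L')) * Y ^ lnu L')"
      unfolding A using wsum_const_on[of "C L'" "\<lambda>L. Y ^ lnu L" "Y ^ (m + lnu L')"] nuC
      by (simp add: power_add mult_ac)
  qed
  also have "\<dots> = Y ^ m * wsum sublats (\<lambda>L'. of_nat (step_count p d m (lrk L')) * Y ^ lnu L')"
    by (rule wsum_cmult)
  also have "wsum sublats (\<lambda>L'. of_nat (step_count p d m (lrk L')) * Y ^ lnu L') =
     (\<Sum>k\<le>d. of_nat (step_count p d m k) * lsum Y k)"
    by (rule wsum_sublats_rk)
  finally show ?thesis .
qed

text \<open>The index of pL in B is computed once through L and once through pB.\<close>

lemma idx_scale_sublat: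
  assumes "L \<in> sublats"
  shows "idx L ((*\<^sub>R) (real p) ` L) = p ^ d"
proof -
  have L: "subgrp L" "L \<subseteq> B" using assms by (auto simp: sublats_def)
  have "(*\<^sub>R) (real p) ` L \<subseteq> L" using subgrp_of_nat[OF L(1)] by auto
  then have "idx B ((*\<^sub>R) (real p) ` L) = idx B L * idx L ((*\<^sub>R) (real p) ` L)"
    using L by (intro idx_mult subgrp_scale subgrp_B)
  moreover have "idx B ((*\<^sub>R) (real p) ` L) = idx B pB * idx pB ((*\<^sub>R) (real p) ` L)"
    using L(2) by (intro idx_mult subgrp_scale L subgrp_B pB_subset image_mono)
  moreover have "idx pB ((*\<^sub>R) (real p) ` L) = idx B L" using scale subgrp_B L by (intro idx_image)
  ultimately show ?thesis using idx_pB idx_sublat[OF assms] p_gt_1 by simp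
qed

end

section \<open>Subgroups of a product\<close>

text \<open>For M inside C these subgroups correspond to the homomorphisms from L to C/M.\<close>

definition fibres :: "'a::real_vector set \<Rightarrow> 'a set \<Rightarrow> 'b::real_vector set \<Rightarrow> 'b set \<Rightarrow> ('a \<times> 'b) set set" where
  "fibres B L C M = {N. subgrp N \<and> N \<subseteq> B \<times> C \<and> fst ` N = L \<and> {c. (0, c) \<in> N} = M}"

lemma linear_Pair0 [simp]: "linear (\<lambda>c::'b::real_vector. (0::'a::real_vector, c))"
  by (intro linearI) simp_all

lemma subgrp_Times: "subgrp A \<Longrightarrow> subgrp C \<Longrightarrow> subgrp (A \<times> C)"
  by (auto simp: subgrp_def zero_prod_def)

lemma fibres_eq_complements:
  assumes "subgrp C" "subgrp L" "L \<subseteq> B"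
  shows "fibres B L C M = complements (L \<times> C) (Pair 0 ` C) (Pair 0 ` M)"
proof (intro equalityI subsetI)
  fix N assume "N \<in> fibres B L C M"
  then have N: "subgrp N" "N \<subseteq> B \<times> C" "fst ` N = L" "{c. (0, c) \<in> N} = M" by (auto simp: fibres_def)
  have NL: "N \<subseteq> L \<times> C" using N(2,3) by force
  have "N \<inter> Pair 0 ` C = Pair 0 ` M" using N(2,4) by auto
  moreover have "N + Pair 0 ` C = L \<times> C"
  proof (intro equalityI subsetI)
    fix x assume "x \<in> N + Pair 0 ` C"
    then obtain a c where "a \<in> N" "c \<in> C" "x = a + (0, c)" by (auto elim!: set_plus_elim)
    then show "x \<in> L \<times> C" using NL assms(1) subgrp_add by (cases a) force
  next
    fix x assume "x \<in> L \<times> C"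
    then obtain l c where x: "x = (l, c)" "l \<in> L" "c \<in> C" by blast
    then obtain y where y: "(l, y) \<in> N" using N(3) by force
    then have "y \<in> C" using N(2) by blast
    then have "c - y \<in> C" using x assms(1) subgrp_diff by blast
    then have "(0, c - y) \<in> Pair 0 ` C" by blast
    moreover have "x = (l, y) + (0, c - y)" using x by simp
    ultimately show "x \<in> N + Pair 0 ` C" using y by (metis set_plus_intro)
  qed
  ultimately show "N \<in> complements (L \<times> C) (Pair 0 ` C) (Pair 0 ` M)"
    using N(1) NL by (simp add: complements_def)
next
  fix N assume "N \<in> complements (L \<times> C) (Pair 0 ` C) (Pair 0 ` M)"
  then have N: "subgrp N" "N \<subseteq> L \<times> C" "N \<inter> Pair 0 ` C = Pair 0 ` M" "N + Pair 0 ` C = L \<times> C"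
    by (auto simp: complements_def)
  have "fst ` N = L"
  proof (intro equalityI subsetI)
    fix l assume "l \<in> L"
    then have "(l, 0) \<in> N + Pair 0 ` C" unfolding N(4) using subgrp_0[OF assms(1)] by blast
    then obtain a c where "a \<in> N" "(l, 0) = a + (0, c)" by (auto elim!: set_plus_elim)
    then have "fst a = l" by (cases a) auto
    then show "l \<in> fst ` N" using \<open>a \<in> N\<close> by blast
  qed (use N(2) in auto)
  moreover have "{c. (0, c) \<in> N} = M"
  proof (intro equalityI subsetI)
    fix c assume c: "c \<in> {c. (0, c) \<in> N}"
    then have "(0, c) \<in> N \<inter> Pair 0 ` C" using N(2) by auto
    then show "c \<in> M" unfolding N(3) by auto
  next
    fix c assume "c \<in> M"
    then have "(0, c) \<in> N \<inter> Pair 0 ` C" unfolding N(3) by blast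
    then show "c \<in> {c. (0, c) \<in> N}" by blast
  qed
  moreover have "N \<subseteq> B \<times> C" using N(2) assms(3) by auto
  ultimately show "N \<in> fibres B L C M" using N(1) by (simp add: fibres_def)
qed

lemma idx_fibres:
  assumes "subgrp B" "subgrp C" "subgrp L" "subgrp M" "L \<subseteq> B" "M \<subseteq> C" and N: "N \<in> fibres B L C M"
  shows "idx (B \<times> C) N = idx B L * idx C M"
proof -
  have N': "subgrp N" "N \<subseteq> L \<times> C" and Nc: "N \<in> complements (L \<times> C) (Pair 0 ` C) (Pair 0 ` M)"
    using N unfolding fibres_eq_complements[OF assms(2,3,5)] by (auto simp: complements_def)
  have "idx (B \<times> C) N = idx (B \<times> C) (L \<times> C) * idx (L \<times> C) N"
    using assms N' by (intro idx_mult subgrp_Times) auto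
  also have "idx (L \<times> C) N = idx (Pair 0 ` C :: ('a \<times> 'b) set) (Pair 0 ` M)"
    by (rule idx_complement(1)[OF _ _ Nc]) (intro subgrp_image subgrp_Times assms; simp)+
  also have "\<dots> = idx C M"
    using assms by (intro idx_image) (auto simp: inj_def)
  also have "idx (B \<times> C) (L \<times> C) = idx B L"
  proof -
    have "L \<times> C = {x \<in> B \<times> C. fst x \<in> L}" using assms(5) by auto
    then have "idx (B \<times> C) (L \<times> C) = idx (fst ` (B \<times> C) + L) L"
      using idx_vimage[of fst "B \<times> C" L] assms by (simp add: linear_fst subgrp_Times)
    also have "fst ` (B \<times> C) = B" using subgrp_0[OF assms(2)] by force
    also have "B + L = B" using assms by (intro plus_absorb)
    finally show ?thesis .
  qed
  finally show ?thesis .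
qed

lemma idx_Times:
  assumes "subgrp B" "subgrp C" "subgrp L" "subgrp M" "L \<subseteq> B" "M \<subseteq> C"
  shows "idx (B \<times> C) (L \<times> M) = idx B L * idx C M"
proof (rule idx_fibres[OF assms])
  have "fst ` (L \<times> M) = L" using subgrp_0[OF assms(4)] by force
  moreover have "{c. (0, c) \<in> L \<times> M} = M" using subgrp_0[OF assms(3)] by auto
  ultimately show "L \<times> M \<in> fibres B L C M" using assms subgrp_Times by (auto simp: fibres_def)
qed

text \<open>The order of Hom(L, C/M). The quotient of L x C by C is L, which is torsion-free with
  L/pL of order p^d, so \<open>card_complements_torsion_free\<close> applies.\<close>

lemma (in p_lattice) card_fibres:
  assumes L: "L \<in> sublats" and C: "subgrp C" "subgrp M" "M \<subseteq> C" "idx C M = p ^ k"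
  shows "finite (fibres B L C M)" "card (fibres B L C M) = p ^ (k * d)"
proof -
  have L': "subgrp L" "L \<subseteq> B" using L by (auto simp: sublats_def)
  let ?E = "L \<times> C" and ?D = "Pair 0 ` C :: ('a \<times> 'b) set" and ?J = "Pair 0 ` M :: ('a \<times> 'b) set"
  let ?P = "(*\<^sub>R) (real p)"
  have inj: "inj (Pair (0::'a) :: 'b \<Rightarrow> _)" by (simp add: inj_def)
  have sg: "subgrp ?J" "subgrp ?D" "subgrp ?E"
    using C L' by (intro subgrp_image subgrp_Times; simp)+
  have "finite (complements ?E ?D ?J) \<and> card (complements ?E ?D ?J) = p ^ (k * d)"
  proof (rule card_complements_torsion_free[OF prime_p sg])
    show "?J \<subseteq> ?D" using C by auto
    show "?D \<subseteq> ?E" using subgrp_0[OF L'(1)] by auto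
    show "x \<in> ?D" if "x \<in> ?E" "real p *\<^sub>R x \<in> ?D" for x
    proof -
      obtain a c where x: "x = (a, c)" by (cases x)
      have "real p *\<^sub>R a = 0" using that(2) x by auto
      then show ?thesis using x that(1) p_gt_1 by auto
    qed
    have "?P ` ?E + ?D = {x \<in> ?E. fst x \<in> ?P ` L}"
    proof (intro equalityI subsetI)
      fix x assume "x \<in> ?P ` ?E + ?D"
      then obtain a c c' where x: "a \<in> L" "c \<in> C" "c' \<in> C" "x = (real p *\<^sub>R a, real p *\<^sub>R c + c')"
        by (auto elim!: set_plus_elim)
      then have "real p *\<^sub>R a \<in> L" "real p *\<^sub>R c + c' \<in> C"
        using subgrp_of_nat[OF L'(1)] subgrp_of_nat[OF C(1)] subgrp_add[OF C(1)] by auto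
      then show "x \<in> {x \<in> ?E. fst x \<in> ?P ` L}" using x by auto
    next
      fix x assume "x \<in> {x \<in> ?E. fst x \<in> ?P ` L}"
      then obtain a c where x: "a \<in> L" "c \<in> C" "x = real p *\<^sub>R (a, 0) + (0, c)" by auto
      then show "x \<in> ?P ` ?E + ?D" using subgrp_0[OF C(1)] by blast
    qed
    then have "idx ?E (?P ` ?E + ?D) = idx (fst ` ?E + ?P ` L) (?P ` L)"
      using idx_vimage[of fst ?E "?P ` L"] sg(3) subgrp_scale[OF L'(1)] by (simp add: linear_fst)
    also have "fst ` ?E = L" using subgrp_0[OF C(1)] by force
    also have "L + ?P ` L = L"
      using subgrp_of_nat[OF L'(1)] by (intro plus_absorb L' subgrp_scale) auto
    also have "idx L (?P ` L) = p ^ d" by (rule idx_scale_sublat[OF L])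
    finally show "idx ?E (?P ` ?E + ?D) = p ^ d" .
    show "idx ?D ?J = p ^ k" using idx_image[OF linear_Pair0 inj C(1,2)] C(4) by simp
  qed
  then show "finite (fibres B L C M)" "card (fibres B L C M) = p ^ (k * d)"
    unfolding fibres_eq_complements[OF C(1) L'] by blast+
qed

section \<open>The zeta function as a sum over pairs of lattices\<close>

lemma wsum_UNIV_nat: "wsum (UNIV :: nat set) h = (\<Sum>k. h k)"
  unfolding wsum_def by (rule nn_integral_count_space_nat)

lemma wsum_ge_point: "x \<in> A \<Longrightarrow> h x \<le> wsum A h"
  unfolding wsum_def by (rule nn_integral_ge_point)

lemma wsum_exponents:
  "wsum {l :: nat \<Rightarrow> nat. \<forall>i\<ge>g. l i = 0} (\<lambda>l. U ^ (\<Sum>i<g. f i * l i)) = (\<Prod>i<g. \<Sum>k. U ^ (f i * k))"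
proof (induction g)
  case 0
  have "{l :: nat \<Rightarrow> nat. \<forall>i\<ge>0. l i = 0} = {\<lambda>_. 0}" by auto
  then show ?case by (simp add: wsum_finite)
next
  case (Suc g)
  let ?S = "\<lambda>g. {l :: nat \<Rightarrow> nat. \<forall>i\<ge>g. l i = 0}"
  have "bij_betw (\<lambda>(l, k). l(g := k)) (?S g \<times> UNIV) (?S (Suc g))"
    by (rule bij_betw_byWitness[of _ "\<lambda>l. (l(g := 0), l g)"]) (auto simp: fun_eq_iff)
  then have "wsum (?S (Suc g)) (\<lambda>l. U ^ (\<Sum>i<Suc g. f i * l i)) =
     wsum (?S g \<times> UNIV) (\<lambda>x. U ^ (\<Sum>i<Suc g. f i * (case x of (l, k) \<Rightarrow> l(g := k)) i))"
    by (rule wsum_bij)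
  also have "\<dots> = wsum (?S g) (\<lambda>l. wsum UNIV (\<lambda>k. U ^ (\<Sum>i<g. f i * l i) * U ^ (f g * k)))"
    unfolding wsum_Sigma by (simp add: power_add)
  also have "\<dots> = wsum (?S g) (\<lambda>l. U ^ (\<Sum>i<g. f i * l i)) * (\<Sum>k. U ^ (f g * k))"
    by (simp add: wsum_cmult wsum_multc wsum_UNIV_nat)
  finally show ?case using Suc by simp
qed

lemma suminf_ennreal_geometric:
  assumes "0 \<le> u" "u < 1" "m > 0"
  shows "(\<Sum>k. ennreal u ^ (m * k)) = ennreal (1 / (1 - u ^ m))"
proof -
  have "u ^ m < 1" using assms by (simp add: power_less_one_iff)
  then have "(\<lambda>k. (u ^ m) ^ k) sums (1 / (1 - u ^ m))"
    using assms by (intro geometric_sums) simp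
  then have "(\<Sum>k. ennreal ((u ^ m) ^ k)) = ennreal (1 / (1 - u ^ m))"
    using assms by (intro suminf_ennreal_eq) simp_all
  then show ?thesis using assms by (simp add: ennreal_power power_mult)
qed

context split_prime
begin

section \<open>Subgroups of p-power index sorted by their central part and their image in
  R^2\<close>

definition sublattices :: "complex set set" where
  "sublattices = {M. subgrp M \<and> M \<subseteq> R \<and> (\<exists>k. idx R M = p ^ k)}"

definition core :: "complex set \<Rightarrow> complex set" where
  "core M = {x \<in> R. \<forall>r\<in>R. x * r \<in> M}"

definition core_exp :: "complex set \<Rightarrow> nat \<Rightarrow> nat" where
  "core_exp M = (SOME l. l \<in> expos \<and> core M = J l)"

lemma J_ideal: "x \<in> J l \<Longrightarrow> r \<in> R \<Longrightarrow> x * r \<in> J l"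
  unfolding J_def by (rule princ_ideal)

text \<open>The core is the largest ideal inside M. If M has index p^k, Lagrange puts p^k R, which
  is \<open>J (\<lambda>_. k)\<close>, inside M, so the core is one of the ideals classified by
  \<open>ideal_eq_J\<close>.\<close>

lemma core_exp:
  assumes M: "M \<in> sublattices"
  shows "core_exp M \<in> expos" "core M = J (core_exp M)"
proof -
  have M': "subgrp M" "M \<subseteq> R" using M by (auto simp: sublattices_def)
  obtain k where k: "idx R M = p ^ k" using M by (auto simp: sublattices_def)
  have Jk: "J (\<lambda>_. k) \<subseteq> M"
  proof
    fix x assume "x \<in> J (\<lambda>_. k)"
    then obtain r where r: "r \<in> R" "x = varpi (\<lambda>_. k) * r" by (auto simp: J_def mem_princ)
    have "varpi (\<lambda>_. k) = (of_nat p * \<epsilon>) ^ k"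
      unfolding eps(4)[symmetric] by (simp add: varpi_def prod_power_distrib)
    then have "x = real (p ^ k) *\<^sub>R (\<epsilon> ^ k * r)" using r by (simp add: scaleR_conv_of_real power_mult_distrib)
    moreover have "\<epsilon> ^ k * r \<in> R" using r eps by (intro mult_mem power_mem)
    ultimately show "x \<in> M" using lagrange[OF M'(1) subgrp_R M'(2)] k p1 by simp
  qed
  have "\<exists>l. (\<forall>i\<ge>g. l i = 0) \<and> core M = J l"
  proof (rule ideal_eq_J)
    show "subgrp (core M)"
      using subgrp_0[OF M'(1)] subgrp_diff[OF M'(1)] zero_mem diff_mem
      by (intro subgrpI) (auto simp: core_def left_diff_distrib)
    show "x * r \<in> core M" if "x \<in> core M" "r \<in> R" for x r
      using that by (auto simp: core_def mult.assoc intro: mult_mem)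
    show "J (\<lambda>_. k) \<subseteq> core M"
      using Jk J_ideal[of _ "\<lambda>_. k"] J_subset[of "\<lambda>_. k"] by (auto simp: core_def)
  qed (auto simp: core_def)
  then have "\<exists>l. l \<in> expos \<and> core M = J l" by (auto simp: expos_def)
  then have "core_exp M \<in> expos \<and> core M = J (core_exp M)" unfolding core_exp_def by (rule someI_ex)
  then show "core_exp M \<in> expos" "core M = J (core_exp M)" by auto
qed

lemma J_subset_iff_core_exp:
  assumes "M \<in> sublattices"
  shows "J l \<subseteq> M \<longleftrightarrow> (\<forall>i<g. core_exp M i \<le> l i)"
proof -
  have "J l \<subseteq> M \<longleftrightarrow> J l \<subseteq> core M"
  proof
    assume "J l \<subseteq> core M"
    then show "J l \<subseteq> M" using one_mem by (force simp: core_def)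
  qed (use J_ideal[of _ l] J_subset[of l] in \<open>auto simp: core_def\<close>)
  then show ?thesis unfolding core_exp(2)[OF assms] J_subset_iff .
qed

text \<open>The ideals inside M are those inside its core, and their exponents are
  \<open>core_exp M\<close> plus an arbitrary vector; the sum over that vector factors out.\<close>

lemma wsum_pairs_total:
  "wsum (pairs_below {..<g}) (wt T U) =
    wsum sublattices (\<lambda>M. T ^ nu M * U ^ deg (core_exp M)) * wsum expos (\<lambda>l. U ^ deg l)"
proof -
  have "wsum (pairs_below {..<g}) (wt T U) =
      wsum sublattices (\<lambda>M. wsum {a \<in> pairs_below {..<g}. snd a = M} (wt T U))"
    using idx_lat(1) by (intro wsum_fiber) (auto simp: pairs_below_def sublattices_def lat_def)
  also have "\<dots> = wsum sublattices (\<lambda>M. T ^ nu M * U ^ deg (core_exp M) * wsum expos (\<lambda>l. U ^ deg l))"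
  proof (rule wsum_cong, simp)
    fix M assume M: "M \<in> sublattices"
    let ?c = "core_exp M"
    have c: "?c \<in> expos" by (rule core_exp(1)[OF M])
    have "bij_betw (\<lambda>l. (\<lambda>i. l i + ?c i, M)) expos {a \<in> pairs_below {..<g}. snd a = M}"
    proof (rule bij_betw_byWitness[of _ "\<lambda>a i. fst a i - ?c i"])
      show "(\<lambda>l. (\<lambda>i. l i + ?c i, M)) ` expos \<subseteq> {a \<in> pairs_below {..<g}. snd a = M}"
      proof (intro image_subsetI)
        fix l assume "l \<in> expos"
        moreover have "J (\<lambda>i. l i + ?c i) \<subseteq> M" unfolding J_subset_iff_core_exp[OF M] by simp
        ultimately show "(\<lambda>i. l i + ?c i, M) \<in> {a \<in> pairs_below {..<g}. snd a = M}"
          using M c by (auto simp: pairs_below_def expos_def supp_def lat_def sublattices_def)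
      qed
      show "\<forall>a'\<in>{a \<in> pairs_below {..<g}. snd a = M}. (\<lambda>i. (fst a' i - ?c i) + ?c i, M) = a'"
      proof
        fix a assume a: "a \<in> {a \<in> pairs_below {..<g}. snd a = M}"
        then obtain l where l: "a = (l, M)" by (cases a) auto
        have "\<forall>i<g. ?c i \<le> l i" "l \<in> expos"
          using a J_subset_iff_core_exp[OF M] by (auto simp: l pairs_below_def lat_def)
        then have "l i - ?c i + ?c i = l i" for i
          using c by (cases "i < g") (auto simp: expos_def)
        then show "(\<lambda>i. (fst a i - ?c i) + ?c i, M) = a"
          by (simp add: l)
      qed
    qed (use c in \<open>auto simp: expos_def pairs_below_def\<close>)
    then have "wsum {a \<in> pairs_below {..<g}. snd a = M} (wt T U) = wsum expos (\<lambda>l. wt T U (\<lambda>i. l i + ?c i, M))"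
      by (rule wsum_bij)
    also have "\<dots> = wsum expos (\<lambda>l. T ^ nu M * U ^ deg ?c * U ^ deg l)"
      by (intro wsum_cong) (simp_all add: wt_def distrib_left sum.distrib power_add mult_ac)
    finally show "wsum {a \<in> pairs_below {..<g}. snd a = M} (wt T U) =
        T ^ nu M * U ^ deg ?c * wsum expos (\<lambda>l. U ^ deg l)"
      by (simp add: wsum_cmult)
  qed
  finally show ?thesis by (simp add: wsum_multc)
qed

lemma scale_p_square: "(*\<^sub>R) (real p) ` (R \<times> R) = pR \<times> pR"
proof (intro equalityI subsetI)
  fix z assume "z \<in> pR \<times> pR"
  then obtain a b where "a \<in> R" "b \<in> R" "z = real p *\<^sub>R (a, b)" by auto
  then show "z \<in> (*\<^sub>R) (real p) ` (R \<times> R)" by blast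
qed auto

sublocale sq: p_lattice p "R \<times> R" "2 * n"
proof
  show "subgrp (R \<times> R)" by (intro subgrp_Times subgrp_R)
  have pR: "subgrp pR" "pR \<subseteq> R" using subgrp_R subgrp_scale subgrp_of_nat[OF subgrp_R] by auto
  have "idx R pR = p ^ n" unfolding scale_p_R idx_J by (simp add: ones_def)
  then show "idx (R \<times> R) ((*\<^sub>R) (real p) ` (R \<times> R)) = p ^ (2 * n)"
    unfolding scale_p_square using idx_Times[OF subgrp_R subgrp_R pR(1) pR(1) pR(2) pR(2)]
    by (simp add: power_add mult_2)
qed (rule p)

text \<open>The last condition is closure under commutators with the whole Heisenberg group; these
  are central elements.\<close>

definition heis_subgrps :: "((complex \<times> complex) \<times> complex) set set" where
  "heis_subgrps = {N. subgrp N \<and> N \<subseteq> (R \<times> R) \<times> R \<and> (\<exists>k. idx ((R \<times> R) \<times> R) N = p ^ k) \<and>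
     (\<forall>a b c x. ((a, b), c) \<in> N \<longrightarrow> x \<in> R \<longrightarrow> (0, a * x) \<in> N \<and> (0, b * x) \<in> N)}"

definition heis_nu :: "((complex \<times> complex) \<times> complex) set \<Rightarrow> nat" where
  "heis_nu N = multiplicity p (idx ((R \<times> R) \<times> R) N)"

text \<open>Multiplication by a generator of the core maps all sublattices of R^2 bijectively to
  those inside core x core and multiplies the index by p^(2 deg).\<close>

lemma wsum_sublats_in_core:
  assumes M: "M \<in> sublattices"
  shows "wsum {L \<in> sq.sublats. L \<subseteq> core M \<times> core M} (\<lambda>L. Y ^ sq.lnu L) =
    (Y\<^sup>2) ^ deg (core_exp M) * wsum sq.sublats (\<lambda>L. Y ^ sq.lnu L)"
proof -
  let ?l = "core_exp M"
  let ?J = "J ?l" and ?B = "R \<times> R"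
  define \<phi> where "\<phi> = (\<lambda>(a, b). (varpi ?l * a, varpi ?l * b))"
  have lin: "linear \<phi>"
    unfolding \<phi>_def by (intro linearI) (auto simp: algebra_simps)
  have inj: "inj \<phi>"
    using varpi_nz[of ?l] by (auto simp: \<phi>_def inj_def)
  have \<phi>B: "\<phi> ` ?B = ?J \<times> ?J" by (force simp: \<phi>_def J_def princ_def)
  have JB: "?J \<times> ?J \<subseteq> ?B" using J_subset by auto
  have sgJ: "subgrp (?J \<times> ?J)" by (intro subgrp_Times subgrp_J)
  have iJ: "idx ?B (?J \<times> ?J) = p ^ (2 * deg ?l)"
    unfolding idx_Times[OF subgrp_R subgrp_R subgrp_J subgrp_J J_subset J_subset] idx_J
    by (simp add: mult_2 power_add)
  have idx\<phi>: "idx ?B (\<phi> ` L) = p ^ (2 * deg ?l) * idx ?B L" if L: "subgrp L" "L \<subseteq> ?B" for L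
  proof -
    have "idx ?B (\<phi> ` L) = idx ?B (?J \<times> ?J) * idx (?J \<times> ?J) (\<phi> ` L)"
      using L JB \<phi>B by (intro idx_mult subgrp_image lin sgJ sq.subgrp_B) auto
    also have "idx (?J \<times> ?J) (\<phi> ` L) = idx ?B L"
      unfolding \<phi>B[symmetric] using L by (intro idx_image lin inj sq.subgrp_B)
    finally show ?thesis using iJ by simp
  qed
  have "bij_betw (\<lambda>L. \<phi> ` L) sq.sublats {L \<in> sq.sublats. L \<subseteq> core M \<times> core M}"
    unfolding core_exp(2)[OF M]
  proof (rule bij_betw_imageI)
    show "inj_on (\<lambda>L. \<phi> ` L) sq.sublats" using inj by (auto simp: inj_on_def inj_image_eq_iff)
    show "(\<lambda>L. \<phi> ` L) ` sq.sublats = {L \<in> sq.sublats. L \<subseteq> ?J \<times> ?J}"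
    proof (intro equalityI subsetI)
      fix K assume "K \<in> (\<lambda>L. \<phi> ` L) ` sq.sublats"
      then obtain L where L: "L \<in> sq.sublats" "K = \<phi> ` L" by blast
      have L': "subgrp L" "L \<subseteq> ?B" "idx ?B L = p ^ sq.lnu L"
        using L(1) sq.idx_sublat[OF L(1)] unfolding sq.sublats_def by blast+
      have "idx ?B K = p ^ (2 * deg ?l + sq.lnu L)"
        unfolding L(2) idx\<phi>[OF L'(1,2)] L'(3) by (simp add: power_add)
      moreover have "K \<subseteq> ?J \<times> ?J" unfolding L(2) \<phi>B[symmetric] using L'(2) by (rule image_mono)
      moreover have "subgrp K" unfolding L(2) by (intro subgrp_image lin L')
      ultimately show "K \<in> {L \<in> sq.sublats. L \<subseteq> ?J \<times> ?J}"
        using JB unfolding sq.sublats_def by blast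
    next
      fix K assume K: "K \<in> {L \<in> sq.sublats. L \<subseteq> ?J \<times> ?J}"
      then have Ks: "K \<in> sq.sublats" by blast
      have K': "subgrp K" "K \<subseteq> ?J \<times> ?J" "idx ?B K = p ^ sq.lnu K"
        using K sq.idx_sublat[OF Ks] unfolding sq.sublats_def by blast+
      define L where "L = {x \<in> ?B. \<phi> x \<in> K}"
      have L: "subgrp L" "L \<subseteq> ?B" unfolding L_def using subgrp_vimage[OF lin sq.subgrp_B K'(1)] by auto
      have "K \<subseteq> \<phi> ` ?B" using K'(2) unfolding \<phi>B .
      then have "\<phi> ` L = K" unfolding L_def by blast
      then have "p ^ sq.lnu K = p ^ (2 * deg ?l) * idx ?B L" using idx\<phi>[OF L] K'(3) by simp
      then have "idx ?B L dvd p ^ sq.lnu K" by (metis dvd_triv_right)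
      then have "\<exists>k. idx ?B L = p ^ k" using divides_primepow_nat[OF p] by blast
      then have "L \<in> sq.sublats" using L by (simp add: sq.sublats_def)
      then show "K \<in> (\<lambda>L. \<phi> ` L) ` sq.sublats" using \<open>\<phi> ` L = K\<close> by blast
    qed
  qed
  then have "wsum {L \<in> sq.sublats. L \<subseteq> core M \<times> core M} (\<lambda>L. Y ^ sq.lnu L) =
     wsum sq.sublats (\<lambda>L. Y ^ sq.lnu (\<phi> ` L))"
    by (rule wsum_bij)
  also have "\<dots> = wsum sq.sublats (\<lambda>L. (Y\<^sup>2) ^ deg ?l * Y ^ sq.lnu L)"
  proof (rule wsum_cong, simp)
    fix L assume L: "L \<in> sq.sublats"
    then have L': "subgrp L" "L \<subseteq> ?B" by (auto simp: sq.sublats_def)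
    have "idx ?B (\<phi> ` L) = p ^ (2 * deg ?l + sq.lnu L)"
      using idx\<phi>[OF L'] sq.idx_sublat[OF L] by (simp add: power_add)
    then have "sq.lnu (\<phi> ` L) = 2 * deg ?l + sq.lnu L" by (rule sq.lnu_power)
    then show "Y ^ sq.lnu (\<phi> ` L) = (Y\<^sup>2) ^ deg ?l * Y ^ sq.lnu L" by (simp add: power_add power_mult)
  qed
  also have "\<dots> = (Y\<^sup>2) ^ deg ?l * wsum sq.sublats (\<lambda>L. Y ^ sq.lnu L)" by (rule wsum_cmult)
  finally show ?thesis .
qed

text \<open>Let M be the central part of N and L its image in R^2. Closure under commutators means
  that L lies in core M x core M, and a pair of this kind belongs to p^(2n nu M) subgroups N, all of
  index exponent nu M plus that of L.\<close>

theorem wsum_heis_subgrps: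
  "wsum heis_subgrps (\<lambda>N. Y ^ heis_nu N) =
    wsum sublattices (\<lambda>M. (of_nat p ^ (2 * n) * Y) ^ nu M * (Y\<^sup>2) ^ deg (core_exp M)) *
    wsum sq.sublats (\<lambda>L. Y ^ sq.lnu L)"
proof -
  let ?E = "(R \<times> R) \<times> R"
  define h where "h = (\<lambda>N :: ((complex \<times> complex) \<times> complex) set. ({c. (0, c) \<in> N}, fst ` N))"
  define P where "P = (SIGMA M:sublattices. {L \<in> sq.sublats. L \<subseteq> core M \<times> core M})"
  have sub: "idx R M = p ^ nu M" if "M \<in> sublattices" for M
    using that nu_power by (auto simp: sublattices_def)
  have h: "h N \<in> P \<and> N \<in> fibres (R \<times> R) (fst ` N) R {c. (0, c) \<in> N}" if N: "N \<in> heis_subgrps" for N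
  proof -
    let ?M = "{c. (0, c) \<in> N}" and ?L = "fst ` N"
    obtain k where k: "idx ?E N = p ^ k" using N by (auto simp: heis_subgrps_def)
    have N': "subgrp N" "N \<subseteq> ?E" using N by (auto simp: heis_subgrps_def)
    have ideal: "(0, a * x) \<in> N \<and> (0, b * x) \<in> N" if "((a, b), c) \<in> N" "x \<in> R" for a b c x
      using N that by (auto simp: heis_subgrps_def)
    have L: "subgrp ?L" "?L \<subseteq> R \<times> R" using N' by (auto intro: subgrp_image linear_fst)
    have "?M = {c \<in> R. (0, c) \<in> N}" using N'(2) by auto
    then have M: "subgrp ?M" "?M \<subseteq> R" using subgrp_vimage[OF linear_Pair0 subgrp_R N'(1)] by auto
    have fib: "N \<in> fibres (R \<times> R) ?L R ?M" using N' by (simp add: fibres_def)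
    have "p ^ k = idx (R \<times> R) ?L * idx R ?M"
      using idx_fibres[OF sq.subgrp_B subgrp_R L(1) M(1) L(2) M(2) fib] k by simp
    then have "idx (R \<times> R) ?L dvd p ^ k" "idx R ?M dvd p ^ k" by simp_all
    then have "?L \<in> sq.sublats" "?M \<in> sublattices"
      using L M divides_primepow_nat[OF p] unfolding sq.sublats_def sublattices_def by blast+
    moreover have "?L \<subseteq> core ?M \<times> core ?M"
    proof
      fix z assume "z \<in> ?L"
      then obtain a b c where z: "z = (a, b)" "((a, b), c) \<in> N" by auto
      then have "a \<in> R" "b \<in> R" using N'(2) by auto
      then show "z \<in> core ?M \<times> core ?M" using ideal[OF z(2)] z(1) by (auto simp: core_def)
    qed
    ultimately show ?thesis using fib by (simp add: h_def P_def)
  qed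
  have members: "subgrp M \<and> M \<subseteq> R \<and> idx R M = p ^ nu M \<and> subgrp L \<and> L \<subseteq> R \<times> R \<and>
      idx (R \<times> R) L = p ^ sq.lnu L \<and> L \<in> sq.sublats \<and> L \<subseteq> core M \<times> core M"
    if inP: "(M, L) \<in> P" for M L
  proof -
    have *: "M \<in> sublattices" "L \<in> sq.sublats" "L \<subseteq> core M \<times> core M"
      using inP unfolding P_def by blast+
    show ?thesis using * sub[OF *(1)] sq.idx_sublat[OF *(2)]
      unfolding sublattices_def sq.sublats_def by blast
  qed
  have fib: "{N \<in> heis_subgrps. h N = (M, L)} = fibres (R \<times> R) L R M" if inP: "(M, L) \<in> P" for M L
  proof (intro equalityI subsetI)
    fix N assume "N \<in> {N \<in> heis_subgrps. h N = (M, L)}"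
    then have N: "N \<in> heis_subgrps" "{c. (0, c) \<in> N} = M" "fst ` N = L" by (auto simp: h_def)
    show "N \<in> fibres (R \<times> R) L R M" using h[OF N(1)] unfolding N(2,3) by blast
  next
    fix N assume N: "N \<in> fibres (R \<times> R) L R M"
    have M: "subgrp M" "M \<subseteq> R" "idx R M = p ^ nu M" and L: "subgrp L" "L \<subseteq> R \<times> R" "idx (R \<times> R) L = p ^ sq.lnu L"
      and LM: "L \<subseteq> core M \<times> core M"
      using members[OF inP] by blast+
    have N': "subgrp N" "N \<subseteq> ?E" "fst ` N = L" "{c. (0, c) \<in> N} = M" using N by (auto simp: fibres_def)
    have "idx ?E N = p ^ (sq.lnu L + nu M)"
      using idx_fibres[OF sq.subgrp_B subgrp_R L(1) M(1) L(2) M(2) N] L(3) M(3) by (simp add: power_add)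
    moreover have "(0, a * x) \<in> N \<and> (0, b * x) \<in> N" if "((a, b), c) \<in> N" "x \<in> R" for a b c x
    proof -
      have "(a, b) \<in> L" using that(1) N'(3) by force
      then have "a * x \<in> M" "b * x \<in> M" using LM that(2) by (auto simp: core_def)
      then show ?thesis using N'(4) by auto
    qed
    ultimately have "N \<in> heis_subgrps" using N'(1,2) unfolding heis_subgrps_def by blast
    then show "N \<in> {N \<in> heis_subgrps. h N = (M, L)}" using N'(3,4) by (simp add: h_def)
  qed
  have "wsum heis_subgrps (\<lambda>N. Y ^ heis_nu N) =
      wsum P (\<lambda>b. wsum {N \<in> heis_subgrps. h N = b} (\<lambda>N. Y ^ heis_nu N))"
    by (rule wsum_fiber) (use h in blast)
  also have "\<dots> = wsum P (\<lambda>(M, L). (of_nat p ^ (2 * n) * Y) ^ nu M * Y ^ sq.lnu L)"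
  proof (rule wsum_cong, simp, clarify)
    fix M L assume inP: "(M, L) \<in> P"
    then have M: "subgrp M" "M \<subseteq> R" "idx R M = p ^ nu M" and L: "subgrp L" "L \<subseteq> R \<times> R"
      "idx (R \<times> R) L = p ^ sq.lnu L" "L \<in> sq.sublats"
      using members[OF inP] by blast+
    have "wsum {N \<in> heis_subgrps. h N = (M, L)} (\<lambda>N. Y ^ heis_nu N) =
       of_nat (card (fibres (R \<times> R) L R M)) * Y ^ (sq.lnu L + nu M)"
      unfolding fib[OF inP]
    proof (rule wsum_const_on)
      show "finite (fibres (R \<times> R) L R M)" by (rule sq.card_fibres(1)[OF L(4) subgrp_R M])
      fix N assume N: "N \<in> fibres (R \<times> R) L R M"
      have "idx ?E N = p ^ (sq.lnu L + nu M)"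
        using idx_fibres[OF sq.subgrp_B subgrp_R L(1) M(1) L(2) M(2) N] L(3) M(3) by (simp add: power_add)
      then have "heis_nu N = sq.lnu L + nu M" using p by (simp add: heis_nu_def)
      then show "Y ^ heis_nu N = Y ^ (sq.lnu L + nu M)" by simp
    qed
    also have "card (fibres (R \<times> R) L R M) = p ^ (nu M * (2 * n))"
      by (rule sq.card_fibres(2)[OF L(4) subgrp_R M])
    also have "of_nat (p ^ (nu M * (2 * n))) * Y ^ (sq.lnu L + nu M) = (of_nat p ^ (2 * n) * Y) ^ nu M * Y ^ sq.lnu L"
      by (simp add: power_add power_mult_distrib power_mult[symmetric] mult_ac)
    finally show "wsum {N \<in> heis_subgrps. h N = (M, L)} (\<lambda>N. Y ^ heis_nu N) =
        (of_nat p ^ (2 * n) * Y) ^ nu M * Y ^ sq.lnu L" .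
  qed
  also have "\<dots> = wsum sublattices (\<lambda>M. (of_nat p ^ (2 * n) * Y) ^ nu M *
      wsum {L \<in> sq.sublats. L \<subseteq> core M \<times> core M} (\<lambda>L. Y ^ sq.lnu L))"
    unfolding P_def wsum_Sigma by (simp add: wsum_cmult)
  also have "\<dots> = wsum sublattices (\<lambda>M. (of_nat p ^ (2 * n) * Y) ^ nu M * (Y\<^sup>2) ^ deg (core_exp M) *
      wsum sq.sublats (\<lambda>L. Y ^ sq.lnu L))"
    by (intro wsum_cong) (simp_all add: wsum_sublats_in_core mult_ac)
  finally show ?thesis by (simp add: wsum_multc)
qed

text \<open>Absolute convergence for one value of \<open>y\<close> already makes all the partial generating functions finite.\<close>

theorem wsum_heis_subgrps_eq_euler_gf:
  fixes y :: real
  assumes y: "0 < y" "y < 1" and gen: "\<And>i j. i > 0 \<Longrightarrow> y ^ i * real p ^ j \<noteq> 1"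
    and fin: "wsum heis_subgrps (\<lambda>N. ennreal y ^ heis_nu N) < Orderings.top"
  shows "complex_of_real (enn2real (wsum heis_subgrps (\<lambda>N. ennreal y ^ heis_nu N))) =
    euler_gf (of_nat p) (of_real y) f {..<g}"
proof -
  define Y T U where "Y = ennreal y" and "T = of_nat p ^ (2 * n) * Y" and "U = Y\<^sup>2"
  define t u where "t = real p ^ (2 * n) * y" and "u = y\<^sup>2"
  have TU: "T = ennreal t" "U = ennreal u"
    using y by (simp_all add: T_def U_def Y_def t_def u_def ennreal_power ennreal_mult ennreal_of_nat_eq_real_of_nat)
  have pos: "t > 0" "u > 0" "u < 1"
    using y p1 by (simp_all add: t_def u_def power_less_one_iff)
  define Zs where "Zs = wsum sq.sublats (\<lambda>L. Y ^ sq.lnu L)"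
  define Ms where "Ms = wsum sublattices (\<lambda>M. T ^ nu M * U ^ deg (core_exp M))"
  define V where "V = (\<lambda>S m. wsum (pairs S m) (wt T U))"
  have tot: "wsum heis_subgrps (\<lambda>N. ennreal y ^ heis_nu N) = Ms * Zs"
    unfolding Ms_def Zs_def T_def U_def Y_def by (rule wsum_heis_subgrps)
  \<comment> \<open>When both factors are non-zero, finiteness of their product makes each of them
    finite.\<close>
  have "Zs \<noteq> 0"
  proof -
    have "Y ^ sq.lnu (R \<times> R) \<le> Zs" unfolding Zs_def by (rule wsum_ge_point) (rule sq.B_sublat)
    then show ?thesis using sq.B_sublat(2) by auto
  qed
  moreover have "Ms \<noteq> 0"
  proof -
    have "R \<in> sublattices" using subgrp_R idx_self[OF subgrp_R] by (auto simp: sublattices_def intro: exI[of _ 0])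
    then have "T ^ nu R * U ^ deg (core_exp R) \<le> Ms" unfolding Ms_def by (rule wsum_ge_point)
    moreover have "T ^ nu R * U ^ deg (core_exp R) \<noteq> 0" using pos by (simp add: TU)
    ultimately show ?thesis by (metis le_zero_eq)
  qed
  ultimately have finZ: "Zs < Orderings.top" and finM: "Ms < Orderings.top"
    using fin unfolding tot by (auto simp: ennreal_mult_less_top)
  \<comment> \<open>\<open>step_count\<close> is lower triangular, which reconciles the full range
    of the counting recursions with the range up to m in the algebraic ones.\<close>
  have c2: "(\<Sum>k\<le>N. of_nat (step_count p r m k) * v k) = (\<Sum>k\<le>m. step_count (of_nat p) r m k * v k)"
    if "m \<le> N" for N r m and v :: "nat \<Rightarrow> complex"
    using that unfolding of_nat_step_count by (intro sum.mono_neutral_right) (auto simp: step_count_def)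
  have genc: "(of_real y)\<^sup>2 ^ a * (of_nat p ^ (2 * n) * of_real y) ^ m * step_count (of_nat p) r m' m' \<noteq> (1::complex)"
    if "2 * a + m > 0" for a m r m'
  proof (cases "m' \<le> r")
    case True
    have "(of_real y)\<^sup>2 ^ a * (of_nat p ^ (2 * n) * of_real y) ^ m * step_count (of_nat p) r m' m' =
        complex_of_real (y ^ (2 * a + m) * real p ^ (2 * n * m + m' * (r - m')))"
      unfolding step_count_diag[OF True] by (simp add: power_add power_mult power_mult_distrib)
    then show ?thesis using gen[OF that] by (metis of_real_eq_1_iff)
  qed (simp add: step_count_def)
  have Z1: "(\<Sum>m\<le>2 * n. sq.lsum Y m) = Zs" unfolding Zs_def by (rule sq.lsum_total[symmetric])
  have finl: "sq.lsum Y m < Orderings.top" if "m \<le> 2 * n" for m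
    using member_le_sum[of m "{..2 * n}" "sq.lsum Y"] that finZ unfolding Z1[symmetric] by (auto intro: le_less_trans)
  define z where "z = (\<lambda>m. enn2real (sq.lsum Y m))"
  have z: "sq.lsum Y m = ennreal (z m)" "z m \<ge> 0" if "m \<le> 2 * n" for m
    using finl[OF that] by (simp_all add: z_def)
  have zrec: "z m = y ^ m * (\<Sum>k\<le>2 * n. real (step_count p (2 * n) m k) * z k)" if m: "m \<le> 2 * n" for m
  proof -
    have "ennreal (z m) = Y ^ m * (\<Sum>k\<le>2 * n. of_nat (step_count p (2 * n) m k) * sq.lsum Y k)"
      using sq.lsum_rec[of Y m] z(1)[OF m] by simp
    also have "(\<Sum>k\<le>2 * n. of_nat (step_count p (2 * n) m k) * sq.lsum Y k) =
       (\<Sum>k\<le>2 * n. ennreal (real (step_count p (2 * n) m k) * z k))"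
      using z by (intro sum.cong) (auto simp: ennreal_mult ennreal_of_nat_eq_real_of_nat)
    also have "\<dots> = ennreal (\<Sum>k\<le>2 * n. real (step_count p (2 * n) m k) * z k)"
      using z by (intro sum_ennreal) auto
    also have "Y ^ m * \<dots> = ennreal (y ^ m * (\<Sum>k\<le>2 * n. real (step_count p (2 * n) m k) * z k))"
      using y z by (subst ennreal_mult) (auto simp: Y_def ennreal_power intro!: sum_nonneg)
    finally show ?thesis using y z m
      by (subst (asm) ennreal_inj) (auto intro!: sum_nonneg mult_nonneg_nonneg)
  qed
  have zl: "complex_of_real (z m) = lattice_gf (of_nat p) (of_real y) (2 * n) m" if "m \<le> 2 * n" for m
  proof (rule lattice_gf_unique[where v = "\<lambda>m. complex_of_real (z m)", OF _ _ _ that])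
    show "complex_of_real (z 0) = 1" using sq.lsum_0 by (simp add: z_def)
    show "complex_of_real (z m) = of_real y ^ m *
        (\<Sum>k\<le>m. step_count (of_nat p) (2 * n) m k * complex_of_real (z k))" if "m \<le> 2 * n" for m
    proof -
      have "complex_of_real (z m) = of_real y ^ m *
         (\<Sum>k\<le>2 * n. of_nat (step_count p (2 * n) m k) * complex_of_real (z k))"
        by (subst zrec[OF that]) simp
      then show ?thesis unfolding c2[OF that] .
    qed
    show "of_real y ^ m * step_count (of_nat p) (2 * n) m m \<noteq> (1::complex)" if "m > 0" for m
    proof (cases "m \<le> 2 * n")
      case True
      have "of_real y ^ m * step_count (of_nat p) (2 * n) m m = complex_of_real (y ^ m * real p ^ (m * (2 * n - m)))"
        unfolding step_count_diag[OF True] by simp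
      then show ?thesis using gen[OF that] by (metis of_real_eq_1_iff)
    qed (simp add: step_count_def)
  qed
  have Zval: "complex_of_real (enn2real Zs) = (\<Sum>m\<le>2 * n. lattice_gf (of_nat p) (of_real y) (2 * n) m)"
  proof -
    have "Zs = (\<Sum>m\<le>2 * n. ennreal (z m))" unfolding Z1[symmetric] using z by (intro sum.cong) auto
    also have "\<dots> = ennreal (\<Sum>m\<le>2 * n. z m)" using z by (intro sum_ennreal) auto
    finally have "Zs = ennreal (\<Sum>m\<le>2 * n. z m)" .
    moreover have "0 \<le> (\<Sum>m\<le>2 * n. z m)" using z(2) by (intro sum_nonneg) auto
    ultimately have "enn2real Zs = (\<Sum>m\<le>2 * n. z m)" by (metis enn2real_ennreal)
    then show ?thesis using zl by simp
  qed
  define G where "G = (\<Prod>i<g. 1 / (1 - u ^ f i))"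
  have u1: "u ^ f i < 1" if "i < g" for i using pos f_pos[OF that] by (simp add: power_less_one_iff)
  have Gpos: "G > 0" unfolding G_def using u1 by (intro prod_pos) auto
  have Gs: "wsum expos (\<lambda>l. U ^ deg l) = ennreal G"
    unfolding expos_def wsum_exponents G_def TU
    using pos u1 f_pos by (subst prod_ennreal[symmetric]) (auto simp: suminf_ennreal_geometric intro!: prod.cong less_imp_le)
  have Vtot: "(\<Sum>S\<in>Pow {..<g}. \<Sum>m\<le>n. V S m) = Ms * ennreal G"
  proof -
    have "wsum (pairs_below {..<g}) (\<lambda>(l, M). 1 * wt T U (l, M)) = (\<Sum>S\<in>Pow {..<g}. \<Sum>m\<le>n. 1 * V S m)"
      unfolding V_def by (rule wsum_pairs_below) simp
    then show ?thesis using wsum_pairs_total[of T U] by (simp add: Ms_def Gs case_prod_beta)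
  qed
  \<comment> \<open>Each partial sum is bounded by the finite total. It is therefore a real number,
    and its recursion may be read in a field.\<close>
  have finV: "V S m < Orderings.top" if "S \<subseteq> {..<g}" "m \<le> n" for S m
  proof -
    have "V S m \<le> (\<Sum>m\<le>n. V S m)" using that by (intro member_le_sum) auto
    also have "\<dots> \<le> (\<Sum>S\<in>Pow {..<g}. \<Sum>m\<le>n. V S m)" using that by (intro member_le_sum) auto
    also have "\<dots> < Orderings.top" unfolding Vtot using finM by (simp add: ennreal_mult_less_top)
    finally show ?thesis .
  qed
  define v where "v = (\<lambda>S m. enn2real (V S m))"
  have v: "V S m = ennreal (v S m)" "v S m \<ge> 0" if "S \<subseteq> {..<g}" "m \<le> n" for S m
    using finV[OF that] by (simp_all add: v_def)
  have vrec: "v S m = u ^ sum f S * t ^ m *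
      (\<Sum>A\<in>Pow S. \<Sum>k\<le>n. real (step_count p (sum f S) m k) * v A k)"
    if S: "S \<subseteq> {..<g}" "m \<le> n" for S m
  proof -
    have sub: "A \<subseteq> {..<g}" if "A \<in> Pow S" for A using that S by blast
    have nn: "(\<Sum>k\<le>n. real (step_count p (sum f S) m k) * v A k) \<ge> 0" if "A \<in> Pow S" for A
      using v(2)[OF sub[OF that]] by (intro sum_nonneg) auto
    have W: "0 \<le> (\<Sum>A\<in>Pow S. \<Sum>k\<le>n. real (step_count p (sum f S) m k) * v A k)"
      by (rule sum_nonneg) (rule nn)
    have "ennreal (v S m) = U ^ sum f S * T ^ m *
        (\<Sum>A\<in>Pow S. \<Sum>k\<le>n. of_nat (step_count p (sum f S) m k) * V A k)"
      using wsum_pairs_rec[OF S(1), of m T U] v(1)[OF S] by (simp add: V_def)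
    also have "(\<Sum>A\<in>Pow S. \<Sum>k\<le>n. of_nat (step_count p (sum f S) m k) * V A k) =
       (\<Sum>A\<in>Pow S. ennreal (\<Sum>k\<le>n. real (step_count p (sum f S) m k) * v A k))"
    proof (intro sum.cong refl)
      fix A assume A: "A \<in> Pow S"
      have "(\<Sum>k\<le>n. of_nat (step_count p (sum f S) m k) * V A k) =
         (\<Sum>k\<le>n. ennreal (real (step_count p (sum f S) m k) * v A k))"
        using v[OF sub[OF A]] by (intro sum.cong) (auto simp: ennreal_mult ennreal_of_nat_eq_real_of_nat)
      also have "\<dots> = ennreal (\<Sum>k\<le>n. real (step_count p (sum f S) m k) * v A k)"
        using v(2)[OF sub[OF A]] by (intro sum_ennreal) auto
      finally show "(\<Sum>k\<le>n. of_nat (step_count p (sum f S) m k) * V A k) =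
        ennreal (\<Sum>k\<le>n. real (step_count p (sum f S) m k) * v A k)" .
    qed
    also have "\<dots> = ennreal (\<Sum>A\<in>Pow S. \<Sum>k\<le>n. real (step_count p (sum f S) m k) * v A k)"
      using nn by (intro sum_ennreal) auto
    also have "U ^ sum f S * T ^ m * \<dots> =
        ennreal (u ^ sum f S * t ^ m * (\<Sum>A\<in>Pow S. \<Sum>k\<le>n. real (step_count p (sum f S) m k) * v A k))"
      using W pos by (simp add: TU ennreal_power ennreal_mult less_imp_le)
    finally have eq: "ennreal (v S m) = ennreal (u ^ sum f S * t ^ m *
       (\<Sum>A\<in>Pow S. \<Sum>k\<le>n. real (step_count p (sum f S) m k) * v A k))" .
    have "0 \<le> u ^ sum f S * t ^ m *
       (\<Sum>A\<in>Pow S. \<Sum>k\<le>n. real (step_count p (sum f S) m k) * v A k)"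
      using pos by (intro mult_nonneg_nonneg W zero_le_power less_imp_le)
    then show ?thesis using eq v(2)[OF S] by (simp only: ennreal_inj)
  qed
  have cu: "(complex_of_real y)\<^sup>2 = of_real u" "of_nat p ^ (2 * n) * complex_of_real y = of_real t"
    by (simp_all add: u_def t_def)
  have vl: "complex_of_real (v S m) = flag_gf (of_nat p) (of_nat p ^ (2 * n) * of_real y) ((of_real y)\<^sup>2) f S m"
    if "S \<subseteq> {..<g}" "m \<le> n" for S m
  proof (rule flag_gf_unique[where v = "\<lambda>S m. complex_of_real (v S m)" and S = "{..<g}" and N = n, OF _ _ _ _ that])
    show "complex_of_real (v {} m) = (if m = 0 then 1 else 0)" for m
      using wsum_pairs_empty[of m T U] by (simp add: v_def V_def)
    fix A m assume A: "A \<subseteq> {..<g}" "A \<noteq> {}"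
    have "f i > 0" if "i \<in> A" for i using A(1) f_pos that by blast
    then have fA: "sum f A > 0" using A(2) finite_subset[OF A(1)] by (intro sum_pos) blast+
    show "((of_real y)\<^sup>2) ^ sum f A * (of_nat p ^ (2 * n) * of_real y) ^ m * step_count (of_nat p) (sum f A) m m \<noteq> (1::complex)"
      using fA by (intro genc) simp
    assume m: "m \<le> n"
    have "complex_of_real (v A m) = of_real u ^ sum f A * of_real t ^ m *
       (\<Sum>B\<in>Pow A. \<Sum>k\<le>n. of_nat (step_count p (sum f A) m k) * complex_of_real (v B k))"
      by (subst vrec[OF A(1) m]) simp
    then show "complex_of_real (v A m) = ((of_real y)\<^sup>2) ^ sum f A * (of_nat p ^ (2 * n) * of_real y) ^ m *
       (\<Sum>B\<in>Pow A. \<Sum>k\<le>m. step_count (of_nat p) (sum f A) m k * complex_of_real (v B k))"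
      unfolding c2[OF m] cu .
  qed simp
  have "ennreal (enn2real Ms * G) = Ms * ennreal G"
    using finM Gpos by (simp add: ennreal_mult less_imp_le)
  also have "\<dots> = (\<Sum>S\<in>Pow {..<g}. \<Sum>m\<le>n. ennreal (v S m))"
    unfolding Vtot[symmetric] using v by (intro sum.cong refl) auto
  also have "\<dots> = ennreal (\<Sum>S\<in>Pow {..<g}. \<Sum>m\<le>n. v S m)"
  proof -
    have "(\<Sum>m\<le>n. ennreal (v S m)) = ennreal (\<Sum>m\<le>n. v S m)" if "S \<in> Pow {..<g}" for S
      using that v(2) by (intro sum_ennreal) auto
    then have "(\<Sum>S\<in>Pow {..<g}. \<Sum>m\<le>n. ennreal (v S m)) = (\<Sum>S\<in>Pow {..<g}. ennreal (\<Sum>m\<le>n. v S m))"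
      by (intro sum.cong refl)
    moreover have nn: "0 \<le> (\<Sum>m\<le>n. v S m)" if "S \<in> Pow {..<g}" for S
      using that v(2) by (intro sum_nonneg) auto
    have "(\<Sum>S\<in>Pow {..<g}. ennreal (\<Sum>m\<le>n. v S m)) = ennreal (\<Sum>S\<in>Pow {..<g}. \<Sum>m\<le>n. v S m)"
      by (rule sum_ennreal) (rule nn)
    ultimately show ?thesis by (simp only:)
  qed
  finally have eqG: "ennreal (enn2real Ms * G) = ennreal (\<Sum>S\<in>Pow {..<g}. \<Sum>m\<le>n. v S m)" .
  have nnV: "0 \<le> (\<Sum>S\<in>Pow {..<g}. \<Sum>m\<le>n. v S m)"
  proof (rule sum_nonneg)
    fix S assume "S \<in> Pow {..<g}"
    then show "0 \<le> (\<Sum>m\<le>n. v S m)" using v(2) by (intro sum_nonneg) auto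
  qed
  have "0 \<le> enn2real Ms * G" using Gpos by simp
  then have MG: "enn2real Ms * G = (\<Sum>S\<in>Pow {..<g}. \<Sum>m\<le>n. v S m)"
    using eqG nnV by (simp only: ennreal_inj)
  \<comment> \<open>G is the sum over the exponent vectors added to \<open>core_exp M\<close>;
    cancelling it leaves the sum over the lattices M alone.\<close>
  have "1 / (1 - u ^ f i) * (1 - u ^ f i) = 1" if "i < g" for i using u1[OF that] by simp
  then have G1: "G * (\<Prod>i<g. 1 - u ^ f i) = 1"
    unfolding G_def prod.distrib[symmetric] by (intro prod.neutral) blast
  have "enn2real Ms = (enn2real Ms * G) * (\<Prod>i<g. 1 - u ^ f i)" unfolding mult.assoc G1 by simp
  then have Mval: "enn2real Ms = (\<Prod>i<g. 1 - u ^ f i) * (\<Sum>S\<in>Pow {..<g}. \<Sum>m\<le>n. v S m)"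
    unfolding MG by (simp only: mult.commute)
  have "complex_of_real (enn2real (Ms * Zs)) =
     complex_of_real (enn2real Zs) * of_real (\<Prod>i<g. 1 - u ^ f i) * (\<Sum>S\<in>Pow {..<g}. \<Sum>m\<le>n. complex_of_real (v S m))"
    unfolding enn2real_mult Mval by (simp only: of_real_mult of_real_sum mult_ac)
  also have "(\<Sum>S\<in>Pow {..<g}. \<Sum>m\<le>n. complex_of_real (v S m)) =
     (\<Sum>S\<in>Pow {..<g}. \<Sum>m\<le>n. flag_gf (of_nat p) (of_nat p ^ (2 * n) * of_real y) ((of_real y)\<^sup>2) f S m)"
    by (intro sum.cong refl vl) auto
  also have "complex_of_real (\<Prod>i<g. 1 - u ^ f i) = (\<Prod>i<g. 1 - ((of_real y)\<^sup>2) ^ f i)"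
    by (simp add: u_def)
  also have "complex_of_real (enn2real Zs) * (\<Prod>i<g. 1 - ((of_real y)\<^sup>2) ^ f i) *
     (\<Sum>S\<in>Pow {..<g}. \<Sum>m\<le>n. flag_gf (of_nat p) (of_nat p ^ (2 * n) * of_real y) ((of_real y)\<^sup>2) f S m) =
     euler_gf (of_nat p) (of_real y) f {..<g}"
    unfolding euler_gf_def Zval by (rule refl)
  finally show ?thesis unfolding tot .
qed

end

section \<open>Algebraic integers\<close>

fun zspan :: "'a::real_vector list \<Rightarrow> 'a set" where
  "zspan [] = {0}"
| "zspan (v # vs) = line (zspan vs) v"

lemma subgrp_zspan: "subgrp (zspan vs)"
proof (induction vs)
  case Nil
  show ?case by (simp add: subgrp_def)
next
  case (Cons v vs)
  then show ?case by (simp add: subgrp_line)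
qed

lemma set_subset_zspan: "set vs \<subseteq> zspan vs"
  using line_base[OF subgrp_zspan] line_point[OF subgrp_zspan] by (induction vs) auto

lemma zspan_subset: "subgrp H \<Longrightarrow> set vs \<subseteq> H \<Longrightarrow> zspan vs \<subseteq> H"
  by (induction vs) (auto intro: subgrp_0 dest: line_subset)

lemma int_subgroup_principal:
  fixes I :: "int set"
  assumes "0 \<in> I" "\<And>a b. a \<in> I \<Longrightarrow> b \<in> I \<Longrightarrow> a - b \<in> I"
  obtains d where "d \<in> I" "\<And>a. a \<in> I \<Longrightarrow> d dvd a"
proof (cases "I = {0}")
  case False
  then obtain b where b: "b \<in> I" "b \<noteq> 0" using assms(1) by blast
  have minus: "- a \<in> I" if "a \<in> I" for a using assms(2)[OF assms(1) that] by simp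
  have add: "a + b \<in> I" if "a \<in> I" "b \<in> I" for a b using assms(2)[OF that(1) minus[OF that(2)]] by simp
  define k where "k = (LEAST k. k > 0 \<and> int k \<in> I)"
  have "\<exists>k>0. int k \<in> I" using b minus[OF b(1)] by (intro exI[of _ "nat \<bar>b\<bar>"]) (auto simp: abs_if)
  then have k: "k > 0" "int k \<in> I" unfolding k_def using LeastI_ex[of "\<lambda>k. k > 0 \<and> int k \<in> I"] by auto
  have mult: "int m * int k \<in> I" for m
    using k assms(1) by (induction m) (auto simp: distrib_right intro: add)
  have multz: "q * int k \<in> I" for q
    using mult[of "nat \<bar>q\<bar>"] minus[OF mult[of "nat \<bar>q\<bar>"]] by (cases "q \<ge> 0") auto
  have "int k dvd a" if a: "a \<in> I" for a
  proof -
    have "a - (a div int k) * int k \<in> I" using assms(2)[OF a multz] .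
    then have m: "a mod int k \<in> I" by (simp add: minus_div_mult_eq_mod)
    have "a mod int k = 0"
    proof (rule ccontr)
      assume "a mod int k \<noteq> 0"
      then have "nat (a mod int k) > 0 \<and> int (nat (a mod int k)) \<in> I"
        using m k(1) by (simp add: order_le_neq_trans)
      then have "k \<le> nat (a mod int k)" unfolding k_def by (rule Least_le)
      then show False using k(1) pos_mod_bound[of "int k" a] by linarith
    qed
    then show ?thesis by (simp add: dvd_eq_mod_eq_0)
  qed
  then show ?thesis by (rule that[OF k(2)])
qed (use that[of 0] in auto)

text \<open>Induction on the generators. The coefficients of v occurring in H form an ideal dZ; an
  element of H realising d, together with generators of the part of H inside the span of the other
  generators, generates H.\<close>

lemma subgroup_finitely_generated:
  "subgrp H \<Longrightarrow> H \<subseteq> zspan vs \<Longrightarrow> \<exists>ws. H = zspan ws"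
proof (induction vs arbitrary: H)
  case Nil
  then have "H = zspan []" using subgrp_0 by auto
  then show ?case by blast
next
  case (Cons v vs)
  let ?V = "zspan vs"
  define I where "I = {k. \<exists>w\<in>?V. w + real_of_int k *\<^sub>R v \<in> H}"
  have "0 \<in> I" using subgrp_0[OF Cons.prems(1)] subgrp_0[OF subgrp_zspan[of vs]] by (force simp: I_def)
  moreover have "a - b \<in> I" if "a \<in> I" "b \<in> I" for a b
  proof -
    obtain x y where xy: "x \<in> ?V" "y \<in> ?V" "x + real_of_int a *\<^sub>R v \<in> H" "y + real_of_int b *\<^sub>R v \<in> H"
      using \<open>a \<in> I\<close> \<open>b \<in> I\<close> by (auto simp: I_def)
    have "(x + real_of_int a *\<^sub>R v) - (y + real_of_int b *\<^sub>R v) \<in> H" using xy Cons.prems(1) subgrp_diff by blast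
    then have "(x - y) + real_of_int (a - b) *\<^sub>R v \<in> H" by (simp add: algebra_simps)
    moreover have "x - y \<in> ?V" using xy subgrp_diff[OF subgrp_zspan] by blast
    ultimately show ?thesis unfolding I_def by blast
  qed
  ultimately obtain d where d: "d \<in> I" "\<And>a. a \<in> I \<Longrightarrow> d dvd a"
    using int_subgroup_principal[of I] by (metis (no_types, lifting))
  then obtain w where w: "w \<in> ?V" "w + real_of_int d *\<^sub>R v \<in> H" by (auto simp: I_def)
  let ?h = "w + real_of_int d *\<^sub>R v"
  obtain ws where ws: "H \<inter> ?V = zspan ws"
    using Cons.IH[of "H \<inter> ?V"] subgrp_Int[OF Cons.prems(1) subgrp_zspan] by blast
  have "H = zspan (?h # ws)"
  proof (intro equalityI subsetI)
    fix x assume x: "x \<in> H"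
    then have "x \<in> line ?V v" using Cons.prems(2) by auto
    then obtain y k where y: "y \<in> ?V" "x = y + real_of_int k *\<^sub>R v" by (auto simp: mem_line)
    then have "k \<in> I" using x by (auto simp: I_def)
    then obtain q where q: "k = q * d" using d(2) by (metis dvdE mult.commute)
    have eq: "x - real_of_int q *\<^sub>R ?h = y - real_of_int q *\<^sub>R w"
      using y q by (simp add: algebra_simps)
    have "x - real_of_int q *\<^sub>R ?h \<in> H" using x w Cons.prems(1) by (intro subgrp_diff subgrp_of_int)
    moreover have "y - real_of_int q *\<^sub>R w \<in> ?V"
      using y w by (intro subgrp_diff subgrp_of_int subgrp_zspan)
    ultimately have "x - real_of_int q *\<^sub>R ?h \<in> zspan ws" using ws eq by auto
    moreover have "x = (x - real_of_int q *\<^sub>R ?h) + real_of_int q *\<^sub>R ?h" by simp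
    ultimately show "x \<in> zspan (?h # ws)" unfolding zspan.simps mem_line by blast
  next
    fix x assume "x \<in> zspan (?h # ws)"
    then show "x \<in> H" using line_subset[OF Cons.prems(1), of "zspan ws" ?h] ws w(2) by auto
  qed
  then show ?case by blast
qed

section \<open>Integrality and finitely generated groups\<close>

definition int_polys :: "complex \<Rightarrow> nat \<Rightarrow> complex set" where
  "int_polys z D = {\<Sum>i<D. of_int (c i) * z ^ i |c. True}"

lemma int_polysI: "x = (\<Sum>i<D. of_int (c i) * z ^ i) \<Longrightarrow> x \<in> int_polys z D"
  by (auto simp: int_polys_def)

lemma subgrp_int_polys: "subgrp (int_polys z D)"
proof (rule subgrpI)
  show "0 \<in> int_polys z D" by (rule int_polysI[of _ "\<lambda>_. 0"]) simp
  fix x y assume "x \<in> int_polys z D" "y \<in> int_polys z D"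
  then obtain b c where "x = (\<Sum>i<D. of_int (b i) * z ^ i)" "y = (\<Sum>i<D. of_int (c i) * z ^ i)"
    by (auto simp: int_polys_def)
  then show "x - y \<in> int_polys z D"
    by (intro int_polysI[of _ "\<lambda>i. b i - c i"]) (simp add: sum_subtractf algebra_simps)
qed

lemma int_polys_mono: "D \<le> E \<Longrightarrow> int_polys z D \<subseteq> int_polys z E"
proof
  fix x assume DE: "D \<le> E" and "x \<in> int_polys z D"
  then obtain c where "x = (\<Sum>i<D. of_int (c i) * z ^ i)" by (auto simp: int_polys_def)
  also have "\<dots> = (\<Sum>i<E. of_int (if i < D then c i else 0) * z ^ i)"
    using DE by (intro sum.mono_neutral_cong_left) auto
  finally show "x \<in> int_polys z E" by (rule int_polysI)
qed

lemma power_in_int_polys: "i < D \<Longrightarrow> z ^ i \<in> int_polys z D"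
proof (rule int_polysI[of _ "\<lambda>j. if j = i then 1 else 0"])
  assume "i < D"
  have "(\<Sum>j<D. of_int (if j = i then 1 else 0) * z ^ j) = (\<Sum>j<D. if j = i then z ^ j else 0)"
    by (intro sum.cong) auto
  also have "\<dots> = z ^ i" using \<open>i < D\<close> by (simp add: sum.delta)
  finally show "z ^ i = (\<Sum>j<D. of_int (if j = i then 1 else 0) * z ^ j)" ..
qed

lemma algebraic_int_iff_int_polys: "algebraic_int z \<longleftrightarrow> (\<exists>D. z ^ D \<in> int_polys z D)"
proof
  assume "algebraic_int z"
  then obtain P where P: "Polynomial.coeff P (Polynomial.degree P) = 1" "\<forall>i. Polynomial.coeff P i \<in> \<int>" "poly P z = 0"
    by (auto elim: algebraic_int.cases)
  let ?D = "Polynomial.degree P"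
  define c where "c = (\<lambda>i. \<lfloor>Re (Polynomial.coeff P i)\<rfloor>)"
  have c: "of_int (c i) = Polynomial.coeff P i" for i
    using P(2)[rule_format, of i] by (auto simp: c_def elim!: Ints_cases)
  have "poly P z = (\<Sum>i\<le>?D. of_int (c i) * z ^ i)" by (simp add: poly_altdef c)
  also have "\<dots> = (\<Sum>i<?D. of_int (c i) * z ^ i) + z ^ ?D"
    using P(1) by (simp add: lessThan_Suc_atMost[symmetric] c)
  finally have "z ^ ?D = (\<Sum>i<?D. of_int (- c i) * z ^ i)"
    using P(3) by (simp add: sum_negf eq_neg_iff_add_eq_0 add.commute)
  then show "\<exists>D. z ^ D \<in> int_polys z D" by (intro exI[of _ ?D] int_polysI)
next
  assume "\<exists>D. z ^ D \<in> int_polys z D"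
  then obtain D c where c: "z ^ D = (\<Sum>i<D. of_int (c i) * z ^ i)" by (auto simp: int_polys_def)
  define P :: "complex poly" where "P = Polynomial.monom 1 D - (\<Sum>i<D. Polynomial.monom (of_int (c i)) i)"
  have coeff: "Polynomial.coeff P i = (if i = D then 1 else if i < D then - of_int (c i) else 0)" for i
    by (simp add: P_def coeff_sum sum.delta)
  have "Polynomial.degree P = D"
    by (rule antisym, rule degree_le) (auto simp: coeff intro: le_degree)
  then have "Polynomial.coeff P (Polynomial.degree P) = 1" by (simp add: coeff)
  moreover have "\<forall>i. Polynomial.coeff P i \<in> \<int>" by (simp add: coeff)
  moreover have "poly P z = 0" by (simp add: P_def poly_sum poly_monom c)
  ultimately show "algebraic_int z" by (rule algebraic_int.intros)
qed

text \<open>Z[z] is a subgroup of a finitely generated group and hence finitely generated. So it is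
  spanned by the powers of z below some D, and z^D is among its elements.\<close>

lemma algebraic_intI_zspan:
  fixes z :: complex
  assumes "1 \<in> zspan vs" and closed: "\<And>v. v \<in> zspan vs \<Longrightarrow> z * v \<in> zspan vs"
  shows "algebraic_int z"
proof -
  have pow: "z ^ i \<in> zspan vs" for i by (induction i) (use assms in auto)
  define H where "H = (\<Union>D. int_polys z D)"
  have sub: "int_polys z D \<subseteq> zspan vs" for D
  proof
    fix x assume "x \<in> int_polys z D"
    then obtain c where "x = (\<Sum>i<D. of_int (c i) * z ^ i)" by (auto simp: int_polys_def)
    then have "x = (\<Sum>i<D. real_of_int (c i) *\<^sub>R z ^ i)" by (simp add: scaleR_conv_of_real)
    also have "\<dots> \<in> zspan vs" using pow by (intro subgrp_sum subgrp_of_int subgrp_zspan)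
    finally show "x \<in> zspan vs" .
  qed
  have "subgrp H"
  proof (rule subgrpI)
    show "0 \<in> H" using subgrp_0[OF subgrp_int_polys] by (auto simp: H_def)
    fix x y assume "x \<in> H" "y \<in> H"
    then obtain D E where "x \<in> int_polys z D" "y \<in> int_polys z E" by (auto simp: H_def)
    then have "x \<in> int_polys z (max D E)" "y \<in> int_polys z (max D E)"
      using int_polys_mono[of D "max D E" z] int_polys_mono[of E "max D E" z] by auto
    then have "x - y \<in> int_polys z (max D E)" by (rule subgrp_diff[OF subgrp_int_polys])
    then show "x - y \<in> H" by (auto simp: H_def)
  qed
  then obtain ws where ws: "H = zspan ws"
    using subgroup_finitely_generated[of H vs] sub by (auto simp: H_def)
  have "\<exists>D. set us \<subseteq> int_polys z D" if "set us \<subseteq> H" for us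
    using that
  proof (induction us)
    case (Cons u us)
    then obtain D E where "set us \<subseteq> int_polys z D" "u \<in> int_polys z E" by (auto simp: H_def)
    then have "set (u # us) \<subseteq> int_polys z (max D E)"
      using int_polys_mono[of D "max D E" z] int_polys_mono[of E "max D E" z] by auto
    then show ?case by blast
  qed auto
  then obtain D where "set ws \<subseteq> int_polys z D" using ws set_subset_zspan by blast
  then have "H \<subseteq> int_polys z D" unfolding ws by (intro zspan_subset subgrp_int_polys)
  moreover have "z ^ D \<in> H" using power_in_int_polys[of D "Suc D" z] by (auto simp: H_def)
  ultimately show ?thesis unfolding algebraic_int_iff_int_polys by blast
qed

lemma int_polys_eq_zspan: "int_polys z D = zspan (map (\<lambda>i. z ^ i) [0..<D])"
proof
  show "zspan (map (\<lambda>i. z ^ i) [0..<D]) \<subseteq> int_polys z D"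
    using power_in_int_polys by (intro zspan_subset subgrp_int_polys) auto
  show "int_polys z D \<subseteq> zspan (map (\<lambda>i. z ^ i) [0..<D])"
  proof
    fix x assume "x \<in> int_polys z D"
    then obtain c where "x = (\<Sum>i<D. real_of_int (c i) *\<^sub>R z ^ i)"
      by (auto simp: int_polys_def scaleR_conv_of_real)
    also have "\<dots> \<in> zspan (map (\<lambda>i. z ^ i) [0..<D])"
      using set_subset_zspan[of "map (\<lambda>i. z ^ i) [0..<D]"]
      by (intro subgrp_sum subgrp_of_int subgrp_zspan) auto
    finally show "x \<in> zspan (map (\<lambda>i. z ^ i) [0..<D])" .
  qed
qed

lemma int_polys_closed:
  assumes "z ^ D \<in> int_polys z D" "x \<in> int_polys z D"
  shows "z * x \<in> int_polys z D"
proof -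
  obtain c where "x = (\<Sum>i<D. of_int (c i) * z ^ i)" using assms(2) by (auto simp: int_polys_def)
  then have "z * x = (\<Sum>i<D. real_of_int (c i) *\<^sub>R z ^ Suc i)"
    by (simp add: sum_distrib_left scaleR_conv_of_real mult_ac)
  moreover have "z ^ Suc i \<in> int_polys z D" if "i < D" for i
    using that assms(1) power_in_int_polys[of "Suc i" D z] by (cases "Suc i = D") (auto simp del: power_Suc)
  ultimately show ?thesis by (auto intro!: subgrp_sum subgrp_of_int subgrp_int_polys)
qed

lemma zspan_mult:
  fixes as bs :: "complex list"
  assumes "x \<in> zspan as" "y \<in> zspan bs"
  shows "x * y \<in> zspan [a * b. a \<leftarrow> as, b \<leftarrow> bs]"
proof -
  let ?V = "zspan [a * b. a \<leftarrow> as, b \<leftarrow> bs]"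
  have sg: "subgrp {y. c * y \<in> ?V}" for c
    using subgrp_0[OF subgrp_zspan] subgrp_diff[OF subgrp_zspan] by (intro subgrpI) (auto simp: right_diff_distrib)
  have sg': "subgrp {x. x * y \<in> ?V}" for y
    using subgrp_0[OF subgrp_zspan] subgrp_diff[OF subgrp_zspan] by (intro subgrpI) (auto simp: left_diff_distrib)
  have "a * b \<in> ?V" if "a \<in> set as" "b \<in> set bs" for a b
    using that set_subset_zspan[of "[a * b. a \<leftarrow> as, b \<leftarrow> bs]"] by auto
  then have "zspan bs \<subseteq> {y. a * y \<in> ?V}" if "a \<in> set as" for a
    using that by (intro zspan_subset sg) auto
  then have "zspan as \<subseteq> {x. x * y \<in> ?V}" using assms(2) by (intro zspan_subset sg') auto
  then show ?thesis using assms(1) by auto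
qed

text \<open>The products x^i y^j span a finitely generated group that contains 1 and is stable under
  x and y, hence under x + y and x y.\<close>

lemma algebraic_int_add_mult:
  fixes x y :: complex
  assumes "algebraic_int x" "algebraic_int y"
  shows "algebraic_int (x + y)" "algebraic_int (x * y)"
proof -
  obtain D E where D: "x ^ D \<in> int_polys x D" and E: "y ^ E \<in> int_polys y E"
    using assms unfolding algebraic_int_iff_int_polys by blast
  \<comment> \<open>With \<open>Suc D\<close> generating powers, the power 0 is certainly among
    them, so the span contains 1.\<close>
  have D': "x ^ Suc D \<in> int_polys x (Suc D)" and E': "y ^ Suc E \<in> int_polys y (Suc E)"
    using int_polys_closed[OF D D] int_polys_closed[OF E E] int_polys_mono[of D "Suc D" x] int_polys_mono[of E "Suc E" y]
    by auto
  define as bs where "as = map (\<lambda>i. x ^ i) [0..<Suc D]" and "bs = map (\<lambda>i. y ^ i) [0..<Suc E]"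
  have as: "zspan as = int_polys x (Suc D)" and bs: "zspan bs = int_polys y (Suc E)"
    unfolding as_def bs_def int_polys_eq_zspan by auto
  let ?vs = "[a * b. a \<leftarrow> as, b \<leftarrow> bs]"
  have one: "1 \<in> zspan as" "1 \<in> zspan bs"
    unfolding as bs using power_in_int_polys[of 0 "Suc D" x] power_in_int_polys[of 0 "Suc E" y] by auto
  have 1: "1 \<in> zspan ?vs" using zspan_mult[OF one] by simp
  have sg: "subgrp {v. c * v \<in> zspan ?vs}" for c
    using subgrp_0[OF subgrp_zspan] subgrp_diff[OF subgrp_zspan] by (intro subgrpI) (auto simp: right_diff_distrib)
  have gen: "a \<in> zspan as \<and> b \<in> zspan bs" if "a \<in> set as" "b \<in> set bs" for a b
    using that set_subset_zspan by blast
  have "x * (a * b) \<in> zspan ?vs" if "a \<in> set as" "b \<in> set bs" for a b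
    using zspan_mult[of "x * a" as b bs] gen[OF that] int_polys_closed[OF D'] unfolding as by (simp add: mult.assoc)
  then have xV: "zspan ?vs \<subseteq> {v. x * v \<in> zspan ?vs}" by (intro zspan_subset sg) auto
  have "y * (a * b) \<in> zspan ?vs" if "a \<in> set as" "b \<in> set bs" for a b
    using zspan_mult[of a as "y * b" bs] gen[OF that] int_polys_closed[OF E'] unfolding bs by (simp add: mult_ac)
  then have yV: "zspan ?vs \<subseteq> {v. y * v \<in> zspan ?vs}" by (intro zspan_subset sg) auto
  have xy: "x * v \<in> zspan ?vs" "y * v \<in> zspan ?vs" if "v \<in> zspan ?vs" for v
    using that xV yV by blast+
  show "algebraic_int (x + y)"
    by (rule algebraic_intI_zspan[OF 1]) (unfold distrib_right, intro subgrp_add[OF subgrp_zspan] xy)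
  show "algebraic_int (x * y)"
    by (rule algebraic_intI_zspan[OF 1]) (unfold mult.assoc, intro xy)
qed

section \<open>Orders generated by a root of a perturbed product of binomials\<close>

lemma set_plus_exhaust: "x \<in> A + B \<Longrightarrow> \<exists>a b. x = a + b \<and> a \<in> A \<and> b \<in> B"
  by (elim set_plus_elim) blast

lemma int_polys_of_int_mult: "x \<in> int_polys z D \<Longrightarrow> of_int k * x \<in> int_polys z D"
  using subgrp_of_int[OF subgrp_int_polys, of x z D k] by (simp add: scaleR_conv_of_real)

lemma int_polys_mult_power:
  assumes "x \<in> int_polys z D"
  shows "x * z ^ k \<in> int_polys z (D + k)"
proof -
  obtain c where "x = (\<Sum>i<D. of_int (c i) * z ^ i)" using assms by (auto simp: int_polys_def)
  then have "x * z ^ k = (\<Sum>i<D. of_int (c i) * z ^ (i + k))"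
    by (simp add: sum_distrib_right power_add mult.assoc)
  also have "\<dots> \<in> int_polys z (D + k)"
    by (intro subgrp_sum[OF subgrp_int_polys] int_polys_of_int_mult power_in_int_polys) auto
  finally show ?thesis .
qed

text \<open>The product is a power of z modulo 4. The essential point is the degree bound on the
  remainder, which keeps q in the span of the lower powers.\<close>

lemma prod_binomials_mod_4:
  fixes z :: complex and m :: nat
  assumes "\<And>i. i < m \<Longrightarrow> f i > (0::nat)" "\<And>i. i < m \<Longrightarrow> (4::int) dvd a i"
  shows "\<exists>q\<in>int_polys z (sum f {..<m}). (\<Prod>i<m. z ^ f i - of_int (a i)) = z ^ sum f {..<m} + 4 * q"
  using assms
proof (induction m)
  case 0
  show ?case using subgrp_0[OF subgrp_int_polys[of z 0]] by force
next
  case (Suc m)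
  let ?s = "sum f {..<m}"
  obtain q where q: "q \<in> int_polys z ?s" "(\<Prod>i<m. z ^ f i - of_int (a i)) = z ^ ?s + 4 * q"
    using Suc.IH Suc.prems by auto
  obtain b where b: "a m = 4 * b" using Suc.prems(2)[of m] by auto
  let ?q = "q * z ^ f m - of_int b * z ^ ?s - of_int (4 * b) * q"
  have fm: "f m > 0" using Suc.prems(1)[of m] by simp
  have "q \<in> int_polys z (?s + f m)" using q(1) int_polys_mono[of ?s "?s + f m" z] by auto
  then have "?q \<in> int_polys z (?s + f m)"
    using fm by (intro subgrp_diff[OF subgrp_int_polys] int_polys_mult_power[OF q(1)] int_polys_of_int_mult
      power_in_int_polys) auto
  moreover have "(\<Prod>i<Suc m. z ^ f i - of_int (a i)) = z ^ (?s + f m) + 4 * ?q"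
    by (simp add: q(2) b power_add algebra_simps)
  ultimately show ?case by (simp only: sum.lessThan_Suc) blast
qed

lemma (in subring_complex) frobenius_add:
  assumes "Factorial_Ring.prime p" "x \<in> R" "y \<in> R"
  shows "(x + y) ^ p - (x ^ p + y ^ p) \<in> princ (of_nat p)"
proof -
  have p0: "p > 0" using assms(1) by (rule prime_gt_0_nat)
  let ?t = "\<lambda>k. of_nat (p choose k) * x ^ k * y ^ (p - k)"
  have "{..p} = insert 0 (insert p {0<..<p})" using p0 by auto
  then have "(x + y) ^ p = y ^ p + (x ^ p + sum ?t {0<..<p})"
    unfolding binomial_ring using p0 by simp
  then have "(x + y) ^ p - (x ^ p + y ^ p) = sum ?t {0<..<p}" by simp
  also have "\<dots> \<in> princ (of_nat p)"
  proof (rule subgrp_sum[OF subgrp_princ])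
    fix k assume "k \<in> {0<..<p}"
    then have "p dvd p choose k" using assms(1) \<open>k \<in> {0<..<p}\<close> by (intro dvd_choose_prime) auto
    then obtain b where "p choose k = p * b" by auto
    then have "?t k = of_nat p * (of_nat b * x ^ k * y ^ (p - k))" by (simp add: mult.assoc)
    moreover have "of_nat b * x ^ k * y ^ (p - k) \<in> R"
      by (intro mult_mem of_nat_mem power_mem assms)
    ultimately show "?t k \<in> princ (of_nat p)" unfolding mem_princ by blast
  qed
  finally show ?thesis .
qed

lemma (in subring_complex) frobenius_sum:
  assumes p: "Factorial_Ring.prime p" and "finite A" "\<And>i. i \<in> A \<Longrightarrow> h i \<in> R"
  shows "sum h A ^ p - (\<Sum>i\<in>A. h i ^ p) \<in> princ (of_nat p)"
  using assms(2,3)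
proof (induction A rule: finite_induct)
  case empty
  then show ?case using subgrp_0[OF subgrp_princ] prime_gt_0_nat[OF p] by (simp add: power_0_left)
next
  case (insert i A)
  have "(h i + sum h A) ^ p - (h i ^ p + sum h A ^ p) \<in> princ (of_nat p)"
    using insert.prems by (intro frobenius_add p sum_mem) auto
  moreover have "sum h A ^ p - (\<Sum>i\<in>A. h i ^ p) \<in> princ (of_nat p)" using insert by auto
  ultimately have "((h i + sum h A) ^ p - (h i ^ p + sum h A ^ p)) + (sum h A ^ p - (\<Sum>i\<in>A. h i ^ p)) \<in> princ (of_nat p)"
    by (rule subgrp_add[OF subgrp_princ])
  then show ?case using insert.hyps by (simp add: algebra_simps)
qed

lemma (in subring_complex) power_diff_princ:
  assumes "x \<in> R" "y \<in> R" "x - y \<in> princ c"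
  shows "x ^ e - y ^ e \<in> princ c"
proof (induction e)
  case (Suc e)
  have "(x - y) * x ^ e + (x ^ e - y ^ e) * y \<in> princ c"
    by (intro subgrp_add[OF subgrp_princ] princ_ideal assms power_mem Suc)
  then show ?case by (simp add: algebra_simps)
qed (simp add: subgrp_0[OF subgrp_princ])

lemma fermat_int:
  assumes "Factorial_Ring.prime p"
  shows "int p dvd z ^ p - z"
proof -
  have p0: "p > 0" using assms by (rule prime_gt_0_nat)
  define m where "m = nat (z mod int p)"
  have zm: "[z = int m] (mod int p)" using p0 by (simp add: m_def cong_def)
  have "[m ^ p = m] (mod p)"
  proof (cases "p dvd m")
    case True
    then have "p dvd m ^ p" using p0 by (simp add: dvd_power_same dvd_trans[OF _ dvd_power])
    then show ?thesis using True by (simp add: cong_def dvd_eq_mod_eq_0)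
  next
    case False
    have "[m ^ (p - 1) * m = 1 * m] (mod p)" by (intro cong_mult fermat_theorem assms False cong_refl)
    then show ?thesis using p0 by (simp add: power_eq_if mult.commute)
  qed
  then have "[int m ^ p = int m] (mod int p)" by (metis cong_int_iff of_nat_power)
  then have "[z ^ p = z] (mod int p)" using zm cong_pow[OF zm, of p] by (metis cong_sym cong_trans)
  then show ?thesis by (simp add: cong_iff_dvd_diff)
qed

text \<open>\<open>a_order\<close> says that a_i^((p-1)/f_i) has order f_i modulo p, which by Kummer
  theory makes x^(f_i) - a_i irreducible modulo p; \<open>a_distinct\<close> separates factors of
  equal degree. The right-hand side of \<open>root\<close> is p times a unit at p and also twice an
  odd number.\<close>

locale kummer =
  fixes p g :: nat and f :: "nat \<Rightarrow> nat" and a :: "nat \<Rightarrow> int" and \<alpha> :: complex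
  assumes p: "Factorial_Ring.prime p" and p4: "p mod 4 = 1" and g_pos: "g > 0"
    and f_pos: "i < g \<Longrightarrow> f i > 0" and f_dvd: "i < g \<Longrightarrow> f i dvd p - 1"
    and a4: "i < g \<Longrightarrow> 4 dvd a i" and a_p: "i < g \<Longrightarrow> \<not> int p dvd a i"
    and a_order: "i < g \<Longrightarrow> j < f i \<Longrightarrow> k < f i \<Longrightarrow> j \<noteq> k \<Longrightarrow>
       \<not> int p dvd a i ^ (j * ((p - 1) div f i)) - a i ^ (k * ((p - 1) div f i))"
    and a_distinct: "i < g \<Longrightarrow> j < g \<Longrightarrow> i \<noteq> j \<Longrightarrow> \<not> int p dvd a i - a j"
    and root: "(\<Prod>i<g. \<alpha> ^ f i - of_int (a i)) = of_nat (p * (p + 1))"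
begin

definition n :: nat where "n = sum f {..<g}"

definition R0 :: "complex set" where "R0 = int_polys \<alpha> n"

text \<open>The localisation at p of the order Z[\<alpha>]. By \<open>ints_subset_Rp\<close> it
  contains the full ring of integers.\<close>

definition Rp :: "complex set" where
  "Rp = {x. \<exists>c::int. \<not> int p dvd c \<and> of_int c * x \<in> R0}"

definition \<pi> :: "nat \<Rightarrow> complex" where "\<pi> i = \<alpha> ^ f i - of_int (a i)"

lemma f_le_n: "i < g \<Longrightarrow> f i \<le> n"
  unfolding n_def by (intro member_le_sum) auto

lemma n_pos: "n > 0"
  using f_le_n[OF g_pos] f_pos[OF g_pos] by simp

lemma subgrp_R0: "subgrp R0"
  unfolding R0_def by (rule subgrp_int_polys)

lemma of_int_mult_R0: "x \<in> R0 \<Longrightarrow> of_int k * x \<in> R0"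
  unfolding R0_def by (rule int_polys_of_int_mult)

lemma power_lt_R0: "k < n \<Longrightarrow> \<alpha> ^ k \<in> R0"
  unfolding R0_def by (rule power_in_int_polys)

lemma of_int_R0: "of_int k \<in> R0"
  using of_int_mult_R0[OF power_lt_R0[OF n_pos], of k] by simp

lemma alpha_n: obtains q where "q \<in> R0" "\<alpha> ^ n = of_nat (p * (p + 1)) - 4 * q"
proof -
  obtain q where "q \<in> int_polys \<alpha> (sum f {..<g})"
    "(\<Prod>i<g. \<alpha> ^ f i - of_int (a i)) = \<alpha> ^ sum f {..<g} + 4 * q"
    using prod_binomials_mod_4[of g f a \<alpha>] f_pos a4 by blast
  then show ?thesis using root that[of q] by (auto simp: R0_def n_def)
qed

lemma alpha_n_R0: "\<alpha> ^ n \<in> R0"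
proof -
  obtain q where "q \<in> R0" "\<alpha> ^ n = of_nat (p * (p + 1)) - 4 * q" by (rule alpha_n)
  then show ?thesis
    using subgrp_diff[OF subgrp_R0 of_int_R0[of "int (p * (p + 1))"] of_int_mult_R0[of q 4]] by simp
qed

lemma alpha_mult_R0: "x \<in> R0 \<Longrightarrow> \<alpha> * x \<in> R0"
  using alpha_n_R0 unfolding R0_def by (rule int_polys_closed)

lemma mult_R0: "x \<in> R0 \<Longrightarrow> y \<in> R0 \<Longrightarrow> x * y \<in> R0"
proof -
  assume x: "x \<in> R0" and y: "y \<in> R0"
  have pw: "\<alpha> ^ k * y \<in> R0" for k
    by (induction k) (auto simp: y mult.assoc intro: alpha_mult_R0)
  obtain c where "x = (\<Sum>i<n. of_int (c i) * \<alpha> ^ i)" using x by (auto simp: R0_def int_polys_def)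
  then have "x * y = (\<Sum>i<n. of_int (c i) * (\<alpha> ^ i * y))" by (simp add: sum_distrib_right mult.assoc)
  also have "\<dots> \<in> R0" by (intro subgrp_sum[OF subgrp_R0] of_int_mult_R0 pw)
  finally show ?thesis .
qed

sublocale order: subring_complex R0
  using of_int_R0[of 1] subgrp_diff[OF subgrp_R0] mult_R0 by unfold_locales auto

lemma alpha_R0: "\<alpha> \<in> R0"
  using alpha_mult_R0[OF order.one_mem] by simp

lemma algebraic_int_R0:
  assumes "x \<in> R0"
  shows "algebraic_int x"
proof (rule algebraic_intI_zspan[of "map (\<lambda>i. \<alpha> ^ i) [0..<n]"])
  have eq: "zspan (map (\<lambda>i. \<alpha> ^ i) [0..<n]) = R0" unfolding R0_def int_polys_eq_zspan ..
  show "1 \<in> zspan (map (\<lambda>i. \<alpha> ^ i) [0..<n])" unfolding eq by (rule order.one_mem)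
  show "x * v \<in> zspan (map (\<lambda>i. \<alpha> ^ i) [0..<n])" if "v \<in> zspan (map (\<lambda>i. \<alpha> ^ i) [0..<n])" for v
    using that assms unfolding eq by (intro order.mult_mem)
qed

text \<open>
  An Eisenstein-type argument at the prime \<open>2\<close>: up to multiples of \<open>4\<close>, the element
  \<open>\<alpha> ^ n\<close> is \<open>p * (p + 1)\<close>, which is twice an odd number.
\<close>

lemma even_coefficients:
  assumes zero: "(\<Sum>j<n. of_int (z j) * \<alpha> ^ j) = 0" and "j < n"
  shows "even (z j)"
proof (rule ccontr)
  assume "odd (z j)"
  define k where "k = (LEAST k. k < n \<and> odd (z k))"
  have k: "k < n" "odd (z k)"
    using LeastI[of "\<lambda>k. k < n \<and> odd (z k)" j] \<open>odd (z j)\<close> \<open>j < n\<close> by (auto simp: k_def)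
  have kmin: "even (z i)" if "i < k" for i
    using not_less_Least[of i "\<lambda>k. k < n \<and> odd (z k)"] that k(1) by (auto simp: k_def)
  define T where "T = (\<lambda>x. 2 * x) ` R0"
  have sgT: "subgrp T" unfolding T_def by (intro subgrp_image linear_times_complex order.subgrp_R)
  have T_ideal: "t * x \<in> T" if "t \<in> T" "x \<in> R0" for t x
    using that by (auto simp: T_def mult.assoc intro!: imageI mult_R0)
  have T2: "of_int (2 * b) * x \<in> T" if "x \<in> R0" for b x
    using of_int_mult_R0[OF that, of b] by (auto simp: T_def mult.assoc)
  obtain q where q: "q \<in> R0" "\<alpha> ^ n = of_nat (p * (p + 1)) - 4 * q" by (rule alpha_n)
  obtain m where m: "p = 4 * m + 1" using p4 by (metis mult_div_mod_eq)
  define u where "u = p * (2 * m + 1)"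
  have u: "p * (p + 1) = 2 * u" "odd u" by (simp_all add: u_def m)
  define w where "w = of_nat u - 2 * q"
  have w: "w \<in> R0" "\<alpha> ^ n = 2 * w"
    unfolding q(2) u(1) using order.diff_mem[OF order.of_nat_mem[of u] of_int_mult_R0[OF q(1), of 2]]
    by (simp_all add: w_def)
  have high: "\<alpha> ^ i \<in> T" if "i \<ge> n" for i
  proof -
    have "\<alpha> ^ i = \<alpha> ^ n * \<alpha> ^ (i - n)" using that by (simp add: power_add[symmetric])
    moreover have "\<alpha> ^ n \<in> T" unfolding w(2) T_def using w(1) by blast
    ultimately show ?thesis by (simp only: T_ideal order.power_mem alpha_R0)
  qed
  \<comment> \<open>This shift moves the k-th term to \<alpha>^(n-1). The earlier terms have even
    coefficients and the later ones contain \<alpha>^n, so all of them lie in 2 R0.\<close>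
  let ?e = "n - 1 - k"
  have rest: "of_int (z i) * \<alpha> ^ (?e + i) \<in> T" if "i \<in> {..<n} - {k}" for i
  proof (cases "i < k")
    case True
    then obtain b where "z i = 2 * b" using kmin[of i] by auto
    then show ?thesis using T2[OF order.power_mem[OF alpha_R0]] by simp
  next
    case False
    then have "\<alpha> ^ (?e + i) \<in> T" using that k(1) by (intro high) auto
    then have "\<alpha> ^ (?e + i) * of_int (z i) \<in> T" by (intro T_ideal of_int_R0)
    then show ?thesis by (simp only: mult.commute)
  qed
  have "\<alpha> ^ ?e * (\<Sum>j<n. of_int (z j) * \<alpha> ^ j) = (\<Sum>j<n. of_int (z j) * \<alpha> ^ (?e + j))"
    by (simp add: sum_distrib_left power_add mult_ac)
  also have "\<dots> = of_int (z k) * \<alpha> ^ (?e + k) + (\<Sum>i\<in>{..<n} - {k}. of_int (z i) * \<alpha> ^ (?e + i))"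
    using k(1) by (intro sum.remove) auto
  finally have "of_int (z k) * \<alpha> ^ (?e + k) = - (\<Sum>i\<in>{..<n} - {k}. of_int (z i) * \<alpha> ^ (?e + i))"
    using zero by (simp add: eq_neg_iff_add_eq_0)
  also have "\<dots> \<in> T" using rest by (intro subgrp_uminus[OF sgT] subgrp_sum[OF sgT])
  finally have zk: "of_int (z k) * \<alpha> ^ (n - 1) \<in> T" using k(1) by simp
  obtain b where b: "z k = 2 * b + 1" using k(2) by (auto elim: oddE)
  have "of_int (z k) * \<alpha> ^ (n - 1) - of_int (2 * b) * \<alpha> ^ (n - 1) \<in> T"
    by (intro subgrp_diff[OF sgT] zk T2 order.power_mem alpha_R0)
  then have "\<alpha> ^ (n - 1) \<in> T" by (simp add: b algebra_simps)
  then obtain s where s: "s \<in> R0" "\<alpha> ^ (n - 1) = 2 * s" by (auto simp: T_def)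
  \<comment> \<open>From \<alpha>^n = 2w and \<alpha>^(n-1) = 2s follows w = \<alpha> s. Hence w^n
    is a multiple of \<alpha>^n and so of 2, although w is congruent to the odd integer u modulo 2;
    then u^n / 2 would be a rational algebraic integer.\<close>
  have "\<alpha> ^ n = \<alpha> * \<alpha> ^ (n - 1)" using n_pos by (simp add: power_eq_if)
  then have ws: "w = \<alpha> * s" using w(2) s(2) by simp
  have "w ^ n = \<alpha> ^ n * s ^ n" unfolding ws by (rule power_mult_distrib)
  also have "\<dots> \<in> T" by (intro T_ideal high order.power_mem s) simp
  finally have wn: "w ^ n \<in> T" .
  have wu: "w ^ i - of_nat u ^ i \<in> T" for i
  proof (induction i)
    case (Suc i)
    have "w - of_nat u = of_int (2 * (-1)) * q" by (simp add: w_def)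
    then have "(w - of_nat u) * w ^ i \<in> T"
      using T2[OF q(1)] w(1) by (intro T_ideal order.power_mem) (simp_all only:)
    moreover have "(w ^ i - of_nat u ^ i) * of_nat u \<in> T" by (intro T_ideal Suc order.of_nat_mem)
    ultimately have "(w - of_nat u) * w ^ i + (w ^ i - of_nat u ^ i) * of_nat u \<in> T"
      by (rule subgrp_add[OF sgT])
    then show ?case by (simp add: algebra_simps)
  qed (simp add: subgrp_0[OF sgT])
  have "w ^ n - (w ^ n - of_nat u ^ n) \<in> T" by (rule subgrp_diff[OF sgT wn wu])
  then obtain t where t: "t \<in> R0" "of_nat u ^ n = 2 * t" by (auto simp: T_def)
  then have "t = of_nat (u ^ n) / of_nat 2" by simp
  then have "t \<in> \<rat>" by (metis Rats_divide Rats_of_nat)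
  then have "t \<in> \<int>" by (rule rational_algebraic_int_is_int[OF algebraic_int_R0[OF t(1)]])
  then obtain i where "t = of_int i" by (auto elim: Ints_cases)
  then have "(of_int (int (u ^ n)) :: complex) = of_int (2 * i)" using t(2) by simp
  then have "int (u ^ n) = 2 * i" by (simp only: of_int_eq_iff)
  then have "even (u ^ n)" by presburger
  then show False using u(2) by simp
qed

text \<open>Infinite descent: all coefficients of a relation are even, and halving them gives
  another relation.\<close>

lemma independent:
  "(\<Sum>j<n. of_int (z j) * \<alpha> ^ j) = 0 \<Longrightarrow> j < n \<Longrightarrow> z j = 0"
proof (induction "nat \<bar>z j\<bar>" arbitrary: z rule: less_induct)
  case less
  have ev: "z i = 2 * (z i div 2)" if "i < n" for i
    using even_coefficients[OF less.prems(1) that] by simp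
  have "(\<Sum>j<n. of_int (z j) * \<alpha> ^ j) = (\<Sum>j<n. of_int (2 * (z j div 2)) * \<alpha> ^ j)"
    using ev by (intro sum.cong refl) (metis lessThan_iff)
  also have "\<dots> = 2 * (\<Sum>j<n. of_int (z j div 2) * \<alpha> ^ j)"
    by (simp add: sum_distrib_left mult.assoc)
  finally have 0: "(\<Sum>j<n. of_int (z j div 2) * \<alpha> ^ j) = 0" using less.prems(1) by simp
  show ?case
  proof (rule ccontr)
    assume nz: "z j \<noteq> 0"
    then have "nat \<bar>z j div 2\<bar> < nat \<bar>z j\<bar>" using ev[OF less.prems(2)] by linarith
    then have "z j div 2 = 0" using less.hyps[of "\<lambda>j. z j div 2"] 0 less.prems(2) by blast
    then show False using nz ev[OF less.prems(2)] by simp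
  qed
qed

section \<open>The localised order and its residue rings\<close>

lemma prime_int_p: "Factorial_Ring.prime (int p)"
  using p by simp

lemma not_dvd_mult: "\<not> int p dvd c \<Longrightarrow> \<not> int p dvd d \<Longrightarrow> \<not> int p dvd c * d"
  using prime_dvd_mult_iff[OF prime_int_p] by blast

lemma not_dvd_1: "\<not> int p dvd 1"
  using p by auto

lemma bezout_p:
  assumes "\<not> int p dvd c"
  obtains u v where "u * c + v * int p = 1"
proof -
  have "coprime c (int p)" using prime_imp_coprime[OF prime_int_p assms] by (simp add: coprime_commute)
  then have "gcd c (int p) = 1" by simp
  then show ?thesis using bezout_int[of c "int p"] that by metis
qed

sublocale loc: subring_complex Rp
proof unfold_locales
  show "1 \<in> Rp" unfolding Rp_def using order.one_mem not_dvd_1 by (intro CollectI exI[of _ 1]) simp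
  fix x y assume "x \<in> Rp" "y \<in> Rp"
  then obtain c d where c: "\<not> int p dvd c" "of_int c * x \<in> R0" and d: "\<not> int p dvd d" "of_int d * y \<in> R0"
    by (auto simp: Rp_def)
  have "of_int (c * d) * (x - y) = of_int d * (of_int c * x) - of_int c * (of_int d * y)"
    by (simp add: algebra_simps)
  also have "\<dots> \<in> R0" by (intro order.diff_mem of_int_mult_R0 c d)
  finally show "x - y \<in> Rp" unfolding Rp_def using not_dvd_mult[OF c(1) d(1)] by blast
  have "of_int (c * d) * (x * y) = (of_int c * x) * (of_int d * y)" by simp
  also have "\<dots> \<in> R0" by (intro mult_R0 c d)
  finally show "x * y \<in> Rp" unfolding Rp_def using not_dvd_mult[OF c(1) d(1)] by blast
qed

lemma R0_subset_Rp: "R0 \<subseteq> Rp"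
  unfolding Rp_def using not_dvd_1 by (intro subsetI CollectI exI[of _ 1]) simp

lemma inverse_Rp: "\<not> int p dvd c \<Longrightarrow> inverse (of_int c) \<in> Rp"
  unfolding Rp_def using order.one_mem by (intro CollectI exI[of _ c]) (cases "c = 0", auto)

lemma alpha_Rp: "\<alpha> \<in> Rp"
  using alpha_R0 R0_subset_Rp by blast

lemma pi_R0: "\<pi> i \<in> R0"
  unfolding \<pi>_def by (intro order.diff_mem order.power_mem alpha_R0 of_int_R0)

lemma pi_Rp: "\<pi> i \<in> Rp"
  using pi_R0 R0_subset_Rp by blast

lemma prod_pi: "(\<Prod>i<g. \<pi> i) = of_nat p * of_nat (p + 1)"
  using root by (simp only: \<pi>_def of_nat_mult)

lemma p_pos: "p > 0" "p > 1"
  using prime_gt_0_nat[OF p] prime_gt_1_nat[OF p] .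

lemma pi_nz: "i < g \<Longrightarrow> \<pi> i \<noteq> 0"
proof
  assume "i < g" "\<pi> i = 0"
  then have "(\<Prod>i<g. \<pi> i) = 0" by auto
  then have "of_nat (p * (p + 1)) = (0::complex)" unfolding prod_pi by (simp only: of_nat_mult)
  then have "p * (p + 1) = 0" by (simp only: of_nat_eq_0_iff)
  then show False using p_pos by auto
qed

lemma eps_Rp: "of_nat (p + 1) \<in> Rp" "inverse (of_nat (p + 1)) \<in> Rp"
proof -
  have "\<not> int p dvd int (p + 1)" using not_dvd_1 by (simp add: dvd_add_right_iff)
  then show "inverse (of_nat (p + 1)) \<in> Rp" using inverse_Rp[of "int (p + 1)"] by simp
qed (rule loc.of_nat_mem)

text \<open>Clearing a denominator c prime to p gives an integral relation, whose coefficients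
  vanish by \<open>independent\<close>. So the powers of \<alpha> below n remain independent modulo
  p.\<close>

lemma coefficients_dvd:
  assumes "(\<Sum>j<n. of_int (d j) * \<alpha> ^ j) \<in> loc.princ (of_nat p)" "j < n"
  shows "int p dvd d j"
proof -
  obtain y where y: "y \<in> Rp" "(\<Sum>j<n. of_int (d j) * \<alpha> ^ j) = of_nat p * y"
    using assms(1) by (auto simp: loc.mem_princ)
  then obtain c where c: "\<not> int p dvd c" "of_int c * y \<in> R0" by (auto simp: Rp_def)
  then obtain b where b: "of_int c * y = (\<Sum>j<n. of_int (b j) * \<alpha> ^ j)"
    by (auto simp: R0_def int_polys_def)
  have "(\<Sum>j<n. of_int (c * d j - int p * b j) * \<alpha> ^ j) =
     of_int c * (\<Sum>j<n. of_int (d j) * \<alpha> ^ j) - of_nat p * (\<Sum>j<n. of_int (b j) * \<alpha> ^ j)"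
    by (simp add: sum_subtractf sum_distrib_left algebra_simps)
  also have "\<dots> = 0" unfolding y(2) b[symmetric] by simp
  finally have "c * d j - int p * b j = 0" by (rule independent) (rule assms(2))
  then have "int p dvd c * d j" by (metis dvd_triv_left eq_iff_diff_eq_0)
  then show ?thesis using c(1) prime_dvd_mult_iff[OF prime_int_p] by blast
qed

lemma p_princ_pi:
  assumes "i < g"
  shows "of_nat p \<in> loc.princ (\<pi> i)"
proof -
  have "(\<Prod>i<g. \<pi> i) = \<pi> i * (\<Prod>j\<in>{..<g} - {i}. \<pi> j)" using assms by (intro prod.remove) auto
  then have "of_nat p * of_nat (p + 1) = \<pi> i * (\<Prod>j\<in>{..<g} - {i}. \<pi> j)" unfolding prod_pi .
  moreover have "of_nat (p + 1) \<noteq> (0::complex)" by (simp only: of_nat_eq_0_iff)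
  ultimately have "of_nat p = \<pi> i * ((\<Prod>j\<in>{..<g} - {i}. \<pi> j) * inverse (of_nat (p + 1)))"
    by (metis mult.assoc mult.right_neutral right_inverse)
  moreover have "(\<Prod>j\<in>{..<g} - {i}. \<pi> j) * inverse (of_nat (p + 1)) \<in> Rp"
    by (intro loc.mult_mem loc.prod_mem pi_Rp eps_Rp)
  ultimately show ?thesis unfolding loc.mem_princ by blast
qed

lemma princ_subset_of_mem: "x \<in> loc.princ y \<Longrightarrow> loc.princ x \<subseteq> loc.princ y"
  by (auto simp: loc.mem_princ[of _ x] intro: loc.princ_ideal)

lemma multiple_of_p_princ_pi: "i < g \<Longrightarrow> int p dvd c \<Longrightarrow> x \<in> Rp \<Longrightarrow> of_int c * x \<in> loc.princ (\<pi> i)"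
proof -
  assume i: "i < g" and "int p dvd c" and x: "x \<in> Rp"
  then obtain b where "c = int p * b" by auto
  then have "of_int c * x = of_nat p * (of_int b * x)" by (simp add: mult.assoc)
  then show ?thesis using loc.princ_ideal[OF p_princ_pi[OF i] loc.mult_mem[OF loc.of_int_mem[of b] x]] by (simp only:)
qed

text \<open>Polynomials in \<alpha> of degree below f_i and multiples of \<pi>_i together form a
  group stable under \<alpha>, because \<alpha>^(f_i) = a_i + \<pi>_i; so it contains Z[\<alpha>].
  Denominators prime to p are removed by Bezout, since p is a multiple of \<pi>_i.\<close>

lemma representatives:
  assumes i: "i < g" and x: "x \<in> Rp"
  shows "\<exists>z. x - (\<Sum>j<f i. of_int (z j) * \<alpha> ^ j) \<in> loc.princ (\<pi> i)"
proof -
  let ?P = "int_polys \<alpha> (f i)" and ?I = "loc.princ (\<pi> i)"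
  define T where "T = ?P + ?I"
  have sgT: "subgrp T" unfolding T_def by (intro subgrp_plus subgrp_int_polys loc.subgrp_princ)
  have PT: "?P \<subseteq> T" and IT: "?I \<subseteq> T"
    unfolding T_def by (intro plus_upper1 plus_upper2 subgrp_int_polys loc.subgrp_princ)+
  have T_int: "of_int k * t \<in> T" if "t \<in> T" for k t
    using subgrp_of_int[OF sgT that, of k] by (simp add: scaleR_conv_of_real)
  have pw: "\<alpha> ^ Suc j \<in> T" if "j < f i" for j
  proof (cases "Suc j < f i")
    case True
    then show ?thesis using PT power_in_int_polys by blast
  next
    case False
    then have "Suc j = f i" using that by simp
    then have "\<alpha> ^ Suc j = of_int (a i) * \<alpha> ^ 0 + \<pi> i" by (simp add: \<pi>_def)
    moreover have "of_int (a i) * \<alpha> ^ 0 \<in> T"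
      using power_in_int_polys[OF f_pos[OF i]] PT by (intro T_int) blast
    moreover have "\<pi> i \<in> T" using loc.princ_self IT by blast
    ultimately show ?thesis by (simp only: subgrp_add[OF sgT])
  qed
  have aT: "\<alpha> * t \<in> T" if t: "t \<in> T" for t
  proof -
    obtain y b where yb: "t = y + b" "y \<in> ?P" "b \<in> ?I" using t set_plus_exhaust[of t ?P ?I] unfolding T_def by blast
    obtain c where "y = (\<Sum>j<f i. of_int (c j) * \<alpha> ^ j)" using yb(2) by (auto simp: int_polys_def)
    then have "\<alpha> * y = (\<Sum>j<f i. of_int (c j) * \<alpha> ^ Suc j)" by (simp add: sum_distrib_left mult_ac)
    also have "\<dots> \<in> T" by (intro subgrp_sum[OF sgT] T_int pw) simp
    finally have "\<alpha> * y \<in> T" .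
    moreover have "b * \<alpha> \<in> T" using loc.princ_ideal[OF yb(3) alpha_Rp] IT by blast
    ultimately have "\<alpha> * y + b * \<alpha> \<in> T" by (rule subgrp_add[OF sgT])
    then show ?thesis by (simp add: yb(1) algebra_simps)
  qed
  have "1 \<in> T" using power_in_int_polys[OF f_pos[OF i], of \<alpha>] PT by auto
  then have "\<alpha> ^ k \<in> T" for k by (induction k) (auto intro: aT)
  then have R0T: "y \<in> T" if "y \<in> R0" for y
    using that unfolding R0_def int_polys_def by (auto intro!: subgrp_sum[OF sgT] T_int)
  obtain c where c: "\<not> int p dvd c" "of_int c * x \<in> R0" using x by (auto simp: Rp_def)
  obtain u v where uv: "u * c + v * int p = 1" by (rule bezout_p[OF c(1)])
  have "x = of_int (u * c + v * int p) * x" by (simp add: uv)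
  also have "\<dots> = of_int u * (of_int c * x) + of_int (v * int p) * x" by (simp add: algebra_simps)
  also have "\<dots> \<in> T"
  proof (rule subgrp_add[OF sgT T_int[OF R0T[OF c(2)]]])
    show "of_int (v * int p) * x \<in> T"
      using multiple_of_p_princ_pi[OF i _ x, of "v * int p"] IT by auto
  qed
  finally obtain y b where yb: "x = y + b" "y \<in> ?P" "b \<in> ?I" using set_plus_exhaust[of x ?P ?I] unfolding T_def by blast
  then obtain c where "y = (\<Sum>j<f i. of_int (c j) * \<alpha> ^ j)" by (auto simp: int_polys_def)
  then have "x - (\<Sum>j<f i. of_int (c j) * \<alpha> ^ j) = b" using yb(1) by simp
  then show ?thesis using yb(3) by (intro exI[of _ c]) (simp only:)
qed

text \<open>Coefficient vectors of residues modulo p. \<open>PiE\<close> fixes the values outside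
  the range, so there are exactly p^D of them.\<close>

definition digits :: "nat \<Rightarrow> (nat \<Rightarrow> int) set" where
  "digits D = PiE {..<D} (\<lambda>_. {0..<int p})"

lemma finite_digits: "finite (digits D)" and card_digits: "card (digits D) = p ^ D"
  by (simp_all add: digits_def card_PiE finite_PiE)

lemma digits_representatives:
  assumes i: "i < g" and x: "x \<in> Rp"
  shows "\<exists>z\<in>digits (f i). x - (\<Sum>j<f i. of_int (z j) * \<alpha> ^ j) \<in> loc.princ (\<pi> i)"
proof -
  obtain z where z: "x - (\<Sum>j<f i. of_int (z j) * \<alpha> ^ j) \<in> loc.princ (\<pi> i)"
    using representatives[OF assms] by blast
  define z' where "z' = restrict (\<lambda>j. z j mod int p) {..<f i}"
  have "(\<Sum>j<f i. of_int (z j) * \<alpha> ^ j) - (\<Sum>j<f i. of_int (z' j) * \<alpha> ^ j) =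
      (\<Sum>j<f i. of_int (z j - z' j) * \<alpha> ^ j)"
    by (simp add: sum_subtractf algebra_simps)
  also have "\<dots> \<in> loc.princ (\<pi> i)"
    by (intro subgrp_sum[OF loc.subgrp_princ] multiple_of_p_princ_pi[OF i] loc.power_mem alpha_Rp)
      (simp add: z'_def)
  finally have "(x - (\<Sum>j<f i. of_int (z j) * \<alpha> ^ j)) +
     ((\<Sum>j<f i. of_int (z j) * \<alpha> ^ j) - (\<Sum>j<f i. of_int (z' j) * \<alpha> ^ j)) \<in> loc.princ (\<pi> i)"
    using z by (intro subgrp_add[OF loc.subgrp_princ])
  then have "x - (\<Sum>j<f i. of_int (z' j) * \<alpha> ^ j) \<in> loc.princ (\<pi> i)" by simp
  moreover have "z' \<in> digits (f i)" using p_pos by (auto simp: z'_def digits_def)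
  ultimately show ?thesis by blast
qed

definition rep_coset :: "nat \<Rightarrow> (nat \<Rightarrow> int) \<Rightarrow> complex set" where
  "rep_coset i z = (+) (\<Sum>j<f i. of_int (z j) * \<alpha> ^ j) ` loc.princ (\<pi> i)"

lemma rep_mem_Rp: "(\<Sum>j<D. of_int (z j) * \<alpha> ^ j) \<in> Rp"
  by (intro loc.sum_mem loc.mult_mem loc.of_int_mem loc.power_mem alpha_Rp)

lemma cosets_pi: "i < g \<Longrightarrow> cosets Rp (loc.princ (\<pi> i)) = rep_coset i ` digits (f i)"
proof (intro equalityI subsetI)
  fix C assume i: "i < g" and "C \<in> cosets Rp (loc.princ (\<pi> i))"
  then obtain x where x: "x \<in> Rp" "C = (+) x ` loc.princ (\<pi> i)" by (auto simp: cosets_def)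
  obtain z where "z \<in> digits (f i)" "x - (\<Sum>j<f i. of_int (z j) * \<alpha> ^ j) \<in> loc.princ (\<pi> i)"
    using digits_representatives[OF i x(1)] by blast
  then show "C \<in> rep_coset i ` digits (f i)"
    unfolding x(2) rep_coset_def using coset_eq_iff[OF loc.subgrp_princ] by blast
qed (auto simp: cosets_def rep_coset_def intro: rep_mem_Rp)

lemma idx_pi_le:
  assumes "i < g"
  shows "idx Rp (loc.princ (\<pi> i)) \<le> p ^ f i" "idx Rp (loc.princ (\<pi> i)) > 0"
proof -
  show "idx Rp (loc.princ (\<pi> i)) \<le> p ^ f i"
    unfolding idx_def cosets_pi[OF assms] card_digits[symmetric] by (rule card_image_le[OF finite_digits])
  have "finite (cosets Rp (loc.princ (\<pi> i)))" unfolding cosets_pi[OF assms] by (intro finite_imageI finite_digits)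
  moreover have "cosets Rp (loc.princ (\<pi> i)) \<noteq> {}" using loc.one_mem by (auto simp: cosets_def)
  ultimately show "idx Rp (loc.princ (\<pi> i)) > 0" unfolding idx_def by (simp add: card_gt_0_iff)
qed

lemma idx_prod_pi: "m \<le> g \<Longrightarrow> idx Rp (loc.princ (\<Prod>i<m. \<pi> i)) = (\<Prod>i<m. idx Rp (loc.princ (\<pi> i)))"
proof (induction m)
  case 0
  show ?case using idx_self[OF loc.subgrp_R] by (simp add: loc.princ_1)
next
  case (Suc m)
  have "(\<Prod>i<m. \<pi> i) \<noteq> 0" using Suc.prems pi_nz by auto
  then have "idx Rp (loc.princ ((\<Prod>i<m. \<pi> i) * \<pi> m)) = idx Rp (loc.princ (\<Prod>i<m. \<pi> i)) * idx Rp (loc.princ (\<pi> m))"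
    by (intro loc.idx_princ_mult loc.prod_mem pi_Rp)
  then show ?case using Suc by simp
qed

lemma princ_prod_pi: "loc.princ (\<Prod>i<g. \<pi> i) = loc.princ (of_nat p)"
proof
  show "loc.princ (\<Prod>i<g. \<pi> i) \<subseteq> loc.princ (of_nat p)"
    unfolding prod_pi by (intro loc.princ_mult_subset eps_Rp)
  have "loc.princ ((of_nat p * of_nat (p + 1)) * inverse (of_nat (p + 1))) \<subseteq> loc.princ (of_nat p * of_nat (p + 1))"
    by (intro loc.princ_mult_subset eps_Rp)
  moreover have "(of_nat p * of_nat (p + 1)) * inverse (of_nat (p + 1)) = (of_nat p :: complex)"
    by (simp del: of_nat_add of_nat_Suc)
  ultimately show "loc.princ (of_nat p) \<subseteq> loc.princ (\<Prod>i<g. \<pi> i)" unfolding prod_pi by (simp only:)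
qed

text \<open>Distinct digit vectors of length n lie in distinct classes modulo p, by
  \<open>coefficients_dvd\<close>.\<close>

lemma idx_p_ge: "p ^ n \<le> idx Rp (loc.princ (of_nat p))"
proof -
  have fin: "finite (cosets Rp (loc.princ (of_nat p)))"
  proof (rule finite_cosets)
    show "idx Rp (loc.princ (of_nat p)) > 0"
      unfolding princ_prod_pi[symmetric] idx_prod_pi[OF order_refl] using idx_pi_le(2) by (intro prod_pos) blast
  qed
  let ?h = "\<lambda>z. (+) (\<Sum>j<n. of_int (z j) * \<alpha> ^ j) ` loc.princ (of_nat p)"
  have "inj_on ?h (digits n)"
  proof (rule inj_onI)
    fix y z assume y: "y \<in> digits n" and z: "z \<in> digits n" and "?h y = ?h z"
    then have "(\<Sum>j<n. of_int (y j) * \<alpha> ^ j) - (\<Sum>j<n. of_int (z j) * \<alpha> ^ j) \<in> loc.princ (of_nat p)"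
      using coset_eq_iff[OF loc.subgrp_princ] by blast
    then have d: "(\<Sum>j<n. of_int (y j - z j) * \<alpha> ^ j) \<in> loc.princ (of_nat p)"
      by (simp add: sum_subtractf algebra_simps)
    have "y j = z j" if "j < n" for j
    proof -
      have jn: "j \<in> {..<n}" using that by simp
      have "y j \<in> {0..<int p}" "z j \<in> {0..<int p}"
        using PiE_mem[OF y[unfolded digits_def] jn] PiE_mem[OF z[unfolded digits_def] jn] .
      moreover have "y j mod int p = z j mod int p"
        unfolding mod_eq_dvd_iff by (rule coefficients_dvd[OF d that])
      ultimately show ?thesis by simp
    qed
    then show "y = z" using y z unfolding digits_def by (intro PiE_ext[of y "{..<n}" _ z]) (simp_all only: lessThan_iff)
  qed
  then have "card (digits n) \<le> card (cosets Rp (loc.princ (of_nat p)))"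
    using fin by (intro card_inj_on_le[of ?h]) (auto simp: cosets_def intro: rep_mem_Rp)
  then show ?thesis by (simp add: card_digits idx_def)
qed

text \<open>Each of the indices is at most p^(f_i), and their product, the index of (p), is at least
  p^n, the product of these bounds. Hence all bounds are attained.\<close>

lemma idx_pi:
  assumes i: "i < g"
  shows "idx Rp (loc.princ (\<pi> i)) = p ^ f i"
proof (rule antisym)
  let ?x = "\<lambda>i. idx Rp (loc.princ (\<pi> i))"
  let ?R = "{..<g} - {i}"
  have pn: "p ^ n = p ^ f i * (\<Prod>j\<in>?R. p ^ f j)"
    unfolding n_def power_sum using i by (intro prod.remove) auto
  have "p ^ n \<le> (\<Prod>j<g. ?x j)"
    using idx_p_ge unfolding princ_prod_pi[symmetric] idx_prod_pi[OF order_refl] .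
  also have "\<dots> = ?x i * (\<Prod>j\<in>?R. ?x j)" using i by (intro prod.remove) auto
  also have "\<dots> \<le> ?x i * (\<Prod>j\<in>?R. p ^ f j)"
    using idx_pi_le(1) by (intro mult_left_mono prod_mono) auto
  finally have "p ^ f i * (\<Prod>j\<in>?R. p ^ f j) \<le> ?x i * (\<Prod>j\<in>?R. p ^ f j)" unfolding pn .
  moreover have "(\<Prod>j\<in>?R. p ^ f j) > 0" using p_pos by (intro prod_pos) auto
  ultimately show "p ^ f i \<le> ?x i" by (metis mult_le_cancel2)
qed (rule idx_pi_le(1)[OF i])

text \<open>By \<open>idx_pi\<close> there are as many digit vectors as classes modulo \<pi>_i, so
  each class has exactly one, and the class of 0 has the zero vector.\<close>

lemma coefficients_dvd_pi:
  assumes i: "i < g" and d: "(\<Sum>j<f i. of_int (d j) * \<alpha> ^ j) \<in> loc.princ (\<pi> i)" and j: "j < f i"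
  shows "int p dvd d j"
proof -
  define d' where "d' = restrict (\<lambda>j. d j mod int p) {..<f i}"
  define o' where "o' = restrict (\<lambda>j. 0::int) {..<f i}"
  have "inj_on (rep_coset i) (digits (f i))"
    using idx_pi[OF i] unfolding idx_def cosets_pi[OF i] card_digits[symmetric]
    by (intro eq_card_imp_inj_on finite_digits)
  moreover have "d' \<in> digits (f i)" "o' \<in> digits (f i)" using p_pos by (auto simp: d'_def o'_def digits_def)
  moreover have "rep_coset i d' = rep_coset i o'"
  proof -
    have "(\<Sum>j<f i. of_int (d' j) * \<alpha> ^ j) - (\<Sum>j<f i. of_int (o' j) * \<alpha> ^ j) =
       (\<Sum>j<f i. of_int (d j) * \<alpha> ^ j) - (\<Sum>j<f i. of_int (d j - d' j) * \<alpha> ^ j)"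
      by (simp add: sum_subtractf algebra_simps o'_def)
    also have "\<dots> \<in> loc.princ (\<pi> i)"
      by (intro subgrp_diff[OF loc.subgrp_princ] d subgrp_sum[OF loc.subgrp_princ] multiple_of_p_princ_pi[OF i]
          loc.power_mem alpha_Rp) (simp add: d'_def)
    finally show ?thesis unfolding rep_coset_def coset_eq_iff[OF loc.subgrp_princ] .
  qed
  ultimately have "d' = o'" by (meson inj_onD)
  then have "d' j = o' j" by simp
  then show ?thesis using j by (simp add: d'_def o'_def dvd_eq_mod_eq_0)
qed


lemma maximal_pi:
  assumes i: "i < g" and x: "x \<in> Rp" "x \<notin> loc.princ (\<pi> i)"
  shows "loc.comax x (\<pi> i)"
proof -
  define F where "F = f i"
  define m where "m = (p - 1) div F"
  have Fm: "F * m = p - 1" using f_dvd[OF i] by (simp add: m_def F_def)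
  define I where "I = loc.princ x + loc.princ (\<pi> i)"
  define E where "E z = (\<Sum>j<F. of_int (z j) * \<alpha> ^ j)" for z :: "nat \<Rightarrow> int"
  define supp where "supp z = {j. j < F \<and> \<not> int p dvd z j}" for z :: "nat \<Rightarrow> int"
  have sgI: "subgrp I" unfolding I_def by (intro subgrp_plus loc.subgrp_princ)
  have xI: "loc.princ x \<subseteq> I" and piI: "loc.princ (\<pi> i) \<subseteq> I"
    unfolding I_def by (intro plus_upper1 plus_upper2 loc.subgrp_princ)+
  have idealI: "t * y \<in> I" if t: "t \<in> I" and y: "y \<in> Rp" for t y
  proof -
    obtain b c where bc: "t = b + c" "b \<in> loc.princ x" "c \<in> loc.princ (\<pi> i)"
      using t set_plus_exhaust[of t "loc.princ x" "loc.princ (\<pi> i)"] unfolding I_def by blast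
    have "b * y \<in> I" using loc.princ_ideal[OF bc(2) y] xI by blast
    moreover have "c * y \<in> I" using loc.princ_ideal[OF bc(3) y] piI by blast
    ultimately have "b * y + c * y \<in> I" by (rule subgrp_add[OF sgI])
    then show ?thesis by (simp only: bc(1) distrib_right)
  qed
  have multI: "of_int k * t \<in> I" if "t \<in> I" for k t
    using idealI[OF that loc.of_int_mem[of k]] by (simp add: mult.commute)
  have pI: "of_int c * t \<in> I" if "int p dvd c" "t \<in> Rp" for c t
    using multiple_of_p_princ_pi[OF i that] piI by blast
  have aj: "\<alpha> ^ j \<in> Rp" for j by (intro loc.power_mem alpha_Rp)
  have divI: "t \<in> I" if c: "\<not> int p dvd c" and ct: "of_int c * t \<in> I" and t: "t \<in> Rp" for c t
  proof -
    obtain u v where uv: "u * c + v * int p = 1" by (rule bezout_p[OF c])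
    have "t = of_int (u * c + v * int p) * t" by (simp add: uv)
    also have "\<dots> = of_int u * (of_int c * t) + of_int (v * int p) * t" by (simp add: algebra_simps)
    also have "\<dots> \<in> I" by (rule subgrp_add[OF sgI multI[OF ct] pI[OF dvd_triv_right t]])
    finally show ?thesis .
  qed
  obtain z0 where z0: "x - E z0 \<in> loc.princ (\<pi> i)"
    using representatives[OF i x(1)] unfolding E_def F_def by blast
  have "x \<in> I" "x - E z0 \<in> I" using xI loc.princ_self[of x] z0 piI by blast+
  then have "x - (x - E z0) \<in> I" by (rule subgrp_diff[OF sgI])
  then have "E z0 \<in> I" by simp
  moreover have "supp z0 \<noteq> {}"
  proof
    assume "supp z0 = {}"
    then have "E z0 \<in> loc.princ (\<pi> i)"
      unfolding E_def by (intro subgrp_sum[OF loc.subgrp_princ] multiple_of_p_princ_pi[OF i] aj) (auto simp: supp_def)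
    then have "(x - E z0) + E z0 \<in> loc.princ (\<pi> i)" by (rule subgrp_add[OF loc.subgrp_princ z0])
    then show False using x(2) by simp
  qed
  ultimately obtain z where z: "E z \<in> I" "supp z \<noteq> {}"
    and zmin: "\<And>y. E y \<in> I \<Longrightarrow> supp y \<noteq> {} \<Longrightarrow> card (supp z) \<le> card (supp y)"
    using ex_has_least_nat[of "\<lambda>z. E z \<in> I \<and> supp z \<noteq> {}" z0 "\<lambda>z. card (supp z)"] by blast
  obtain k where k: "k \<in> supp z" using z(2) by blast
  then have kF: "k < F" by (simp add: supp_def)
  text \<open>
    The \<open>p\<close>-th power map is the Frobenius modulo \<open>\<pi> i\<close>; it multiplies \<open>\<alpha> ^ j\<close> by
    \<open>a i ^ (j * m)\<close>, and these factors are distinct. An element of \<open>I\<close> with minimal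
    support is therefore a monomial.
  \<close>
  have single: "supp z = {k}"
  proof (rule ccontr)
    assume "supp z \<noteq> {k}"
    then obtain l where l: "l \<in> supp z" "l \<noteq> k" using k by blast
    \<comment> \<open>The coefficients of the Frobenius image of E z minus a_i^(k m) times E z: the
      k-th one is 0, while the l-th one stays prime to p.\<close>
    define z' where "z' j = z j * (a i ^ (j * m) - a i ^ (k * m))" for j
    have summand: "(of_int (z j) * \<alpha> ^ j) ^ p - of_int (z j * a i ^ (j * m)) * \<alpha> ^ j \<in> loc.princ (\<pi> i)" if "j < F" for j
    proof -
      let ?A = "(\<alpha> ^ F) ^ (j * m)"
      \<comment> \<open>Hence \<alpha>^(j p) = \<alpha>^j (\<alpha>^F)^(j m), where \<alpha>^F is
        congruent to a_i modulo \<pi>_i.\<close>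
      have "j * p = j + F * (j * m)"
      proof -
        have "j * p = j + j * (p - 1)" using p_pos by (simp add: algebra_simps)
        then show ?thesis unfolding Fm[symmetric] by (simp add: mult_ac)
      qed
      then have "(of_int (z j) * \<alpha> ^ j) ^ p = of_int (z j ^ p) * (\<alpha> ^ j * ?A)"
        by (simp add: power_mult_distrib power_mult[symmetric] power_add[symmetric])
      then have "(of_int (z j) * \<alpha> ^ j) ^ p - of_int (z j * a i ^ (j * m)) * \<alpha> ^ j =
         of_int (z j ^ p - z j) * (\<alpha> ^ j * ?A) + (?A - of_int (a i) ^ (j * m)) * (of_int (z j) * \<alpha> ^ j)"
        by (simp add: algebra_simps)
      moreover have "of_int (z j ^ p - z j) * (\<alpha> ^ j * ?A) \<in> loc.princ (\<pi> i)"
        by (intro multiple_of_p_princ_pi[OF i] fermat_int p loc.mult_mem loc.power_mem alpha_Rp)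
      moreover have "?A - of_int (a i) ^ (j * m) \<in> loc.princ (\<pi> i)"
        using loc.princ_self[of "\<pi> i"] unfolding \<pi>_def F_def[symmetric]
        by (intro loc.power_diff_princ loc.power_mem alpha_Rp loc.of_int_mem)
      then have "(?A - of_int (a i) ^ (j * m)) * (of_int (z j) * \<alpha> ^ j) \<in> loc.princ (\<pi> i)"
        by (intro loc.princ_ideal loc.mult_mem loc.of_int_mem aj)
      ultimately show ?thesis by (simp only: subgrp_add[OF loc.subgrp_princ])
    qed
    let ?h = "\<lambda>j. of_int (z j) * \<alpha> ^ j"
    have "E z ^ p = E z * E z ^ (p - 1)" using p_pos by (simp add: power_eq_if)
    then have 1: "E z ^ p \<in> I" using idealI[OF z(1)] rep_mem_Rp unfolding E_def by (simp add: loc.power_mem)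
    have "E z ^ p - (\<Sum>j<F. ?h j ^ p) \<in> loc.princ (of_nat p)"
      unfolding E_def by (intro loc.frobenius_sum p loc.mult_mem loc.of_int_mem aj) simp
    then have 2: "E z ^ p - (\<Sum>j<F. ?h j ^ p) \<in> I"
      using princ_subset_of_mem[OF p_princ_pi[OF i]] piI by blast
    have "(\<Sum>j<F. ?h j ^ p - of_int (z j * a i ^ (j * m)) * \<alpha> ^ j) \<in> loc.princ (\<pi> i)"
      using summand by (intro subgrp_sum[OF loc.subgrp_princ]) simp
    then have 3: "(\<Sum>j<F. ?h j ^ p) - (\<Sum>j<F. of_int (z j * a i ^ (j * m)) * \<alpha> ^ j) \<in> I"
      using piI unfolding sum_subtractf by blast
    have "E z ^ p - (E z ^ p - (\<Sum>j<F. ?h j ^ p)) - ((\<Sum>j<F. ?h j ^ p) - (\<Sum>j<F. of_int (z j * a i ^ (j * m)) * \<alpha> ^ j))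
       - of_int (a i ^ (k * m)) * E z \<in> I"
      by (rule subgrp_diff[OF sgI subgrp_diff[OF sgI subgrp_diff[OF sgI 1 2] 3] multI[OF z(1)]])
    also have "E z ^ p - (E z ^ p - (\<Sum>j<F. ?h j ^ p)) - ((\<Sum>j<F. ?h j ^ p) - (\<Sum>j<F. of_int (z j * a i ^ (j * m)) * \<alpha> ^ j))
       - of_int (a i ^ (k * m)) * E z = (\<Sum>j<F. of_int (z j * a i ^ (j * m)) * \<alpha> ^ j) - of_int (a i ^ (k * m)) * E z"
      by simp
    also have "\<dots> = E z'"
      unfolding E_def z'_def by (simp add: sum_distrib_left sum_subtractf algebra_simps)
    finally have "E z' \<in> I" .
    moreover have "l \<in> supp z'"
      using l a_order[OF i, of l k] kF prime_dvd_mult_iff[OF prime_int_p]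
      by (auto simp: supp_def z'_def m_def F_def)
    moreover have "supp z' \<subseteq> supp z - {k}" by (auto simp: supp_def z'_def)
    then have "card (supp z') < card (supp z)"
      using k by (intro psubset_card_mono) (auto simp: supp_def)
    ultimately show False using zmin[of z'] by auto
  qed
  have "(\<Sum>j\<in>{..<F} - {k}. of_int (z j) * \<alpha> ^ j) \<in> I"
    using single by (intro subgrp_sum[OF sgI] pI aj) (auto simp: supp_def)
  then have "E z - (\<Sum>j\<in>{..<F} - {k}. of_int (z j) * \<alpha> ^ j) \<in> I" by (rule subgrp_diff[OF sgI z(1)])
  moreover have Ez: "E z = of_int (z k) * \<alpha> ^ k + (\<Sum>j\<in>{..<F} - {k}. of_int (z j) * \<alpha> ^ j)"
    unfolding E_def using kF by (intro sum.remove) auto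
  ultimately have zk: "of_int (z k) * \<alpha> ^ k \<in> I" by (simp only: Ez add_diff_cancel_right')
  have "\<not> int p dvd z k" using k by (simp add: supp_def)
  then have "\<alpha> ^ k \<in> I" by (rule divI[OF _ zk aj])
  \<comment> \<open>A power of \<alpha> in I brings \<alpha>^F into I, and with it a_i, which is a
    unit at p.\<close>
  then have "\<alpha> ^ k * \<alpha> ^ (F - k) \<in> I" by (intro idealI aj)
  then have "\<alpha> ^ F \<in> I" using kF by (simp add: power_add[symmetric])
  then have "\<alpha> ^ F - \<pi> i \<in> I" using piI loc.princ_self[of "\<pi> i"] by (intro subgrp_diff[OF sgI]) blast+
  then have "of_int (a i) * 1 \<in> I" by (simp add: \<pi>_def F_def)
  then have "1 \<in> I" by (rule divI[OF a_p[OF i] _ loc.one_mem])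
  then obtain b c where "1 = b + c" "b \<in> loc.princ x" "c \<in> loc.princ (\<pi> i)"
    using set_plus_exhaust[of 1 "loc.princ x" "loc.princ (\<pi> i)"] unfolding I_def by blast
  then show ?thesis unfolding loc.comax_def by (auto simp: loc.mem_princ)
qed

section \<open>Comaximality of the primes\<close>

lemma one_notin_pi: "i < g \<Longrightarrow> 1 \<notin> loc.princ (\<pi> i)"
proof
  assume i: "i < g" and 1: "1 \<in> loc.princ (\<pi> i)"
  have "(\<Sum>j<f i. of_int (if j = 0 then 1 else 0) * \<alpha> ^ j) = (\<Sum>j<f i. if j = 0 then \<alpha> ^ j else 0)"
    by (intro sum.cong) auto
  also have "\<dots> = 1" using f_pos[OF i] by (simp add: sum.delta)
  finally have "(\<Sum>j<f i. of_int (if j = 0 then 1 else 0) * \<alpha> ^ j) \<in> loc.princ (\<pi> i)" using 1 by (simp only:)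
  from coefficients_dvd_pi[OF i this f_pos[OF i]] show False using not_dvd_1 by simp
qed

lemma not_dvd_notin_pi: "i < g \<Longrightarrow> \<not> int p dvd c \<Longrightarrow> of_int c \<notin> loc.princ (\<pi> i)"
proof
  assume i: "i < g" and c: "\<not> int p dvd c" "of_int c \<in> loc.princ (\<pi> i)"
  have "of_int c * inverse (of_int c) \<in> loc.princ (\<pi> i)" by (intro loc.princ_ideal c inverse_Rp)
  moreover have "c \<noteq> 0" using c(1) by auto
  ultimately show False using one_notin_pi[OF i] by simp
qed

text \<open>If f_j = f_i, the difference of \<pi>_j and \<pi>_i is an integer prime to p. If f_j <
  f_i, then \<pi>_j is already reduced modulo \<pi>_i and has the coefficient 1.\<close>

lemma pi_notin_princ_pi:
  assumes "i < g" "j < g" "i \<noteq> j" "f j \<le> f i"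
  shows "\<pi> j \<notin> loc.princ (\<pi> i)"
proof (cases "f j = f i")
  case True
  have eq: "\<pi> j - \<pi> i = of_int (a i - a j)" by (simp add: \<pi>_def True)
  have "of_int (a i - a j) \<notin> loc.princ (\<pi> i)" by (intro not_dvd_notin_pi a_distinct assms)
  then show ?thesis
    using subgrp_diff[OF loc.subgrp_princ[of "\<pi> i"] _ loc.princ_self, of "\<pi> j"] unfolding eq by blast
next
  case False
  show ?thesis
  proof
    assume mem: "\<pi> j \<in> loc.princ (\<pi> i)"
    let ?d = "\<lambda>k. (if k = f j then 1 else 0) - (if k = 0 then a j else 0)"
    have "(\<Sum>k<f i. of_int (?d k) * \<alpha> ^ k) =
       (\<Sum>k<f i. if k = f j then \<alpha> ^ k else 0) - (\<Sum>k<f i. if k = 0 then of_int (a j) * \<alpha> ^ k else 0)"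
      unfolding sum_subtractf[symmetric] by (intro sum.cong) (auto simp: algebra_simps)
    also have "\<dots> = \<pi> j" using False assms(4) f_pos[OF assms(1)] by (simp add: sum.delta \<pi>_def)
    finally have "(\<Sum>k<f i. of_int (?d k) * \<alpha> ^ k) \<in> loc.princ (\<pi> i)" using mem by (simp only:)
    from coefficients_dvd_pi[OF assms(1) this, of "f j"] False assms(4) f_pos[OF assms(2)] not_dvd_1
    show False by simp
  qed
qed

lemma comax_pi: "i < g \<Longrightarrow> j < g \<Longrightarrow> i \<noteq> j \<Longrightarrow> loc.comax (\<pi> i) (\<pi> j)"
proof -
  assume ij: "i < g" "j < g" "i \<noteq> j"
  show ?thesis
  proof (cases "f j \<le> f i")
    case True
    have "loc.comax (\<pi> j) (\<pi> i)" by (rule maximal_pi[OF ij(1) pi_Rp pi_notin_princ_pi[OF ij True]])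
    then show ?thesis by (rule loc.comax_sym)
  next
    case False
    then show ?thesis using pi_notin_princ_pi[OF ij(2,1)] ij(3) by (intro maximal_pi[OF ij(2) pi_Rp]) auto
  qed
qed

sublocale semilocal: split_prime Rp p g \<pi> f "of_nat (p + 1)"
proof unfold_locales
  show "of_nat (p + 1) \<noteq> (0::complex)" by (simp only: of_nat_eq_0_iff)
qed (use p pi_Rp pi_nz eps_Rp prod_pi f_pos idx_pi maximal_pi comax_pi in blast)+

end

section \<open>Number fields with prescribed decomposition of a prime\<close>

interpretation C: cring complex_ring
  by (rule cring_from_type_algebra)

lemma complex_ring_simps [simp]:
  "carrier complex_ring = UNIV" "x \<otimes>\<^bsub>complex_ring\<^esub> y = x * y" "x \<oplus>\<^bsub>complex_ring\<^esub> y = x + y"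
  "\<one>\<^bsub>complex_ring\<^esub> = 1" "\<zero>\<^bsub>complex_ring\<^esub> = 0"
  by (simp_all add: ring_of_type_algebra_def)

lemma a_inv_complex_ring [simp]: "\<ominus>\<^bsub>complex_ring\<^esub> x = - x"
  by (rule C.minus_equality) simp_all

section \<open>Subrings of the complex numbers as algebraic structures\<close>

context subring_complex
begin

abbreviation cring_of :: "complex ring" where "cring_of \<equiv> complex_ring \<lparr> carrier := R \<rparr>"

lemma subring_complex_ring: "subring R complex_ring"
  by (rule C.subringI) (simp_all add: one_mem uminus_mem mult_mem add_mem)

lemma cring_cring_of: "cring cring_of"
  using C.subcringI'[OF subring_complex_ring] C.subcring_iff[of R] by simp

lemma cring_of_simps:
  "carrier cring_of = R" "x \<otimes>\<^bsub>cring_of\<^esub> y = x * y" "x \<oplus>\<^bsub>cring_of\<^esub> y = x + y"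
  "\<one>\<^bsub>cring_of\<^esub> = 1" "\<zero>\<^bsub>cring_of\<^esub> = 0"
  by (simp_all add: ring_of_type_algebra_def)

lemma a_inv_cring_of:
  assumes "x \<in> R"
  shows "\<ominus>\<^bsub>cring_of\<^esub> x = - x"
proof -
  interpret D: cring cring_of by (rule cring_cring_of)
  show ?thesis by (rule D.minus_equality) (simp_all only: cring_of_simps assms uminus_mem left_minus)
qed

lemma ideal_cring_ofI:
  assumes "subgrp I" "I \<subseteq> R" "\<And>x r. x \<in> I \<Longrightarrow> r \<in> R \<Longrightarrow> x * r \<in> I"
  shows "ideal I cring_of"
proof -
  interpret D: cring cring_of by (rule cring_cring_of)
  show ?thesis
  proof (rule idealI)
    show "ring cring_of" by (rule D.ring_axioms)
    show "subgroup I (add_monoid cring_of)"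
    proof (rule D.add.subgroupI)
      show "I \<subseteq> carrier cring_of" unfolding cring_of_simps by (rule assms(2))
      show "I \<noteq> {}" using subgrp_0[OF assms(1)] by blast
      fix x assume x: "x \<in> I"
      then have "\<ominus>\<^bsub>cring_of\<^esub> x = - x" using assms(2) by (intro a_inv_cring_of) blast
      then show "\<ominus>\<^bsub>cring_of\<^esub> x \<in> I" using subgrp_uminus[OF assms(1) x] by (simp only:)
      fix y assume "y \<in> I"
      then show "x \<oplus>\<^bsub>cring_of\<^esub> y \<in> I" unfolding cring_of_simps by (rule subgrp_add[OF assms(1) x])
    qed
    fix x r assume "x \<in> I" "r \<in> carrier cring_of"
    then have "x * r \<in> I" unfolding cring_of_simps by (rule assms(3))
    then show "r \<otimes>\<^bsub>cring_of\<^esub> x \<in> I" "x \<otimes>\<^bsub>cring_of\<^esub> r \<in> I"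
      unfolding cring_of_simps by (simp_all only: mult.commute)
  qed
qed

lemma a_r_coset_cring_of: "I +>\<^bsub>cring_of\<^esub> x = (+) x ` I"
  unfolding a_r_coset_def' cring_of_simps by (auto simp: add.commute image_iff)

lemma carrier_Quot_cring_of: "carrier (cring_of Quot I) = (\<lambda>x. I +>\<^bsub>cring_of\<^esub> x) ` R"
  by (auto simp: FactRing_def A_RCOSETS_def' cring_of_simps(1) simp del: complex_ring_simps)

lemma comax_Int:
  assumes "comax b c" "x \<in> princ b" "x \<in> princ c"
  shows "x \<in> princ (b * c)"
proof -
  obtain y z where yz: "y \<in> R" "z \<in> R" "b * y + c * z = 1" using assms(1) by (auto simp: comax_def)
  obtain r r' where r: "r \<in> R" "x = b * r" "r' \<in> R" "x = c * r'" using assms(2,3) unfolding mem_princ by blast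
  have "x = b * y * x + c * z * x" using yz(3) by (simp only: distrib_right[symmetric] mult_1_left)
  also have "b * y * x = b * c * (r' * y)" by (simp only: r(4) mult_ac)
  also have "c * z * x = b * c * (r * z)" by (simp only: r(2) mult_ac)
  finally have "x = b * c * (r' * y + r * z)" by (simp only: distrib_left)
  moreover have "r' * y + r * z \<in> R" by (intro add_mem mult_mem r yz)
  ultimately show ?thesis unfolding mem_princ by blast
qed

end

text \<open>In a shortest integral relation the constant coefficient is non-zero, as otherwise the
  relation could be divided by x; this coefficient is the multiple of x.\<close>

lemma algebraic_int_inverse_multiple:
  assumes "algebraic_int x" "x \<noteq> (0::complex)"
  shows "\<exists>c t D. (c::int) \<noteq> 0 \<and> t \<in> int_polys x D \<and> of_int c = x * t"
proof -
  define D where "D = (LEAST D. x ^ D \<in> int_polys x D)"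
  have ex: "\<exists>D. x ^ D \<in> int_polys x D" using assms(1) unfolding algebraic_int_iff_int_polys .
  have D: "x ^ D \<in> int_polys x D" unfolding D_def by (rule LeastI_ex[OF ex])
  obtain c where c: "x ^ D = (\<Sum>i<D. of_int (c i) * x ^ i)" using D by (auto simp: int_polys_def)
  have "D \<noteq> 0" using c by (intro notI) simp
  then obtain d where d: "D = Suc d" using not0_implies_Suc by blast
  let ?s = "\<Sum>i<d. of_int (c (Suc i)) * x ^ i"
  have "x ^ D = of_int (c 0) + (\<Sum>i<d. of_int (c (Suc i)) * x ^ Suc i)"
    unfolding c unfolding d sum.lessThan_Suc_shift by simp
  also have "(\<Sum>i<d. of_int (c (Suc i)) * x ^ Suc i) = x * ?s" by (simp add: sum_distrib_left mult_ac)
  finally have eq: "of_int (c 0) = x * (x ^ d - ?s)" by (simp add: d algebra_simps)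
  have s: "?s \<in> int_polys x d" by (rule int_polysI) simp
  have "c 0 \<noteq> 0"
  proof
    assume "c 0 = 0"
    then have "x ^ d = ?s" using eq assms(2) by simp
    then have "x ^ d \<in> int_polys x d" using s by simp
    then have "D \<le> d" unfolding D_def by (rule Least_le)
    then show False using d by simp
  qed
  moreover have "x ^ d - ?s \<in> int_polys x (Suc d)"
    using s int_polys_mono[of d "Suc d" x] power_in_int_polys[of d "Suc d" x]
    by (intro subgrp_diff[OF subgrp_int_polys]) auto
  ultimately show ?thesis using eq by blast
qed

context kummer
begin

section \<open>The number field and its ring of integers\<close>

definition poly_space :: "nat \<Rightarrow> complex set" where
  "poly_space m = {x. \<exists>c::int. c \<noteq> 0 \<and> of_int c * x \<in> int_polys \<alpha> m}"

definition K :: "complex set" where "K = poly_space n"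

lemma mem_K: "x \<in> K \<longleftrightarrow> (\<exists>c::int. c \<noteq> 0 \<and> of_int c * x \<in> R0)"
  by (simp add: K_def poly_space_def R0_def)

sublocale fld: subring_complex K
proof unfold_locales
  show "1 \<in> K" unfolding mem_K using order.one_mem by (intro exI[of _ 1]) simp
  fix x y assume "x \<in> K" "y \<in> K"
  then obtain c d :: int where c: "c \<noteq> 0" "of_int c * x \<in> R0" and d: "d \<noteq> 0" "of_int d * y \<in> R0"
    by (auto simp: mem_K)
  have cd: "c * d \<noteq> 0" using c(1) d(1) by simp
  have "of_int (c * d) * (x - y) = of_int d * (of_int c * x) - of_int c * (of_int d * y)"
    by (simp add: algebra_simps)
  also have "\<dots> \<in> R0" by (rule order.diff_mem[OF of_int_mult_R0[OF c(2)] of_int_mult_R0[OF d(2)]])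
  finally show "x - y \<in> K" unfolding mem_K using cd by blast
  have "of_int (c * d) * (x * y) = (of_int c * x) * (of_int d * y)" by simp
  also have "\<dots> \<in> R0" by (rule mult_R0[OF c(2) d(2)])
  finally show "x * y \<in> K" unfolding mem_K using cd by blast
qed

lemma R0_subset_K: "R0 \<subseteq> K"
  unfolding mem_K subset_iff by (intro allI impI exI[of _ 1]) simp

lemma rat_mem_K: "inverse (of_int c) \<in> K"
  unfolding mem_K using order.one_mem order.zero_mem by (cases "c = 0") (auto intro!: exI[of _ "if c = 0 then 1 else c"])

lemma inverse_mem_K:
  assumes "x \<in> K" "x \<noteq> 0"
  shows "inverse x \<in> K"
proof -
  obtain c :: int where c: "c \<noteq> 0" "of_int c * x \<in> R0" using assms(1) by (auto simp: mem_K)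
  let ?y = "of_int c * x"
  have "?y \<noteq> 0" using c(1) assms(2) by simp
  then obtain b :: int and t D where t: "b \<noteq> 0" "t \<in> int_polys ?y D" "of_int b = ?y * t"
    using algebraic_int_inverse_multiple[OF algebraic_int_R0[OF c(2)]] by blast
  have "t \<in> R0"
  proof -
    obtain z where "t = (\<Sum>i<D. of_int (z i) * ?y ^ i)" using t(2) by (auto simp: int_polys_def)
    then show ?thesis using order.sum_mem[of "{..<D}" "\<lambda>i. of_int (z i) * ?y ^ i"] of_int_mult_R0[OF order.power_mem[OF c(2)]] by simp
  qed
  then have "inverse (of_int b) * (of_int c * t) \<in> K"
    using R0_subset_K by (intro fld.mult_mem rat_mem_K fld.of_int_mem) blast
  moreover have "inverse x = inverse (of_int b) * (of_int c * t)"
  proof -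
    have "x * (inverse (of_int b) * (of_int c * t)) = inverse (of_int b) * (?y * t)" by (simp only: mult_ac)
    also have "\<dots> = 1" unfolding t(3)[symmetric] using t(1) by simp
    finally show ?thesis by (rule inverse_unique)
  qed
  ultimately show ?thesis by simp
qed

lemma subfield_K: "subfield K complex_ring"
proof (rule field.subfieldI'[OF field_from_type_algebra fld.subring_complex_ring])
  fix k assume k: "k \<in> K - {\<zero>\<^bsub>complex_ring\<^esub>}"
  then have "k \<noteq> 0" by simp
  then have "inv\<^bsub>complex_ring\<^esub> k = inverse k" by (intro C.comm_inv_char) simp_all
  then show "inv\<^bsub>complex_ring\<^esub> k \<in> K" using k inverse_mem_K[of k] by simp
qed

lemma power_notin_poly_space:
  assumes m: "m < n"
  shows "\<alpha> ^ m \<notin> poly_space m"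
proof
  assume "\<alpha> ^ m \<in> poly_space m"
  then obtain c :: int and z where c: "c \<noteq> 0" "of_int c * \<alpha> ^ m = (\<Sum>i<m. of_int (z i) * \<alpha> ^ i)"
    by (auto simp: poly_space_def int_polys_def)
  let ?w = "\<lambda>j. if j < m then z j else if j = m then - c else 0"
  have "(\<Sum>j<n. of_int (?w j) * \<alpha> ^ j) = (\<Sum>j<Suc m. of_int (?w j) * \<alpha> ^ j)"
    using m by (intro sum.mono_neutral_right) auto
  also have "\<dots> = (\<Sum>j<m. of_int (z j) * \<alpha> ^ j) - of_int c * \<alpha> ^ m" by simp
  finally have "(\<Sum>j<n. of_int (?w j) * \<alpha> ^ j) = 0" by (simp only: c(2) diff_self)
  from independent[OF this m] show False using c(1) by simp
qed

text \<open>Each power of \<alpha> enlarges the rational span by one line, which is the form in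
  which the dimension of K is built up.\<close>

lemma line_extension_poly_space: "C.line_extension \<rat> (\<alpha> ^ m) (poly_space m) = poly_space (Suc m)"
proof (intro equalityI subsetI)
  fix u assume "u \<in> C.line_extension \<rat> (\<alpha> ^ m) (poly_space m)"
  then obtain k v where kv: "k \<in> \<rat>" "v \<in> poly_space m" "u = k * \<alpha> ^ m + v"
    unfolding C.line_extension_mem_iff by auto
  obtain a' b where ab: "b > 0" "k = of_int a' / of_int b" using kv(1) by (rule Rats_cases')
  obtain c :: int where c: "c \<noteq> 0" "of_int c * v \<in> int_polys \<alpha> m" using kv(2) by (auto simp: poly_space_def)
  have "of_int (b * c) * u = of_int (a' * c) * \<alpha> ^ m + of_int b * (of_int c * v)"
    using ab(1) by (simp add: kv(3) ab(2) algebra_simps)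
  also have "\<dots> \<in> int_polys \<alpha> (Suc m)"
  proof (rule subgrp_add[OF subgrp_int_polys])
    show "of_int (a' * c) * \<alpha> ^ m \<in> int_polys \<alpha> (Suc m)"
      by (intro int_polys_of_int_mult power_in_int_polys) simp
    have "of_int c * v \<in> int_polys \<alpha> (Suc m)" using c(2) int_polys_mono[of m "Suc m" \<alpha>] by auto
    then show "of_int b * (of_int c * v) \<in> int_polys \<alpha> (Suc m)" by (rule int_polys_of_int_mult)
  qed
  finally show "u \<in> poly_space (Suc m)"
    unfolding poly_space_def using ab(1) c(1) by (intro CollectI exI[of _ "b * c"]) simp
next
  fix u assume "u \<in> poly_space (Suc m)"
  then obtain c :: int and z where c: "c \<noteq> 0" "of_int c * u = (\<Sum>i<Suc m. of_int (z i) * \<alpha> ^ i)"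
    by (auto simp: poly_space_def int_polys_def)
  let ?s = "\<Sum>i<m. of_int (z i) * \<alpha> ^ i"
  have cs: "of_int c * (?s / of_int c) = ?s" using c(1) by simp
  have "?s / of_int c \<in> poly_space m"
    unfolding poly_space_def using c(1) by (intro CollectI exI[of _ c] conjI) (auto simp only: cs int_polysI)
  moreover have "u = (of_int (z m) / of_int c) * \<alpha> ^ m + ?s / of_int c"
    using c by (simp add: field_simps)
  moreover have "of_int (z m) / of_int c \<in> (\<rat> :: complex set)" by simp
  ultimately show "u \<in> C.line_extension \<rat> (\<alpha> ^ m) (poly_space m)"
    unfolding C.line_extension_mem_iff complex_ring_simps by blast
qed

lemma number_field_K: "number_field K n"
proof -
  have "C.dimension m \<rat> (poly_space m)" if "m \<le> n" for m
    using that
  proof (induction m)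
    case 0
    have "poly_space 0 = {\<zero>\<^bsub>complex_ring\<^esub>}" by (auto simp: poly_space_def int_polys_def intro: exI[of _ 1])
    then show ?case using C.zero_dim by simp
  next
    case (Suc m)
    have "C.dimension (Suc m) \<rat> (C.line_extension \<rat> (\<alpha> ^ m) (poly_space m))"
      using Suc power_notin_poly_space[of m] by (intro C.Suc_dim) auto
    then show ?case unfolding line_extension_poly_space .
  qed
  then show ?thesis unfolding number_field_def using subfield_K by (simp add: K_def)
qed

sublocale ints: subring_complex "integers_of K"
proof unfold_locales
  show "1 \<in> integers_of K" using fld.one_mem by (simp add: integers_of_def)
  fix x y assume "x \<in> integers_of K" "y \<in> integers_of K"
  then have xy: "x \<in> K" "y \<in> K" "algebraic_int x" "algebraic_int y" by (auto simp: integers_of_def)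
  have "algebraic_int (- y)" using xy(4) by simp
  from algebraic_int_add_mult(1)[OF xy(3) this] show "x - y \<in> integers_of K"
    using fld.diff_mem[OF xy(1,2)] by (simp add: integers_of_def)
  show "x * y \<in> integers_of K"
    using algebraic_int_add_mult(2)[OF xy(3,4)] fld.mult_mem[OF xy(1,2)] by (simp add: integers_of_def)
qed

lemma R0_subset_ints: "R0 \<subseteq> integers_of K"
  using R0_subset_K algebraic_int_R0 by (auto simp: integers_of_def)

text \<open>Comaximal principal ideals intersect in their product, and the product of the \<pi>_i
  generates the same ideal as p.\<close>

lemma princ_p_eq_Inter:
  assumes "\<And>i. i < g \<Longrightarrow> x \<in> loc.princ (\<pi> i)"
  shows "x \<in> loc.princ (of_nat p)"
proof -
  have x: "x \<in> Rp" using assms[OF g_pos] loc.princ_subset[OF pi_Rp] by blast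
  have "x \<in> loc.princ (\<Prod>i<m. \<pi> i)" if "m \<le> g" for m
    using that
  proof (induction m)
    case 0
    show ?case using x by (simp add: loc.princ_1)
  next
    case (Suc m)
    have "loc.comax (\<Prod>i<m. \<pi> i) (\<pi> m)"
      using Suc.prems by (intro loc.comax_prod pi_Rp conjI comax_pi) auto
    moreover have "x \<in> loc.princ (\<Prod>i<m. \<pi> i)" using Suc by simp
    moreover have "x \<in> loc.princ (\<pi> m)" using assms Suc.prems by simp
    ultimately have "x \<in> loc.princ ((\<Prod>i<m. \<pi> i) * \<pi> m)" by (rule loc.comax_Int)
    then show ?case by simp
  qed
  from this[OF order_refl] show ?thesis unfolding princ_prod_pi .
qed

text \<open>
  \<open>Rp\<close> is integrally closed at \<open>p\<close>: if \<open>y\<close> is integral, a power of \<open>p * y\<close> is divisible by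
  \<open>p\<close>, and \<open>p\<close> generates the product of the distinct maximal ideals, hence a radical ideal.
\<close>

lemma Rp_divide_p:
  assumes y: "algebraic_int y" and py: "of_nat p * y \<in> Rp"
  shows "y \<in> Rp"
proof -
  let ?w = "of_nat p * y"
  obtain D where "y ^ D \<in> int_polys y D" using y unfolding algebraic_int_iff_int_polys by blast
  then obtain c where c: "y ^ D = (\<Sum>i<D. of_int (c i) * y ^ i)" by (auto simp: int_polys_def)
  \<comment> \<open>Multiplied by p^D, the integral equation of y becomes one for p y in which all
    lower coefficients are divisible by p.\<close>
  have "?w ^ D = of_nat p * (\<Sum>i<D. of_int (c i) * (of_nat p ^ (D - Suc i) * ?w ^ i))"
  proof -
    have "?w ^ D = (\<Sum>i<D. of_nat p ^ D * (of_int (c i) * y ^ i))"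
      unfolding power_mult_distrib c sum_distrib_left ..
    also have "\<dots> = (\<Sum>i<D. of_nat p * (of_int (c i) * (of_nat p ^ (D - Suc i) * ?w ^ i)))"
    proof (rule sum.cong[OF refl])
      fix i assume "i \<in> {..<D}"
      then have "D = Suc (D - Suc i + i)" by simp
      then have "(of_nat p :: complex) ^ D = of_nat p * (of_nat p ^ (D - Suc i) * of_nat p ^ i)"
        by (metis power_Suc power_add)
      then show "of_nat p ^ D * (of_int (c i) * y ^ i) = of_nat p * (of_int (c i) * (of_nat p ^ (D - Suc i) * ?w ^ i))"
        unfolding power_mult_distrib by (simp only: mult_ac)
    qed
    finally show ?thesis unfolding sum_distrib_left .
  qed
  moreover have "(\<Sum>i<D. of_int (c i) * (of_nat p ^ (D - Suc i) * ?w ^ i)) \<in> Rp"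
    by (rule loc.sum_mem, rule loc.mult_mem[OF loc.of_int_mem],
        rule loc.mult_mem[OF loc.power_mem[OF loc.of_nat_mem] loc.power_mem[OF py]])
  ultimately have wD: "?w ^ D \<in> loc.princ (of_nat p)" unfolding loc.mem_princ by blast
  have "?w \<in> loc.princ (\<pi> i)" if i: "i < g" for i
  proof (rule ccontr)
    assume "?w \<notin> loc.princ (\<pi> i)"
    then have "loc.comax ?w (\<pi> i)" by (rule maximal_pi[OF i py])
    then have "loc.comax (?w ^ D) (\<pi> i)" by (rule loc.comax_power[OF py pi_Rp])
    then obtain y z where yz: "y \<in> Rp" "z \<in> Rp" "?w ^ D * y + \<pi> i * z = 1" by (auto simp: loc.comax_def)
    have "?w ^ D \<in> loc.princ (\<pi> i)" using wD princ_subset_of_mem[OF p_princ_pi[OF i]] by blast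
    from subgrp_add[OF loc.subgrp_princ loc.princ_ideal[OF this yz(1)] loc.princ_ideal[OF loc.princ_self yz(2)]]
    show False unfolding yz(3) using one_notin_pi[OF i] by blast
  qed
  then have "?w \<in> loc.princ (of_nat p)" by (rule princ_p_eq_Inter)
  then obtain r where r: "r \<in> Rp" "?w = of_nat p * r" by (auto simp: loc.mem_princ)
  then have "y = r" using p_pos by simp
  then show ?thesis using r(1) by simp
qed

text \<open>The factors p of a denominator are removed one at a time by \<open>Rp_divide_p\<close>,
  until it is prime to p.\<close>

lemma ints_subset_Rp: "integers_of K \<subseteq> Rp"
proof
  fix y assume "y \<in> integers_of K"
  then have y: "y \<in> K" "algebraic_int y" by (auto simp: integers_of_def)
  then obtain c :: int where c: "c \<noteq> 0" "of_int c * y \<in> R0" by (auto simp: mem_K)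
  have "y \<in> Rp" if "algebraic_int y" "of_int c * y \<in> R0" "c \<noteq> 0" for y and c :: int
    using that
  proof (induction "nat \<bar>c\<bar>" arbitrary: c y rule: less_induct)
    case less
    show ?case
    proof (cases "int p dvd c")
      case False
      then show ?thesis unfolding Rp_def using less.prems(2) by blast
    next
      case True
      then obtain b where b: "c = int p * b" by auto
      have b0: "b \<noteq> 0" using less.prems(3) b by auto
      have "\<bar>b\<bar> * 1 < \<bar>b\<bar> * int p" using b0 p_pos by (intro mult_strict_left_mono) auto
      then have lt: "nat \<bar>b\<bar> < nat \<bar>c\<bar>" unfolding b by (simp add: abs_mult mult.commute)
      have ai: "algebraic_int (of_nat p * y)" by (intro algebraic_int_add_mult(2) less.prems(1)) simp
      have "of_int b * (of_nat p * y) \<in> R0" using less.prems(2) unfolding b by (simp add: mult_ac)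
      from less.hyps[OF lt ai this b0] show ?thesis by (rule Rp_divide_p[OF less.prems(1)])
    qed
  qed
  from this[OF y(2) c(2,1)] show "y \<in> Rp" .
qed

lemma Rp_eq_localization: "Rp = {x. \<exists>c::int. \<not> int p dvd c \<and> of_int c * x \<in> integers_of K}"
proof (intro equalityI subsetI)
  fix x assume "x \<in> Rp"
  then show "x \<in> {x. \<exists>c::int. \<not> int p dvd c \<and> of_int c * x \<in> integers_of K}"
    using R0_subset_ints unfolding Rp_def by blast
next
  fix x assume "x \<in> {x. \<exists>c::int. \<not> int p dvd c \<and> of_int c * x \<in> integers_of K}"
  then obtain c :: int where c: "\<not> int p dvd c" "of_int c * x \<in> Rp" using ints_subset_Rp by blast
  have "inverse (of_int c) * (of_int c * x) \<in> Rp" by (rule loc.mult_mem[OF inverse_Rp[OF c(1)] c(2)])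
  moreover have "c \<noteq> 0" using c(1) by auto
  then have "inverse (of_int c) * (of_int c * x) = x" by simp
  ultimately show "x \<in> Rp" by simp
qed

section \<open>The primes above p in the ring of integers\<close>

definition prime_above :: "nat \<Rightarrow> complex set" where
  "prime_above i = loc.princ (\<pi> i) \<inter> integers_of K"

lemma pi_prime_above: "\<pi> i \<in> prime_above i"
  using pi_R0 R0_subset_ints loc.princ_self unfolding prime_above_def by blast

lemma subgrp_prime_above: "subgrp (prime_above i)"
  unfolding prime_above_def by (intro subgrp_Int loc.subgrp_princ ints.subgrp_R)

lemma ideal_prime_above: "ideal (prime_above i) ints.cring_of"
proof (rule ints.ideal_cring_ofI[OF subgrp_prime_above])
  fix x r assume "x \<in> prime_above i" "r \<in> integers_of K"
  then show "x * r \<in> prime_above i"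
    using loc.princ_ideal[of x "\<pi> i" r] ints.mult_mem[of x r] ints_subset_Rp unfolding prime_above_def by blast
qed (simp add: prime_above_def)

lemma primeideal_prime_above:
  assumes i: "i < g"
  shows "primeideal (prime_above i) ints.cring_of"
proof (rule primeidealI[OF ideal_prime_above ints.cring_cring_of])
  show "carrier ints.cring_of \<noteq> prime_above i"
    unfolding ints.cring_of_simps prime_above_def using one_notin_pi[OF i] ints.one_mem by blast
  fix x y assume "x \<in> carrier ints.cring_of" "y \<in> carrier ints.cring_of" and xy: "x \<otimes>\<^bsub>ints.cring_of\<^esub> y \<in> prime_above i"
  then have x: "x \<in> integers_of K" and y: "y \<in> integers_of K" unfolding ints.cring_of_simps by blast+
  have xy: "x * y \<in> loc.princ (\<pi> i)" using xy unfolding ints.cring_of_simps prime_above_def by blast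
  have "y \<in> loc.princ (\<pi> i)" if nx: "x \<notin> loc.princ (\<pi> i)"
  proof -
    have yR: "y \<in> Rp" and xR: "x \<in> Rp" using x y ints_subset_Rp by blast+
    obtain r s where rs: "r \<in> Rp" "s \<in> Rp" "x * r + \<pi> i * s = 1"
      using maximal_pi[OF i xR nx] by (auto simp: loc.comax_def)
    have "x * y * r + \<pi> i * (s * y) \<in> loc.princ (\<pi> i)"
      by (rule subgrp_add[OF loc.subgrp_princ loc.princ_ideal[OF xy rs(1)]
          loc.princ_ideal[OF loc.princ_self loc.mult_mem[OF rs(2) yR]]])
    also have "x * y * r + \<pi> i * (s * y) = (x * r + \<pi> i * s) * y" by (simp add: algebra_simps)
    finally show ?thesis unfolding rs(3) by simp
  qed
  then show "x \<in> prime_above i \<or> y \<in> prime_above i" using x y unfolding prime_above_def by blast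
qed

text \<open>The classes of the powers of \<alpha> below f_i form a basis: they span by
  \<open>representatives\<close> and are independent by \<open>coefficients_dvd_pi\<close>.\<close>

lemma residue_dimension:
  assumes i: "i < g"
  shows "ring.dimension (ints.cring_of Quot prime_above i) (f i)
    (range (\<lambda>m::int. prime_above i +>\<^bsub>ints.cring_of\<^esub> of_int m)) (carrier (ints.cring_of Quot prime_above i))"
proof -
  let ?P = "prime_above i" and ?D = "ints.cring_of"
  interpret P: ideal ?P ?D by (rule ideal_prime_above)
  interpret Q: ring "?D Quot ?P" by (rule P.quotient_is_ring)
  define q where "q x = ?P +>\<^bsub>?D\<^esub> x" for x
  have hom: "q \<in> ring_hom ?D (?D Quot ?P)" unfolding q_def using P.rcos_ring_hom by simp
  have q_add: "q (x + y) = q x \<oplus>\<^bsub>?D Quot ?P\<^esub> q y" if "x \<in> integers_of K" "y \<in> integers_of K" for x y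
    using ring_hom_add[OF hom, of x y] that unfolding ints.cring_of_simps by blast
  have q_mult: "q (x * y) = q x \<otimes>\<^bsub>?D Quot ?P\<^esub> q y" if "x \<in> integers_of K" "y \<in> integers_of K" for x y
    using ring_hom_mult[OF hom, of x y] that unfolding ints.cring_of_simps by blast
  have q_0: "q 0 = \<zero>\<^bsub>?D Quot ?P\<^esub>"
    using ring_hom_zero[OF hom] P.ring_axioms Q.ring_axioms unfolding ints.cring_of_simps by blast
  have q_eq: "q x = q y \<longleftrightarrow> x - y \<in> ?P" for x y
    unfolding q_def ints.a_r_coset_cring_of by (rule coset_eq_iff[OF subgrp_prime_above])
  have carrier: "carrier (?D Quot ?P) = q ` integers_of K"
    unfolding ints.carrier_Quot_cring_of q_def ..
  have pw: "\<alpha> ^ m \<in> integers_of K" for m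
    using order.power_mem[OF alpha_R0] R0_subset_ints by blast
  have polys: "int_polys \<alpha> m \<subseteq> integers_of K" for m
    unfolding int_polys_def by (auto intro!: ints.sum_mem ints.mult_mem ints.of_int_mem pw)
  let ?F = "range (\<lambda>m::int. q (of_int m))"
  have "Q.dimension m ?F (q ` int_polys \<alpha> m)" if "m \<le> f i" for m
    using that
  proof (induction m)
    case 0
    have "q ` int_polys \<alpha> 0 = {\<zero>\<^bsub>?D Quot ?P\<^esub>}" using q_0 by (auto simp: int_polys_def)
    then show ?case using Q.zero_dim by (simp only:)
  next
    case (Suc m)
    have notin: "q (\<alpha> ^ m) \<notin> q ` int_polys \<alpha> m"
    proof
      assume "q (\<alpha> ^ m) \<in> q ` int_polys \<alpha> m"
      then obtain z where "\<alpha> ^ m - (\<Sum>j<m. of_int (z j) * \<alpha> ^ j) \<in> ?P"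
        by (auto simp: int_polys_def q_eq)
      then have mem: "\<alpha> ^ m - (\<Sum>j<m. of_int (z j) * \<alpha> ^ j) \<in> loc.princ (\<pi> i)"
        unfolding prime_above_def by blast
      let ?w = "\<lambda>j. if j < m then - z j else if j = m then 1 else 0"
      have "(\<Sum>j<f i. of_int (?w j) * \<alpha> ^ j) = (\<Sum>j<Suc m. of_int (?w j) * \<alpha> ^ j)"
        using Suc.prems by (intro sum.mono_neutral_right) auto
      also have "\<dots> = \<alpha> ^ m - (\<Sum>j<m. of_int (z j) * \<alpha> ^ j)" by (simp add: sum_negf)
      finally have "(\<Sum>j<f i. of_int (?w j) * \<alpha> ^ j) \<in> loc.princ (\<pi> i)" using mem by (simp only:)
      from coefficients_dvd_pi[OF i this, of m] show False using Suc.prems not_dvd_1 by simp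
    qed
    have "q ` int_polys \<alpha> (Suc m) = Q.line_extension ?F (q (\<alpha> ^ m)) (q ` int_polys \<alpha> m)"
    proof (intro equalityI subsetI)
      fix u assume "u \<in> q ` int_polys \<alpha> (Suc m)"
      then obtain z where "u = q (\<Sum>j<Suc m. of_int (z j) * \<alpha> ^ j)" by (auto simp: int_polys_def)
      then have u: "u = q (of_int (z m) * \<alpha> ^ m + (\<Sum>j<m. of_int (z j) * \<alpha> ^ j))" by (simp add: add.commute)
      have s: "(\<Sum>j<m. of_int (z j) * \<alpha> ^ j) \<in> int_polys \<alpha> m" by (rule int_polysI) simp
      have "u = q (of_int (z m)) \<otimes>\<^bsub>?D Quot ?P\<^esub> q (\<alpha> ^ m) \<oplus>\<^bsub>?D Quot ?P\<^esub> q (\<Sum>j<m. of_int (z j) * \<alpha> ^ j)"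
        unfolding u q_mult[OF ints.of_int_mem pw, symmetric]
        by (rule q_add[OF ints.mult_mem[OF ints.of_int_mem pw] subsetD[OF polys s]])
      then show "u \<in> Q.line_extension ?F (q (\<alpha> ^ m)) (q ` int_polys \<alpha> m)"
        unfolding Q.line_extension_mem_iff using s by blast
    next
      fix u assume "u \<in> Q.line_extension ?F (q (\<alpha> ^ m)) (q ` int_polys \<alpha> m)"
      then obtain c :: int and e where e: "e \<in> int_polys \<alpha> m"
        and u: "u = q (of_int c) \<otimes>\<^bsub>?D Quot ?P\<^esub> q (\<alpha> ^ m) \<oplus>\<^bsub>?D Quot ?P\<^esub> q e"
        unfolding Q.line_extension_mem_iff by blast
      have "u = q (of_int c * \<alpha> ^ m + e)"
        unfolding u q_mult[OF ints.of_int_mem pw, symmetric]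
        by (rule q_add[OF ints.mult_mem[OF ints.of_int_mem pw] subsetD[OF polys e], symmetric])
      moreover have "of_int c * \<alpha> ^ m + e \<in> int_polys \<alpha> (Suc m)"
        using e int_polys_mono[of m "Suc m" \<alpha>] power_in_int_polys[of m "Suc m" \<alpha>]
        by (intro subgrp_add[OF subgrp_int_polys] int_polys_of_int_mult) auto
      ultimately show "u \<in> q ` int_polys \<alpha> (Suc m)" by blast
    qed
    moreover have "Q.dimension (Suc m) ?F (Q.line_extension ?F (q (\<alpha> ^ m)) (q ` int_polys \<alpha> m))"
      using Suc notin pw unfolding carrier by (intro Q.Suc_dim) (auto simp: carrier)
    ultimately show ?case by (simp only:)
  qed
  moreover have "q ` int_polys \<alpha> (f i) = carrier (?D Quot ?P)"
    unfolding carrier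
  proof (rule equalityI)
    show "q ` int_polys \<alpha> (f i) \<subseteq> q ` integers_of K" by (rule image_mono[OF polys])
    show "q ` integers_of K \<subseteq> q ` int_polys \<alpha> (f i)"
    proof
      fix u assume "u \<in> q ` integers_of K"
      then obtain x where x: "x \<in> integers_of K" "u = q x" by blast
      obtain z where z: "x - (\<Sum>j<f i. of_int (z j) * \<alpha> ^ j) \<in> loc.princ (\<pi> i)"
        using representatives[OF i subsetD[OF ints_subset_Rp x(1)]] by blast
      have s: "(\<Sum>j<f i. of_int (z j) * \<alpha> ^ j) \<in> int_polys \<alpha> (f i)" by (rule int_polysI) simp
      have "x - (\<Sum>j<f i. of_int (z j) * \<alpha> ^ j) \<in> ?P"
        unfolding prime_above_def using z ints.diff_mem[OF x(1) subsetD[OF polys s]] by blast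
      then have "u = q (\<Sum>j<f i. of_int (z j) * \<alpha> ^ j)" unfolding x(2) q_eq .
      then show "u \<in> q ` int_polys \<alpha> (f i)" using s by blast
    qed
  qed
  ultimately show ?thesis unfolding q_def by (metis order_refl)
qed

text \<open>An element of the intersection is p r with r in the localisation. Both p r and some c r
  with c prime to p are integral, hence r is, by Bezout.\<close>

lemma Inter_prime_above: "(\<Inter>i<g. prime_above i) = {x * of_nat p | x. x \<in> integers_of K}"
proof (intro equalityI subsetI)
  fix x assume x: "x \<in> (\<Inter>i<g. prime_above i)"
  then have xi: "x \<in> loc.princ (\<pi> i)" if "i < g" for i using that unfolding prime_above_def by blast
  have xO: "x \<in> integers_of K" using x g_pos unfolding prime_above_def by blast
  have "x \<in> loc.princ (of_nat p)" by (rule princ_p_eq_Inter[OF xi])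
  then obtain r where r: "r \<in> Rp" "x = of_nat p * r" by (auto simp: loc.mem_princ)
  obtain c :: int where c: "\<not> int p dvd c" "of_int c * r \<in> integers_of K"
    using r(1) unfolding Rp_eq_localization by blast
  obtain u v where uv: "u * c + v * int p = 1" by (rule bezout_p[OF c(1)])
  have "r = of_int (u * c + v * int p) * r" by (simp add: uv)
  also have "\<dots> = of_int u * (of_int c * r) + of_int v * x" by (simp add: r(2) algebra_simps)
  also have "\<dots> \<in> integers_of K"
    by (rule ints.add_mem[OF ints.mult_mem[OF ints.of_int_mem c(2)] ints.mult_mem[OF ints.of_int_mem xO]])
  finally show "x \<in> {x * of_nat p | x. x \<in> integers_of K}" using r(2) by (auto simp: mult.commute)
next
  fix x assume "x \<in> {x * of_nat p | x. x \<in> integers_of K}"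
  then obtain r where r: "x = of_nat p * r" "r \<in> integers_of K" by (auto simp: mult.commute)
  have "x \<in> loc.princ (\<pi> i)" if "i < g" for i
    unfolding r(1) using r(2) ints_subset_Rp by (intro loc.princ_ideal p_princ_pi that) blast
  moreover have "x \<in> integers_of K" unfolding r(1) by (rule ints.mult_mem[OF ints.of_nat_mem r(2)])
  ultimately show "x \<in> (\<Inter>i<g. prime_above i)" unfolding prime_above_def by blast
qed

text \<open>A relation \<pi>_i y + \<pi>_j z = 1 over the localisation becomes integral after
  multiplication by an integer prime to p. As p itself lies in the sum of the two ideals, so does
  1.\<close>

lemma prime_above_comaximal:
  assumes ij: "i < g" "j < g" "i \<noteq> j"
  shows "prime_above i <+>\<^bsub>ints.cring_of\<^esub> prime_above j = carrier ints.cring_of"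
proof -
  have sum: "prime_above i <+>\<^bsub>ints.cring_of\<^esub> prime_above j = prime_above i + prime_above j"
    unfolding set_add_def' ints.cring_of_simps set_plus_def by blast
  have sg: "subgrp (prime_above i + prime_above j)" by (intro subgrp_plus subgrp_prime_above)
  obtain y z where yz: "y \<in> Rp" "z \<in> Rp" "\<pi> i * y + \<pi> j * z = 1"
    using comax_pi[OF ij] by (auto simp: loc.comax_def)
  obtain b c :: int where b: "\<not> int p dvd b" "of_int b * y \<in> R0" and c: "\<not> int p dvd c" "of_int c * z \<in> R0"
    using yz unfolding Rp_def by blast
  have mem: "\<pi> k * t \<in> prime_above k" if t: "t \<in> R0" for k t
    unfolding prime_above_def
    using loc.princ_ideal[OF loc.princ_self, of t "\<pi> k"] t R0_subset_Rp R0_subset_ints mult_R0[OF pi_R0 t, of k] by blast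
  have "\<pi> i * (of_int c * (of_int b * y)) + \<pi> j * (of_int b * (of_int c * z)) \<in> prime_above i + prime_above j"
    by (rule set_plus_intro[OF mem[OF of_int_mult_R0[OF b(2)]] mem[OF of_int_mult_R0[OF c(2)]]])
  moreover have "\<pi> i * (of_int c * (of_int b * y)) + \<pi> j * (of_int b * (of_int c * z)) = of_int (b * c) * (\<pi> i * y + \<pi> j * z)"
    by (simp add: algebra_simps)
  ultimately have bc: "of_int (b * c) \<in> prime_above i + prime_above j" unfolding yz(3) by simp
  have pm: "of_nat p \<in> prime_above i + prime_above j"
    using p_princ_pi[OF ij(1)] ints.of_nat_mem[of p] plus_upper1[OF subgrp_prime_above, of "prime_above i" j]
    unfolding prime_above_def by blast
  obtain u v where uv: "u * (b * c) + v * int p = 1" by (rule bezout_p[OF not_dvd_mult[OF b(1) c(1)]])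
  have "real_of_int u *\<^sub>R of_int (b * c) + real_of_int v *\<^sub>R of_nat p \<in> prime_above i + prime_above j"
    by (rule subgrp_add[OF sg subgrp_of_int[OF sg bc] subgrp_of_int[OF sg pm]])
  moreover have "real_of_int u *\<^sub>R of_int (b * c) + real_of_int v *\<^sub>R of_nat p = (of_int (u * (b * c) + v * int p) :: complex)"
    by (simp add: scaleR_conv_of_real)
  ultimately have one: "1 \<in> prime_above i + prime_above j" unfolding uv by simp
  obtain s t where st: "1 = s + t" "s \<in> prime_above i" "t \<in> prime_above j"
    using set_plus_exhaust[OF one] by blast
  have "r \<in> prime_above i + prime_above j" if r: "r \<in> integers_of K" for r
  proof -
    have "r = s * r + t * r" using st(1) by (simp only: distrib_right[symmetric]) simp
    moreover have "s * r \<in> prime_above i" "t * r \<in> prime_above j"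
      using ideal.I_r_closed[OF ideal_prime_above st(2), of r] ideal.I_r_closed[OF ideal_prime_above st(3), of r] r
      unfolding ints.cring_of_simps by blast+
    ultimately show ?thesis using set_plus_intro by metis
  qed
  moreover have "prime_above i + prime_above j \<subseteq> integers_of K"
    by (rule plus_least[OF ints.subgrp_R]) (auto simp: prime_above_def)
  ultimately show ?thesis unfolding sum ints.cring_of_simps by blast
qed

text \<open>The product of pairwise comaximal ideals is their intersection, which
  \<open>Inter_prime_above\<close> identifies with the ideal generated by p.\<close>

lemma decomposition_type_K:
  assumes "length fs = g" "\<And>i. i < g \<Longrightarrow> fs ! i = f i"
  shows "decomposition_type K p (replicate g 1) fs"
proof -
  interpret D: cring ints.cring_of by (rule ints.cring_cring_of)
  interpret I: comm_monoid "ideals_set ints.cring_of" by (rule D.ideals_set_is_comm_monoid)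
  have ring: "ring_of_integers K = ints.cring_of" by (simp add: ring_of_integers_def)
  have inj: "inj_on prime_above {..<g}"
  proof (rule inj_onI, rule ccontr)
    fix i j assume ij: "i \<in> {..<g}" "j \<in> {..<g}" "prime_above i = prime_above j" "i \<noteq> j"
    have "\<pi> i \<in> prime_above j" using pi_prime_above[of i] ij(3) by (simp only:)
    then have "\<pi> i \<in> loc.princ (\<pi> j)" unfolding prime_above_def by blast
    moreover obtain y z where yz: "y \<in> Rp" "z \<in> Rp" "\<pi> i * y + \<pi> j * z = 1"
      using comax_pi[of i j] ij by (auto simp: loc.comax_def)
    ultimately have "\<pi> i * y + \<pi> j * z \<in> loc.princ (\<pi> j)"
      by (intro subgrp_add[OF loc.subgrp_princ] loc.princ_ideal loc.princ_self)
    then show False using one_notin_pi[of j] ij(2) unfolding yz(3) by simp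
  qed
  have carr: "prime_above i \<in> carrier (ideals_set ints.cring_of)" for i
    using ideal_prime_above by (simp add: ideals_set_def)
  obtain m where "g = Suc m" using g_pos not0_implies_Suc by blast
  then have lt: "{..<g} = {..m}" by auto
  have "(\<Otimes>\<^bsub>ideals_set ints.cring_of\<^esub> i\<in>{..<g}. prime_above i [^]\<^bsub>ideals_set ints.cring_of\<^esub> (replicate g 1 ! i :: nat)) =
      (\<Otimes>\<^bsub>ideals_set ints.cring_of\<^esub> i\<in>{..<g}. prime_above i)"
    by (rule I.finprod_cong') (use carr I.nat_pow_eone in \<open>auto simp del: One_nat_def\<close>)
  also have "\<dots> = (\<Inter>i\<in>{..<g}. prime_above i)"
    unfolding lt
  proof (rule D.ideal_prod_eq_Inter)
    show "prime_above \<in> {..m} \<rightarrow> {J. ideal J ints.cring_of}" using ideal_prime_above by blast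
    fix i j assume "i \<in> {..m}" "j \<in> {..m}" "i \<noteq> j"
    then show "prime_above i <+>\<^bsub>ints.cring_of\<^esub> prime_above j = carrier ints.cring_of"
      unfolding lt[symmetric] by (intro prime_above_comaximal) auto
  qed
  also have "\<dots> = PIdl\<^bsub>ints.cring_of\<^esub> (of_nat p)"
    unfolding Inter_prime_above cgenideal_def ints.cring_of_simps ..
  also have "\<dots> = Idl\<^bsub>ints.cring_of\<^esub> {of_nat p}"
    by (rule D.cgenideal_eq_genideal) (simp only: ints.cring_of_simps ints.of_nat_mem)
  finally have idl: "Idl\<^bsub>ints.cring_of\<^esub> {of_nat p} = (\<Otimes>\<^bsub>ideals_set ints.cring_of\<^esub> i\<in>{..<g}.
     prime_above i [^]\<^bsub>ideals_set ints.cring_of\<^esub> (replicate g 1 ! i :: nat))" ..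
  show ?thesis
    unfolding decomposition_type_def ring residue_prime_field_def assms(1)
    using inj idl primeideal_prime_above residue_dimension assms(2)
    by (intro conjI exI[of _ prime_above] allI impI) simp_all
qed

end

section \<open>Normal subgroups of Heisenberg groups\<close>

lemma bezout_prime_power:
  assumes "Factorial_Ring.prime p" "\<not> int p dvd c"
  shows "\<exists>u v. u * c + v * int (p ^ k) = 1"
proof -
  have "coprime (int p) c" using assms by (intro prime_imp_coprime) auto
  then have "coprime c (int (p ^ k))" by (simp add: coprime_commute)
  then have "gcd c (int (p ^ k)) = 1" by (simp only: coprime_iff_gcd_eq_1)
  then show ?thesis using bezout_int[of c "int (p ^ k)"] by simp
qed

lemma not_dvd_prime_mult:
  "Factorial_Ring.prime p \<Longrightarrow> \<not> int p dvd c \<Longrightarrow> \<not> int p dvd d \<Longrightarrow> \<not> int p dvd c * d"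
  by (simp add: prime_dvd_mult_iff)

text \<open>E' consists of fractions of elements of E with denominators prime to p. On subgroups of
  p-power index, saturation in E' and intersection with E are inverse to each other.\<close>

locale prime_to_p_extension =
  fixes E E' :: "'a::real_vector set" and p :: nat
  assumes p: "Factorial_Ring.prime p" and E: "subgrp E" and E': "subgrp E'" and sub: "E \<subseteq> E'"
    and ext: "x \<in> E' \<Longrightarrow> \<exists>c::int. \<not> int p dvd c \<and> real_of_int c *\<^sub>R x \<in> E"
begin

definition saturate :: "'a set \<Rightarrow> 'a set" where
  "saturate N = {x \<in> E'. \<exists>c::int. \<not> int p dvd c \<and> real_of_int c *\<^sub>R x \<in> N}"

lemma not_dvd_1: "\<not> int p dvd 1"
  using p by auto

lemma subset_saturate: "N \<subseteq> E' \<Longrightarrow> N \<subseteq> saturate N"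
  unfolding saturate_def using not_dvd_1 by (auto intro!: exI[of _ 1])

lemma subgrp_saturate:
  assumes "subgrp N"
  shows "subgrp (saturate N)"
proof (rule subgrpI)
  show "0 \<in> saturate N"
    unfolding saturate_def using subgrp_0[OF E'] subgrp_0[OF assms] not_dvd_1 by (auto intro!: exI[of _ 1])
  fix x y assume "x \<in> saturate N" "y \<in> saturate N"
  then obtain c d where c: "\<not> int p dvd c" "real_of_int c *\<^sub>R x \<in> N" "x \<in> E'"
    and d: "\<not> int p dvd d" "real_of_int d *\<^sub>R y \<in> N" "y \<in> E'" by (auto simp: saturate_def)
  have "real_of_int d *\<^sub>R (real_of_int c *\<^sub>R x) - real_of_int c *\<^sub>R (real_of_int d *\<^sub>R y) \<in> N"
    by (rule subgrp_diff[OF assms subgrp_of_int[OF assms c(2)] subgrp_of_int[OF assms d(2)]])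
  then have "real_of_int (c * d) *\<^sub>R (x - y) \<in> N" by (simp add: algebra_simps)
  then show "x - y \<in> saturate N"
    using not_dvd_prime_mult[OF p c(1) d(1)] subgrp_diff[OF E' c(3) d(3)] unfolding saturate_def by blast
qed

lemma combine:
  assumes "subgrp H" "u * c + v * int (p ^ k) = 1" "real_of_int c *\<^sub>R x \<in> H" "real (p ^ k) *\<^sub>R x \<in> H"
  shows "x \<in> H"
proof -
  have "real_of_int u *\<^sub>R (real_of_int c *\<^sub>R x) + real_of_int v *\<^sub>R (real (p ^ k) *\<^sub>R x) =
     real_of_int (u * c + v * int (p ^ k)) *\<^sub>R x"
    by (simp add: scaleR_add_left)
  also have "\<dots> = x" by (simp only: assms(2) of_int_1 scaleR_one)
  finally show ?thesis
    using subgrp_add[OF assms(1) subgrp_of_int[OF assms(1,3), of u] subgrp_of_int[OF assms(1,4), of v]] by simp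
qed

lemma combine_plus:
  assumes H: "subgrp H" and x: "x \<in> E'" and pk: "\<And>x. x \<in> E' \<Longrightarrow> real (p ^ k) *\<^sub>R x \<in> H"
  shows "x \<in> E + H"
proof -
  obtain c where c: "\<not> int p dvd c" "real_of_int c *\<^sub>R x \<in> E" using ext[OF x] by blast
  obtain u v where uv: "u * c + v * int (p ^ k) = 1" using bezout_prime_power[OF p c(1)] by blast
  show ?thesis
  proof (rule combine[OF subgrp_plus[OF E H] uv])
    show "real_of_int c *\<^sub>R x \<in> E + H" using c(2) plus_upper1[OF H] by blast
    show "real (p ^ k) *\<^sub>R x \<in> E + H" using pk[OF x] plus_upper2[OF E] by blast
  qed
qed

text \<open>By Lagrange p^k E lies in N. Bezout for p^k and a denominator prime to p then recovers N
  from its saturation and shows that E and the saturation together generate E', so the index is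
  preserved.\<close>

lemma
  assumes N: "subgrp N" "N \<subseteq> E" "idx E N = p ^ k"
  shows saturate_Int: "E \<inter> saturate N = N" and idx_saturate: "idx E' (saturate N) = p ^ k"
proof -
  have "p ^ k > 0" using prime_gt_0_nat[OF p] by simp
  then have pk: "real (p ^ k) *\<^sub>R x \<in> N" if "x \<in> E" for x
    using lagrange[OF N(1) E N(2) _ that] unfolding N(3) by blast
  show eq: "E \<inter> saturate N = N"
  proof (intro equalityI subsetI)
    fix x assume x: "x \<in> E \<inter> saturate N"
    then obtain c where c: "\<not> int p dvd c" "real_of_int c *\<^sub>R x \<in> N" by (auto simp: saturate_def)
    obtain u v where uv: "u * c + v * int (p ^ k) = 1" using bezout_prime_power[OF p c(1)] by blast
    show "x \<in> N" using combine[OF N(1) uv c(2)] pk x by blast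
  qed (use N(2) sub subset_saturate[of N] in blast)
  have "real (p ^ k) *\<^sub>R x \<in> saturate N" if x: "x \<in> E'" for x
  proof -
    obtain c where c: "\<not> int p dvd c" "real_of_int c *\<^sub>R x \<in> E" using ext[OF x] by blast
    have "real_of_int c *\<^sub>R (real (p ^ k) *\<^sub>R x) \<in> N" using pk[OF c(2)] by (simp add: mult.commute)
    then show ?thesis using c(1) subgrp_of_nat[OF E' x, of "p ^ k"] unfolding saturate_def by blast
  qed
  then have "E' \<subseteq> E + saturate N" using combine_plus[OF subgrp_saturate[OF N(1)]] by blast
  moreover have "E + saturate N \<subseteq> E'" by (rule plus_least[OF E' sub]) (auto simp: saturate_def)
  ultimately have "E + saturate N = E'" by blast
  then show "idx E' (saturate N) = p ^ k"
    using idx_Int[OF E subgrp_saturate[OF N(1)]] unfolding eq N(3) by simp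
qed

lemma
  assumes N: "subgrp N" "N \<subseteq> E'" "idx E' N = p ^ k"
  shows saturate_of_Int: "saturate (E \<inter> N) = N" and idx_Int_E: "idx E (E \<inter> N) = p ^ k"
proof -
  have "p ^ k > 0" using prime_gt_0_nat[OF p] by simp
  then have pk: "real (p ^ k) *\<^sub>R x \<in> N" if "x \<in> E'" for x
    using lagrange[OF N(1) E' N(2) _ that] unfolding N(3) by blast
  show "saturate (E \<inter> N) = N"
  proof (intro equalityI subsetI)
    fix x assume "x \<in> saturate (E \<inter> N)"
    then obtain c where c: "\<not> int p dvd c" "real_of_int c *\<^sub>R x \<in> N" "x \<in> E'" by (auto simp: saturate_def)
    obtain u v where uv: "u * c + v * int (p ^ k) = 1" using bezout_prime_power[OF p c(1)] by blast
    show "x \<in> N" by (rule combine[OF N(1) uv c(2) pk[OF c(3)]])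
  next
    fix x assume x: "x \<in> N"
    then have x': "x \<in> E'" using N(2) by blast
    obtain c where c: "\<not> int p dvd c" "real_of_int c *\<^sub>R x \<in> E" using ext[OF x'] by blast
    then show "x \<in> saturate (E \<inter> N)" using x' subgrp_of_int[OF N(1) x, of c] unfolding saturate_def by blast
  qed
  have "E' \<subseteq> E + N" using combine_plus[OF N(1)] pk by blast
  then have "E + N = E'" using plus_least[OF E' sub N(2)] by blast
  then show "idx E (E \<inter> N) = p ^ k" using idx_Int[OF E N(1)] N(3) by simp
qed

end

text \<open>An ideal of the Heisenberg Lie ring: the bracket of ((a, b), c) with ((x, y), z) is the
  central element a y - b x, and x = 0 or y = 0 gives the two conditions.\<close>

definition heis_ideal :: "complex set \<Rightarrow> ((complex \<times> complex) \<times> complex) set \<Rightarrow> bool" where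
  "heis_ideal R N \<longleftrightarrow> subgrp N \<and> N \<subseteq> (R \<times> R) \<times> R \<and>
     (\<forall>a b c x. ((a, b), c) \<in> N \<longrightarrow> x \<in> R \<longrightarrow> (0, a * x) \<in> N \<and> (0, b * x) \<in> N)"

lemma heis_idealD:
  assumes "heis_ideal R N"
  shows "subgrp N" "N \<subseteq> (R \<times> R) \<times> R"
    and "((a, b), c) \<in> N \<Longrightarrow> x \<in> R \<Longrightarrow> (0, a * x) \<in> N" "((a, b), c) \<in> N \<Longrightarrow> x \<in> R \<Longrightarrow> (0, b * x) \<in> N"
  using assms unfolding heis_ideal_def by blast+

definition heis_ideals :: "nat \<Rightarrow> complex set \<Rightarrow> ((complex \<times> complex) \<times> complex) set set" where
  "heis_ideals p R = {N. heis_ideal R N \<and> (\<exists>k. idx ((R \<times> R) \<times> R) N = p ^ k)}"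

locale prime_to_p_ring_extension = base: subring_complex R + top: subring_complex R'
  for R R' :: "complex set" +
  fixes p :: nat
  assumes p: "Factorial_Ring.prime p"
    and R': "R' = {x. \<exists>c::int. \<not> int p dvd c \<and> of_int c * x \<in> R}"
begin

abbreviation "E \<equiv> (R \<times> R) \<times> R"
abbreviation "E' \<equiv> (R' \<times> R') \<times> R'"

lemma R'_D: "x \<in> R' \<Longrightarrow> \<exists>c::int. \<not> int p dvd c \<and> of_int c * x \<in> R"
  unfolding R' by blast

lemma R_subset: "R \<subseteq> R'"
proof
  fix x assume "x \<in> R"
  moreover have "\<not> int p dvd 1" using p by auto
  ultimately show "x \<in> R'" unfolding R' by (intro CollectI exI[of _ 1]) simp
qed

sublocale heis: prime_to_p_extension E E' p
proof
  show "subgrp E" "subgrp E'" by (intro subgrp_Times base.subgrp_R top.subgrp_R)+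
  show "E \<subseteq> E'" using R_subset by auto
  fix z assume "z \<in> E'"
  then obtain a b c where abc: "z = ((a, b), c)" "a \<in> R'" "b \<in> R'" "c \<in> R'" by auto
  obtain i j k :: int where i: "\<not> int p dvd i" "of_int i * a \<in> R" and j: "\<not> int p dvd j" "of_int j * b \<in> R"
    and k: "\<not> int p dvd k" "of_int k * c \<in> R"
    using R'_D[OF abc(2)] R'_D[OF abc(3)] R'_D[OF abc(4)] by blast
  let ?d = "i * j * k"
  have "of_int (j * k) * (of_int i * a) \<in> R" "of_int (i * k) * (of_int j * b) \<in> R" "of_int (i * j) * (of_int k * c) \<in> R"
    by (rule base.mult_mem[OF base.of_int_mem i(2)] base.mult_mem[OF base.of_int_mem j(2)] base.mult_mem[OF base.of_int_mem k(2)])+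
  then have "real_of_int ?d *\<^sub>R z \<in> E" by (simp add: abc(1) scaleR_conv_of_real mult_ac)
  moreover have "\<not> int p dvd ?d"
    by (rule not_dvd_prime_mult[OF p not_dvd_prime_mult[OF p i(1) j(1)] k(1)])
  ultimately show "\<exists>c::int. \<not> int p dvd c \<and> real_of_int c *\<^sub>R z \<in> E"
    by (intro exI[of _ ?d] conjI)
qed (rule p)

lemma heis_ideal_saturate:
  assumes N: "heis_ideal R N"
  shows "heis_ideal R' (heis.saturate N)"
  unfolding heis_ideal_def
proof (intro conjI allI impI)
  show "subgrp (heis.saturate N)" by (rule heis.subgrp_saturate[OF heis_idealD(1)[OF N]])
  show "heis.saturate N \<subseteq> E'" unfolding heis.saturate_def by blast
  fix a b c x assume "((a, b), c) \<in> heis.saturate N" and x: "x \<in> R'"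
  then obtain d :: int where d: "\<not> int p dvd d" "real_of_int d *\<^sub>R ((a, b), c) \<in> N" "((a, b), c) \<in> E'"
    unfolding heis.saturate_def by blast
  obtain e :: int where e: "\<not> int p dvd e" "of_int e * x \<in> R" using R'_D[OF x] by blast
  have d2: "((of_int d * a, of_int d * b), of_int d * c) \<in> N" using d(2) by (simp add: scaleR_conv_of_real)
  have "(0, (of_int d * a) * (of_int e * x)) \<in> N" "(0, (of_int d * b) * (of_int e * x)) \<in> N"
    by (rule heis_idealD(3)[OF N d2 e(2)], rule heis_idealD(4)[OF N d2 e(2)])
  then have *: "real_of_int (d * e) *\<^sub>R (0, a * x) \<in> N" "real_of_int (d * e) *\<^sub>R (0, b * x) \<in> N"
    by (simp_all add: scaleR_conv_of_real zero_prod_def mult_ac)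
  have "a * x \<in> R'" "b * x \<in> R'" using d(3) x by (auto intro: top.mult_mem)
  then have mem: "(0, a * x) \<in> E'" "(0, b * x) \<in> E'" using top.zero_mem by (simp_all add: zero_prod_def)
  have sat: "w \<in> heis.saturate N" if "w \<in> E'" "real_of_int (d * e) *\<^sub>R w \<in> N" for w
    unfolding heis.saturate_def using that not_dvd_prime_mult[OF p d(1) e(1)]
    by (intro CollectI conjI exI[of _ "d * e"])
  show "(0, a * x) \<in> heis.saturate N" "(0, b * x) \<in> heis.saturate N"
    by (rule sat[OF mem(1) *(1)], rule sat[OF mem(2) *(2)])
qed

lemma heis_ideal_Int:
  assumes N: "heis_ideal R' N"
  shows "heis_ideal R (E \<inter> N)"
  unfolding heis_ideal_def
proof (intro conjI allI impI)
  show "subgrp (E \<inter> N)" by (intro subgrp_Int heis.E heis_idealD(1)[OF N])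
  fix a b c x assume abc: "((a, b), c) \<in> E \<inter> N" and x: "x \<in> R"
  then have "x \<in> R'" using R_subset by blast
  then have "(0, a * x) \<in> N" "(0, b * x) \<in> N" using abc by (auto intro: heis_idealD(3,4)[OF N])
  moreover have "a * x \<in> R" "b * x \<in> R" using abc x by (auto intro: base.mult_mem)
  ultimately show "(0, a * x) \<in> E \<inter> N" "(0, b * x) \<in> E \<inter> N" using base.zero_mem by (simp_all add: zero_prod_def)
qed simp

lemma bij_betw_saturate:
  "bij_betw heis.saturate {N. heis_ideal R N \<and> idx E N = p ^ k} {N. heis_ideal R' N \<and> idx E' N = p ^ k}"
proof (rule bij_betw_byWitness[where f' = "\<lambda>N. E \<inter> N"])
  show "\<forall>N\<in>{N. heis_ideal R N \<and> idx E N = p ^ k}. E \<inter> heis.saturate N = N"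
  proof
    fix N assume "N \<in> {N. heis_ideal R N \<and> idx E N = p ^ k}"
    then have N: "heis_ideal R N" "idx E N = p ^ k" by blast+
    show "E \<inter> heis.saturate N = N" by (rule heis.saturate_Int[OF heis_idealD(1,2)[OF N(1)] N(2)])
  qed
  show "\<forall>N\<in>{N. heis_ideal R' N \<and> idx E' N = p ^ k}. heis.saturate (E \<inter> N) = N"
  proof
    fix N assume "N \<in> {N. heis_ideal R' N \<and> idx E' N = p ^ k}"
    then have N: "heis_ideal R' N" "idx E' N = p ^ k" by blast+
    show "heis.saturate (E \<inter> N) = N" by (rule heis.saturate_of_Int[OF heis_idealD(1,2)[OF N(1)] N(2)])
  qed
  show "heis.saturate ` {N. heis_ideal R N \<and> idx E N = p ^ k} \<subseteq> {N. heis_ideal R' N \<and> idx E' N = p ^ k}"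
  proof clarify
    fix N assume N: "heis_ideal R N" "idx E N = p ^ k"
    show "heis_ideal R' (heis.saturate N) \<and> idx E' (heis.saturate N) = p ^ k"
      using heis_ideal_saturate[OF N(1)] heis.idx_saturate[OF heis_idealD(1,2)[OF N(1)] N(2)] by blast
  qed
  show "(\<inter>) E ` {N. heis_ideal R' N \<and> idx E' N = p ^ k} \<subseteq> {N. heis_ideal R N \<and> idx E N = p ^ k}"
  proof clarify
    fix N assume N: "heis_ideal R' N" "idx E' N = p ^ k"
    show "heis_ideal R (E \<inter> N) \<and> idx E (E \<inter> N) = p ^ k"
      using heis_ideal_Int[OF N(1)] heis.idx_Int_E[OF heis_idealD(1,2)[OF N(1)] N(2)] by blast
  qed
qed

end

section \<open>The Heisenberg group in coordinates\<close>

definition heis_mat :: "(complex \<times> complex) \<times> complex \<Rightarrow> complex^3^3" where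
  "heis_mat z = vector [vector [1, fst (fst z), snd z], vector [0, 1, snd (fst z)], vector [0, 0, 1]]"

lemma heis_mat_nth [simp]:
  "heis_mat z $ 1 $ 1 = 1" "heis_mat z $ 1 $ 2 = fst (fst z)" "heis_mat z $ 1 $ 3 = snd z"
  "heis_mat z $ 2 $ 1 = 0" "heis_mat z $ 2 $ 2 = 1" "heis_mat z $ 2 $ 3 = snd (fst z)"
  "heis_mat z $ 3 $ 1 = 0" "heis_mat z $ 3 $ 2 = 0" "heis_mat z $ 3 $ 3 = 1"
  by (simp_all add: heis_mat_def)

lemma heis_mat_mult:
  "heis_mat ((a, b), c) ** heis_mat ((a', b'), c') = heis_mat ((a + a', b + b'), c + c' + a * b')"
  by (simp add: vec_eq_iff forall_3 matrix_matrix_mult_def sum_3)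

lemma inj_heis_mat: "inj heis_mat"
proof (rule injI)
  fix z w assume "heis_mat z = heis_mat w"
  then have "heis_mat z $ i $ j = heis_mat w $ i $ j" for i j by simp
  from this[of 1 2] this[of 1 3] this[of 2 3] show "z = w" by (simp add: prod_eq_iff)
qed

lemma heis_mat_0: "heis_mat 0 = mat 1"
  by (simp add: vec_eq_iff forall_3 mat_def zero_prod_def)

context subring_complex
begin

abbreviation "Heis \<equiv> heisenberg_group R"
abbreviation "H3 \<equiv> (R \<times> R) \<times> R"

lemma carrier_Heis: "carrier Heis = heis_mat ` H3"
proof (intro equalityI subsetI)
  fix A assume A: "A \<in> carrier Heis"
  then have "A = heis_mat ((A $ 1 $ 2, A $ 2 $ 3), A $ 1 $ 3)"
    by (simp add: heisenberg_group_def vec_eq_iff forall_3)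
  moreover have "((A $ 1 $ 2, A $ 2 $ 3), A $ 1 $ 3) \<in> H3" using A by (simp add: heisenberg_group_def)
  ultimately show "A \<in> heis_mat ` H3" by blast
qed (auto simp: heisenberg_group_def)

lemma mult_Heis: "A \<otimes>\<^bsub>Heis\<^esub> B = A ** B"
  by (simp add: heisenberg_group_def)

lemma one_Heis: "\<one>\<^bsub>Heis\<^esub> = heis_mat 0"
  by (simp add: heisenberg_group_def heis_mat_0)

lemma heis_mat_carrier: "a \<in> R \<Longrightarrow> b \<in> R \<Longrightarrow> c \<in> R \<Longrightarrow> heis_mat ((a, b), c) \<in> carrier Heis"
  unfolding carrier_Heis by blast

lemma group_Heis: "group Heis"
proof (rule groupI)
  show "\<one>\<^bsub>Heis\<^esub> \<in> carrier Heis"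
    unfolding one_Heis zero_prod_def by (intro heis_mat_carrier zero_mem)
  fix A assume "A \<in> carrier Heis"
  then obtain a b c where A: "A = heis_mat ((a, b), c)" "a \<in> R" "b \<in> R" "c \<in> R"
    unfolding carrier_Heis by auto
  show "\<one>\<^bsub>Heis\<^esub> \<otimes>\<^bsub>Heis\<^esub> A = A" unfolding mult_Heis one_Heis A(1) zero_prod_def heis_mat_mult by simp
  have "heis_mat ((- a, - b), - c + a * b) \<in> carrier Heis"
    by (intro heis_mat_carrier uminus_mem add_mem mult_mem A)
  moreover have "heis_mat ((- a, - b), - c + a * b) \<otimes>\<^bsub>Heis\<^esub> A = \<one>\<^bsub>Heis\<^esub>"
    unfolding mult_Heis one_Heis A(1) heis_mat_mult by (simp add: zero_prod_def)
  ultimately show "\<exists>B\<in>carrier Heis. B \<otimes>\<^bsub>Heis\<^esub> A = \<one>\<^bsub>Heis\<^esub>" by blast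
  fix B assume "B \<in> carrier Heis"
  then obtain a' b' c' where B: "B = heis_mat ((a', b'), c')" "a' \<in> R" "b' \<in> R" "c' \<in> R"
    unfolding carrier_Heis by auto
  show "A \<otimes>\<^bsub>Heis\<^esub> B \<in> carrier Heis"
    unfolding mult_Heis A(1) B(1) heis_mat_mult by (intro heis_mat_carrier add_mem mult_mem A B)
  fix C show "A \<otimes>\<^bsub>Heis\<^esub> B \<otimes>\<^bsub>Heis\<^esub> C = A \<otimes>\<^bsub>Heis\<^esub> (B \<otimes>\<^bsub>Heis\<^esub> C)"
    unfolding mult_Heis by (simp only: matrix_mul_assoc)
qed

interpretation heis_group: group Heis
  by (rule group_Heis)

lemma inv_heis_mat:
  assumes "a \<in> R" "b \<in> R" "c \<in> R"
  shows "inv\<^bsub>Heis\<^esub> (heis_mat ((a, b), c)) = heis_mat ((- a, - b), - c + a * b)"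
proof (rule heis_group.inv_equality)
  show "heis_mat ((- a, - b), - c + a * b) \<otimes>\<^bsub>Heis\<^esub> heis_mat ((a, b), c) = \<one>\<^bsub>Heis\<^esub>"
    unfolding mult_Heis one_Heis heis_mat_mult by (simp add: zero_prod_def)
qed (intro heis_mat_carrier uminus_mem add_mem mult_mem assms)+

text \<open>The group law differs from addition by a product a b' in the central coordinate. L
  absorbs such terms, so its image is a normal subgroup whose multiplicative cosets are the images
  of the additive ones.\<close>

lemma heis_ideal_cosets:
  assumes L: "heis_ideal R L"
  shows "heis_mat ` L \<lhd> Heis" "card (rcosets\<^bsub>Heis\<^esub> (heis_mat ` L)) = idx H3 L"
proof -
  note sg = heis_idealD(1)[OF L]
  have LR: "a \<in> R" "b \<in> R" "c \<in> R" if "((a, b), c) \<in> L" for a b c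
    using that heis_idealD(2)[OF L] by auto
  have shift: "((a, b), c + d) \<in> L" if "((a, b), c) \<in> L" "(0, d) \<in> L" for a b c d
    using subgrp_add[OF sg that] by (simp add: zero_prod_def)
  have "subgroup (heis_mat ` L) Heis"
  proof (rule heis_group.subgroupI)
    show "heis_mat ` L \<subseteq> carrier Heis" unfolding carrier_Heis using heis_idealD(2)[OF L] by blast
    show "heis_mat ` L \<noteq> {}" using subgrp_0[OF sg] by blast
    fix A assume "A \<in> heis_mat ` L"
    then obtain a b c where A: "A = heis_mat ((a, b), c)" "((a, b), c) \<in> L" by auto
    have "((- a, - b), - c) \<in> L" using subgrp_uminus[OF sg A(2)] by simp
    then have "((- a, - b), - c + a * b) \<in> L"
      by (rule shift) (rule heis_idealD(3)[OF L A(2) LR(2)[OF A(2)]])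
    then show "inv\<^bsub>Heis\<^esub> A \<in> heis_mat ` L" unfolding A(1) inv_heis_mat[OF LR[OF A(2)]] by blast
    fix B assume "B \<in> heis_mat ` L"
    then obtain a' b' c' where B: "B = heis_mat ((a', b'), c')" "((a', b'), c') \<in> L" by auto
    have "((a + a', b + b'), c + c') \<in> L" using subgrp_add[OF sg A(2) B(2)] by simp
    then have "((a + a', b + b'), c + c' + a * b') \<in> L"
      by (rule shift) (rule heis_idealD(3)[OF L A(2) LR(2)[OF B(2)]])
    then show "A \<otimes>\<^bsub>Heis\<^esub> B \<in> heis_mat ` L" unfolding mult_Heis A(1) B(1) heis_mat_mult by blast
  qed
  moreover have "A \<otimes>\<^bsub>Heis\<^esub> B \<otimes>\<^bsub>Heis\<^esub> inv\<^bsub>Heis\<^esub> A \<in> heis_mat ` L"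
    if AB: "A \<in> carrier Heis" "B \<in> heis_mat ` L" for A B
  proof -
    obtain x y z where A: "A = heis_mat ((x, y), z)" "x \<in> R" "y \<in> R" "z \<in> R"
      using AB(1) unfolding carrier_Heis by auto
    obtain a b c where B: "B = heis_mat ((a, b), c)" "((a, b), c) \<in> L" using AB(2) by auto
    have "(0, b * x) \<in> L" "(0, a * (- y)) \<in> L"
      by (rule heis_idealD(4)[OF L B(2) A(2)], rule heis_idealD(3)[OF L B(2) uminus_mem[OF A(3)]])
    from shift[OF shift[OF B(2) this(1)] this(2)] have "((a, b), c + b * x + a * - y) \<in> L" .
    moreover have "A \<otimes>\<^bsub>Heis\<^esub> B \<otimes>\<^bsub>Heis\<^esub> inv\<^bsub>Heis\<^esub> A = heis_mat ((a, b), c + b * x + a * - y)"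
      unfolding A(1) inv_heis_mat[OF A(2-4)] unfolding B(1) mult_Heis heis_mat_mult by (simp add: algebra_simps)
    ultimately show ?thesis by (simp only: imageI)
  qed
  ultimately show "heis_mat ` L \<lhd> Heis" unfolding heis_group.normal_inv_iff by blast
  have coset: "heis_mat ` L #>\<^bsub>Heis\<^esub> heis_mat z = heis_mat ` ((+) z ` L)" if z: "z \<in> H3" for z
  proof -
    obtain x y w where xyw: "z = ((x, y), w)" "x \<in> R" "y \<in> R" "w \<in> R" using z by auto
    have "heis_mat ` L #>\<^bsub>Heis\<^esub> heis_mat z = (\<lambda>l. heis_mat l ** heis_mat z) ` L"
      unfolding r_coset_def mult_Heis by blast
    also have "\<dots> = heis_mat ` ((+) z ` L)"
    proof (intro equalityI subsetI)
      fix A assume "A \<in> (\<lambda>l. heis_mat l ** heis_mat z) ` L"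
      then obtain a b c where l: "((a, b), c) \<in> L" "A = heis_mat ((a, b), c) ** heis_mat z" by auto
      have "((a, b), c + a * y) \<in> L" by (rule shift[OF l(1) heis_idealD(3)[OF L l(1) xyw(3)]])
      then have "heis_mat (z + ((a, b), c + a * y)) \<in> heis_mat ` ((+) z ` L)" by blast
      moreover have "A = heis_mat (z + ((a, b), c + a * y))"
        unfolding l(2) xyw(1) heis_mat_mult by (simp add: algebra_simps)
      ultimately show "A \<in> heis_mat ` ((+) z ` L)" by simp
    next
      fix A assume "A \<in> heis_mat ` ((+) z ` L)"
      then obtain a b c where l: "((a, b), c) \<in> L" "A = heis_mat (z + ((a, b), c))" by auto
      have "((a, b), c + a * (- y)) \<in> L"
        by (rule shift[OF l(1) heis_idealD(3)[OF L l(1) uminus_mem[OF xyw(3)]]])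
      then have "heis_mat ((a, b), c + a * (- y)) ** heis_mat z \<in> (\<lambda>l. heis_mat l ** heis_mat z) ` L" by blast
      moreover have "A = heis_mat ((a, b), c + a * (- y)) ** heis_mat z"
        unfolding l(2) xyw(1) heis_mat_mult by (simp add: algebra_simps)
      ultimately show "A \<in> (\<lambda>l. heis_mat l ** heis_mat z) ` L" by simp
    qed
    finally show ?thesis .
  qed
  have "rcosets\<^bsub>Heis\<^esub> (heis_mat ` L) = (\<lambda>A. heis_mat ` L #>\<^bsub>Heis\<^esub> A) ` carrier Heis"
    unfolding RCOSETS_def by blast
  also have "\<dots> = (\<lambda>z. heis_mat ` L #>\<^bsub>Heis\<^esub> heis_mat z) ` H3"
    unfolding carrier_Heis by (rule image_image)
  also have "\<dots> = (\<lambda>z. heis_mat ` ((+) z ` L)) ` H3" by (rule image_cong[OF refl coset])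
  also have "\<dots> = image heis_mat ` cosets H3 L" unfolding cosets_def by (rule image_image[symmetric])
  finally have "rcosets\<^bsub>Heis\<^esub> (heis_mat ` L) = image heis_mat ` cosets H3 L" .
  moreover have "inj_on (image heis_mat) (cosets H3 L)"
    using inj_heis_mat by (simp add: inj_on_def inj_image_eq_iff)
  ultimately show "card (rcosets\<^bsub>Heis\<^esub> (heis_mat ` L)) = idx H3 L"
    unfolding idx_def by (simp add: card_image)
qed

text \<open>
  Commutators with elements of \<open>Heis\<close> show that a normal subgroup is invariant under the
  translations by which multiplication in \<open>Heis\<close> differs from addition of coordinates.
\<close>

lemma normal_heis_ideal:
  assumes N: "N \<lhd> Heis"
  shows "\<exists>L. heis_ideal R L \<and> N = heis_mat ` L"
proof -
  interpret N: normal N Heis by (rule N)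
  define L where "L = {z \<in> H3. heis_mat z \<in> N}"
  have NC: "A \<in> carrier Heis" if "A \<in> N" for A using that N.subset by blast
  have multN: "A ** B \<in> N" if "A \<in> N" "B \<in> N" for A B
    using N.m_closed[OF that] by (simp only: mult_Heis)
  have invN: "heis_mat ((- a, - b), - c + a * b) \<in> N" if "((a, b), c) \<in> L" for a b c
  proof -
    have "a \<in> R" "b \<in> R" "c \<in> R" "heis_mat ((a, b), c) \<in> N" using that by (auto simp: L_def)
    then show ?thesis using N.m_inv_closed inv_heis_mat by metis
  qed
  \<comment> \<open>The commutator with the element ((x, y), 0). Setting x or y to 0 isolates the
    multiples of b or of a.\<close>
  have conjN: "heis_mat ((0, 0), x * b - a * y) \<in> N" if abc: "((a, b), c) \<in> L" and xy: "x \<in> R" "y \<in> R" for a b c x y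
  proof -
    have R: "a \<in> R" "b \<in> R" "c \<in> R" and n: "heis_mat ((a, b), c) \<in> N" using abc by (auto simp: L_def)
    have "heis_mat ((x, y), 0) \<otimes>\<^bsub>Heis\<^esub> heis_mat ((a, b), c) \<otimes>\<^bsub>Heis\<^esub> inv\<^bsub>Heis\<^esub> (heis_mat ((x, y), 0)) \<in> N"
      by (rule N.inv_op_closed2[OF heis_mat_carrier[OF xy zero_mem] n])
    then have "heis_mat ((x, y), 0) ** heis_mat ((a, b), c) ** heis_mat ((- x, - y), - 0 + x * y) \<in> N"
      unfolding mult_Heis inv_heis_mat[OF xy zero_mem] .
    from multN[OF this invN[OF abc]] show ?thesis
      unfolding heis_mat_mult by (simp add: algebra_simps)
  qed
  have central: "(0, a * x) \<in> L \<and> (0, b * x) \<in> L" if abc: "((a, b), c) \<in> L" and x: "x \<in> R" for a b c x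
  proof -
    have R: "a \<in> R" "b \<in> R" using abc by (auto simp: L_def)
    have "heis_mat ((0, 0), a * x) \<in> N" "heis_mat ((0, 0), b * x) \<in> N"
      using conjN[OF abc zero_mem uminus_mem[OF x]] conjN[OF abc x zero_mem] by (simp_all add: mult.commute)
    then show ?thesis using R x by (simp add: L_def zero_prod_def zero_mem mult_mem)
  qed
  have "subgrp L"
  proof (rule subgrpI)
    show "0 \<in> L" using N.one_closed by (simp add: L_def one_Heis zero_mem zero_prod_def)
    fix z w assume z: "z \<in> L" and w: "w \<in> L"
    obtain a b c where abc: "z = ((a, b), c)" by (metis prod.collapse)
    obtain a' b' c' where abc': "w = ((a', b'), c')" by (metis prod.collapse)
    have R: "a \<in> R" "b \<in> R" "c \<in> R" "a' \<in> R" "b' \<in> R" "c' \<in> R" using z w by (auto simp: L_def abc abc')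
    have 1: "heis_mat ((a, b), c) \<in> N" using z by (simp add: L_def abc)
    \<comment> \<open>The product of z with the inverse of w has the central coordinate c - c' + a'
      b' - a b'. Multiplying by these two central elements corrects it to c - c', that of z -
      w.\<close>
    have 2: "heis_mat ((0, 0), a * b') \<in> N"
      using central[OF z[unfolded abc] R(5)] by (simp add: L_def zero_prod_def)
    have 3: "heis_mat ((0, 0), a' * (- b')) \<in> N"
      using central[OF w[unfolded abc'] uminus_mem[OF R(5)]] by (simp add: L_def zero_prod_def)
    from multN[OF multN[OF multN[OF 1 invN[OF w[unfolded abc']]] 2] 3]
    have "heis_mat (z - w) \<in> N" unfolding heis_mat_mult by (simp add: abc abc' algebra_simps)
    then show "z - w \<in> L" using R by (simp add: L_def abc abc' diff_mem)
  qed
  then have "heis_ideal R L" unfolding heis_ideal_def using central L_def by blast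
  moreover have "N = heis_mat ` L" using NC unfolding carrier_Heis L_def by blast
  ultimately show ?thesis by blast
qed

lemma normal_subgroup_count_Heis:
  "normal_subgroup_count Heis m = card {L. heis_ideal R L \<and> idx H3 L = m}"
proof -
  have "{N. N \<lhd> Heis \<and> card (rcosets\<^bsub>Heis\<^esub> N) = m} = image heis_mat ` {L. heis_ideal R L \<and> idx H3 L = m}"
  proof (intro equalityI subsetI)
    fix N assume N: "N \<in> {N. N \<lhd> Heis \<and> card (rcosets\<^bsub>Heis\<^esub> N) = m}"
    then obtain L where L: "heis_ideal R L" "N = heis_mat ` L" using normal_heis_ideal[of N] by blast
    moreover have "idx H3 L = m" using N heis_ideal_cosets(2)[OF L(1)] unfolding L(2) by simp
    ultimately show "N \<in> image heis_mat ` {L. heis_ideal R L \<and> idx H3 L = m}" by blast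
  next
    fix N assume "N \<in> image heis_mat ` {L. heis_ideal R L \<and> idx H3 L = m}"
    then obtain L where "heis_ideal R L" "N = heis_mat ` L" "idx H3 L = m" by blast
    then show "N \<in> {N. N \<lhd> Heis \<and> card (rcosets\<^bsub>Heis\<^esub> N) = m}"
      using heis_ideal_cosets[of L] by simp
  qed
  moreover have "inj_on (image heis_mat) {L. heis_ideal R L \<and> idx H3 L = m}"
    using inj_heis_mat by (simp add: inj_on_def inj_image_eq_iff)
  ultimately show ?thesis unfolding normal_subgroup_count_def by (simp add: card_image)
qed

end

section \<open>The local zeta function as a sum over subgroups\<close>

context split_prime
begin

lemma heis_subgrps_eq: "heis_subgrps = heis_ideals p R"
  unfolding heis_subgrps_def heis_ideals_def heis_ideal_def by blast

lemma idx_princ_p_power: "idx R (princ (of_nat p ^ k)) > 0"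
proof (induction k)
  case 0
  show ?case using idx_self[OF subgrp_R] by (simp add: princ_1)
next
  case (Suc k)
  have "princ (of_nat p) = J (ones {..<g})"
    unfolding scale_p_R[symmetric] by (simp add: princ_def scaleR_conv_of_real)
  then have "idx R (princ (of_nat p)) > 0" using p1 by (simp add: idx_J)
  moreover have "idx R (princ (of_nat p * of_nat p ^ k)) = idx R (princ (of_nat p)) * idx R (princ (of_nat p ^ k))"
    using p1 by (intro idx_princ_mult of_nat_mem power_mem) auto
  ultimately show ?case using Suc by simp
qed

text \<open>A subgroup of index p^k contains all multiples by p^k, and these form a subgroup of
  finite index.\<close>

lemma finite_heis_ideals: "finite {N. heis_ideal R N \<and> idx H3 N = p ^ k}"
proof -
  let ?P = "princ (of_nat p ^ k)"
  let ?J = "(?P \<times> ?P) \<times> ?P"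
  have P: "subgrp ?P" "?P \<subseteq> R" by (intro subgrp_princ princ_subset power_mem of_nat_mem)+
  have PP: "subgrp (?P \<times> ?P)" "?P \<times> ?P \<subseteq> R \<times> R" "subgrp (R \<times> R)" using P by (auto intro: subgrp_Times subgrp_R)
  have "idx H3 ?J = idx R ?P * idx R ?P * idx R ?P"
    unfolding idx_Times[OF PP(3) subgrp_R PP(1) P(1) PP(2) P(2)] idx_Times[OF subgrp_R subgrp_R P(1) P(1) P(2) P(2)] ..
  then have pos: "idx H3 ?J > 0" using idx_princ_p_power[of k] by simp
  have "{N. heis_ideal R N \<and> idx H3 N = p ^ k} \<subseteq> {H. subgrp H \<and> ?J \<subseteq> H \<and> H \<subseteq> H3}"
  proof clarify
    fix N assume N: "heis_ideal R N" "idx H3 N = p ^ k"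
    note N' = heis_idealD(1,2)[OF N(1)]
    have "?J \<subseteq> N"
    proof
      fix z assume "z \<in> ?J"
      then obtain a b c where abc: "a \<in> R" "b \<in> R" "c \<in> R"
        and z: "z = ((of_nat p ^ k * a, of_nat p ^ k * b), of_nat p ^ k * c)" by (auto simp: mem_princ)
      have "real (idx H3 N) *\<^sub>R ((a, b), c) \<in> N"
        using abc N(2) p1 by (intro lagrange[OF N'(1) _ N'(2)] subgrp_Times subgrp_R) auto
      then show "z \<in> N" by (simp add: z N(2) scaleR_conv_of_real)
    qed
    then show "subgrp N \<and> ?J \<subseteq> N \<and> N \<subseteq> H3" using N' by blast
  qed
  moreover have "finite {H. subgrp H \<and> ?J \<subseteq> H \<and> H \<subseteq> H3}"
    by (rule finite_between[OF subgrp_Times[OF PP(1) P(1)] pos])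
  ultimately show ?thesis by (rule finite_subset)
qed

lemma wsum_heis_subgrps_series:
  "wsum heis_subgrps (\<lambda>N. Y ^ heis_nu N) = (\<Sum>k. of_nat (card {N. heis_ideal R N \<and> idx H3 N = p ^ k}) * Y ^ k)"
proof -
  have nu: "heis_nu N = k" if "idx H3 N = p ^ k" for N k
    using that p by (simp add: heis_nu_def)
  have fib: "{N \<in> heis_subgrps. heis_nu N = k} = {N. heis_ideal R N \<and> idx H3 N = p ^ k}" for k
  proof (intro equalityI subsetI)
    fix N assume N: "N \<in> {N \<in> heis_subgrps. heis_nu N = k}"
    then obtain j where j: "idx H3 N = p ^ j" "heis_ideal R N" unfolding heis_subgrps_eq heis_ideals_def by blast
    then show "N \<in> {N. heis_ideal R N \<and> idx H3 N = p ^ k}" using N nu[OF j(1)] by auto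
  next
    fix N assume N: "N \<in> {N. heis_ideal R N \<and> idx H3 N = p ^ k}"
    then have "heis_nu N = k" using nu by blast
    then show "N \<in> {N \<in> heis_subgrps. heis_nu N = k}" using N unfolding heis_subgrps_eq heis_ideals_def by blast
  qed
  have "wsum heis_subgrps (\<lambda>N. Y ^ heis_nu N) = wsum UNIV (\<lambda>k. wsum {N \<in> heis_subgrps. heis_nu N = k} (\<lambda>N. Y ^ heis_nu N))"
    by (rule wsum_fiber) simp
  also have "\<dots> = wsum UNIV (\<lambda>k. of_nat (card {N. heis_ideal R N \<and> idx H3 N = p ^ k}) * Y ^ k)"
  proof (rule wsum_cong[OF refl])
    fix k
    show "wsum {N \<in> heis_subgrps. heis_nu N = k} (\<lambda>N. Y ^ heis_nu N) =
       of_nat (card {N. heis_ideal R N \<and> idx H3 N = p ^ k}) * Y ^ k"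
      unfolding fib by (rule wsum_const_on[OF finite_heis_ideals]) (simp add: nu)
  qed
  also have "\<dots> = (\<Sum>k. of_nat (card {N. heis_ideal R N \<and> idx H3 N = p ^ k}) * Y ^ k)"
    unfolding wsum_def by (rule nn_integral_count_space_nat)
  finally show ?thesis .
qed

text \<open>The counts for S agree with those for its localisation R by
  \<open>bij_betw_saturate\<close>. For real s all terms are nonnegative, so the assumed summability
  gives the finiteness required for the sum over subgroups.\<close>

theorem local_normal_zeta_eq_euler_gf:
  assumes S: "subring_complex S" and RS: "R = {x. \<exists>c::int. \<not> int p dvd c \<and> of_int c * x \<in> S}"
    and s: "s > 0" and gen: "\<And>i j. i > 0 \<Longrightarrow> (real p powr (- s)) ^ i * real p ^ j \<noteq> 1"
    and sm: "summable (local_normal_zeta_term (heisenberg_group S) p (of_real s))"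
  shows "local_normal_zeta (heisenberg_group S) p (of_real s) =
    euler_gf (of_nat p) (of_nat p powr (- of_real s)) f {..<g}"
proof -
  interpret ext: prime_to_p_ring_extension S R p
    by (intro prime_to_p_ring_extension.intro prime_to_p_ring_extension_axioms.intro S subring_complex_axioms p RS)
  define y where "y = real p powr (- s)"
  define cnt where "cnt k = card {N. heis_ideal R N \<and> idx H3 N = p ^ k}" for k
  have p0: "real p > 1" using p1 by simp
  have y: "0 < y" "y < 1" unfolding y_def using p0 s by (simp_all add: powr_less_one)
  have cy: "of_nat p powr (- of_real s) = complex_of_real y"
    unfolding y_def using powr_of_real[of "real p" "- s"] by simp
  have count: "normal_subgroup_count (heisenberg_group S) (p ^ k) = cnt k" for k
    unfolding cnt_def ext.base.normal_subgroup_count_Heis by (rule bij_betw_same_card[OF ext.bij_betw_saturate])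
  have "of_nat p powr (- of_nat k * of_real s) = complex_of_real (y ^ k)" for k
  proof -
    have "real p powr (- real k * s) = y ^ k"
      unfolding y_def using p0 by (simp add: powr_realpow[symmetric] powr_powr mult.commute)
    then show ?thesis using powr_of_real[of "real p" "- real k * s"] by simp
  qed
  then have trm: "local_normal_zeta_term (heisenberg_group S) p (of_real s) = (\<lambda>k. complex_of_real (real (cnt k) * y ^ k))"
    by (simp add: local_normal_zeta_term_def count fun_eq_iff)
  have sr: "summable (\<lambda>k. real (cnt k) * y ^ k)" using sm unfolding trm summable_of_real_iff .
  have nn: "0 \<le> real (cnt k) * y ^ k" for k using y by simp
  have "wsum heis_subgrps (\<lambda>N. ennreal y ^ heis_nu N) = (\<Sum>k. of_nat (cnt k) * ennreal y ^ k)"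
    unfolding wsum_heis_subgrps_series cnt_def ..
  also have "\<dots> = (\<Sum>k. ennreal (real (cnt k) * y ^ k))"
    using y by (simp add: ennreal_mult ennreal_of_nat_eq_real_of_nat ennreal_power)
  also have "\<dots> = ennreal (\<Sum>k. real (cnt k) * y ^ k)" by (rule suminf_ennreal2[OF nn sr])
  finally have w: "wsum heis_subgrps (\<lambda>N. ennreal y ^ heis_nu N) = ennreal (\<Sum>k. real (cnt k) * y ^ k)" .
  have "local_normal_zeta (heisenberg_group S) p (of_real s) = of_real (\<Sum>k. real (cnt k) * y ^ k)"
    unfolding local_normal_zeta_def trm by (rule suminf_of_real[OF sr, symmetric])
  also have "\<dots> = of_real (enn2real (wsum heis_subgrps (\<lambda>N. ennreal y ^ heis_nu N)))"
    unfolding w using suminf_nonneg[OF sr nn] by simp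
  also have "\<dots> = euler_gf (of_nat p) (of_real y) f {..<g}"
    using y gen unfolding y_def[symmetric] by (intro wsum_heis_subgrps_eq_euler_gf) (simp_all add: w)
  finally show ?thesis unfolding cy .
qed

end

section \<open>Existence of suitable primes\<close>

lemma exists_primitive_root_multiple_4:
  assumes p: "Factorial_Ring.prime p" "p mod 4 = 1"
  shows "\<exists>r::nat. 4 dvd r \<and> coprime p r \<and> ord p r = p - 1"
proof -
  have "odd p" using p(2) by presburger
  obtain h where "\<forall>k>0. residue_primroot (p ^ k) h"
    using residue_primroot_odd_prime_power_exists[OF p(1) \<open>odd p\<close>] by blast
  then have h: "residue_primroot p h" by (metis power_one_right zero_less_one)
  have ordh: "ord p h = p - 1" using h p(1) by (simp add: residue_primroot_def totient_prime)
  have cop: "coprime p h" using h by (simp add: residue_primroot_def)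
  obtain m where m: "p = 4 * m + 1" using p(2) by (metis mult_div_mod_eq)
  \<comment> \<open>As p is 1 modulo 4, the factor 1 + 3p is divisible by 4, and it is 1 modulo
    p.\<close>
  let ?r = "h * (1 + 3 * p)"
  have "?r = 4 * (h * (1 + 3 * m))" by (simp add: m algebra_simps)
  then have "4 dvd ?r" by (rule dvdI)
  moreover have cong: "[?r = h] (mod p)"
  proof -
    have "?r = h + (3 * h) * p" by (simp add: algebra_simps)
    then show ?thesis by (simp only: cong_def mod_mult_self1)
  qed
  have "ord p ?r = p - 1" using ord_cong[OF cong] ordh by simp
  moreover have "coprime p ?r" using cop cong_imp_coprime[OF cong_sym[OF cong]] by (simp add: coprime_commute)
  ultimately show ?thesis by blast
qed

lemma cong_imp_int_dvd_diff: "int p dvd int x - int y \<longleftrightarrow> [x = y] (mod p)"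
  by (simp add: cong_iff_dvd_diff[symmetric] cong_int_iff)

lemma exists_root_prod_binomials:
  fixes f :: "nat \<Rightarrow> nat" and b :: "nat \<Rightarrow> complex" and g :: nat
  assumes "g > 0" "\<And>i. i < g \<Longrightarrow> f i > 0"
  shows "\<exists>\<alpha>. (\<Prod>i<g. \<alpha> ^ f i - b i) = c"
proof -
  define Q :: "nat \<Rightarrow> complex poly" where "Q i = Polynomial.monom 1 (f i) - [:b i:]" for i
  have deg: "Polynomial.degree (Q i) > 0" if "i < g" for i
  proof -
    have "Polynomial.coeff (Q i) (f i) = 1" using assms(2)[OF that] by (simp add: Q_def coeff_pCons split: nat.split)
    then have "f i \<le> Polynomial.degree (Q i)" by (intro le_degree) simp
    then show ?thesis using assms(2)[OF that] by simp
  qed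
  have "Q i \<noteq> 0" if "i < g" for i using deg[OF that] by auto
  then have "Polynomial.degree (\<Prod>i<g. Q i) = (\<Sum>i<g. Polynomial.degree (Q i))"
    by (intro degree_prod_eq_sum_degree) simp
  moreover have "Polynomial.degree (Q 0) \<le> (\<Sum>i<g. Polynomial.degree (Q i))"
    using assms(1) by (intro member_le_sum) auto
  ultimately have pos: "Polynomial.degree (\<Prod>i<g. Q i) > 0" using deg[OF assms(1)] by simp
  have "Polynomial.degree ((\<Prod>i<g. Q i) - [:c:]) \<noteq> 0"
  proof
    assume "Polynomial.degree ((\<Prod>i<g. Q i) - [:c:]) = 0"
    then obtain d where "(\<Prod>i<g. Q i) - [:c:] = [:d:]" by (metis degree_eq_zeroE)
    then have "(\<Prod>i<g. Q i) = [:d + c:]" by (simp add: diff_eq_eq)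
    then show False using pos by simp
  qed
  then have "\<not> constant (poly ((\<Prod>i<g. Q i) - [:c:]))" by (simp only: constant_degree not_False_eq_True)
  then obtain \<alpha> where "poly ((\<Prod>i<g. Q i) - [:c:]) \<alpha> = 0" using fundamental_theorem_of_algebra by blast
  then have "(\<Prod>i<g. \<alpha> ^ f i - b i) = c" by (simp add: poly_prod Q_def poly_monom)
  then show ?thesis ..
qed

lemma exists_kummer:
  assumes g: "g > 0" and f: "\<And>i. i < g \<Longrightarrow> f i > (0::nat)"
  shows "\<exists>p>B. \<exists>a \<alpha>. kummer p g f a \<alpha>"
proof -
  define N where "N = 4 * (\<Prod>i<g. f i)"
  have "N > 0" using f by (simp add: N_def prod_pos)
  \<comment> \<open>The bound keeps all exponents 1 + N i below p - 1, so the powers of r chosen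
    below are distinct modulo p.\<close>
  then obtain p where p: "Factorial_Ring.prime p" "p > B + N * g + 2" "N dvd p - 1"
    using exists_prime_cong_1[of N "B + N * g + 2"] by blast
  have fN: "f i dvd N" if "i < g" for i
    using that dvd_prodI[of "{..<g}" i f] by (simp add: N_def)
  have "4 dvd p - 1" using p(3) unfolding N_def by (metis dvd_mult_left)
  then have p4: "p mod 4 = 1" using p(2) by presburger
  obtain r where r: "4 dvd r" "coprime p r" "ord p r = p - 1"
    using exists_primitive_root_multiple_4[OF p(1) p4] by blast
  \<comment> \<open>The exponent is 1 modulo N and hence prime to every f_i, so that a_i^((p-1)/f_i)
    has exact order f_i modulo p.\<close>
  define a where "a i = int (r ^ (1 + N * i))" for i
  have rp: "\<not> p dvd r" using r(2) p(1) by (metis coprime_absorb_left not_prime_unit)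
  obtain \<alpha> :: complex where \<alpha>: "(\<Prod>i<g. \<alpha> ^ f i - of_int (a i)) = of_nat (p * (p + 1))"
    using exists_root_prod_binomials[where f = f and b = "\<lambda>i. of_int (a i)" and c = "of_nat (p * (p + 1))", OF g f]
    by blast
  have diff: "int p dvd int (r ^ d) - int (r ^ e) \<longleftrightarrow> [d = e] (mod (p - 1))" for d e
    unfolding cong_imp_int_dvd_diff order_divides_expdiff[OF r(2)] r(3) ..
  have "kummer p g f a \<alpha>"
  proof unfold_locales
    show "Factorial_Ring.prime p" "p mod 4 = 1" "0 < g" by (rule p(1) p4 g)+
    show "(\<Prod>i<g. \<alpha> ^ f i - of_int (a i)) = of_nat (p * (p + 1))" by (rule \<alpha>)
    fix i assume i: "i < g"
    show "0 < f i" by (rule f[OF i])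
    show fp: "f i dvd p - 1" by (rule dvd_trans[OF fN[OF i] p(3)])
    have "4 dvd r ^ (1 + N * i)" using r(1) by (simp add: dvd_mult2)
    then show "4 dvd a i" unfolding a_def by (metis int_dvd_int_iff of_nat_numeral)
    have "\<not> p dvd r ^ (1 + N * i)" using rp p(1) prime_dvd_power by blast
    then show "\<not> int p dvd a i" unfolding a_def by (simp only: int_dvd_int_iff not_False_eq_True)
    show "\<not> int p dvd a i ^ (j * ((p - 1) div f i)) - a i ^ (k * ((p - 1) div f i))"
      if jk: "j < f i" "k < f i" "j \<noteq> k" for j k
    proof
      let ?m = "(p - 1) div f i" and ?e = "1 + N * i"
      have fm: "f i * ?m = p - 1" using fp by simp
      have m0: "?m \<noteq> 0" using fm p(2) by (metis mult_0_right not_less_zero zero_less_diff add_lessD1 add.commute one_add_one less_trans)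
      assume "int p dvd a i ^ (j * ?m) - a i ^ (k * ?m)"
      then have "int p dvd int (r ^ (?e * (j * ?m))) - int (r ^ (?e * (k * ?m)))"
        by (simp only: a_def of_nat_power power_mult)
      then have "[?e * (j * ?m) = ?e * (k * ?m)] (mod (f i * ?m))" unfolding diff fm .
      then have "int (f i * ?m) dvd int (?e * (j * ?m)) - int (?e * (k * ?m))"
        unfolding cong_imp_int_dvd_diff .
      moreover have "int (?e * (j * ?m)) - int (?e * (k * ?m)) = (int ?e * (int j - int k)) * int ?m"
        by (simp only: of_nat_mult) (simp only: left_diff_distrib right_diff_distrib mult.assoc)
      ultimately have "int (f i) * int ?m dvd (int ?e * (int j - int k)) * int ?m" by (simp only: of_nat_mult)
      then have dv: "int (f i) dvd int ?e * (int j - int k)" using m0 by (simp only: dvd_mult_cancel_right) simp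
      have "coprime (f i) ?e"
      proof -
        obtain t where t: "N * i = f i * t" using fN[OF i] by (metis dvd_def dvd_mult2)
        show ?thesis unfolding t by (metis coprime_1_right coprime_iff_gcd_eq_1 gcd_add_mult mult.commute add.commute)
      qed
      then have "coprime (int (f i)) (int ?e)" by (simp only: coprime_int_iff)
      then have "int (f i) dvd int j - int k" using dv by (simp only: coprime_dvd_mult_right_iff)
      then have "\<bar>int j - int k\<bar> \<ge> int (f i)" using jk(3) dvd_imp_le_int[of "int j - int k" "int (f i)"] by simp
      then show False using jk(1,2) by linarith
    qed
    show "\<not> int p dvd a i - a j" if j: "j < g" "i \<noteq> j" for j
    proof
      assume "int p dvd a i - a j"
      then have c: "[1 + N * i = 1 + N * j] (mod (p - 1))" unfolding a_def diff .
      have "N * i \<le> N * g" "N * j \<le> N * g" using i j(1) by simp_all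
      then have "1 + N * i < p - 1" "1 + N * j < p - 1" using p(2) by linarith+
      then have "1 + N * i = 1 + N * j" using c by (simp only: cong_def mod_less)
      then show False using j(2) \<open>N > 0\<close> by simp
    qed
  qed
  then show ?thesis using p(2) by (intro exI[of _ p]) auto
qed

section \<open>The points of evaluation and the conclusion\<close>

lemma infinite_irrationals_above: "infinite {s::real. s > M \<and> s \<notin> \<rat>}"
proof -
  have "uncountable ({M<..<M+1} - \<rat>)"
    by (intro uncountable_minus_countable countable_rat) (simp add: uncountable_open_interval)
  then have "infinite ({M<..<M+1} - \<rat>)" using countable_finite by blast
  then show ?thesis by (rule infinite_super[rotated]) auto
qed

text \<open>The value is p^(j - s i), which is 1 only for s = j / i.\<close>

lemma powr_irrational_independent:
  assumes "p > 1" "s \<notin> \<rat>" "i > 0"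
  shows "(real p powr (- s)) ^ i * real p ^ j \<noteq> 1"
proof
  assume eq: "(real p powr (- s)) ^ i * real p ^ j = 1"
  have "(real p powr (- s)) ^ i = real p powr (- s * real i)"
    using assms(1) by (simp add: powr_realpow[symmetric] powr_powr)
  moreover have "real p ^ j = real p powr (real j)" using assms(1) by (simp add: powr_realpow)
  ultimately have "real p powr (- s * real i + real j) = 1" using eq by (simp only: powr_add)
  then have "s = real j / real i" using assms(1,3) by (simp add: field_simps)
  then show False using assms(2) by simp
qed

theorem theorem1p2:
  fixes n g :: nat and f :: "nat list" and W :: ratfun2
  assumes "n \<ge> 1" and "g \<ge> 1"
    and "length f = g" and "\<forall>i<g. f ! i \<ge> 1" and "(\<Sum>i<g. f ! i) = n"
    and "describes_euler_factors n (replicate g 1) f W"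
  shows "rf_eval W (inverse rfX) (inverse rfY) =
           (- 1) ^ (3 * n) * rfX ^ ((3 * n) choose 2) * rfY ^ (5 * n) * W"
proof -
  let ?f = "\<lambda>i. f ! i"
  define E where "E = euler_gf rfX rfY ?f {..<g}"
  have f_pos: "?f i > 0" if "i < g" for i using assms(4) that by (simp add: Suc_le_eq)
  have g_pos: "g > 0" using assms(2) by simp
  \<comment> \<open>Infinitely many primes realised in number fields; for each of them
    \<open>B\<close> collects the values of Y at which \<open>W\<close> and \<open>E\<close>
    agree.\<close>
  define A where "A = {p. \<exists>a \<alpha>. kummer p g ?f a \<alpha>}"
  define B where "B p = {y :: complex. rf_has_value (W - E) (of_nat p) y 0}" for p :: nat
  have "W - E = 0"
  proof (rule ratfun2_eq_0I[where A = A and B = B])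
    show "infinite A"
      unfolding infinite_nat_iff_unbounded A_def using exists_kummer[where f = ?f, OF g_pos f_pos] by blast
    fix p assume "p \<in> A"
    then obtain a \<alpha> where "kummer p g ?f a \<alpha>" unfolding A_def by blast
    then interpret k: kummer p g ?f a \<alpha> .
    have kn: "k.n = n" unfolding k.n_def by (rule assms(5))
    have "number_field k.K n \<and> Factorial_Ring.prime p \<and> decomposition_type k.K p (replicate g 1) f"
      using k.number_field_K k.p k.decomposition_type_K[OF assms(3) refl] unfolding kn by (intro conjI)
    from mp[OF spec[OF spec[OF assms(6)[unfolded describes_euler_factors_def], of k.K], of p] this]
    obtain \<sigma> :: real where \<sigma>: "\<forall>s. Re s > \<sigma> \<longrightarrow>
           summable (local_normal_zeta_term (heisenberg_group (integers_of k.K)) p s) \<and>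
           rf_regular W (of_nat p) (of_nat p powr (- s)) \<and>
           local_normal_zeta (heisenberg_group (integers_of k.K)) p s = rf_eval W (of_nat p) (of_nat p powr (- s))"
      by (rule exE)
    \<comment> \<open>For s beyond \<sigma> the Euler factor is a value of \<open>W\<close>;
      irrationality of s keeps the point away from the poles of \<open>E\<close>.\<close>
    define S where "S = {s::real. s > max \<sigma> 0 \<and> s \<notin> \<rat>}"
    define h where "h s = of_nat p powr (- complex_of_real s)" for s
    have h: "h s = complex_of_real (real p powr (- s))" for s
      unfolding h_def using powr_of_real[of "real p" "- s"] by simp
    have "h s \<in> B p" if s: "s \<in> S" for s
    proof -
      have s': "s > \<sigma>" "s > 0" "s \<notin> \<rat>" using s by (auto simp: S_def)
      have gen: "(real p powr (- s)) ^ i * real p ^ j \<noteq> 1" if "i > 0" for i j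
        by (rule powr_irrational_independent[OF k.p_pos(2) s'(3) that])
      have genc: "h s ^ i * of_nat p ^ j \<noteq> 1" if "i > 0" for i j
      proof -
        have "h s ^ i * of_nat p ^ j = complex_of_real ((real p powr (- s)) ^ i * real p ^ j)" unfolding h by simp
        then show ?thesis using gen[OF that, of j] by (metis of_real_eq_1_iff)
      qed
      note \<sigma>s = mp[OF spec[OF \<sigma>, of "complex_of_real s", unfolded Re_complex_of_real] s'(1)]
      have "local_normal_zeta (heisenberg_group (integers_of k.K)) p (of_real s) =
         euler_gf (of_nat p) (of_nat p powr (- of_real s)) ?f {..<g}"
        by (rule k.semilocal.local_normal_zeta_eq_euler_gf[OF k.ints.subring_complex_axioms k.Rp_eq_localization
          s'(2) gen conjunct1[OF \<sigma>s]])
      then have "rf_eval W (of_nat p) (h s) = euler_gf (of_nat p) (h s) ?f {..<g}"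
        using conjunct2[OF conjunct2[OF \<sigma>s]] unfolding h_def by (simp only:)
      moreover have "rf_has_value W (of_nat p) (h s) (rf_eval W (of_nat p) (h s))"
        using \<sigma>s unfolding h_def by (intro rf_regular_has_value) blast
      moreover have "rf_has_value E (of_nat p) (h s) (euler_gf (of_nat p) (h s) ?f {..<g})"
        unfolding E_def using f_pos genc by (intro rf_has_value_euler_gf) auto
      ultimately have "rf_has_value (W - E) (of_nat p) (h s) (rf_eval W (of_nat p) (h s) - rf_eval W (of_nat p) (h s))"
        by (simp only: rf_has_value_diff)
      then show ?thesis unfolding B_def diff_self by blast
    qed
    then have sub: "h ` S \<subseteq> B p" by blast
    have "inj_on h S"
    proof (rule inj_onI)
      fix s t assume "h s = h t"
      then have "real p powr (- s) = real p powr (- t)" unfolding h by (simp only: of_real_eq_iff)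
      then show "s = t" using k.p_pos(2) by (simp add: powr_inj)
    qed
    then have "infinite (h ` S)"
      using infinite_irrationals_above[of "max \<sigma> 0"] unfolding S_def[symmetric] by (simp add: finite_image_iff)
    then show "infinite (B p)" by (rule infinite_super[OF sub])
  qed (simp add: B_def)
  then have W: "W = E" by simp
  have "{..<g} \<noteq> {}" using g_pos by blast
  from euler_gf_ratfun_functional_equation[of "{..<g}" ?f, OF finite_lessThan this] f_pos
  show ?thesis unfolding W E_def assms(5)[symmetric] by (simp only: lessThan_iff)
qed

end
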